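(* Let $d,k\in\mathbb{N}$, $1\le p\le\infty$, and $0<q,r\le\infty$. The following equivalences hold for all $0<t<1$, with constants independent of $t$ and $f$; all spaces are on $\mathbb{R}^d$, and integrals are replaced by suprema when $q=\infty$ or $r=\infty$. (i) If $0<s<k$ and $-\infty<b<\infty$, then $$K(t^{s/k}(1-\log t)^{-b},f;L_p,\mathbf{B}^{s,b}_{p,q})\asymp t^{s/k}(1-\log t)^{-b}\|f\|_{L_p}+t^{s/k}(1-\log t)^{-b}\left(\int_{t^{1/k}}^1(u^{-s}(1-\log u)^b\omega_k(f,u)_p)^q\frac{du}u\right)^{1/q}.$$ (ii) If $0<s<k$ and $-\infty<b<\infty$, then $$K(t^{1-s/k}(1-\log t)^b,f;\mathbf{B}^{s,b}_{p,q},W^k_p)\asymp t^{1-s/k}(1-\log t)^b\|f\|_{L_p}+\left(\int_0^{t^{1/k}}(u^{-s}(1-\log u)^b\omega_k(f,u)_p)^q\frac{du}u\right)^{1/q}.$$ (iii) If $\alpha>1/r$ ($\alpha\ge0$ if $r=\infty$), then $$K(t^k(1-\log t)^{\alpha-\frac1r},f;L_p,\mathrm{Lip}^{(k,-\alpha)}_{p,r})\asymp t^k(1-\log t)^{\alpha-\frac1r}\|f\|_{L_p}+\omega_k(f,t)_p+t^k(1-\log t)^{\alpha-\frac1r}\left(\int_t^1(u^{-k}(1-\log u)^{-\alpha}\omega_k(f,u)_p)^r\frac{du}u\right)^{\frac1r}.$$ (iv) If $b>-1/q$, then $$K(t^k(1-\log t)^{b+\frac1q},f;\mathbf{B}^{0,b}_{p,q},W^k_p)\asymp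 t^k(1-\log t)^{b+\frac1q}\|f\|_{L_p}+(1-\log t)^{b+\frac1q}\omega_k(f,t)_p+\left(\int_0^t((1-\log u)^b\omega_k(f,u)_p)^q\frac{du}u\right)^{\frac1q}.$$ (v) If $b>-1/q$, then $$K((1-\log t)^{-b-\frac1q},f;L_p,\mathbf{B}^{0,b}_{p,q})\asymp(1-\log t)^{-b-\frac1q}\|f\|_{L_p}+(1-\log t)^{-b-\frac1q}\left(\int_t^1((1-\log u)^b\omega_k(f,u)_p)^q\frac{du}u\right)^{\frac1q}.$$ (vi) If $\alpha>1/r$ ($\alpha\ge0$ if $r=\infty$), then $$K((1-\log t)^{-\alpha+\frac1r},f;\mathrm{Lip}^{(k,-\alpha)}_{p,r},W^k_p)\asymp(1-\log t)^{-\alpha+\frac1r}\|f\|_{L_p}+\left(\int_0^t(u^{-k}(1-\log u)^{-\alpha}\omega_k(f,u)_p)^r\frac{du}u\right)^{\frac1r}.$$ (vii) If $b>-1/q$ and $\alpha>1/r$, then $$K(t^k(1-\log t)^{b+\frac1q+\alpha-\frac1r},f;\mathbf{B}^{0,b}_{p,q},\mathrm{Lip}^{(k,-\alpha)}_{p,r})\asymp t^k(1-\log t)^{b+\frac1q+\alpha-\frac1r}\|f\|_{L_p}+(1-\log t)^{b+\frac1q}\omega_k(f,t)_p$$ $$+\left(\int_0^t((1-\log u)^b\omega_k(f,u)_p)^q\frac{du}u\right)^{\frac1q}+t^k(1-\log t)^{b+\frac1q+\alpha-\frac1r}\left(\int_t^1(u^{-k}(1-\log u)^{-\alpha}\omega_k(f,u)_p)^r\frac{du}u\right)^{\frac1r}.$$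 The same estimates also hold for periodic functions (spaces on $\mathbb{T}$).
   Context: Convention: $1/\infty=0$. For quasi-normed spaces $A_1\hookrightarrow A_0$ and $a\in A_0$, $K(t,a;A_0,A_1)=\inf\{\|a_0\|_{A_0}+t\|a_1\|_{A_1}:a=a_0+a_1,\ a_j\in A_j\}$. $\omega_k(f,t)_p=\sup_{|h|\le t}\|\Delta_h^kf\|_{L_p(\mathbb{R}^d)}$, $\Delta^1_hf(x)=f(x+h)-f(x)$, $\Delta_h^{k+1}=\Delta_h^1\Delta_h^k$. $\mathbf{B}^{s,b}_{p,q}(\mathbb{R}^d)$ ($s\ge0$, $b\in\mathbb{R}$): $f\in L_p(\mathbb{R}^d)$ with $\|f\|_{\mathbf{B}^{s,b}_{p,q}}=\|f\|_{L_p}+\left(\int_0^1(t^{-s}(1-\log t)^b\omega_m(f,t)_p)^q\frac{dt}t\right)^{1/q}<\infty$, where $m\in\mathbb{N}$, $m>s$ (different $m$ give equivalent quasi-norms). $\mathrm{Lip}^{(k,-\alpha)}_{p,r}(\mathbb{R}^d)$: $f\in L_p(\mathbb{R}^d)$ with $\|f\|_{L_p}+\left(\int_0^1(t^{-k}(1-\log t)^{-\alpha}\omega_k(f,t)_p)^r\frac{dt}t\right)^{1/r}<\infty$. $W^k_p(\mathbb{R}^d)$: Sobolev space with norm $\sum_{|\beta|\le k}\|D^\beta f\|_{L_p}$ (weak derivatives). Each $f$ belongs to the first (larger) space of the couple in question. The periodic versions are obtained by replacing $L_p(\mathbb{R}^d)$ by $L_p(\mathbb{T})$. *)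

theory Defs
  imports "HOL-Analysis.Analysis" "HOL-Probability.Essential_Supremum"
begin

text \<open>
  All norms and quasi-norms take values in \<^typ>\<open>ennreal\<close>; a function belongs to a space exactly
  when the corresponding value is finite. Functions are complex-valued, and \<open>\<real>\<^sup>d\<close> is an arbitrary
  Euclidean space \<^typ>\<open>'a::euclidean_space\<close> of dimension \<open>d\<close>. Elements of \<open>L\<^sub>p\<close> are represented by
  Lebesgue measurable functions; nothing below depends on the chosen representative.
\<close>

definition epowr :: "ennreal \<Rightarrow> real \<Rightarrow> ennreal" where
  "epowr x a = (if x = \<infinity> then \<infinity> else ennreal (enn2real x powr a))"
  \<comment> \<open>only used with \<open>a > 0\<close>, where \<open>\<infinity>\<^sup>a = \<infinity>\<close> and \<open>0\<^sup>a = 0\<close>\<close>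

definition recip :: "ennreal \<Rightarrow> real" where
  "recip q = enn2real (1 / q)"
  \<comment> \<open>for \<open>0 < q \<le> \<infinity>\<close> this is \<open>1/q\<close>, with \<open>1/\<infinity> = 0\<close>\<close>


section \<open>Lebesgue spaces on Euclidean space and on the torus\<close>

definition lp_norm :: "'a measure \<Rightarrow> ennreal \<Rightarrow> ('a \<Rightarrow> complex) \<Rightarrow> ennreal" where
  "lp_norm M p f =
     (if p = \<infinity> then esssup M (\<lambda>x. ennreal (norm (f x)))
      else epowr (\<integral>\<^sup>+x. epowr (ennreal (norm (f x))) (enn2real p) \<partial>M) (recip p))"

definition Lp_space :: "ennreal \<Rightarrow> ('a::euclidean_space \<Rightarrow> complex) \<Rightarrow> ennreal" where
  "Lp_space p f = (if f \<in> borel_measurable lebesgue then lp_norm lebesgue p f else \<infinity>)"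

text \<open>
  A function on the torus is a function on the whole space that is \<open>2\<pi>\<close>-periodic in each coordinate;
  its norm is taken over one period. The one-dimensional torus is the case \<open>DIM('a) = 1\<close>.
\<close>

definition Lp_torus :: "ennreal \<Rightarrow> ('a::euclidean_space \<Rightarrow> complex) \<Rightarrow> ennreal" where
  "Lp_torus p f =
     (if f \<in> borel_measurable lebesgue \<and> (\<forall>b\<in>Basis. \<forall>x. f (x + (2 * pi) *\<^sub>R b) = f x)
      then lp_norm (lebesgue_on {x. \<forall>b\<in>Basis. 0 \<le> x \<bullet> b \<and> x \<bullet> b < 2 * pi}) p f
      else \<infinity>)"

text \<open>
  Everything that follows is parametrised by the underlying norm \<open>L\<close>, which is either
  \<^term>\<open>Lp_space p\<close> or \<^term>\<open>Lp_torus p\<close>.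
\<close>


section \<open>Moduli of smoothness\<close>

definition fdiff :: "'a::euclidean_space \<Rightarrow> ('a \<Rightarrow> complex) \<Rightarrow> 'a \<Rightarrow> complex" where
  "fdiff h f = (\<lambda>x. f (x + h) - f x)"

definition modulus ::
  "(('a::euclidean_space \<Rightarrow> complex) \<Rightarrow> ennreal) \<Rightarrow> nat \<Rightarrow> ('a \<Rightarrow> complex) \<Rightarrow> real \<Rightarrow> ennreal" where
  "modulus L k f t = (SUP h\<in>{h. norm h \<le> t}. L ((fdiff h ^^ k) f))"


section \<open>Besov and Lipschitz spaces of logarithmic smoothness\<close>

text \<open>\<open>(\<integral>\<^sub>a\<^sup>c (u\<^sup>\<sigma> (1 - log u)\<^sup>\<beta> w(u))\<^sup>q du/u)\<^sup>1\<^sup>/\<^sup>q\<close>, and the supremum over \<open>a < u < c\<close> for \<open>q = \<infinity>\<close>.\<close>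

definition log_integral ::
  "real \<Rightarrow> real \<Rightarrow> ennreal \<Rightarrow> real \<Rightarrow> real \<Rightarrow> (real \<Rightarrow> ennreal) \<Rightarrow> ennreal" where
  "log_integral \<sigma> \<beta> q a c w =
     (let g = (\<lambda>u. ennreal (u powr \<sigma> * (1 - ln u) powr \<beta>) * w u) in
      if q = \<infinity> then (SUP u\<in>{a<..<c}. g u)
      else epowr (\<integral>\<^sup>+u\<in>{a<..<c}. epowr (g u) (enn2real q) * ennreal (1 / u) \<partial>lborel) (recip q))"

text \<open>The Besov quasi-norm, computed with differences of order \<open>m > s\<close>.\<close>

definition besov ::
  "(('a::euclidean_space \<Rightarrow> complex) \<Rightarrow> ennreal) \<Rightarrow> nat \<Rightarrow> real \<Rightarrow> real \<Rightarrow> ennreal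
     \<Rightarrow> ('a \<Rightarrow> complex) \<Rightarrow> ennreal" where
  "besov L m s b q f = L f + log_integral (- s) b q 0 1 (modulus L m f)"

definition lip ::
  "(('a::euclidean_space \<Rightarrow> complex) \<Rightarrow> ennreal) \<Rightarrow> nat \<Rightarrow> real \<Rightarrow> ennreal
     \<Rightarrow> ('a \<Rightarrow> complex) \<Rightarrow> ennreal" where
  "lip L k \<alpha> r f = L f + log_integral (- real k) (- \<alpha>) r 0 1 (modulus L k f)"


section \<open>Weak derivatives and Sobolev spaces\<close>

text \<open>Iterated classical partial derivatives along a list of coordinate directions.\<close>

definition partials :: "'a::euclidean_space list \<Rightarrow> ('a \<Rightarrow> real) \<Rightarrow> 'a \<Rightarrow> real" where
  "partials bs \<phi> = foldr (\<lambda>b g. \<lambda>x. frechet_derivative g (at x) b) bs \<phi>"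

definition test_functions :: "('a::euclidean_space \<Rightarrow> real) set" where
  "test_functions =
     {\<phi>. (\<forall>bs. set bs \<subseteq> Basis \<longrightarrow> (\<forall>x. partials bs \<phi> differentiable (at x))) \<and>
         compact (closure {x. \<phi> x \<noteq> 0})}"

definition multi_indices :: "nat \<Rightarrow> ('a::euclidean_space \<Rightarrow> nat) set" where
  "multi_indices k = {\<beta>. (\<forall>b. b \<notin> Basis \<longrightarrow> \<beta> b = 0) \<and> (\<Sum>b\<in>Basis. \<beta> b) \<le> k}"

text \<open>
  The order in which the partial derivatives are taken is arbitrary; it does not matter
  for smooth functions.
\<close>

definition multi_partial :: "('a::euclidean_space \<Rightarrow> nat) \<Rightarrow> ('a \<Rightarrow> real) \<Rightarrow> 'a \<Rightarrow> real" where
  "multi_partial \<beta> = partials (SOME bs. \<forall>b. count_list bs b = \<beta> b)"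

definition locally_integrable :: "('a::euclidean_space \<Rightarrow> complex) \<Rightarrow> bool" where
  "locally_integrable f \<longleftrightarrow> (\<forall>K. compact K \<longrightarrow> set_integrable lebesgue K f)"

definition has_weak_derivative ::
  "('a::euclidean_space \<Rightarrow> complex) \<Rightarrow> ('a \<Rightarrow> nat) \<Rightarrow> ('a \<Rightarrow> complex) \<Rightarrow> bool" where
  "has_weak_derivative f \<beta> g \<longleftrightarrow>
     locally_integrable f \<and> locally_integrable g \<and>
     (\<forall>\<phi>\<in>test_functions.
        (LINT x|lebesgue. multi_partial \<beta> \<phi> x *\<^sub>R f x) =
        (- 1) ^ (\<Sum>b\<in>Basis. \<beta> b) * (LINT x|lebesgue. \<phi> x *\<^sub>R g x))"

text \<open>
  Weak derivatives are unique up to null sets, so each infimum below is the norm of the weak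
  derivative \<open>D\<^sup>\<beta> f\<close> if that exists and lies in the underlying space, and is \<open>\<infinity>\<close> otherwise.
  (On the torus it selects the periodic representatives of \<open>D\<^sup>\<beta> f\<close>.)
\<close>

definition sobolev ::
  "(('a::euclidean_space \<Rightarrow> complex) \<Rightarrow> ennreal) \<Rightarrow> nat \<Rightarrow> ('a \<Rightarrow> complex) \<Rightarrow> ennreal" where
  "sobolev L k f =
     (if L f < \<infinity> then (\<Sum>\<beta>\<in>multi_indices k. INF g\<in>{g. has_weak_derivative f \<beta> g}. L g) else \<infinity>)"


section \<open>The K-functional and equivalence of functionals\<close>

definition K_functional ::
  "real \<Rightarrow> ('a \<Rightarrow> complex) \<Rightarrow> (('a \<Rightarrow> complex) \<Rightarrow> ennreal) \<Rightarrow> (('a \<Rightarrow> complex) \<Rightarrow> ennreal) \<Rightarrow> ennreal"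
  where
  "K_functional t f A\<^sub>0 A\<^sub>1 =
     Inf {A\<^sub>0 f\<^sub>0 + ennreal t * A\<^sub>1 f\<^sub>1 | f\<^sub>0 f\<^sub>1.
            f = (\<lambda>x. f\<^sub>0 x + f\<^sub>1 x) \<and> A\<^sub>0 f\<^sub>0 < \<infinity> \<and> A\<^sub>1 f\<^sub>1 < \<infinity>}"

text \<open>
  \<open>F(f, t)\<close> and \<open>G(f, t)\<close> are equivalent for all \<open>f\<close> in the space \<open>A\<close> and all \<open>0 < t < 1\<close>, with
  constants independent of \<open>f\<close> and \<open>t\<close>.
\<close>

definition equivalent_on ::
  "(('a \<Rightarrow> complex) \<Rightarrow> ennreal) \<Rightarrow> (('a \<Rightarrow> complex) \<Rightarrow> real \<Rightarrow> ennreal)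
     \<Rightarrow> (('a \<Rightarrow> complex) \<Rightarrow> real \<Rightarrow> ennreal) \<Rightarrow> bool" where
  "equivalent_on A F G \<longleftrightarrow>
     (\<exists>C>0::real. \<forall>f t. A f < \<infinity> \<and> 0 < t \<and> t < 1 \<longrightarrow>
        F f t \<le> ennreal C * G f t \<and> G f t \<le> ennreal C * F f t)"

end

theory Submission
  imports Defs
begin

text \<open>
  The formulas are instances of Holmstedt's method. Let \<open>f \<mapsto> g\<^sub>t\<close> be smoothing operators with
  \<open>\<parallel>f - g\<^sub>t\<parallel> \<lesssim> \<omega>\<^sub>k(f, t)\<close> and \<open>\<parallel>g\<^sub>t\<parallel>\<close> in \<open>W\<^sup>k\<close> at most a constant times \<open>\<parallel>f\<parallel> + t\<^sup>-\<^sup>k \<omega>\<^sub>k(f, t)\<close>.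
  Splitting \<open>f = (f - g\<^sub>t) + g\<^sub>t\<close> and inserting these bounds into the weighted integrals over \<open>(0, t)\<close> and
  \<open>(t, 1)\<close> gives the upper estimates. The lower estimates hold because each term on the right-hand
  side is quasi-subadditive in \<open>f\<close> and bounded by the quasi-norms of both spaces.

  To construct \<open>g\<^sub>t\<close>, put \<open>A\<^sub>h f(x) = \<integral>\<^sub>0\<^sup>1 f(x + u h) du\<close>. Up to sign,
  \<open>\<Sum>\<^sub>j (-1)\<^sup>k\<^sup>-\<^sup>j (k choose j) A\<^sub>j\<^sub>h\<^sup>k f\<close> is an average of \<open>k\<close>-th differences of \<open>f\<close>, while its summand with \<open>j = 0\<close>
  is \<open>f\<close>; the remaining summands, composed over steps \<open>h\<close> of size comparable to \<open>t\<close> in all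
  coordinate directions, make up \<open>g\<^sub>t\<close>. A derivative of \<open>A\<^sub>h f\<close> is a difference quotient of \<open>f\<close>, mixed differences are controlled by pure
  ones, and differences of order less than \<open>k\<close> by Marchaud's inequality. Only translation invariance
  and Minkowski's inequality for integrals enter, hence the space and the torus are treated alike.
\<close>

section \<open>Powers and logarithmic integrals\<close>

text \<open>All seven formulas are one estimate. To each space belongs a growth function R: 1 for
  L_p, t^(-k) for W^k, and \<open>characteristic\<close> for the Besov spaces, Lip being the Besov
  case s = k. The K-functional at R_0(t)/R_1(t) is comparable to (R_0/R_1) L f + R_0 \<omega>_k(f,t)
  + the integral over (0,t) belonging to the first space + R_0/R_1 times the integral over (t,1)
  belonging to the second. The cases differ in whether the term with \<omega>_k(f,t) is absorbed.
  For 0 < s < k a dyadic interval next to t suffices, on either side. For s = 0 and s = k the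
  relevant weight is purely logarithmic; its integral gains the factor (1 - ln t)^(1/q), and so does
  R. Then only the integral over (t,1) for s = 0, and the one over (0,t) for s = k, still absorbs
  \<omega>_k(f,t). Hence this term remains in (iii), (iv) and (vii). For q < 1 the triangle
  inequality fails in L_q(du/u), so the Hardy inequality is set up with the inner norm in the same
  L_q, where Tonelli's theorem suffices.\<close>

abbreviation (input) weight :: "real => real => real => real" where
 "weight s b t \<equiv> t powr s * (1 - ln t) powr b"

lemma epowr_mono: "a \<ge> 0 ==> x \<le> y ==> epowr x a \<le> epowr y a"
 by (auto simp: epowr_def top.extremum_unique less_top[symmetric] intro!: ennreal_leI powr_mono2 enn2real_mono)

lemma epowr_ennreal: "x \<ge> 0 ==> epowr (ennreal x) a = ennreal (x powr a)"
 by (simp add: epowr_def)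

lemma epowr_mult:
 assumes "c > 0" "a > 0"
 shows "epowr (ennreal c * x) a = ennreal (c powr a) * epowr x a"
 using assms
 by (cases x) (auto simp: epowr_def ennreal_mult_top powr_mult ennreal_mult' [symmetric] ennreal_mult[symmetric])

lemma epowr_epowr:
 assumes "a > 0" "b > 0" shows "epowr (epowr x a) b = epowr x (a * b)"
 by (cases x) (use assms in \<open>auto simp: epowr_def powr_powr\<close>)

lemma epowr_one: "epowr x 1 = x"
 by (cases x) (auto simp: epowr_def)

lemma epowr_zero: "a > 0 ==> epowr 0 a = 0"
 by (auto simp: epowr_def)

lemma epowr_measurable [measurable]: "(\<lambda>x. epowr x a) \<in> borel_measurable borel"
 unfolding epowr_def by measurable

text \<open>Bounding the sum by twice the maximum works for every exponent a > 0, so exponents below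
  1 need no separate treatment; the price is a constant of quasi-norm type.\<close>

lemma epowr_add_le:
 assumes "a > 0"
 shows "epowr (x + y) a \<le> ennreal (2 powr a) * (epowr x a + epowr y a)"
proof -
 have "epowr (x + y) a \<le> epowr (ennreal 2 * max x y) a"
  using assms by (intro epowr_mono) (auto simp: max_def mult_2 add_mono)
 also have "... = ennreal (2 powr a) * epowr (max x y) a"
  using assms by (intro epowr_mult) auto
 also have "... \<le> ennreal (2 powr a) * (epowr x a + epowr y a)"
  by (intro mult_left_mono) (auto simp: max_def)
 finally show ?thesis .
qed

lemma recip_pos: "0 < q ==> q \<noteq> \<infinity> ==> recip q = 1 / enn2real q \<and> enn2real q > 0"
 by (cases q) (auto simp: recip_def divide_ennreal ennreal_1[symmetric] simp del: ennreal_1)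

lemma recip_infinity: "recip \<infinity> = 0"
 by (simp add: recip_def)

lemma recip_nonneg: "0 \<le> recip q"
 by (simp add: recip_def)

section \<open>Weighted norms with respect to du/u\<close>

lemma log_integral_infinity:
 "log_integral s b \<infinity> a c w = (SUP u\<in>{a<..<c}. ennreal (weight s b u) * w u)"
 "log_integral s b top a c w = (SUP u\<in>{a<..<c}. ennreal (weight s b u) * w u)"
 by (simp_all add: log_integral_def)

text \<open>The measure du/u becomes the exponent -1. On u < 1 the base 1 - ln u is positive, which
  the power laws require.\<close>

lemma log_integral_finite:
 assumes "0 < q" "q \<noteq> \<infinity>" "0 \<le> a" "c \<le> 1"
 shows "log_integral s b q a c w = epowr (\<integral>\<^sup>+u\<in>{a<..<c}. ennreal (weight (s * enn2real q - 1) (b * enn2real q) u) * epowr (w u) (enn2real q) \<partial>lborel) (recip q)"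
proof -
 have q: "enn2real q > 0" using recip_pos assms by auto
 have *: "epowr (ennreal (weight s b u) * w u) (enn2real q) * ennreal (1 / u)
   = ennreal (weight (s * enn2real q - 1) (b * enn2real q) u) * epowr (w u) (enn2real q)"
  if "u \<in> {a<..<c}" for u
 proof -
  have u: "0 < u" "u < 1" using that assms by auto
  have l: "1 - ln u > 0" using u ln_less_zero[of u] by linarith
  have "weight s b u > 0" using u l by simp
  then have "epowr (ennreal (weight s b u) * w u) (enn2real q) * ennreal (1 / u)
   = ennreal (1 / u) * ennreal (weight s b u powr enn2real q) * epowr (w u) (enn2real q)"
   using q by (subst epowr_mult) (auto simp: mult_ac)
  also have "ennreal (1 / u) * ennreal (weight s b u powr enn2real q)
    = ennreal (weight (s * enn2real q - 1) (b * enn2real q) u)"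
   using u l by (subst ennreal_mult[symmetric]) (auto simp: powr_mult powr_powr powr_diff)
  finally show ?thesis .
 qed
 show ?thesis unfolding log_integral_def Let_def using assms(2)
  by (simp, intro arg_cong[where f="\<lambda>x. epowr x _"] nn_integral_cong) (auto simp: indicator_def *)
qed

lemma log_integral_weight_mono:
 assumes "0 < q" "\<And>u. a < u ==> u < c ==> ennreal (weight s b u) * w u \<le> ennreal (u powr s' * (1 - ln u) powr b') * w' u"
 shows "log_integral s b q a c w \<le> log_integral s' b' q a c w'"
proof (cases "q = \<infinity>")
 case True then show ?thesis using assms unfolding log_integral_def Let_def
  by (auto intro!: SUP_least intro: SUP_upper2)
next
 case False
 then have "enn2real q > 0" "recip q \<ge> 0" using recip_pos assms recip_nonneg by auto
 then show ?thesis using False assms unfolding log_integral_def Let_def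
  by (auto intro!: epowr_mono nn_integral_mono simp: indicator_def)
    (auto intro!: mult_right_mono epowr_mono)
qed

lemma log_integral_mono:
 assumes "0 < q" "\<And>u. a < u ==> u < c ==> w u \<le> w' u"
 shows "log_integral s b q a c w \<le> log_integral s b q a c w'"
 using assms by (intro log_integral_weight_mono mult_left_mono) auto

lemma log_integral_mono_interval:
 assumes "0 < q" "a' \<le> a" "c \<le> c'"
 shows "log_integral s b q a c w \<le> log_integral s b q a' c' w"
proof (cases "q = \<infinity>")
 case True then show ?thesis using assms unfolding log_integral_def Let_def
  by (auto intro!: SUP_subset_mono)
next
 case False
 then have "enn2real q > 0" "recip q \<ge> 0" using recip_pos assms recip_nonneg by auto
 then show ?thesis using False assms unfolding log_integral_def Let_def
  by (auto intro!: epowr_mono nn_integral_mono mult_right_mono mult_left_mono simp: indicator_def)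
qed

lemma log_integral_zero:
 assumes "0 < q" shows "log_integral s b q a c (\<lambda>u. 0) = 0"
 using recip_pos[OF assms]
 using SUP_bot[where 'a=ennreal and A="{a<..<c}"]
 by (cases "q = \<infinity>") (auto simp: log_integral_def Let_def epowr_zero bot_ennreal)

lemma log_integral_cmult:
 assumes "0 < q" and C: "C < \<infinity>" and [measurable]: "w \<in> borel_measurable borel"
 shows "log_integral s b q a c (\<lambda>u. C * w u) = C * log_integral s b q a c w"
proof (cases "q = \<infinity> \<or> C = 0")
 case True
 show ?thesis
 proof (cases "C = 0")
  case True then show ?thesis using log_integral_zero[OF assms(1)] by simp
 next
  case False
  with True have "q = \<infinity>" by simp
  then show ?thesis
   by (simp add: log_integral_infinity SUP_mult_left_ennreal mult.left_commute)
 qed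
next
 case False
 then have q: "enn2real q > 0" "recip q > 0" "recip q = 1 / enn2real q" using recip_pos assms by auto
 define D where "D = enn2real C"
 have D: "C = ennreal D" "D > 0"
  using C False by (auto simp: D_def enn2real_positive_iff less_top zero_less_iff_neq_zero)
 let ?g = "\<lambda>u. ennreal (weight s b u) * w u"
 have "(\<integral>\<^sup>+u\<in>{a<..<c}. epowr (ennreal (weight s b u) * (C * w u)) (enn2real q) * ennreal (1 / u) \<partial>lborel)
   = (\<integral>\<^sup>+u. ennreal (D powr enn2real q) * (epowr (?g u) (enn2real q) * ennreal (1 / u) * indicator {a<..<c} u) \<partial>lborel)"
  using q D by (intro nn_integral_cong) (subst mult.left_commute, simp only: D(1), subst epowr_mult, auto simp: mult_ac)
 also have "... = ennreal (D powr enn2real q) * (\<integral>\<^sup>+u\<in>{a<..<c}. epowr (?g u) (enn2real q) * ennreal (1 / u) \<partial>lborel)"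
  by (rule nn_integral_cmult) measurable
 finally show ?thesis using False q D
  by (simp add: log_integral_def Let_def epowr_mult powr_powr)
qed

lemma log_integral_add:
 assumes "0 < q"
 obtains C :: real where "C > 0"
  "\<And>a c w w'. w \<in> borel_measurable borel ==> w' \<in> borel_measurable borel ==>
    log_integral s b q a c (\<lambda>u. w u + w' u) \<le> ennreal C * (log_integral s b q a c w + log_integral s b q a c w')"
proof (cases "q = \<infinity>")
 case True
 show ?thesis
 proof (rule that[of 1])
  fix a c and w w' :: "real => ennreal"
  show "log_integral s b q a c (\<lambda>u. w u + w' u) \<le> ennreal 1 * (log_integral s b q a c w + log_integral s b q a c w')"
   unfolding True log_integral_infinity distrib_left
   by (auto intro!: SUP_least add_mono SUP_upper)
 qed simp
next
 case False
 then have q: "enn2real q > 0" "recip q > 0" "recip q = 1 / enn2real q" using recip_pos assms by auto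
 show ?thesis
 \<comment> \<open>The factor 2 is (2^q)^(1/q) from the pointwise inequality; 2^(1/q) comes from
   separating the outer power.\<close>
 proof (rule that[of "2 * 2 powr recip q"])
  fix a c and w w' :: "real => ennreal"
  assume [measurable]: "w \<in> borel_measurable borel" "w' \<in> borel_measurable borel"
  define g where "g = (\<lambda>(v::real => ennreal) u. epowr (ennreal (weight s b u) * v u) (enn2real q) * ennreal (1 / u) * indicator {a<..<c} u)"
  have LI_g: "log_integral s b q a c v = epowr (\<integral>\<^sup>+u. g v u \<partial>lborel) (recip q)" for v
   using False by (simp add: g_def log_integral_def Let_def)
  have [measurable]: "g w \<in> borel_measurable borel" "g w' \<in> borel_measurable borel"
   unfolding g_def by measurable
  have "g (\<lambda>u. w u + w' u) u \<le> ennreal (2 powr enn2real q) * (g w u + g w' u)" for u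
  proof -
   have "g (\<lambda>u. w u + w' u) u \<le> ennreal (2 powr enn2real q) * (epowr (ennreal (weight s b u) * w u) (enn2real q)
     + epowr (ennreal (weight s b u) * w' u) (enn2real q)) * ennreal (1 / u) * indicator {a<..<c} u"
    unfolding g_def distrib_left[of _ "w u" "w' u"] by (intro mult_right_mono epowr_add_le) (use q in auto)
   then show ?thesis unfolding g_def by (simp add: distrib_left distrib_right mult_ac)
  qed
  then have "(\<integral>\<^sup>+u. g (\<lambda>u. w u + w' u) u \<partial>lborel) \<le> (\<integral>\<^sup>+u. ennreal (2 powr enn2real q) * (g w u + g w' u) \<partial>lborel)"
   by (intro nn_integral_mono)
  also have "... = ennreal (2 powr enn2real q) * ((\<integral>\<^sup>+u. g w u \<partial>lborel) + (\<integral>\<^sup>+u. g w' u \<partial>lborel))"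
   by (simp add: nn_integral_cmult nn_integral_add)
  finally have "log_integral s b q a c (\<lambda>u. w u + w' u) \<le> epowr (ennreal (2 powr enn2real q) * ((\<integral>\<^sup>+u. g w u \<partial>lborel) + (\<integral>\<^sup>+u. g w' u \<partial>lborel))) (recip q)"
   unfolding LI_g using q by (intro epowr_mono) auto
  also have "... = ennreal 2 * epowr ((\<integral>\<^sup>+u. g w u \<partial>lborel) + (\<integral>\<^sup>+u. g w' u \<partial>lborel)) (recip q)"
   using q by (subst epowr_mult) (auto simp: powr_powr)
  also have "... \<le> ennreal 2 * (ennreal (2 powr recip q) * (log_integral s b q a c w + log_integral s b q a c w'))"
   unfolding LI_g using q by (intro mult_left_mono epowr_add_le) auto
  also have "... = ennreal (2 * 2 powr recip q) * (log_integral s b q a c w + log_integral s b q a c w')"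
   by (simp add: ennreal_mult' mult.assoc)
  finally show "log_integral s b q a c (\<lambda>u. w u + w' u) \<le> ennreal (2 * 2 powr recip q) * (log_integral s b q a c w + log_integral s b q a c w')" .
 qed simp
qed

lemma log_integral_indicator:
 assumes "0 < q" "a \<le> a'" "c' \<le> c"
 shows "log_integral s b q a c (\<lambda>u. w u * indicator {a'<..<c'} u) = log_integral s b q a' c' w"
proof (rule antisym)
 show "log_integral s b q a' c' w \<le> log_integral s b q a c (\<lambda>u. w u * indicator {a'<..<c'} u)"
  by (rule order.trans[OF log_integral_mono log_integral_mono_interval]) (use assms in auto)
next
 show "log_integral s b q a c (\<lambda>u. w u * indicator {a'<..<c'} u) \<le> log_integral s b q a' c' w"
 proof (cases "q = \<infinity>")
  case True
  show ?thesis unfolding True log_integral_infinity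
   by (rule SUP_least) (auto simp: indicator_def intro: SUP_upper2)
 next
  case False
  then have q: "enn2real q > 0" "recip q > 0" using recip_pos assms by auto
  show ?thesis unfolding log_integral_def Let_def using False q
   by (auto intro!: epowr_mono nn_integral_mono simp: indicator_def epowr_zero)
 qed
qed

text \<open>The value at t is there for q = \<infinity>: the suprema run over open intervals, which
  miss the point t. For finite q the cut is at a null set.\<close>

lemma log_integral_split:
 assumes "0 < q"
 obtains C :: real where "C > 0"
  "\<And>a t c w. a < t ==> t < c ==> w \<in> borel_measurable borel ==>
    log_integral s b q a c w \<le> ennreal C * (log_integral s b q a t w + log_integral s b q t c w + ennreal (weight s b t) * w t)"
proof -
 obtain C where C: "C > 0" "\<And>a c w w'. w \<in> borel_measurable borel ==> w' \<in> borel_measurable borel ==>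
    log_integral s b q a c (\<lambda>u. w u + w' u) \<le> ennreal C * (log_integral s b q a c w + log_integral s b q a c w')"
  using log_integral_add[OF assms] by metis
 show thesis
 proof (rule that[of "max 1 C"])
  fix a t c :: real and w :: "real => ennreal"
  assume t: "a < t" "t < c" and [measurable]: "w \<in> borel_measurable borel"
  show "log_integral s b q a c w \<le> ennreal (max 1 C) * (log_integral s b q a t w + log_integral s b q t c w + ennreal (weight s b t) * w t)"
  proof (cases "q = \<infinity>")
   case True
   have "log_integral s b q a c w \<le> ennreal 1 * (log_integral s b q a t w + log_integral s b q t c w + ennreal (weight s b t) * w t)"
    unfolding True log_integral_infinity
   proof (rule SUP_least)
    fix u assume u: "u \<in> {a<..<c}"
    consider "u \<in> {a<..<t}" | "u = t" | "u \<in> {t<..<c}" using u by force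
    then show "ennreal (weight s b u) * w u
     \<le> ennreal 1 * ((SUP u\<in>{a<..<t}. ennreal (weight s b u) * w u) +
       (SUP u\<in>{t<..<c}. ennreal (weight s b u) * w u) +
      ennreal (weight s b t) * w t)"
    proof cases
     case 1 then show ?thesis
      by (auto intro!: order.trans[OF SUP_upper[OF 1, of "\<lambda>u. ennreal (weight s b u) * w u"]] simp: add.assoc)
    next
     case 2 then show ?thesis by (auto simp: add.commute)
    next
     case 3
     have "(SUP u\<in>{t<..<c}. ennreal (weight s b u) * w u) \<le> ennreal 1 * ((SUP u\<in>{a<..<t}. ennreal (weight s b u) * w u) +
       (SUP u\<in>{t<..<c}. ennreal (weight s b u) * w u) +
      ennreal (weight s b t) * w t)" by (simp add: add_increasing add_increasing2)
     then show ?thesis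
      by (rule order.trans[OF SUP_upper[OF 3, of "\<lambda>u. ennreal (weight s b u) * w u"]])
    qed
   qed
   also have "... \<le> ennreal (max 1 C) * (log_integral s b q a t w + log_integral s b q t c w + ennreal (weight s b t) * w t)"
    by (intro mult_right_mono ennreal_leI) auto
   finally show ?thesis .
  next
   case False
   then have q: "enn2real q > 0" "recip q > 0" using recip_pos assms by auto
   have "log_integral s b q a c w \<le> log_integral s b q a c (\<lambda>u. w u * indicator {a<..<t} u + w u * indicator {t<..<c} u)"
    unfolding log_integral_def Let_def using False q
    by (auto intro!: epowr_mono nn_integral_mono_AE eventually_mono[OF AE_lborel_singleton[of t]] simp: indicator_def)
   also have "... \<le> ennreal C * (log_integral s b q a c (\<lambda>u. w u * indicator {a<..<t} u) + log_integral s b q a c (\<lambda>u. w u * indicator {t<..<c} u))"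
    by (rule C) measurable
   also have "... \<le> ennreal (max 1 C) * (log_integral s b q a t w + log_integral s b q t c w + ennreal (weight s b t) * w t)"
    using t assms by (intro mult_mono ennreal_leI) (auto simp: log_integral_indicator)
   finally show ?thesis .
  qed
 qed (use C in auto)
qed

text \<open>One-sided limits instead of endpoint values admit the endpoint 0, where the primitives
  in use involve ln.\<close>

lemma nn_integral_FTC_open:
 fixes f F :: "real => real"
 assumes "a < c"
  and F: "\<And>x. a < x ==> x < c ==> (F has_real_derivative f x) (at x)"
  and f: "\<And>x. a < x ==> x < c ==> isCont f x"
  and nonneg: "\<And>x. a < x ==> x < c ==> 0 \<le> f x"
  and A: "(F \<longlongrightarrow> A) (at_right a)" and B: "(F \<longlongrightarrow> B) (at_left c)"
 shows "(\<integral>\<^sup>+x\<in>{a<..<c}. ennreal (f x) \<partial>lborel) = ennreal (B - A)"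
proof -
 have *: "set_integrable lborel (einterval (ereal a) (ereal c)) f"
  "(LBINT x=ereal a..ereal c. f x) = B - A"
  by (rule interval_integral_FTC_nonneg[where F=F]; use assms in \<open>auto simp: ereal_tendsto_simps1\<close>)+
 then have i: "integrable lborel (\<lambda>x. indicator {a<..<c} x * f x)"
  and v: "(\<integral>x. indicator {a<..<c} x * f x \<partial>lborel) = B - A"
  using \<open>a < c\<close> by (simp_all add: set_integrable_def interval_lebesgue_integral_def set_lebesgue_integral_def)
 have "(\<integral>\<^sup>+x\<in>{a<..<c}. ennreal (f x) \<partial>lborel) = (\<integral>\<^sup>+x. ennreal (indicator {a<..<c} x * f x) \<partial>lborel)"
  by (intro nn_integral_cong) (auto simp: indicator_def)
 also have "... = ennreal (B - A)"
  using nn_integral_eq_integral[OF i] nonneg v by (auto simp: indicator_def)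
 finally show ?thesis .
qed

lemma ln_less_one: "0 < (t::real) ==> t \<le> 1 ==> ln t < 1"
 using ln_le_zero_iff[of t] by linarith

text \<open>Powers of 1 - ln vary slowly: the quotient of 1 - ln u and 1 - ln t is at most 1 + ln
  (t/u) either way, and this is dominated by an arbitrarily small power of t/u. Working with
  \<bar>b\<bar> covers both signs of b.\<close>

lemma log_weight_compare:
 fixes b e :: real
 assumes "e > 0"
 obtains C where "C > 0"
  "\<And>u t. 0 < u ==> u \<le> t ==> t \<le> 1 ==> (1 - ln u) powr b \<le> C * (t / u) powr e * (1 - ln t) powr b"
  "\<And>u t. 0 < u ==> u \<le> t ==> t \<le> 1 ==> (1 - ln t) powr b \<le> C * (t / u) powr e * (1 - ln u) powr b"
proof -
 \<comment> \<open>Adding 1 keeps B positive for b = 0, so that e / B makes sense.\<close>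
 define B where "B = \<bar>b\<bar> + 1"
 have B: "B > 0" "\<bar>b\<bar> \<le> B" by (auto simp: B_def)
 define C where "C = (1 + B / e) powr B"
 have "1 + B / e > 0" using assms B by (simp add: add_pos_pos)
 then have C: "C > 0" by (simp add: C_def)
 have key: "(1 + ln y) powr \<bar>b\<bar> \<le> C * y powr e" if "y \<ge> 1" for y
 proof -
  have "ln y \<le> y powr (e / B) / (e / B)"
   using that assms B by (intro ln_powr_bound) auto
  moreover have "1 \<le> y powr (e / B)" using that assms B by (auto intro!: ge_one_powr_ge_zero)
  ultimately have "1 + ln y \<le> (1 + B / e) * y powr (e / B)" by (simp add: algebra_simps)
  then have "(1 + ln y) powr B \<le> ((1 + B / e) * y powr (e / B)) powr B"
   using that B by (intro powr_mono2) auto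
  also have "... = C * y powr e" using assms B that by (simp add: powr_mult powr_powr C_def)
  finally have "(1 + ln y) powr B \<le> C * y powr e" .
  moreover have "(1 + ln y) powr \<bar>b\<bar> \<le> (1 + ln y) powr B" using that B by (intro powr_mono) auto
  ultimately show ?thesis by linarith
 qed
 have cmp: "x powr b \<le> r powr \<bar>b\<bar> * y powr b" if "x \<ge> 1" "y \<ge> 1" "r \<ge> 1" "x \<le> r * y" "y \<le> r * x" for x y r :: real
 proof (cases "b \<ge> 0")
  case True
  have "x powr b \<le> (r * y) powr b" using that True by (intro powr_mono2) auto
  then show ?thesis using that True by (simp add: powr_mult)
 next
  case False
  have "(r * x) powr b \<le> y powr b" using that False by (intro powr_mono2') auto
  then have "r powr b * x powr b \<le> y powr b" using that by (simp add: powr_mult)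
  then have "r powr (-b) * (r powr b * x powr b) \<le> r powr (-b) * y powr b" by (intro mult_left_mono) auto
  moreover have "r powr (-b) * (r powr b * x powr b) = x powr b"
   using that by (simp add: mult.assoc[symmetric] powr_add[symmetric])
  ultimately show ?thesis using False by simp
 qed
 have fin: "x powr b \<le> C * (t / u) powr e * y powr b"
  if "x \<ge> 1" "y \<ge> 1" "0 < u" "u \<le> t" "x \<le> (1 + ln (t / u)) * y" "y \<le> (1 + ln (t / u)) * x" for x y t u :: real
 proof -
  have "t / u \<ge> 1" using that by simp
  then show ?thesis
   using order.trans[OF cmp[of x y "1 + ln (t / u)"] mult_right_mono[OF key[of "t/u"]]] that by simp
 qed
 have prod: "1 - ln u \<le> (1 + ln (t / u)) * (1 - ln t)" "1 - ln t \<le> (1 + ln (t / u)) * (1 - ln u)"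
   if "0 < u" "u \<le> t" "t \<le> 1" for u t :: real
 proof -
  have l: "ln (t / u) = ln t - ln u" "ln t \<le> 0" "ln u \<le> ln t" using that by (auto simp: ln_div)
  have "(ln t - ln u) * (- ln t) \<ge> 0" using l by (intro mult_nonneg_nonneg) auto
  then show "1 - ln u \<le> (1 + ln (t / u)) * (1 - ln t)" unfolding l(1) by (simp add: algebra_simps)
  have "(ln t - ln u) * (1 - ln u) \<ge> 0" using l by (intro mult_nonneg_nonneg) auto
  then show "1 - ln t \<le> (1 + ln (t / u)) * (1 - ln u)" unfolding l(1) using l by (simp add: algebra_simps)
 qed
 show thesis
  by (rule that[OF C]; rule fin; use prod in auto)
qed

section \<open>Integrals of the weights\<close>

text \<open>With 1 in place of w, \<open>log_integral\<close> is the norm of the weight itself; a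
  primitive of its q-th power divided by u gives the value exactly.\<close>

lemma log_integral_one_FTC:
 assumes q: "0 < q" "q \<noteq> \<infinity>" and ac: "0 \<le> a" "a < c" "c \<le> 1"
  and F: "\<And>u. a < u ==> u < c ==>
   (F has_real_derivative weight (s * enn2real q - 1) (b * enn2real q) u) (at u)"
  and A: "(F \<longlongrightarrow> A) (at_right a)" and B: "(F \<longlongrightarrow> B) (at_left c)"
 shows "A \<le> B" "log_integral s b q a c (\<lambda>u. 1) = ennreal ((B - A) powr recip q)"
proof -
 let ?f = "\<lambda>u. weight (s * enn2real q - 1) (b * enn2real q) u"
 have l: "0 < u" "u < 1" "1 - ln u > 0" if "a < u" "u < c" for u
  using that ac ln_less_one[of u] by auto
 have mono: "F x \<le> F y" if "a < x" "x \<le> y" "y < c" for x y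
 proof (rule DERIV_nonneg_imp_nondecreasing[OF that(2)])
  fix z assume "x \<le> z" "z \<le> y"
  then show "\<exists>d. (F has_real_derivative d) (at z) \<and> 0 \<le> d"
   using F[of z] that by (intro exI[of _ "?f z"]) auto
 qed
 show AB: "A \<le> B"
 proof -
  define m where "m = (a + c) / 2"
  have m: "a < m" "m < c" using ac by (auto simp: m_def)
  have "A \<le> F m"
   by (rule tendsto_upperbound[OF A]) (use m mono in \<open>auto simp: eventually_at_right_field intro!: exI[of _ m]\<close>)
  moreover have "F m \<le> B"
   by (rule tendsto_lowerbound[OF B]) (use m mono in \<open>auto simp: eventually_at_left_field intro!: exI[of _ m]\<close>)
  ultimately show ?thesis by simp
 qed
 have "(\<integral>\<^sup>+u\<in>{a<..<c}. ennreal (?f u) \<partial>lborel) = ennreal (B - A)"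
 proof (rule nn_integral_FTC_open[OF ac(2) F _ _ A B])
  fix u assume "a < u" "u < c"
  then show "isCont ?f u" using l[of u] by (intro continuous_intros) auto
 qed auto
 moreover have "epowr 1 (enn2real q) = 1" using epowr_ennreal[of 1] by simp
 ultimately show "log_integral s b q a c (\<lambda>u. 1) = ennreal ((B - A) powr recip q)"
  using ac AB by (simp add: log_integral_finite[OF q] epowr_ennreal)
qed

lemma log_integral_power_low:
 assumes q: "0 < q" and s: "0 < s"
 obtains C where "C > 0" "\<And>t. 0 < t ==> t \<le> 1 ==> log_integral s 0 q 0 t (\<lambda>u. 1) \<le> ennreal (C * t powr s)"
proof (cases "q = \<infinity>")
 case True
 show ?thesis
  by (rule that[of 1]) (use s in \<open>auto simp: True log_integral_infinity intro!: SUP_least ennreal_leI powr_mono2\<close>)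
next
 case False
 define Q where "Q = enn2real q"
 have Q: "Q > 0" "recip q = 1 / Q" using recip_pos[OF q False] by (auto simp: Q_def)
 show ?thesis
 proof (rule that[of "(1 / (s * Q)) powr recip q"])
  fix t :: real assume t: "0 < t" "t \<le> 1"
  have "log_integral s 0 q 0 t (\<lambda>u. 1) = ennreal ((t powr (s * Q) / (s * Q) - 0) powr recip q)"
  proof (rule log_integral_one_FTC[OF q False])
   fix u :: real assume u: "0 < u" "u < t"
   then have "1 - ln u \<noteq> 0" using u t ln_less_one[of u] by auto
   then show "((\<lambda>u. u powr (s * Q) / (s * Q)) has_real_derivative weight (s * enn2real q - 1) (0 * enn2real q) u) (at u)"
    using u Q s by (auto intro!: derivative_eq_intros simp: Q_def[symmetric])
  next
   have "((\<lambda>u. u powr (s * Q) / (s * Q)) \<longlongrightarrow> 0 powr (s * Q) / (s * Q)) (at_right 0)"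
    using Q s by (intro tendsto_intros) (auto simp: eventually_at_right_field intro!: exI[of _ 1])
   then show "((\<lambda>u. u powr (s * Q) / (s * Q)) \<longlongrightarrow> 0) (at_right 0)" by simp
   show "((\<lambda>u. u powr (s * Q) / (s * Q)) \<longlongrightarrow> t powr (s * Q) / (s * Q)) (at_left t)"
    using Q s t by (intro tendsto_intros) auto
  qed (use t in auto)
  also have "(t powr (s * Q) / (s * Q) - 0) powr recip q = (1 / (s * Q)) powr recip q * t powr s"
  proof -
   have 1: "s * Q * recip q = s" using Q by simp
   have "(1 / (s * Q) * t powr (s * Q)) powr recip q = (1 / (s * Q)) powr recip q * t powr s"
    using Q(1) s by (subst powr_mult) (auto simp: powr_powr 1)
   then show ?thesis by simp
  qed
  finally show "log_integral s 0 q 0 t (\<lambda>u. 1) \<le> ennreal ((1 / (s * Q)) powr recip q * t powr s)" by simp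
 qed (use Q s in auto)
qed

lemma log_integral_power_high:
 assumes q: "0 < q" and s: "s < 0"
 obtains C where "C > 0" "\<And>t. 0 < t ==> t < 1 ==> log_integral s 0 q t 1 (\<lambda>u. 1) \<le> ennreal (C * t powr s)"
proof (cases "q = \<infinity>")
 case True
 show ?thesis
  by (rule that[of 1]) (use s in \<open>auto simp: True log_integral_infinity intro!: SUP_least ennreal_leI powr_mono2'\<close>)
next
 case False
 define Q where "Q = enn2real q"
 have Q: "Q > 0" "recip q = 1 / Q" using recip_pos[OF q False] by (auto simp: Q_def)
 then have sQ: "s * Q < 0" using s by (simp add: mult_neg_pos)
 show ?thesis
 proof (rule that[of "(1 / (- s * Q)) powr recip q"])
  fix t :: real assume t: "0 < t" "t < 1"
  have F: "((\<lambda>u. u powr (s * Q) / (s * Q)) has_real_derivative weight (s * enn2real q - 1) (0 * enn2real q) u) (at u)"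
   if u: "t < u" "u < 1" for u
  proof -
   have "1 - ln u \<noteq> 0" using u t ln_less_one[of u] by auto
   then show ?thesis
    using u Q s t by (auto intro!: derivative_eq_intros simp: Q_def[symmetric])
  qed
  have A: "((\<lambda>u. u powr (s * Q) / (s * Q)) \<longlongrightarrow> t powr (s * Q) / (s * Q)) (at_right t)"
   using Q s t by (intro tendsto_intros) auto
  have B: "((\<lambda>u. u powr (s * Q) / (s * Q)) \<longlongrightarrow> 1 powr (s * Q) / (s * Q)) (at_left 1)"
   using Q s t by (intro tendsto_intros) auto
  note * = log_integral_one_FTC[OF q False less_imp_le[OF t(1)] t(2) order_refl F A B]
  have "log_integral s 0 q t 1 (\<lambda>u. 1) = ennreal ((1 powr (s * Q) / (s * Q) - t powr (s * Q) / (s * Q)) powr recip q)" by (rule *(2))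
  also have "... \<le> ennreal ((t powr (s * Q) / (- s * Q)) powr recip q)"
   using * sQ Q by (intro ennreal_leI powr_mono2) (auto simp: divide_nonneg_neg divide_le_0_iff)
  also have "(t powr (s * Q) / (- s * Q)) powr recip q = (1 / (- s * Q)) powr recip q * t powr s"
  proof -
   have "(t powr (s * Q) / (- s * Q)) powr recip q = (t powr (s * Q) * (1 / (- s * Q))) powr recip q" by simp
   also have "... = (t powr (s * Q)) powr recip q * (1 / (- s * Q)) powr recip q"
    using sQ by (subst powr_mult) auto
   finally show ?thesis using Q by (simp add: powr_powr mult.commute)
  qed
  finally show "log_integral s 0 q t 1 (\<lambda>u. 1) \<le> ennreal ((1 / (- s * Q)) powr recip q * t powr s)" .
 qed (use sQ in auto)
qed

lemma log_integral_const:
 assumes "0 < q" "0 \<le> D"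
 shows "log_integral s b q a c (\<lambda>u. ennreal D) = ennreal D * log_integral s b q a c (\<lambda>u. 1)"
 using log_integral_cmult[of q "ennreal D" "\<lambda>u. 1"] assms by simp

lemma powr_halve: "0 < u ==> u powr s = u powr (s/2) * u powr (s/2)" for u s :: real
 by (simp flip: powr_add)

lemma powr_half_quotient:
 fixes u t s :: real
 assumes "0 < u" "0 < t"
 shows "u powr s * (t / u) powr (s/2) = u powr (s/2) * t powr (s/2)"
 using assms powr_halve[of u s] by (simp add: powr_divide)

lemma powr_half_quotient':
 fixes u t s :: real
 assumes "0 < u" "0 < t"
 shows "u powr s * (u / t) powr (-s/2) = u powr (s/2) * t powr (s/2)"
proof -
 have "(-s/2) * (ln u - ln t) = (s/2) * (ln t - ln u)" by (simp add: field_simps)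
 then have "(u / t) powr (-s/2) = (t / u) powr (s/2)"
  using assms by (simp only: powr_def ln_div) simp
 then show ?thesis using powr_half_quotient[OF assms, of s] by simp
qed

text \<open>Half of the exponent s pays for the logarithm by \<open>log_weight_compare\<close>, the
  other half is integrated as a pure power. \<open>log_integral_high\<close> does the same with a
  negative exponent on (t, 1).\<close>

lemma log_integral_low:
 assumes q: "0 < q" and s: "0 < s"
 obtains C where "C > 0"
  "\<And>t. 0 < t ==> t \<le> 1 ==> log_integral s b q 0 t (\<lambda>u. 1) \<le> ennreal (C * weight s b t)"
proof -
 obtain C1 where C1: "C1 > 0" "\<And>u t. 0 < u ==> u \<le> t ==> t \<le> 1 ==> (1 - ln u) powr b \<le> C1 * (t / u) powr (s/2) * (1 - ln t) powr b"
  using log_weight_compare[of "s/2" b] s by (metis half_gt_zero)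
 obtain C2 where C2: "C2 > 0" "\<And>t. 0 < t ==> t \<le> 1 ==> log_integral (s/2) 0 q 0 t (\<lambda>u. 1) \<le> ennreal (C2 * t powr (s/2))"
  using log_integral_power_low[OF q, of "s/2"] s by (metis half_gt_zero)
 show thesis
 proof (rule that[of "C1 * C2"])
  fix t :: real assume t: "0 < t" "t \<le> 1"
  let ?D = "C1 * weight (s/2) b t"
  have "log_integral s b q 0 t (\<lambda>u. 1) \<le> log_integral (s/2) 0 q 0 t (\<lambda>u. ennreal ?D)"
  proof (rule log_integral_weight_mono[OF q])
   fix u assume u: "0 < u" "u < t"
   have l: "1 - ln u > 0" using u t ln_less_one[of u] by auto
   have "weight s b u \<le> u powr s * (C1 * (t / u) powr (s/2) * (1 - ln t) powr b)"
    using u t by (intro mult_left_mono C1) auto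
   also have "... = u powr (s/2) * ?D"
    using powr_half_quotient[OF _ t(1), of u s] u by (simp add: mult_ac)
   finally show "ennreal (weight s b u) * 1 \<le> ennreal (weight (s/2) 0 u) * ennreal ?D"
    using l C1 t by (simp add: ennreal_mult'[symmetric] ennreal_leI)
  qed
  also have "... = ennreal ?D * log_integral (s/2) 0 q 0 t (\<lambda>u. 1)"
   using q C1 by (intro log_integral_const) auto
  also have "... \<le> ennreal ?D * ennreal (C2 * t powr (s/2))"
   using t by (intro mult_left_mono C2) auto
  also have "... = ennreal (C1 * C2 * weight s b t)"
   using C1 C2 t by (subst powr_halve[of t s]) (auto simp: ennreal_mult'[symmetric] mult_ac)
  finally show "log_integral s b q 0 t (\<lambda>u. 1) \<le> ennreal (C1 * C2 * weight s b t)" .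
 qed (use C1 C2 in auto)
qed

lemma log_integral_high:
 assumes q: "0 < q" and s: "s < 0"
 obtains C where "C > 0"
  "\<And>t. 0 < t ==> t < 1 ==> log_integral s b q t 1 (\<lambda>u. 1) \<le> ennreal (C * weight s b t)"
proof -
 have s2: "- s/2 > 0" "s / 2 < 0" using s by auto
 obtain C1 where C1: "C1 > 0" "\<And>u t. 0 < u ==> u \<le> t ==> t \<le> 1 ==> (1 - ln t) powr b \<le> C1 * (t / u) powr (-s/2) * (1 - ln u) powr b"
  using log_weight_compare[OF s2(1), of b] by metis
 obtain C2 where C2: "C2 > 0" "\<And>t. 0 < t ==> t < 1 ==> log_integral (s/2) 0 q t 1 (\<lambda>u. 1) \<le> ennreal (C2 * t powr (s/2))"
  using log_integral_power_high[OF q s2(2)] by metis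
 show thesis
 proof (rule that[of "C1 * C2"])
  fix t :: real assume t: "0 < t" "t < 1"
  let ?D = "C1 * weight (s/2) b t"
  have "log_integral s b q t 1 (\<lambda>u. 1) \<le> log_integral (s/2) 0 q t 1 (\<lambda>u. ennreal ?D)"
  proof (rule log_integral_weight_mono[OF q])
   fix u assume u: "t < u" "u < 1"
   have l: "1 - ln u > 0" using u t ln_less_one[of u] by auto
   have "weight s b u \<le> u powr s * (C1 * (u / t) powr (-s/2) * (1 - ln t) powr b)"
    using u t by (intro mult_left_mono C1) auto
   also have "... = u powr (s/2) * ?D"
    using powr_half_quotient'[OF _ t(1), of u s] u t by (simp add: mult_ac)
   finally show "ennreal (weight s b u) * 1 \<le> ennreal (weight (s/2) 0 u) * ennreal ?D"
    using l C1 t by (simp add: ennreal_mult'[symmetric] ennreal_leI)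
  qed
  also have "... = ennreal ?D * log_integral (s/2) 0 q t 1 (\<lambda>u. 1)"
   using q C1 by (intro log_integral_const) auto
  also have "... \<le> ennreal ?D * ennreal (C2 * t powr (s/2))"
   using t by (intro mult_left_mono C2) auto
  also have "... = ennreal (C1 * C2 * weight s b t)"
   using C1 C2 t by (subst powr_halve[of t s]) (auto simp: ennreal_mult'[symmetric] mult_ac)
  finally show "log_integral s b q t 1 (\<lambda>u. 1) \<le> ennreal (C1 * C2 * weight s b t)" .
 qed (use C1 C2 in auto)
qed

text \<open>On (t/2, t) the weight is bounded below by a multiple of its value at t, and du/u has
  mass ln 2 there for every t.\<close>

lemma log_integral_dyadic:
 assumes q: "0 < q"
 obtains c where "c > 0"
  "\<And>t. 0 < t ==> t \<le> 1 ==> ennreal (c * weight s b t) \<le> log_integral s b q (t/2) t (\<lambda>u. 1)"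
proof -
 obtain C1 where C1: "C1 > 0" "\<And>u t. 0 < u ==> u \<le> t ==> t \<le> 1 ==> (1 - ln t) powr b \<le> C1 * (t / u) powr 1 * (1 - ln u) powr b"
  using log_weight_compare[of 1 b] by (metis zero_less_one)
 define m where "m = (2::real) powr (- \<bar>s\<bar>)"
 have m: "m > 0" by (simp add: m_def)
 obtain d where d: "d > 0" "\<And>t. 0 < t ==> t \<le> 1 ==> log_integral 0 0 q (t/2) t (\<lambda>u. 1) = ennreal d"
 proof (cases "q = \<infinity>")
  case True
  show ?thesis
  proof (rule that[of 1])
   fix t :: real assume t: "0 < t" "t \<le> 1"
   have "(SUP u\<in>{t/2<..<t}. ennreal (weight 0 0 u) * 1) = (SUP u\<in>{t/2<..<t}. (1::ennreal))"
   proof (rule SUP_cong[OF refl])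
    fix u assume u: "u \<in> {t/2<..<t}"
    then have "u \<noteq> 0" "1 - ln u \<noteq> 0" using t ln_less_one[of u] by auto
    then show "ennreal (weight 0 0 u) * 1 = 1" by simp
   qed
   also have "... = 1" using t dense[of "t/2" t] by (intro SUP_const) auto
   finally show "log_integral 0 0 q (t/2) t (\<lambda>u. 1) = ennreal 1"
    by (simp add: True log_integral_infinity)
  qed simp
 next
  case False
  show ?thesis
  proof (rule that[of "ln 2 powr recip q"])
   fix t :: real assume t: "0 < t" "t \<le> 1"
   have "log_integral 0 0 q (t/2) t (\<lambda>u. 1) = ennreal ((ln t - ln (t/2)) powr recip q)"
   proof (rule log_integral_one_FTC[OF q False])
    fix u :: real assume u: "t/2 < u" "u < t"
    have u0: "u > 0" using u t by auto
    have "1 - ln u \<noteq> 0" using u t ln_less_one[of u] by auto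
    then show "(ln has_real_derivative weight (0 * enn2real q - 1) (0 * enn2real q) u) (at u)"
     using DERIV_ln_divide[of u] u0 by (simp add: powr_minus divide_inverse)
   qed (use t in \<open>auto intro!: tendsto_intros\<close>)
   then show "log_integral 0 0 q (t/2) t (\<lambda>u. 1) = ennreal (ln 2 powr recip q)"
    using t by (simp add: ln_div)
  qed auto
 qed
 show thesis
 proof (rule that[of "d * (m / (2 * C1))"])
  fix t :: real assume t: "0 < t" "t \<le> 1"
  let ?D = "m / (2 * C1) * weight s b t"
  have "log_integral 0 0 q (t/2) t (\<lambda>u. ennreal ?D) \<le> log_integral s b q (t/2) t (\<lambda>u. 1)"
  proof (rule log_integral_weight_mono[OF q])
   fix u assume u: "t/2 < u" "u < t"
   have l: "1 - ln u > 0" using u t ln_less_one[of u] by auto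
   have "(1 - ln t) powr b \<le> C1 * (t / u) powr 1 * (1 - ln u) powr b" using u t by (intro C1) auto
   also have "... \<le> C1 * 2 * (1 - ln u) powr b" using u t C1 by (intro mult_right_mono mult_left_mono) (auto simp: field_simps)
   finally have 1: "(1 - ln t) powr b / (2 * C1) \<le> (1 - ln u) powr b" using C1 by (simp add: field_simps)
   have 2: "m * t powr s \<le> u powr s"
   proof (cases "s \<ge> 0")
    case True
    have "(t/2) powr s \<le> u powr s" using u t True by (intro powr_mono2) auto
    moreover have "(t/2) powr s = t powr s / 2 powr s" by (rule powr_divide)
    moreover have "m = 1 / 2 powr s" using True by (simp add: m_def powr_minus_divide)
    ultimately show ?thesis by simp
   next
    case False
    have "t powr s \<le> u powr s" using u t False by (intro powr_mono2') auto
    moreover have "m \<le> 1" by (simp add: m_def powr_minus_divide ge_one_powr_ge_zero)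
    ultimately show ?thesis using m mult_left_le_one_le[of "t powr s" m] by auto
   qed
   have "?D = m * t powr s * ((1 - ln t) powr b / (2 * C1))" by simp
   also have "... \<le> weight s b u"
    using m C1 by (intro mult_mono 1 2) auto
   finally show "ennreal (weight 0 0 u) * ennreal ?D \<le> ennreal (weight s b u) * 1"
    using l u t by (simp add: ennreal_leI)
  qed
  also have "log_integral 0 0 q (t/2) t (\<lambda>u. ennreal ?D) = ennreal ?D * ennreal d"
   using q C1 m d t by (subst log_integral_const) auto
  finally show "ennreal (d * (m / (2 * C1)) * weight s b t) \<le> log_integral s b q (t/2) t (\<lambda>u. 1)"
   using d by (simp add: ennreal_mult'[symmetric] mult_ac)
 qed (use d m C1 in auto)
qed

lemma has_derivative_log_power:
 fixes e u :: real
 assumes "0 < u" "u < 1" "e \<noteq> 0"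
 shows "((\<lambda>u. - ((1 - ln u) powr e) / e) has_real_derivative weight (-1) (e - 1) u) (at u)"
 using assms ln_less_one[of u]
 by (auto intro!: derivative_eq_intros simp: powr_minus field_simps)

lemma tendsto_log_power:
 fixes e t :: real
 assumes "0 < t" "t \<le> 1"
 shows "((\<lambda>u. - ((1 - ln u) powr e) / e) \<longlongrightarrow> - ((1 - ln t) powr e) / e) (at t within A)"
 using assms ln_less_one[of t] by (cases "e = 0") (auto intro!: tendsto_intros)

text \<open>For finite q the integral of (1 - ln u)^(bq) du/u over (t, 1) is ((1 - ln t)^e - 1) / e
  with e = bq + 1, and the q-th root of the leading term has the exponent b + 1/q. The integral
  vanishes as t tends to 1, hence the summand 1 in the lower bound.\<close>

lemma log_integral_zero_high:
 assumes q: "0 < q" and b: "b > - recip q"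
 obtains C where "C > 0"
  "\<And>t. 0 < t ==> t < 1 ==> log_integral 0 b q t 1 (\<lambda>u. 1) \<le> ennreal (C * (1 - ln t) powr (b + recip q))"
  "\<And>t. 0 < t ==> t < 1 ==> ennreal ((1 - ln t) powr (b + recip q)) \<le> ennreal C * (1 + log_integral 0 b q t 1 (\<lambda>u. 1))"
proof (cases "q = \<infinity>")
 case True
 then have b: "b > 0" "recip q = 0" using b by (auto simp: recip_infinity[unfolded infinity_ennreal_def])
 show ?thesis
 proof (rule that[of "2 powr b"])
  fix t :: real assume t: "0 < t" "t < 1"
  have "weight 0 b u \<le> 2 powr b * (1 - ln t) powr (b + recip q)" if "t < u" "u < 1" for u
  proof -
   have "(1 - ln u) powr b \<le> 1 * (1 - ln t) powr b" using that t b ln_less_one[of u] by (auto intro!: powr_mono2)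
   also have "... \<le> 2 powr b * (1 - ln t) powr b" using b by (intro mult_right_mono) (auto simp: ge_one_powr_ge_zero)
   finally show ?thesis using that t b by simp
  qed
  then show "log_integral 0 b q t 1 (\<lambda>u. 1) \<le> ennreal (2 powr b * (1 - ln t) powr (b + recip q))"
   unfolding True log_integral_infinity by (auto intro!: SUP_least ennreal_leI)
  \<comment> \<open>At the square root 1 - ln t \<le> 2 (1 - ln u), so the weight at this single
    point already has the required size.\<close>
  define u where "u = sqrt t"
  have u: "t < u" "u < 1" "0 < u" using t by (auto simp: u_def real_less_rsqrt power2_eq_square)
  have l: "ln t = 2 * ln u" using t by (simp add: u_def ln_sqrt)
  have "(1 - ln t) powr b \<le> (2 * (1 - ln u)) powr b" using u b ln_less_one[of t] t unfolding l by (intro powr_mono2) auto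
  also have "... = 2 powr b * (1 - ln u) powr b" by (rule powr_mult)
  finally have "ennreal ((1 - ln t) powr b) \<le> ennreal (2 powr b) * (ennreal (weight 0 b u) * 1)"
   using u by (simp add: ennreal_leI flip: ennreal_mult)
  also have "... \<le> ennreal (2 powr b) * log_integral 0 b q t 1 (\<lambda>u. 1)"
   unfolding True log_integral_infinity by (intro mult_left_mono SUP_upper) (use u in auto)
  finally show "ennreal ((1 - ln t) powr (b + recip q)) \<le> ennreal (2 powr b) * (1 + log_integral 0 b q t 1 (\<lambda>u. 1))"
   using b by (simp add: add_increasing distrib_left)
 qed simp
next
 case False
 define Q where "Q = enn2real q"
 have Q: "Q > 0" "recip q = 1 / Q" using recip_pos[OF q False] by (auto simp: Q_def)
 define e where "e = b * Q + 1"
 have e: "e > 0" "e * recip q = b + recip q" using b Q by (auto simp: e_def field_simps)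
 have LI: "log_integral 0 b q t 1 (\<lambda>u. 1) = ennreal ((((1 - ln t) powr e - 1) / e) powr recip q)"
  and ge: "(1 - ln t) powr e - 1 \<ge> 0" if t: "0 < t" "t < 1" for t
 proof -
  have F: "((\<lambda>u. - ((1 - ln u) powr e) / e) has_real_derivative weight (0 * enn2real q - 1) (b * enn2real q) u) (at u)"
   if "t < u" "u < 1" for u
   using has_derivative_log_power[of u e] that t e by (simp add: e_def Q_def)
  note * = log_integral_one_FTC[OF q False less_imp_le[OF t(1)] t(2) order_refl F tendsto_log_power tendsto_log_power]
  show "log_integral 0 b q t 1 (\<lambda>u. 1) = ennreal ((((1 - ln t) powr e - 1) / e) powr recip q)"
   using *(2) t by (simp add: diff_divide_distrib)
  show "(1 - ln t) powr e - 1 \<ge> 0" using t e ln_less_one[of t] by (simp add: ge_one_powr_ge_zero)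
 qed
 show ?thesis
 proof (rule that[of "max ((1 / e) powr recip q) (max (2 powr recip q) (2 powr recip q * e powr recip q))"])
  let ?C = "max ((1 / e) powr recip q) (max (2 powr recip q) (2 powr recip q * e powr recip q))"
  fix t :: real assume t: "0 < t" "t < 1"
  have "(((1 - ln t) powr e - 1) / e) powr recip q \<le> ((1 / e) * (1 - ln t) powr e) powr recip q"
   using ge[OF t] e Q by (intro powr_mono2) (auto simp: divide_right_mono)
  also have "... = (1 / e) powr recip q * (1 - ln t) powr (b + recip q)"
   using e by (subst powr_mult) (auto simp: powr_powr)
  also have "... \<le> ?C * (1 - ln t) powr (b + recip q)" by (intro mult_right_mono) auto
  finally show "log_integral 0 b q t 1 (\<lambda>u. 1) \<le> ennreal (?C * (1 - ln t) powr (b + recip q))"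
   unfolding LI[OF t] by (rule ennreal_leI)
  define I where "I = ((1 - ln t) powr e - 1) / e"
  have I: "I \<ge> 0" "(1 - ln t) powr e = e * I + 1" using ge[OF t] e by (auto simp: I_def)
  have "ennreal ((1 - ln t) powr (b + recip q)) = epowr (ennreal (e * I) + ennreal 1) (recip q)"
  proof -
   have "(1 - ln t) powr (b + recip q) = (e * I + 1) powr recip q"
    unfolding e(2)[symmetric] powr_powr[symmetric] I(2) ..
   then show ?thesis using e I by (simp add: epowr_ennreal ennreal_plus[symmetric] del: ennreal_plus ennreal_1)
  qed
  also have "... \<le> ennreal (2 powr recip q) * (epowr (ennreal (e * I)) (recip q) + epowr (ennreal 1) (recip q))"
   using Q by (intro epowr_add_le) auto
  also have "... = ennreal (2 powr recip q * e powr recip q) * ennreal (I powr recip q) + ennreal (2 powr recip q) * 1"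
  proof -
   have "epowr (ennreal (e * I)) (recip q) = ennreal (e powr recip q) * ennreal (I powr recip q)"
    using e I by (subst epowr_ennreal) (auto simp: powr_mult ennreal_mult)
   then show ?thesis by (simp add: epowr_ennreal distrib_left mult.assoc ennreal_mult del: ennreal_1) simp
  qed
  also have "... \<le> ennreal ?C * ennreal (I powr recip q) + ennreal ?C * 1"
   by (intro add_mono mult_right_mono ennreal_leI) auto
  finally show "ennreal ((1 - ln t) powr (b + recip q)) \<le> ennreal ?C * (1 + log_integral 0 b q t 1 (\<lambda>u. 1))"
   unfolding LI[OF t] I_def by (simp add: distrib_left add.commute)
 qed (use e in \<open>simp add: less_max_iff_disj\<close>)
qed

text \<open>For finite q the exponent bq + 1 is negative, the primitive tends to 0 at 0, and the
  integral over (0, t) is an exact multiple of (1 - ln t)^(bq + 1). For q = \<infinity> the weight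
  increases with u, and its value at t/2 serves for the lower bound.\<close>

lemma log_integral_zero_low:
 assumes q: "0 < q" and b: "b < - recip q \<or> q = \<infinity> \<and> b \<le> 0"
 obtains C where "C > 0"
  "\<And>t. 0 < t ==> t \<le> 1 ==> log_integral 0 b q 0 t (\<lambda>u. 1) \<le> ennreal (C * (1 - ln t) powr (b + recip q))"
  "\<And>t. 0 < t ==> t \<le> 1 ==> ennreal ((1 - ln t) powr (b + recip q)) \<le> ennreal C * log_integral 0 b q 0 t (\<lambda>u. 1)"
proof (cases "q = \<infinity>")
 case True
 then have b: "b \<le> 0" "recip q = 0" using b by (auto simp: recip_infinity[unfolded infinity_ennreal_def])
 show ?thesis
 proof (rule that[of "2 powr (-b)"])
  fix t :: real assume t: "0 < t" "t \<le> 1"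
  have "weight 0 b u \<le> 2 powr (-b) * (1 - ln t) powr (b + recip q)" if "0 < u" "u < t" for u
  proof -
   have "(1 - ln u) powr b \<le> 1 * (1 - ln t) powr b" using that t b ln_less_one[of t] by (auto intro!: powr_mono2')
   also have "... \<le> 2 powr (-b) * (1 - ln t) powr b" using b by (intro mult_right_mono) (auto simp: ge_one_powr_ge_zero)
   finally show ?thesis using that t b by simp
  qed
  then show "log_integral 0 b q 0 t (\<lambda>u. 1) \<le> ennreal (2 powr (-b) * (1 - ln t) powr (b + recip q))"
   unfolding True log_integral_infinity by (auto intro!: SUP_least ennreal_leI)
  define u where "u = t / 2"
  have u: "u < t" "u < 1" "0 < u" using t by (auto simp: u_def)
  define a :: real where "a = ln 2"
  define y where "y = ln t"
  have l: "ln u = y - a" using t by (simp add: u_def a_def y_def ln_div)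
  have "a \<le> 1" using ln_le_minus_one[of "2::real"] by (simp add: a_def)
  moreover have "y \<le> 0" using t by (simp add: y_def)
  ultimately have "y + a \<le> 1" by linarith
  then have "1 - ln u \<le> 2 * (1 - y)" unfolding l by (simp add: algebra_simps)
  then have "1 - ln u \<le> 2 * (1 - ln t)" by (simp add: y_def)
  then have "(2 * (1 - ln t)) powr b \<le> (1 - ln u) powr b"
   using u b ln_less_one[of u] by (intro powr_mono2') auto
  then have "2 powr (-b) * (2 powr b * (1 - ln t) powr b) \<le> 2 powr (-b) * (1 - ln u) powr b"
   using t by (subst powr_mult[symmetric]) (auto intro!: mult_left_mono)
  then have "(1 - ln t) powr b \<le> 2 powr (-b) * (1 - ln u) powr b"
   by (simp add: mult.assoc[symmetric] powr_add[symmetric])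
  then have "ennreal ((1 - ln t) powr b) \<le> ennreal (2 powr (-b)) * (ennreal (weight 0 b u) * 1)"
   using u by (simp add: ennreal_leI flip: ennreal_mult)
  also have "... \<le> ennreal (2 powr (-b)) * log_integral 0 b q 0 t (\<lambda>u. 1)"
   unfolding True log_integral_infinity by (intro mult_left_mono SUP_upper) (use u in auto)
  finally show "ennreal ((1 - ln t) powr (b + recip q)) \<le> ennreal (2 powr (-b)) * log_integral 0 b q 0 t (\<lambda>u. 1)"
   using b by simp
 qed simp
next
 case False
 define Q where "Q = enn2real q"
 have Q: "Q > 0" "recip q = 1 / Q" using recip_pos[OF q False] by (auto simp: Q_def)
 define e where "e = b * Q + 1"
 have "b < - recip q" using b False by auto
 then have e: "e < 0" "e * recip q = b + recip q" using Q by (auto simp: e_def field_simps)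
 have LI: "log_integral 0 b q 0 t (\<lambda>u. 1) = ennreal ((1 / (-e)) powr recip q * (1 - ln t) powr (b + recip q))"
  if t: "0 < t" "t \<le> 1" for t
 proof -
  have F: "((\<lambda>u. - ((1 - ln u) powr e) / e) has_real_derivative weight (0 * enn2real q - 1) (b * enn2real q) u) (at u)"
   if "0 < u" "u < t" for u
   using has_derivative_log_power[of u e] that t e by (simp add: e_def Q_def)
  have "filterlim (\<lambda>u::real. - ln u) at_top (at_right 0)"
   using ln_at_0 by (simp add: filterlim_uminus_at_bot)
  then have "filterlim (\<lambda>u::real. 1 + - ln u) at_top (at_right 0)"
   by (intro filterlim_tendsto_add_at_top[OF tendsto_const])
  then have "((\<lambda>u::real. (1 + - ln u) powr e) \<longlongrightarrow> 0) (at_right 0)"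
   using e by (intro tendsto_neg_powr) auto
  then have "((\<lambda>u. - ((1 + - ln u) powr e) / e) \<longlongrightarrow> - 0 / e) (at_right 0)"
   using e by (intro tendsto_intros) auto
  then have A: "((\<lambda>u. - ((1 - ln u) powr e) / e) \<longlongrightarrow> 0) (at_right 0)" by simp
  note * = log_integral_one_FTC[OF q False order_refl t F A tendsto_log_power[OF t]]
  have "log_integral 0 b q 0 t (\<lambda>u. 1) = ennreal (((1 / (-e)) * (1 - ln t) powr e) powr recip q)"
   using *(2) t by simp
  also have "((1 / (-e)) * (1 - ln t) powr e) powr recip q = (1 / (-e)) powr recip q * (1 - ln t) powr (b + recip q)"
   using e by (subst powr_mult) (auto simp: powr_powr)
  finally show ?thesis .
 qed
 define d where "d = (1 / (-e)) powr recip q"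
 have d: "d > 0" using e by (simp add: d_def)
 show ?thesis
 proof (rule that[of "max d (1 / d)"])
  fix t :: real assume t: "0 < t" "t \<le> 1"
  show "log_integral 0 b q 0 t (\<lambda>u. 1) \<le> ennreal (max d (1 / d) * (1 - ln t) powr (b + recip q))"
   unfolding LI[OF t] d_def[symmetric] by (intro ennreal_leI mult_right_mono) auto
  have "(1 - ln t) powr (b + recip q) = (1 / d) * (d * (1 - ln t) powr (b + recip q))" using d by simp
  also have "... \<le> max d (1 / d) * (d * (1 - ln t) powr (b + recip q))" using d by (intro mult_right_mono) auto
  finally show "ennreal ((1 - ln t) powr (b + recip q)) \<le> ennreal (max d (1 / d)) * log_integral 0 b q 0 t (\<lambda>u. 1)"
   unfolding LI[OF t] d_def[symmetric] using d by (simp add: ennreal_leI flip: ennreal_mult)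
 qed (use d in auto)
qed

section \<open>Absorption and Hardy inequalities\<close>

text \<open>Moduli of smoothness are suprema over uncountably many steps; monotonicity is what
  supplies their measurability, superlevel sets being intervals.\<close>

lemma borel_measurable_mono_ennreal:
 fixes f :: "real => ennreal"
 assumes "\<And>x y. x \<le> y ==> f x \<le> f y"
 shows "f \<in> borel_measurable borel"
proof (rule borel_measurableI_greater)
 fix a
 have "is_interval {x. a < f x}"
  unfolding is_interval_1 using assms less_le_trans by blast
 then show "{x \<in> space borel. a < f x} \<in> sets borel"
  by (simp add: real_interval_borel_measurable)
qed

lemma borel_measurable_antimono_ennreal:
 fixes f :: "real => ennreal"
 assumes "\<And>x y. x \<le> y ==> f y \<le> f x"
 shows "f \<in> borel_measurable borel"
proof (rule borel_measurableI_greater)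
 fix a
 have "is_interval {x. a < f x}"
  unfolding is_interval_1 using assms less_le_trans by blast
 then show "{x \<in> space borel. a < f x} \<in> sets borel"
  by (simp add: real_interval_borel_measurable)
qed

text \<open>Iterated doubling: about log_2 (t/u) steps, each costing 2^k. The last, incomplete step
  accounts for the extra factor 2^k. In effect w(t) / t^k is almost decreasing.\<close>

lemma doubling_power_bound:
 fixes w :: "real => ennreal"
 assumes mono: "\<And>u v. u \<le> v ==> w u \<le> w v"
  and double: "\<And>u. 0 < u ==> w (2 * u) \<le> ennreal (2 ^ k) * w u"
  and u: "0 < u" and ut: "u \<le> t"
 shows "w t \<le> ennreal (2 ^ k * (t / u) ^ k) * w u"
proof -
 have "t \<le> 2 ^ n * u ==> w t \<le> ennreal (2 ^ k * (t / u) ^ k) * w u" if "u \<le> t" for n t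
  using that
 proof (induction n arbitrary: t)
  case 0
  then have "t = u" by simp
  then show ?case using u mult_right_mono[of 1 "ennreal (2 ^ k)" "w u"] by simp
 next
  case (Suc n)
  show ?case
  proof (cases "t \<le> 2 * u")
   case True
   have "w t \<le> ennreal (2 ^ k) * w u" using mono[OF True] double[OF u] by (rule order.trans)
   also have "... \<le> ennreal (2 ^ k * (t / u) ^ k) * w u"
    using Suc u by (intro mult_right_mono ennreal_leI) (auto simp: one_le_power)
   finally show ?thesis .
  next
   case False
   then have "w (t/2) \<le> ennreal (2 ^ k * (t / 2 / u) ^ k) * w u" using Suc by (intro Suc.IH) auto
   moreover have "w t \<le> ennreal (2 ^ k) * w (t/2)" using double[of "t/2"] u Suc by simp
   ultimately have "w t \<le> ennreal (2 ^ k) * (ennreal (2 ^ k * (t / 2 / u) ^ k) * w u)"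
    by (meson mult_left_mono order.trans zero_le)
   also have "... = ennreal (2 ^ k * (2 ^ k * (t / 2 / u) ^ k)) * w u"
    using u Suc by (simp add: ennreal_mult mult.assoc)
   also have "2 ^ k * (2 ^ k * (t / 2 / u) ^ k) = 2 ^ k * (t / u) ^ k"
    by (simp add: power_mult_distrib[symmetric])
   finally show ?thesis .
  qed
 qed
 moreover obtain n where "t / u \<le> 2 ^ n"
  using real_arch_pow[of 2 "t / u"] less_imp_le by auto
 ultimately show ?thesis using u ut by (metis pos_divide_le_eq)
qed

lemma weight_comparable:
 fixes s b :: real
 obtains C where "C > 0"
  "\<And>u t. 0 < u ==> u \<le> t ==> t \<le> 1 ==> t \<le> 2 * u ==>
    weight s b u \<le> C * weight s b t"
proof -
 obtain C1 where C1: "C1 > 0" "\<And>u t. 0 < u ==> u \<le> t ==> t \<le> 1 ==> (1 - ln u) powr b \<le> C1 * (t / u) powr 1 * (1 - ln t) powr b"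
  using log_weight_compare[of 1 b] by (metis zero_less_one)
 show thesis
 proof (rule that[of "2 powr \<bar>s\<bar> * (C1 * 2)"])
  fix u t :: real assume u: "0 < u" "u \<le> t" "t \<le> 1" "t \<le> 2 * u"
  have "(1 - ln u) powr b \<le> C1 * (t / u) powr 1 * (1 - ln t) powr b" using u by (intro C1) auto
  also have "... \<le> C1 * 2 * (1 - ln t) powr b" using u C1 by (intro mult_right_mono mult_left_mono) (auto simp: field_simps)
  finally have 1: "(1 - ln u) powr b \<le> C1 * 2 * (1 - ln t) powr b" .
  have 2: "u powr s \<le> 2 powr \<bar>s\<bar> * t powr s"
  proof (cases "s \<ge> 0")
   case True
   have "u powr s \<le> 1 * t powr s" using u True by (auto intro!: powr_mono2)
   also have "... \<le> 2 powr \<bar>s\<bar> * t powr s" by (intro mult_right_mono) (auto simp: ge_one_powr_ge_zero)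
   finally show ?thesis .
  next
   case False
   have "u powr s \<le> (t / 2) powr s" using u False by (intro powr_mono2') auto
   also have "(t / 2) powr s = t powr s / 2 powr s" by (rule powr_divide)
   also have "... = 2 powr \<bar>s\<bar> * t powr s" using False powr_minus_divide[of 2 s] by (simp add: mult.commute)
   finally show ?thesis by simp
  qed
  have "weight s b u \<le> (2 powr \<bar>s\<bar> * t powr s) * (C1 * 2 * (1 - ln t) powr b)"
   using C1 by (intro mult_mono 1 2) auto
  then show "weight s b u \<le> 2 powr \<bar>s\<bar> * (C1 * 2) * weight s b t"
   by (simp add: mult_ac)
 qed (use C1 in auto)
qed

lemma log_integral_const_le:
 assumes "0 < q" "x < \<infinity>"
 shows "x * log_integral s b q a c (\<lambda>u. 1) = log_integral s b q a c (\<lambda>u. x)"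
 using log_integral_cmult[OF assms(1,2), of "\<lambda>u. 1"] by simp

text \<open>On (t/2, t) doubling and monotonicity give w(u) \<ge> 2^(-k) w(t), and the weight has a
  norm there of at least a multiple of its value at t.\<close>

lemma absorb_low:
 assumes q: "0 < q"
 obtains C where "C > 0"
  "\<And>w t. (\<And>u v. u \<le> v ==> w u \<le> w v) ==> (\<And>u. 0 < u ==> w (2 * u) \<le> ennreal (2 ^ k) * w u) ==>
    w t < \<infinity> ==> 0 < t ==> t \<le> 1 ==>
    ennreal (weight s b t) * w t \<le> ennreal C * log_integral s b q 0 t w"
proof -
 obtain c where c: "c > 0"
  "\<And>t. 0 < t ==> t \<le> 1 ==> ennreal (c * weight s b t) \<le> log_integral s b q (t/2) t (\<lambda>u. 1)"
  using log_integral_dyadic[OF q] by metis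
 show thesis
 proof (rule that[of "2 ^ k / c"])
  fix w :: "real => ennreal" and t :: real
  assume mono: "\<And>u v. u \<le> v ==> w u \<le> w v" and double: "\<And>u. 0 < u ==> w (2 * u) \<le> ennreal (2 ^ k) * w u"
   and fin: "w t < \<infinity>" and t: "0 < t" "t \<le> 1"
  have [measurable]: "w \<in> borel_measurable borel" by (rule borel_measurable_mono_ennreal) (rule mono)
  have "ennreal c * (ennreal (weight s b t) * w t) = w t * ennreal (c * weight s b t)"
   using c by (simp add: ennreal_mult mult_ac)
  also have "... \<le> w t * log_integral s b q (t/2) t (\<lambda>u. 1)"
   using c(2)[OF t] by (rule mult_left_mono) simp
  also have "... = log_integral s b q (t/2) t (\<lambda>u. w t)" by (rule log_integral_const_le[OF q fin])
  also have "... \<le> log_integral s b q (t/2) t (\<lambda>u. ennreal (2 ^ k) * w u)"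
  proof (rule log_integral_mono[OF q])
   fix u assume u: "t/2 < u" "u < t"
   then have "w t \<le> w (2 * u)" by (intro mono) auto
   also have "... \<le> ennreal (2 ^ k) * w u" using u t by (intro double) auto
   finally show "w t \<le> ennreal (2 ^ k) * w u" .
  qed
  also have "... \<le> log_integral s b q 0 t (\<lambda>u. ennreal (2 ^ k) * w u)"
   using t by (intro log_integral_mono_interval q) auto
  also have "... = ennreal (2 ^ k) * log_integral s b q 0 t w" using q by (intro log_integral_cmult) auto
  finally have "ennreal (1 / c) * (ennreal c * (ennreal (weight s b t) * w t)) \<le> ennreal (1 / c) * (ennreal (2 ^ k) * log_integral s b q 0 t w)"
   by (rule mult_left_mono) simp
  then show "ennreal (weight s b t) * w t \<le> ennreal (2 ^ k / c) * log_integral s b q 0 t w"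
   using c by (simp add: mult.assoc[symmetric] ennreal_mult'[symmetric])
 qed (use c in auto)
qed

text \<open>To the right of t monotonicity alone gives w(u) \<ge> w(t); the interval (t, 2t) has to
  fit below 1.\<close>

lemma absorb_dyadic_high:
 assumes q: "0 < q"
 obtains C where "C > 0"
  "\<And>w t. (\<And>u v. u \<le> v ==> w u \<le> w v) ==>
    w t < \<infinity> ==> 0 < t ==> t \<le> 1/2 ==>
    ennreal (weight s b t) * w t \<le> ennreal C * log_integral s b q t 1 w"
proof -
 obtain c where c: "c > 0"
  "\<And>t. 0 < t ==> t \<le> 1 ==> ennreal (c * weight s b t) \<le> log_integral s b q (t/2) t (\<lambda>u. 1)"
  using log_integral_dyadic[OF q] by metis
 obtain C1 where C1: "C1 > 0"
  "\<And>u t. 0 < u ==> u \<le> t ==> t \<le> 1 ==> t \<le> 2 * u ==>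
    weight s b u \<le> C1 * weight s b t"
  using weight_comparable[of s b] by metis
 show thesis
 proof (rule that[of "C1 / c"])
  fix w :: "real => ennreal" and t :: real
  assume mono: "\<And>u v. u \<le> v ==> w u \<le> w v" and fin: "w t < \<infinity>" and t: "0 < t" "t \<le> 1/2"
  have "weight s b t \<le> C1 * ((2*t) powr s * (1 - ln (2*t)) powr b)"
   using t by (intro C1) auto
  then have "ennreal (weight s b t) \<le> ennreal (C1 / c) * ennreal (c * ((2*t) powr s * (1 - ln (2*t)) powr b))"
   using c C1 by (simp add: ennreal_mult'[symmetric] ennreal_leI)
  also have "... \<le> ennreal (C1 / c) * log_integral s b q (2*t/2) (2*t) (\<lambda>u. 1)"
   using t by (intro mult_left_mono c) auto
  finally have "ennreal (weight s b t) * w t \<le> (ennreal (C1 / c) * log_integral s b q (2*t/2) (2*t) (\<lambda>u. 1)) * w t"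
   by (rule mult_right_mono) simp
  also have "... = ennreal (C1 / c) * log_integral s b q t (2*t) (\<lambda>u. w t)"
   by (simp only: log_integral_const_le[OF q fin, symmetric]) (simp add: mult_ac)
  also have "log_integral s b q t (2*t) (\<lambda>u. w t) \<le> log_integral s b q t (2*t) w"
   by (intro log_integral_mono q mono) auto
  also have "... \<le> log_integral s b q t 1 w" using t by (intro log_integral_mono_interval q) auto
  finally show "ennreal (weight s b t) * w t \<le> ennreal (C1 / c) * log_integral s b q t 1 w"
   by (simp add: mult_left_mono)
 qed (use c C1 in auto)
qed

text \<open>For t > 1/2 the interval (t, 1) may be too short to detect w(t). There the weight is
  bounded, and the a priori bound by x, later the norm of f, takes over.\<close>

lemma absorb_high:
 assumes q: "0 < q"
 obtains C where "C > 0"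
  "\<And>w t x. (\<And>u v. u \<le> v ==> w u \<le> w v) ==> w t \<le> ennreal (2 ^ k) * x ==> x < \<infinity> ==>
    0 < t ==> t < 1 ==>
    ennreal (weight s b t) * w t \<le> ennreal C * (x + log_integral s b q t 1 w)"
proof -
 obtain C where C: "C > 0"
  "\<And>w t. (\<And>u v. u \<le> v ==> w u \<le> w v) ==>
    w t < \<infinity> ==> 0 < t ==> t \<le> 1/2 ==>
    ennreal (weight s b t) * w t \<le> ennreal C * log_integral s b q t 1 w"
  using absorb_dyadic_high[OF q] by metis
 obtain C1 where C1: "C1 > 0"
  "\<And>u t. 0 < u ==> u \<le> t ==> t \<le> 1 ==> t \<le> 2 * u ==>
    weight s b u \<le> C1 * weight s b t"
  using weight_comparable[of s b] by metis
 show thesis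
 proof (rule that[of "max C (C1 * 2 ^ k)"])
  fix w :: "real => ennreal" and t :: real and x :: ennreal
  assume mono: "\<And>u v. u \<le> v ==> w u \<le> w v" and wx: "w t \<le> ennreal (2 ^ k) * x" "x < \<infinity>" and t: "0 < t" "t < 1"
  have fin: "w t < \<infinity>" using wx by (auto simp: ennreal_mult_less_top intro: le_less_trans)
  show "ennreal (weight s b t) * w t \<le> ennreal (max C (C1 * 2 ^ k)) * (x + log_integral s b q t 1 w)"
  proof (cases "t \<le> 1/2")
   case True
   have "ennreal (weight s b t) * w t \<le> ennreal C * log_integral s b q t 1 w"
    using fin t True by (intro C mono) auto
   also have "... \<le> ennreal (max C (C1 * 2 ^ k)) * (x + log_integral s b q t 1 w)"
    by (intro mult_mono ennreal_leI) auto
   finally show ?thesis .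
  next
   case False
   have "weight s b t \<le> C1" using C1(2)[of t 1] t False by simp
   then have "ennreal (weight s b t) * w t \<le> ennreal C1 * (ennreal (2 ^ k) * x)"
    by (intro mult_mono ennreal_leI wx) auto
   also have "... = ennreal (C1 * 2 ^ k) * x" using C1 by (simp add: ennreal_mult mult.assoc)
   also have "... \<le> ennreal (max C (C1 * 2 ^ k)) * (x + log_integral s b q t 1 w)"
    by (intro mult_mono ennreal_leI) auto
   finally show ?thesis .
  qed
 qed (use C in auto)
qed

text \<open>The whole interval (0, t) counts now, not a dyadic piece: w(u) / u^k is at least a
  multiple of w(t) / t^k throughout, so the logarithmic weight contributes its full norm, with the
  exponent b + 1/q.\<close>

lemma absorb_low_limiting:
 assumes q: "0 < q" and b: "b < - recip q \<or> q = \<infinity> \<and> b \<le> 0"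
 obtains C where "C > 0"
  "\<And>w t. (\<And>u v. u \<le> v ==> w u \<le> w v) ==> (\<And>u. 0 < u ==> w (2 * u) \<le> ennreal (2 ^ k) * w u) ==>
    w t < \<infinity> ==> 0 < t ==> t \<le> 1 ==>
    ennreal (weight (- real k) (b + recip q) t) * w t \<le> ennreal C * log_integral (- real k) b q 0 t w"
proof -
 obtain C where C: "C > 0"
  "\<And>t. 0 < t ==> t \<le> 1 ==> ennreal ((1 - ln t) powr (b + recip q)) \<le> ennreal C * log_integral 0 b q 0 t (\<lambda>u. 1)"
  using log_integral_zero_low[OF q b] by metis
 show thesis
 proof (rule that[of "C * 2 ^ k"])
  fix w :: "real => ennreal" and t :: real
  assume mono: "\<And>u v. u \<le> v ==> w u \<le> w v" and double: "\<And>u. 0 < u ==> w (2 * u) \<le> ennreal (2 ^ k) * w u"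
   and fin: "w t < \<infinity>" and t: "0 < t" "t \<le> 1"
  have [measurable]: "w \<in> borel_measurable borel" by (rule borel_measurable_mono_ennreal) (rule mono)
  have fin': "ennreal (t powr (- real k)) * w t < \<infinity>" using fin by (simp add: ennreal_mult_less_top)
  have "ennreal (weight (- real k) (b + recip q) t) * w t
    = ennreal ((1 - ln t) powr (b + recip q)) * (ennreal (t powr (- real k)) * w t)"
   by (simp add: ennreal_mult mult_ac)
  also have "... \<le> (ennreal C * log_integral 0 b q 0 t (\<lambda>u. 1)) * (ennreal (t powr (- real k)) * w t)"
   by (intro mult_right_mono C t) simp
  also have "... = ennreal C * log_integral 0 b q 0 t (\<lambda>u. ennreal (t powr (- real k)) * w t)"
   using log_integral_const_le[OF q fin'] by (simp add: mult_ac)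
  also have "log_integral 0 b q 0 t (\<lambda>u. ennreal (t powr (- real k)) * w t) \<le> log_integral (- real k) b q 0 t (\<lambda>u. ennreal (2 ^ k) * w u)"
  proof (rule log_integral_weight_mono[OF q])
   fix u assume u: "0 < u" "u < t"
   have "ennreal (t powr (- real k)) * w t \<le> ennreal (t powr (- real k)) * (ennreal (2 ^ k * (t / u) ^ k) * w u)"
    using u by (intro mult_left_mono doubling_power_bound mono double) auto
   also have "... = ennreal (t powr (- real k) * (2 ^ k * (t / u) ^ k)) * w u"
    using u t by (simp add: ennreal_mult mult.assoc)
   also have "t powr (- real k) * (2 ^ k * (t / u) ^ k) = u powr (- real k) * 2 ^ k"
    using u t by (simp add: powr_minus powr_realpow power_divide field_simps)
   finally have "ennreal ((1 - ln u) powr b) * (ennreal (t powr (- real k)) * w t) \<le> ennreal ((1 - ln u) powr b) * (ennreal (u powr (- real k) * 2 ^ k) * w u)"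
    by (rule mult_left_mono) simp
   then show "ennreal (weight 0 b u) * (ennreal (t powr (- real k)) * w t)
    \<le> ennreal (weight (- real k) b u) * (ennreal (2 ^ k) * w u)"
    using u by (simp add: ennreal_mult mult_ac)
  qed
  also have "log_integral (- real k) b q 0 t (\<lambda>u. ennreal (2 ^ k) * w u) = ennreal (2 ^ k) * log_integral (- real k) b q 0 t w"
   using q by (intro log_integral_cmult) auto
  finally show "ennreal (weight (- real k) (b + recip q) t) * w t \<le> ennreal (C * 2 ^ k) * log_integral (- real k) b q 0 t w"
   using C by (simp add: ennreal_mult mult.assoc mult_left_mono)
 qed (use C in auto)
qed

text \<open>Counterpart on (t, 1), where w(u) \<ge> w(t) lets the whole logarithmic weight be
  collected. The summand x compensates for t close to 1.\<close>

lemma absorb_high_limiting: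
 assumes q: "0 < q" and b: "b > - recip q"
 obtains C where "C > 0"
  "\<And>w t x. (\<And>u v. u \<le> v ==> w u \<le> w v) ==> w t \<le> ennreal (2 ^ k) * x ==> x < \<infinity> ==>
    0 < t ==> t < 1 ==>
    ennreal ((1 - ln t) powr (b + recip q)) * w t \<le> ennreal C * (x + log_integral 0 b q t 1 w)"
proof -
 obtain C where C: "C > 0"
  "\<And>t. 0 < t ==> t < 1 ==> ennreal ((1 - ln t) powr (b + recip q)) \<le> ennreal C * (1 + log_integral 0 b q t 1 (\<lambda>u. 1))"
  using log_integral_zero_high[OF q b] by metis
 show thesis
 proof (rule that[of "C * 2 ^ k"])
  fix w :: "real => ennreal" and t :: real and x :: ennreal
  assume mono: "\<And>u v. u \<le> v ==> w u \<le> w v" and wx: "w t \<le> ennreal (2 ^ k) * x" "x < \<infinity>" and t: "0 < t" "t < 1"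
  have fin: "w t < \<infinity>" using wx by (auto simp: ennreal_mult_less_top intro: le_less_trans)
  have "ennreal ((1 - ln t) powr (b + recip q)) * w t \<le> (ennreal C * (1 + log_integral 0 b q t 1 (\<lambda>u. 1))) * w t"
   by (intro mult_right_mono C t) simp
  also have "... = ennreal C * (w t + log_integral 0 b q t 1 (\<lambda>u. w t))"
   using log_integral_const_le[OF q fin, symmetric] by (simp add: distrib_left distrib_right mult_ac)
  also have "... \<le> ennreal C * (ennreal (2 ^ k) * x + ennreal (2 ^ k) * log_integral 0 b q t 1 w)"
  proof (intro mult_left_mono add_mono wx)
   have "log_integral 0 b q t 1 (\<lambda>u. w t) \<le> 1 * log_integral 0 b q t 1 w"
    by (simp, intro log_integral_mono q mono) auto
   also have "... \<le> ennreal (2 ^ k) * log_integral 0 b q t 1 w" by (intro mult_right_mono) auto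
   finally show "log_integral 0 b q t 1 (\<lambda>u. w t) \<le> ennreal (2 ^ k) * log_integral 0 b q t 1 w" .
  qed auto
  also have "... = ennreal (C * 2 ^ k) * (x + log_integral 0 b q t 1 w)"
   using C by (simp add: ennreal_mult mult.assoc distrib_left)
  finally show "ennreal ((1 - ln t) powr (b + recip q)) * w t \<le> ennreal (C * 2 ^ k) * (x + log_integral 0 b q t 1 w)" .
 qed (use C in auto)
qed

text \<open>A Hardy inequality whose inner norm lies in the same L_q(du/u). For finite q the q-th
  power is a double integral, so exchanging the order works for every q > 0, including q < 1; it
  leaves the weight integral over (0, u), which s < \<kappa> makes convergent.\<close>

lemma log_integral_hardy:
 assumes q: "0 < q" and s: "s < \<kappa>"
 obtains C where "C > 0"
  "\<And>w. w \<in> borel_measurable borel ==>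
    log_integral (\<kappa> - s) b q 0 1 (\<lambda>t. log_integral (- \<kappa>) 0 q t 1 w) \<le> ennreal C * log_integral (- s) b q 0 1 w"
proof (cases "q = \<infinity>")
 case True
 obtain C1 where C1: "C1 > 0" "\<And>u t. 0 < u ==> u \<le> t ==> t \<le> 1 ==> (1 - ln u) powr b \<le> C1 * (t / u) powr (\<kappa> - s) * (1 - ln t) powr b"
  using log_weight_compare[of "\<kappa> - s" b] s by (metis diff_gt_0_iff_gt)
 show ?thesis
 proof (rule that[OF C1(1)])
  fix w :: "real => ennreal"
  show "log_integral (\<kappa> - s) b q 0 1 (\<lambda>t. log_integral (- \<kappa>) 0 q t 1 w) \<le> ennreal C1 * log_integral (- s) b q 0 1 w"
   unfolding True log_integral_infinity
  proof (intro SUP_least)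
   fix t :: real assume t: "t \<in> {0<..<1}"
   have "ennreal (weight (\<kappa> - s) b t) * (ennreal (weight (- \<kappa>) 0 u) * w u)
     \<le> ennreal C1 * (SUP u\<in>{0<..<1}. ennreal (weight (- s) b u) * w u)" if u: "u \<in> {t<..<1}" for u
   proof -
    have "weight (\<kappa> - s) b t * u powr (-\<kappa>) \<le> t powr (\<kappa> - s) * (C1 * (u / t) powr (\<kappa> - s) * (1 - ln u) powr b) * u powr (-\<kappa>)"
     using t u by (intro mult_left_mono mult_right_mono C1) auto
    also have "... = C1 * weight (-s) b u"
    proof -
     have "t powr (\<kappa> - s) * (u / t) powr (\<kappa> - s) = u powr (\<kappa> - s)"
      using t u powr_mult[of t "u / t" "\<kappa> - s"] by auto
     moreover have "u powr (\<kappa> - s) * u powr (-\<kappa>) = u powr (-s)" by (simp flip: powr_add)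
     ultimately show ?thesis by (metis (no_types, lifting) mult.assoc mult.commute)
    qed
    finally have le: "weight (\<kappa> - s) b t * u powr (-\<kappa>) \<le> C1 * weight (-s) b u" .
    have "1 - ln u \<noteq> 0" using u t ln_less_one[of u] by auto
    then have "ennreal (weight (\<kappa> - s) b t) * (ennreal (weight (- \<kappa>) 0 u) * w u)
     = ennreal (weight (\<kappa> - s) b t * u powr (-\<kappa>)) * w u"
     by (simp add: ennreal_mult mult.assoc)
    also have "... \<le> ennreal (C1 * weight (-s) b u) * w u"
     using le by (intro mult_right_mono ennreal_leI) auto
    also have "... = ennreal C1 * (ennreal (weight (- s) b u) * w u)"
     using C1 by (simp add: ennreal_mult mult.assoc)
    also have "... \<le> ennreal C1 * (SUP u\<in>{0<..<1}. ennreal (weight (- s) b u) * w u)"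
     using t u by (intro mult_left_mono SUP_upper) auto
    finally show ?thesis .
   qed
   then show "ennreal (weight (\<kappa> - s) b t) * (SUP u\<in>{t<..<1}. ennreal (weight (- \<kappa>) 0 u) * w u)
     \<le> ennreal C1 * (SUP u\<in>{0<..<1}. ennreal (weight (- s) b u) * w u)"
    by (simp add: SUP_mult_left_ennreal SUP_le_iff)
  qed
 qed
next
 case False
 define Q where "Q = enn2real q"
 have Q: "Q > 0" "recip q = 1 / Q" using recip_pos[OF q False] by (auto simp: Q_def)
 obtain C where C: "C > 0" "\<And>t. 0 < t ==> t \<le> 1 ==> log_integral (\<kappa> - s) b q 0 t (\<lambda>u. 1) \<le> ennreal (C * weight (\<kappa> - s) b t)"
  using log_integral_low[OF q, of "\<kappa> - s" b] s by (metis diff_gt_0_iff_gt)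
 have inner: "(\<integral>\<^sup>+t\<in>{0<..<u}. ennreal (weight ((\<kappa> - s) * Q - 1) (b * Q) t) \<partial>lborel)
   \<le> ennreal (C powr Q * weight ((\<kappa> - s) * Q) (b * Q) u)" (is "?I \<le> _") if u: "0 < u" "u < 1" for u
 proof -
  have "epowr 1 (enn2real q) = 1" using epowr_ennreal[of 1] by simp
  then have "log_integral (\<kappa> - s) b q 0 u (\<lambda>u. 1) = epowr ?I (recip q)"
   using u by (simp add: log_integral_finite[OF q False] Q_def)
  then have "?I = epowr (log_integral (\<kappa> - s) b q 0 u (\<lambda>u. 1)) Q"
   using Q by (simp add: epowr_epowr epowr_one)
  also have "... \<le> epowr (ennreal (C * weight (\<kappa> - s) b u)) Q"
   using u Q by (intro epowr_mono C) auto
  also have "... = ennreal (C powr Q * weight ((\<kappa> - s) * Q) (b * Q) u)"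
   using C u by (simp add: epowr_ennreal powr_mult powr_powr)
  finally show ?thesis .
 qed
 show ?thesis
 proof (rule that[of "C"])
  fix w :: "real => ennreal" assume [measurable]: "w \<in> borel_measurable borel"
  define A where "A = (\<lambda>t. ennreal (weight ((\<kappa> - s) * Q - 1) (b * Q) t))"
  define B where "B = (\<lambda>u. ennreal (u powr (- \<kappa> * Q - 1)) * epowr (w u) Q)"
  have [measurable]: "A \<in> borel_measurable borel" "B \<in> borel_measurable borel" unfolding A_def B_def by measurable
  have in1: "epowr (log_integral (- \<kappa>) 0 q t 1 w) Q = (\<integral>\<^sup>+u\<in>{t<..<1}. B u \<partial>lborel)" if "0 < t" "t < 1" for t
  proof -
   have "(\<integral>\<^sup>+u\<in>{t<..<1}. ennreal (weight (- \<kappa> * enn2real q - 1) (0 * enn2real q) u) * epowr (w u) (enn2real q) \<partial>lborel)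
    = (\<integral>\<^sup>+u\<in>{t<..<1}. B u \<partial>lborel)"
   proof (intro nn_integral_cong)
    fix u :: real
    show "ennreal (weight (- \<kappa> * enn2real q - 1) (0 * enn2real q) u) * epowr (w u) (enn2real q) * indicator {t<..<1} u
     = B u * indicator {t<..<1} u"
     using that ln_less_one[of u] by (cases "u \<in> {t<..<1}") (auto simp: B_def Q_def)
   qed
   then show ?thesis using that Q
    by (simp add: log_integral_finite[OF q False] epowr_epowr epowr_one)
  qed
  have outer: "log_integral (\<kappa> - s) b q 0 1 (\<lambda>t. log_integral (- \<kappa>) 0 q t 1 w)
    = epowr (\<integral>\<^sup>+t\<in>{0<..<1}. A t * epowr (log_integral (- \<kappa>) 0 q t 1 w) Q \<partial>lborel) (recip q)"
   by (simp add: log_integral_finite[OF q False] A_def Q_def)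
  have "(\<integral>\<^sup>+t\<in>{0<..<1}. A t * epowr (log_integral (- \<kappa>) 0 q t 1 w) Q \<partial>lborel)
    = (\<integral>\<^sup>+t. (\<integral>\<^sup>+u. A t * B u * indicator {(t, u). 0 < t \<and> t < u \<and> u < 1} (t, u) \<partial>lborel) \<partial>lborel)"
  proof (intro nn_integral_cong)
   fix t :: real
   show "A t * epowr (log_integral (- \<kappa>) 0 q t 1 w) Q * indicator {0<..<1} t
    = (\<integral>\<^sup>+u. A t * B u * indicator {(t, u). 0 < t \<and> t < u \<and> u < 1} (t, u) \<partial>lborel)"
   proof (cases "t \<in> {0<..<1}")
    case True
    then have "A t * epowr (log_integral (- \<kappa>) 0 q t 1 w) Q * indicator {0<..<1} t = A t * (\<integral>\<^sup>+u\<in>{t<..<1}. B u \<partial>lborel)"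
     using in1 by simp
    also have "... = (\<integral>\<^sup>+u. A t * (B u * indicator {t<..<1} u) \<partial>lborel)"
     by (rule nn_integral_cmult[symmetric]) measurable
    also have "... = (\<integral>\<^sup>+u. A t * B u * indicator {(t, u). 0 < t \<and> t < u \<and> u < 1} (t, u) \<partial>lborel)"
     using True by (intro nn_integral_cong) (auto simp: indicator_def)
    finally show ?thesis .
   next
    case False
    then have "(\<lambda>u. A t * B u * indicator {(t, u). 0 < t \<and> t < u \<and> u < 1} (t, u)) = (\<lambda>u. 0)"
     by (auto simp: indicator_def)
    then show ?thesis using False by simp
   qed
  qed
  also have "... = (\<integral>\<^sup>+u. (\<integral>\<^sup>+t. A t * B u * indicator {(t, u). 0 < t \<and> t < u \<and> u < 1} (t, u) \<partial>lborel) \<partial>lborel)"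
   by (rule lborel_pair.Fubini') measurable
  also have "... \<le> (\<integral>\<^sup>+u. ennreal (C powr Q) * (ennreal (weight (- s * Q - 1) (b * Q) u) * epowr (w u) Q * indicator {0<..<1} u) \<partial>lborel)"
  proof (intro nn_integral_mono)
   fix u :: real
   show "(\<integral>\<^sup>+t. A t * B u * indicator {(t, u). 0 < t \<and> t < u \<and> u < 1} (t, u) \<partial>lborel)
    \<le> ennreal (C powr Q) * (ennreal (weight (- s * Q - 1) (b * Q) u) * epowr (w u) Q * indicator {0<..<1} u)"
   proof (cases "u \<in> {0<..<1}")
    case True
    have "(\<integral>\<^sup>+t. A t * B u * indicator {(t, u). 0 < t \<and> t < u \<and> u < 1} (t, u) \<partial>lborel)
     = (\<integral>\<^sup>+t. B u * (A t * indicator {0<..<u} t) \<partial>lborel)"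
     using True by (intro nn_integral_cong) (auto simp: indicator_def mult_ac)
    also have "... = B u * (\<integral>\<^sup>+t\<in>{0<..<u}. A t \<partial>lborel)"
     by (rule nn_integral_cmult) measurable
    also have "... \<le> B u * ennreal (C powr Q * weight ((\<kappa> - s) * Q) (b * Q) u)"
     unfolding A_def using True by (intro mult_left_mono inner) auto
    also have "... = ennreal (u powr (- \<kappa> * Q - 1) * (C powr Q * weight ((\<kappa> - s) * Q) (b * Q) u)) * epowr (w u) Q"
     unfolding B_def by (simp add: ennreal_mult mult_ac)
    also have "u powr (- \<kappa> * Q - 1) * (C powr Q * weight ((\<kappa> - s) * Q) (b * Q) u)
      = C powr Q * weight (- s * Q - 1) (b * Q) u"
    proof -
     have "u powr (- \<kappa> * Q - 1) * u powr ((\<kappa> - s) * Q) = u powr (- s * Q - 1)"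
      unfolding powr_add[symmetric] by (rule arg_cong) (simp add: algebra_simps)
     from this[symmetric] show ?thesis by (simp only: mult_ac)
    qed
    finally show ?thesis using True by (simp add: ennreal_mult mult.assoc)
   next
    case False
    then have "(\<lambda>t. A t * B u * indicator {(t, u). 0 < t \<and> t < u \<and> u < 1} (t, u)) = (\<lambda>t. 0)"
     by (auto simp: indicator_def)
    then show ?thesis by simp
   qed
  qed
  also have "... = ennreal (C powr Q) * (\<integral>\<^sup>+u. ennreal (weight (- s * Q - 1) (b * Q) u) * epowr (w u) Q * indicator {0<..<1} u \<partial>lborel)"
   by (rule nn_integral_cmult) measurable
  finally have "log_integral (\<kappa> - s) b q 0 1 (\<lambda>t. log_integral (- \<kappa>) 0 q t 1 w)
   \<le> epowr (ennreal (C powr Q) * (\<integral>\<^sup>+u. ennreal (weight (- s * Q - 1) (b * Q) u) * epowr (w u) Q * indicator {0<..<1} u \<partial>lborel)) (recip q)"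
   unfolding outer using Q by (simp add: epowr_mono)
  also have "... = ennreal C * log_integral (- s) b q 0 1 w"
   using Q C by (simp add: epowr_mult powr_powr log_integral_finite[OF q False] Q_def)
  finally show "log_integral (\<kappa> - s) b q 0 1 (\<lambda>t. log_integral (- \<kappa>) 0 q t 1 w) \<le> ennreal C * log_integral (- s) b q 0 1 w" .
 qed (use C in auto)
qed

section \<open>Domination and Holmstedt estimates\<close>

lemma ennreal_combine:
 assumes "0 \<le> a" "0 \<le> b" "0 \<le> e" "0 \<le> g" "0 \<le> c"
 shows "ennreal a * (ennreal e * y) + ennreal b * (ennreal g * (ennreal c * y)) = ennreal (a * e + b * (g * c)) * y"
 using assms by (simp add: ennreal_plus ennreal_mult distrib_right mult.assoc)

text \<open>Here v and w stand for the moduli of order k and k + 1, x for the norm. Iterating the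
  last hypothesis up to scale 1 bounds v(t) by t^\<kappa> times the sum of x and the norm of
  u^(-\<kappa>) w(u) over (t, 1); Hardy's inequality then finishes. This avoids summing a dyadic
  series in L_q, which would need a triangle inequality.\<close>

lemma log_integral_raise_order:
 assumes q: "0 < q" and s: "s < real k"
 obtains C where "C > 0"
  "\<And>v w x. (\<And>t u. t \<le> u ==> w t \<le> w u) ==> (\<And>t. 0 < t ==> v t \<le> ennreal (2 ^ k) * x) ==>
    (\<And>t. 0 < t ==> w t \<le> ennreal (2 ^ Suc k) * x) ==> x < \<infinity> ==>
    (\<And>t. 0 < t ==> v t \<le> ennreal (2 powr (- real k)) * v (2 * t) + ennreal (real k / 2) * w t) ==>
    log_integral (- s) b q 0 1 v \<le> ennreal C * (x + log_integral (- s) b q 0 1 w)"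
proof -
 \<comment> \<open>For k > 0 this lies strictly between s and k: s < \<kappa> is what Hardy's
   inequality needs, and \<kappa> < k makes the iteration contract. The maximum with 0 keeps
   \<kappa> positive.\<close>
 define \<kappa> where "\<kappa> = (max 0 s + real k) / 2"
 show thesis
 proof (cases "k = 0")
  case True
  obtain C1 where C1: "C1 > 0" "\<And>t. 0 < t ==> t \<le> 1 ==> log_integral (- s) b q 0 t (\<lambda>u. 1) \<le> ennreal (C1 * weight (- s) b t)"
   using log_integral_low[OF q, of "- s" b] s True by (metis neg_0_less_iff_less of_nat_0)
  show ?thesis
  proof (rule that[OF C1(1)])
   fix v w :: "real => ennreal" and x :: ennreal
   assume v: "\<And>t. 0 < t ==> v t \<le> ennreal (2 ^ k) * x" and x: "x < \<infinity>"
   have "log_integral (- s) b q 0 1 v \<le> log_integral (- s) b q 0 1 (\<lambda>_. x)"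
    using v True by (intro log_integral_mono q) auto
   also have "... = x * log_integral (- s) b q 0 1 (\<lambda>_. 1)" by (rule log_integral_const_le[OF q x, symmetric])
   also have "... \<le> x * ennreal C1" using C1(2)[of 1] by (intro mult_left_mono) auto
   also have "... \<le> ennreal C1 * (x + log_integral (- s) b q 0 1 w)"
    by (simp add: mult.commute distrib_left)
   finally show "log_integral (- s) b q 0 1 v \<le> ennreal C1 * (x + log_integral (- s) b q 0 1 w)" .
  qed
 next
  case False
  then have \<kappa>: "s < \<kappa>" "\<kappa> < real k" "0 < \<kappa>" using s by (auto simp: \<kappa>_def)
  obtain c where c: "c > 0"
   "\<And>w t. (\<And>u v. u \<le> v ==> w u \<le> w v) ==> w t < \<infinity> ==> 0 < t ==> t \<le> 1/2 ==>
    ennreal (weight (- \<kappa>) 0 t) * w t \<le> ennreal c * log_integral (- \<kappa>) 0 q t 1 w"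
   using absorb_dyadic_high[OF q, of "- \<kappa>" 0] by metis
  obtain H where H: "H > 0"
   "\<And>w. w \<in> borel_measurable borel ==>
    log_integral (\<kappa> - s) b q 0 1 (\<lambda>t. log_integral (- \<kappa>) 0 q t 1 w) \<le> ennreal H * log_integral (- s) b q 0 1 w"
   using log_integral_hardy[OF q \<kappa>(1), of b] by metis
  obtain A where A: "A > 0" "\<And>a c w w'. w \<in> borel_measurable borel ==> w' \<in> borel_measurable borel ==>
    log_integral (\<kappa> - s) b q a c (\<lambda>u. w u + w' u) \<le> ennreal A * (log_integral (\<kappa> - s) b q a c w + log_integral (\<kappa> - s) b q a c w')"
   using log_integral_add[OF q, of "\<kappa> - s" b] by metis
  obtain P where P: "P > 0" "\<And>t. 0 < t ==> t \<le> 1 ==> log_integral (\<kappa> - s) b q 0 t (\<lambda>u. 1) \<le> ennreal (P * weight (\<kappa> - s) b t)"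
   using log_integral_low[OF q, of "\<kappa> - s" b] \<kappa>(1) by (metis diff_gt_0_iff_gt)
  define r where "r = (2::real) powr (\<kappa> - real k)"
  have r: "0 < r" "r < 1" using \<kappa> by (auto simp: r_def powr_less_one)
  \<comment> \<open>The first entry covers t \<ge> 1/2, where v is at most 2^k x; the second is the
    fixed point of D = r D + k c / 2, the recursion of the induction step.\<close>
  define D where "D = max (2 ^ k * 2 powr \<kappa>) ((real k / 2 * c) / (1 - r))"
  have "(real k / 2 * c) / (1 - r) \<le> D" by (simp add: D_def)
  then have "real k / 2 * c \<le> D * (1 - r)" using r by (simp only: pos_divide_le_eq diff_gt_0_iff_gt)
  then have D: "D > 0" "2 ^ k * 2 powr \<kappa> \<le> D" "r * D + real k / 2 * c \<le> D"
   by (simp_all add: less_max_iff_disj algebra_simps) (simp_all add: D_def less_max_iff_disj)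
  show ?thesis
  proof (rule that[of "D * A * max P H"])
   fix v w :: "real => ennreal" and x :: ennreal
   assume mono: "\<And>t u. t \<le> u ==> w t \<le> w u" and vx: "\<And>t. 0 < t ==> v t \<le> ennreal (2 ^ k) * x"
    and wx: "\<And>t. 0 < t ==> w t \<le> ennreal (2 ^ Suc k) * x" and x: "x < \<infinity>"
    and step: "\<And>t. 0 < t ==> v t \<le> ennreal (2 powr (- real k)) * v (2 * t) + ennreal (real k / 2) * w t"
   have [measurable]: "w \<in> borel_measurable borel" by (rule borel_measurable_mono_ennreal) (rule mono)
   have wfin: "w t < \<infinity>" if "0 < t" for t
    using wx[OF that] x by (auto simp: ennreal_mult_less_top intro: le_less_trans)
   define Y where "Y = (\<lambda>t. log_integral (- \<kappa>) 0 q t 1 w + x)"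
   have Ymono: "Y u \<le> Y t" if "t \<le> u" for t u
    unfolding Y_def using that by (intro add_mono log_integral_mono_interval q) auto
   have *: "t \<ge> (1/2) ^ n ==> 0 < t ==> t \<le> 1 ==> v t \<le> ennreal (D * t powr \<kappa>) * Y t" for n t
   proof (induction n arbitrary: t)
    case 0
    then have "t = 1" by simp
    have "v t \<le> ennreal (2 ^ k) * x" using 0 by (intro vx) auto
    also have "... \<le> ennreal (D * t powr \<kappa>) * Y t"
    proof (intro mult_mono ennreal_leI)
     have "2 ^ k * 1 \<le> 2 ^ k * 2 powr \<kappa>" using \<kappa> by (intro mult_left_mono) (auto simp: ge_one_powr_ge_zero)
     also have "... \<le> D" by (rule D(2))
     finally show "2 ^ k \<le> D * t powr \<kappa>" using D \<open>t = 1\<close> by simp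
    qed (auto simp: Y_def)
    finally show ?case .
   next
    case (Suc n)
    show ?case
    proof (cases "t \<ge> 1/2")
     case True
     have "v t \<le> ennreal (2 ^ k) * x" using Suc by (intro vx) auto
     also have "... \<le> ennreal (D * t powr \<kappa>) * Y t"
     proof (intro mult_mono ennreal_leI)
      have "1 \<le> (2 * t) powr \<kappa>" using True \<kappa> by (intro ge_one_powr_ge_zero) auto
      then have "2 ^ k * 1 \<le> 2 ^ k * (2 powr \<kappa> * t powr \<kappa>)" by (simp add: powr_mult)
      also have "... \<le> D * t powr \<kappa>" using D(2) by (simp add: mult.assoc[symmetric] mult_right_mono)
      finally show "2 ^ k \<le> D * t powr \<kappa>" by simp
     qed (auto simp: Y_def)
     finally show ?thesis .
    next
     case False
     have "v (2 * t) \<le> ennreal (D * (2 * t) powr \<kappa>) * Y (2 * t)"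
      using Suc False by (intro Suc.IH) auto
     also have "... \<le> ennreal (D * (2 * t) powr \<kappa>) * Y t"
      using Suc by (intro mult_left_mono Ymono) auto
     finally have 1: "ennreal (2 powr (- real k)) * v (2 * t) \<le> ennreal (2 powr (- real k)) * (ennreal (D * (2 * t) powr \<kappa>) * Y t)"
      by (rule mult_left_mono) simp
     have "1 - ln t \<noteq> 0" using ln_less_one[of t] Suc by auto
     then have "ennreal (t powr (- \<kappa>)) * w t \<le> ennreal c * log_integral (- \<kappa>) 0 q t 1 w"
      using c(2)[of w t, OF mono wfin] Suc False by simp
     then have "ennreal (t powr \<kappa>) * (ennreal (t powr (- \<kappa>)) * w t) \<le> ennreal (t powr \<kappa>) * (ennreal c * Y t)"
      unfolding Y_def by (intro mult_left_mono) (simp_all add: distrib_left add_increasing2)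
     moreover have "ennreal (t powr \<kappa>) * (ennreal (t powr (- \<kappa>)) * w t) = w t"
      using Suc by (simp add: mult.assoc[symmetric] ennreal_mult'[symmetric] flip: powr_add)
     ultimately have 2: "w t \<le> ennreal (t powr \<kappa>) * (ennreal c * Y t)" by simp
     have "v t \<le> ennreal (2 powr (- real k)) * v (2 * t) + ennreal (real k / 2) * w t"
      using Suc by (intro step) auto
     also have "... \<le> ennreal (2 powr (- real k)) * (ennreal (D * (2 * t) powr \<kappa>) * Y t)
       + ennreal (real k / 2) * (ennreal (t powr \<kappa>) * (ennreal c * Y t))"
      by (intro add_mono 1 mult_left_mono 2) auto
     also have "... = ennreal (2 powr (- real k) * (D * (2 * t) powr \<kappa>) + real k / 2 * (t powr \<kappa> * c)) * Y t"
      by (rule ennreal_combine) (use D c in auto)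
     also have "2 powr (- real k) * (D * (2 * t) powr \<kappa>) + real k / 2 * (t powr \<kappa> * c) = (r * D + real k / 2 * c) * t powr \<kappa>"
     proof -
      have "2 powr (- real k) * 2 powr \<kappa> = r" unfolding r_def by (simp flip: powr_add)
      from this[symmetric] have "2 powr (- real k) * (D * (2 * t) powr \<kappa>) = r * D * t powr \<kappa>"
       unfolding powr_mult by (simp only: mult_ac)
      then show ?thesis by (simp add: algebra_simps)
     qed
     also have "ennreal ((r * D + real k / 2 * c) * t powr \<kappa>) * Y t \<le> ennreal (D * t powr \<kappa>) * Y t"
      by (intro mult_right_mono ennreal_leI D) auto
     finally show ?thesis .
    qed
   qed
   have vY: "v t \<le> ennreal (D * t powr \<kappa>) * Y t" if "0 < t" "t \<le> 1" for t
   proof -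
    obtain n where "(1/2) ^ n < t" using real_arch_pow_inv[of t "1/2"] \<open>0 < t\<close> by auto
    then show ?thesis using *[of n t] that by auto
   qed
   have [measurable]: "(\<lambda>t. log_integral (- \<kappa>) 0 q t 1 w) \<in> borel_measurable borel"
    by (rule borel_measurable_antimono_ennreal) (auto intro!: log_integral_mono_interval q)
   have [measurable]: "Y \<in> borel_measurable borel" unfolding Y_def by measurable
   have "log_integral (- s) b q 0 1 v \<le> log_integral (\<kappa> - s) b q 0 1 (\<lambda>t. ennreal D * Y t)"
   proof (rule log_integral_weight_mono[OF q])
    fix u :: real assume u: "0 < u" "u < 1"
    have "ennreal (weight (- s) b u) * v u \<le> ennreal (weight (- s) b u) * (ennreal (D * u powr \<kappa>) * Y u)"
     using u by (intro mult_left_mono vY) auto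
    also have "... = ennreal (weight (- s) b u * (D * u powr \<kappa>)) * Y u"
     using D by (simp add: ennreal_mult mult.assoc)
    also have "weight (- s) b u * (D * u powr \<kappa>) = weight (\<kappa> - s) b u * D"
    proof -
     have "u powr (- s) * u powr \<kappa> = u powr (\<kappa> - s)" by (simp flip: powr_add)
     from this[symmetric] show ?thesis by (simp only: mult_ac)
    qed
    finally show "ennreal (weight (- s) b u) * v u \<le> ennreal (weight (\<kappa> - s) b u) * (ennreal D * Y u)"
     using D by (simp add: ennreal_mult mult.assoc)
   qed
   also have "... = ennreal D * log_integral (\<kappa> - s) b q 0 1 Y" using q by (intro log_integral_cmult) auto
   also have "log_integral (\<kappa> - s) b q 0 1 Y \<le> ennreal A * (log_integral (\<kappa> - s) b q 0 1 (\<lambda>t. log_integral (- \<kappa>) 0 q t 1 w) + log_integral (\<kappa> - s) b q 0 1 (\<lambda>t. x))"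
    unfolding Y_def by (rule A) measurable
   also have "... \<le> ennreal A * (ennreal (max P H) * log_integral (- s) b q 0 1 w + ennreal (max P H) * x)"
   proof (intro mult_left_mono add_mono)
    have "log_integral (\<kappa> - s) b q 0 1 (\<lambda>t. log_integral (- \<kappa>) 0 q t 1 w) \<le> ennreal H * log_integral (- s) b q 0 1 w"
     by (rule H) measurable
    also have "... \<le> ennreal (max P H) * log_integral (- s) b q 0 1 w" by (intro mult_right_mono ennreal_leI) auto
    finally show "log_integral (\<kappa> - s) b q 0 1 (\<lambda>t. log_integral (- \<kappa>) 0 q t 1 w) \<le> ennreal (max P H) * log_integral (- s) b q 0 1 w" .
    have "log_integral (\<kappa> - s) b q 0 1 (\<lambda>t. x) = x * log_integral (\<kappa> - s) b q 0 1 (\<lambda>t. 1)"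
     by (rule log_integral_const_le[OF q x, symmetric])
    also have "... \<le> x * ennreal (max P H)"
    proof (rule mult_left_mono)
     have "log_integral (\<kappa> - s) b q 0 1 (\<lambda>t. 1) \<le> ennreal P" using P(2)[of 1] by simp
     also have "... \<le> ennreal (max P H)" by (rule ennreal_leI) simp
     finally show "log_integral (\<kappa> - s) b q 0 1 (\<lambda>t. 1) \<le> ennreal (max P H)" .
    qed simp
    finally show "log_integral (\<kappa> - s) b q 0 1 (\<lambda>t. x) \<le> ennreal (max P H) * x" by (simp add: mult.commute)
   qed auto
   finally show "log_integral (- s) b q 0 1 v \<le> ennreal (D * A * max P H) * (x + log_integral (- s) b q 0 1 w)"
    using D A P by (simp add: ennreal_mult mult.assoc distrib_left add.commute mult_left_mono)
  qed (use D A P in \<open>auto simp: less_max_iff_disj\<close>)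
 qed
qed

text \<open>The relation \<lesssim> with a constant uniform on X. Being transitive and additive, it
  lets chains of estimates compose without naming constants.\<close>

definition dominated_on :: "'x set => ('x => ennreal) => ('x => ennreal) => bool" where
 "dominated_on X F G \<longleftrightarrow> (\<exists>C>0::real. \<forall>x\<in>X. F x \<le> ennreal C * G x)"

abbreviation (input) below :: "('f => ennreal) => ('f \<times> real) set" where
 "below A \<equiv> {(f,t). A f < \<infinity> \<and> 0 < t \<and> t < 1}"

lemma dominated_onI: "C > 0 ==> (\<And>x. x \<in> X ==> F x \<le> ennreal C * G x) ==> dominated_on X F G"
 unfolding dominated_on_def by blast

lemma dominated_on_belowI:
 assumes "C > 0" "\<And>f t. A f < \<infinity> ==> 0 < t ==> t < 1 ==> F f t \<le> ennreal C * G f t"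
 shows "dominated_on (below A) (\<lambda>(f, t). F f t) (\<lambda>(f, t). G f t)"
 using assms by (auto intro!: dominated_onI)

lemma dominated_on_le: "(\<And>x. x \<in> X ==> F x \<le> G x) ==> dominated_on X F G"
 by (rule dominated_onI[of 1]) auto

lemma dominated_on_trans [trans]:
 assumes "dominated_on X F G" "dominated_on X G H" shows "dominated_on X F H"
proof -
 obtain C D where C: "C > 0" "\<And>x. x \<in> X ==> F x \<le> ennreal C * G x"
  and D: "D > 0" "\<And>x. x \<in> X ==> G x \<le> ennreal D * H x"
  using assms unfolding dominated_on_def by metis
 show ?thesis
 proof (rule dominated_onI[of "C * D"])
  fix x assume "x \<in> X"
  then have "F x \<le> ennreal C * (ennreal D * H x)"
   using C D by (meson mult_left_mono order.trans zero_le)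
  then show "F x \<le> ennreal (C * D) * H x" using C D by (simp add: ennreal_mult mult.assoc)
 qed (use C D in simp)
qed

lemma dominated_on_add:
 assumes "dominated_on X F H" "dominated_on X G H" shows "dominated_on X (\<lambda>x. F x + G x) H"
proof -
 obtain C D where C: "C > 0" "\<And>x. x \<in> X ==> F x \<le> ennreal C * H x"
  and D: "D > 0" "\<And>x. x \<in> X ==> G x \<le> ennreal D * H x"
  using assms unfolding dominated_on_def by metis
 show ?thesis
 proof (rule dominated_onI[of "C + D"])
  fix x assume "x \<in> X"
  then show "F x + G x \<le> ennreal (C + D) * H x"
   using C D by (simp add: distrib_right add_mono)
 qed (use C D in simp)
qed

lemma dominated_on_mult:
 assumes "dominated_on X F G" shows "dominated_on X (\<lambda>x. c x * F x) (\<lambda>x. c x * G x)"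
 using assms unfolding dominated_on_def by (metis mult.left_commute mult_left_mono zero_le)

lemma dominated_on_reindex:
 assumes "dominated_on X F G" "\<And>y. y \<in> Y ==> \<phi> y \<in> X"
 shows "dominated_on Y (\<lambda>y. F (\<phi> y)) (\<lambda>y. G (\<phi> y))"
 using assms unfolding dominated_on_def by metis

lemma dominated_onD:
 assumes "dominated_on X F G"
 obtains C where "C > 0" "\<And>x. x \<in> X ==> F x \<le> ennreal C * G x"
 using assms unfolding dominated_on_def by metis

lemma equivalent_on_iff_dominated_on:
 fixes F G :: "('a => complex) => real => ennreal"
 shows "equivalent_on A F G \<longleftrightarrow>
   dominated_on (below A) (\<lambda>(f, t). F f t) (\<lambda>(f, t). G f t) \<and>
   dominated_on (below A) (\<lambda>(f, t). G f t) (\<lambda>(f, t). F f t)"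
 (is "?l \<longleftrightarrow> ?r")
proof
 assume ?l then show ?r unfolding equivalent_on_def dominated_on_def by fastforce
next
 assume ?r
 then obtain C D where C: "C > 0" "\<And>f (t::real). A f < \<infinity> ==> 0 < t ==> t < 1 ==> F f t \<le> ennreal C * G f t"
  and D: "D > 0" "\<And>f (t::real). A f < \<infinity> ==> 0 < t ==> t < 1 ==> G f t \<le> ennreal D * F f t"
  unfolding dominated_on_def by auto
 show ?l unfolding equivalent_on_def
 proof (intro exI[of _ "max C D"] conjI allI impI)
  fix f and t :: real assume "A f < \<infinity> \<and> 0 < t \<and> t < 1"
  then show "F f t \<le> ennreal (max C D) * G f t" "G f t \<le> ennreal (max C D) * F f t"
   using C(2)[of f t] D(2)[of f t]
   by (meson ennreal_leI max.cobounded1 max.cobounded2 mult_right_mono order.trans zero_le)+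
 qed (use C in auto)
qed

section \<open>Holmstedt's equivalence in abstract form\<close>

lemma le_mult_Inf:
 assumes "C > 0" "\<And>x. x \<in> S ==> y \<le> ennreal C * x"
 shows "y \<le> ennreal C * Inf S"
proof -
 have "ennreal (1 / C) * y \<le> Inf S"
 proof (rule Inf_greatest)
  fix x assume "x \<in> S"
  then have "ennreal (1 / C) * y \<le> ennreal (1 / C) * (ennreal C * x)" by (intro mult_left_mono assms) auto
  then show "ennreal (1 / C) * y \<le> x" using assms(1) by (simp add: mult.assoc[symmetric] ennreal_mult'[symmetric])
 qed
 then have "ennreal C * (ennreal (1 / C) * y) \<le> ennreal C * Inf S" by (rule mult_left_mono) simp
 then show ?thesis using assms(1) by (simp add: mult.assoc[symmetric] ennreal_mult'[symmetric])
qed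

text \<open>\<open>R\<^sub>0\<close> and \<open>R\<^sub>1\<close> are the growth functions of the
  two spaces, \<open>n\<^sub>0\<close> and \<open>n\<^sub>1\<close> the parts of their norms over
  (0, t) and (t, 1). The hypothesis \<open>upper\<close> provides the splitting f = (f - g) + g. For
  the lower estimate each of the four terms is bounded by the norm in \<open>E\<^sub>0\<close> on
  the first summand of a decomposition and by \<open>R\<^sub>0 / R\<^sub>1\<close> times the norm in
  \<open>E\<^sub>1\<close> on the second; \<open>ratio\<close> handles the term with L on the first
  summand.\<close>

lemma K_functional_equivalent:
 fixes L E\<^sub>0 E\<^sub>1 A :: "('a => complex) => ennreal" and \<omega> n\<^sub>0 n\<^sub>1 :: "('a => complex) => real => ennreal"
  and R\<^sub>0 R\<^sub>1 :: "real => real"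
 defines "D \<equiv> (below L)"
  and "X \<equiv> {(f, g, t). E\<^sub>0 f < \<infinity> \<and> E\<^sub>1 g < \<infinity> \<and> 0 < t \<and> t < (1::real)}"
  and "Y\<^sub>0 \<equiv> (below E\<^sub>0)"
  and "Y\<^sub>1 \<equiv> (below E\<^sub>1)"
 assumes pos: "\<And>t. 0 < t ==> t < 1 ==> 0 < R\<^sub>0 t \<and> 0 < R\<^sub>1 t"
  and A: "\<And>f. A f < \<infinity> ==> L f < \<infinity>"
  and L_add: "\<And>f g. L (\<lambda>x. f x + g x) \<le> L f + L g"
  and w_add: "\<And>f g t. \<omega> (\<lambda>x. f x + g x) t \<le> \<omega> f t + \<omega> g t"
  and n0_add: "dominated_on X (\<lambda>(f, g, t). n\<^sub>0 (\<lambda>x. f x + g x) t) (\<lambda>(f, g, t). n\<^sub>0 f t + n\<^sub>0 g t)"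
  and n1_add: "dominated_on X (\<lambda>(f, g, t). n\<^sub>1 (\<lambda>x. f x + g x) t) (\<lambda>(f, g, t). n\<^sub>1 f t + n\<^sub>1 g t)"
  and upper: "\<exists>g. dominated_on D (\<lambda>(f, t). E\<^sub>0 (\<lambda>x. f x - g f t x))
          (\<lambda>(f, t). ennreal (R\<^sub>0 t) * \<omega> f t + ennreal (R\<^sub>0 t / R\<^sub>1 t) * L f + n\<^sub>0 f t) \<and>
         dominated_on D (\<lambda>(f, t). E\<^sub>1 (g f t)) (\<lambda>(f, t). L f + ennreal (R\<^sub>1 t) * \<omega> f t + n\<^sub>1 f t)"
  and ratio: "\<exists>c. \<forall>t. 0 < t \<and> t < 1 \<longrightarrow> R\<^sub>0 t / R\<^sub>1 t \<le> c"
  and L0: "dominated_on Y\<^sub>0 (\<lambda>(f, t). L f) (\<lambda>(f, t). E\<^sub>0 f)"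
  and L1: "dominated_on Y\<^sub>1 (\<lambda>(f, t). L f) (\<lambda>(f, t). E\<^sub>1 f)"
  and w0: "dominated_on Y\<^sub>0 (\<lambda>(f, t). ennreal (R\<^sub>0 t) * \<omega> f t) (\<lambda>(f, t). E\<^sub>0 f)"
  and w1: "dominated_on Y\<^sub>1 (\<lambda>(f, t). ennreal (R\<^sub>1 t) * \<omega> f t) (\<lambda>(f, t). E\<^sub>1 f)"
  and n00: "dominated_on Y\<^sub>0 (\<lambda>(f, t). n\<^sub>0 f t) (\<lambda>(f, t). E\<^sub>0 f)"
  and n01: "dominated_on Y\<^sub>1 (\<lambda>(f, t). n\<^sub>0 f t) (\<lambda>(f, t). ennreal (R\<^sub>0 t / R\<^sub>1 t) * E\<^sub>1 f)"
  and n10: "dominated_on Y\<^sub>0 (\<lambda>(f, t). ennreal (R\<^sub>0 t / R\<^sub>1 t) * n\<^sub>1 f t) (\<lambda>(f, t). E\<^sub>0 f)"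
  and n11: "dominated_on Y\<^sub>1 (\<lambda>(f, t). n\<^sub>1 f t) (\<lambda>(f, t). E\<^sub>1 f)"
 shows "equivalent_on A (\<lambda>f t. K_functional (R\<^sub>0 t / R\<^sub>1 t) f E\<^sub>0 E\<^sub>1)
   (\<lambda>f t. ennreal (R\<^sub>0 t / R\<^sub>1 t) * L f + ennreal (R\<^sub>0 t) * \<omega> f t + n\<^sub>0 f t + ennreal (R\<^sub>0 t / R\<^sub>1 t) * n\<^sub>1 f t)"
  (is "equivalent_on A ?K ?G")
proof -
 have R: "ennreal (R\<^sub>0 t / R\<^sub>1 t) * ennreal (R\<^sub>1 t) = ennreal (R\<^sub>0 t)" if "0 < t" "t < 1" for t
  using pos[OF that] by (subst ennreal_mult'[symmetric]) auto
 obtain g where g0: "dominated_on D (\<lambda>(f, t). E\<^sub>0 (\<lambda>x. f x - g f t x))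
          (\<lambda>(f, t). ennreal (R\<^sub>0 t) * \<omega> f t + ennreal (R\<^sub>0 t / R\<^sub>1 t) * L f + n\<^sub>0 f t)"
  and g1: "dominated_on D (\<lambda>(f, t). E\<^sub>1 (g f t)) (\<lambda>(f, t). L f + ennreal (R\<^sub>1 t) * \<omega> f t + n\<^sub>1 f t)"
  using upper by blast
 have "dominated_on D (\<lambda>(f, t). E\<^sub>0 (\<lambda>x. f x - g f t x)) (\<lambda>(f, t). ?G f t)"
  by (rule dominated_on_trans[OF g0 dominated_on_le]) (auto simp: add.assoc add_mono add.left_commute add_increasing2)
 moreover have "dominated_on D (\<lambda>(f, t). ennreal (R\<^sub>0 t / R\<^sub>1 t) * E\<^sub>1 (g f t)) (\<lambda>(f, t). ?G f t)"
 proof -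
  have "dominated_on D (\<lambda>y. (case y of (f, t) => ennreal (R\<^sub>0 t / R\<^sub>1 t)) * (case y of (f, t) => E\<^sub>1 (g f t)))
    (\<lambda>y. (case y of (f, t) => ennreal (R\<^sub>0 t / R\<^sub>1 t)) * (case y of (f, t) => L f + ennreal (R\<^sub>1 t) * \<omega> f t + n\<^sub>1 f t))"
   by (rule dominated_on_mult[OF g1])
  also have "dominated_on D ... (\<lambda>(f, t). ?G f t)"
  proof (rule dominated_on_le)
   fix y assume "y \<in> D"
   then obtain f t where y: "y = (f, t)" and t: "0 < t" "t < 1" by (auto simp: D_def)
   show "(case y of (f, t) => ennreal (R\<^sub>0 t / R\<^sub>1 t)) * (case y of (f, t) => L f + ennreal (R\<^sub>1 t) * \<omega> f t + n\<^sub>1 f t)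
    \<le> (case y of (f, t) => ?G f t)"
    using R[OF t] by (simp add: y distrib_left mult.assoc[symmetric] add_mono add_increasing2)
  qed
  finally show ?thesis by (simp add: case_prod_beta')
 qed
 ultimately have "dominated_on D (\<lambda>y. (case y of (f, t) => E\<^sub>0 (\<lambda>x. f x - g f t x)) + (case y of (f, t) => ennreal (R\<^sub>0 t / R\<^sub>1 t) * E\<^sub>1 (g f t))) (\<lambda>(f, t). ?G f t)"
  by (rule dominated_on_add)
 then obtain C where C: "C > 0" "\<And>y. y \<in> D ==> (case y of (f, t) => E\<^sub>0 (\<lambda>x. f x - g f t x)) + (case y of (f, t) => ennreal (R\<^sub>0 t / R\<^sub>1 t) * E\<^sub>1 (g f t)) \<le> ennreal C * (case y of (f, t) => ?G f t)"
  by (rule dominated_onD) blast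
 have up: "?K f t \<le> ennreal C * ?G f t" if f: "A f < \<infinity>" and t: "0 < t" "t < 1" for f t
 proof (cases "?G f t = \<infinity>")
  case True show ?thesis unfolding True using C(1) by (simp add: ennreal_mult_top)
 next
  \<comment> \<open>A finite right-hand side makes both parts finite, as the definition of
    \<open>K_functional\<close> demands; for the second part this uses that the parameter is
    positive.\<close>
  case False
  have *: "E\<^sub>0 (\<lambda>x. f x - g f t x) + ennreal (R\<^sub>0 t / R\<^sub>1 t) * E\<^sub>1 (g f t) \<le> ennreal C * ?G f t"
   using C(2)[of "(f, t)"] A[OF f] t by (simp add: D_def)
  also have "ennreal C * ?G f t < \<infinity>" using False by (simp add: ennreal_mult_less_top less_top)
  finally have fin: "E\<^sub>0 (\<lambda>x. f x - g f t x) < \<infinity>" "E\<^sub>1 (g f t) < \<infinity>"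
   using pos[OF t] by (auto simp: ennreal_mult_less_top)
  have "?K f t \<le> E\<^sub>0 (\<lambda>x. f x - g f t x) + ennreal (R\<^sub>0 t / R\<^sub>1 t) * E\<^sub>1 (g f t)"
   unfolding K_functional_def using fin
   by - (rule Inf_lower, rule CollectI, rule exI[of _ "\<lambda>x. f x - g f t x"], rule exI[of _ "g f t"], simp)
  then show ?thesis using * by (rule order.trans)
 qed
 obtain c where c: "\<And>t. 0 < t ==> t < 1 ==> R\<^sub>0 t / R\<^sub>1 t \<le> c" using ratio by auto
 define S where "S = (\<lambda>(f, g, t). E\<^sub>0 f + ennreal (R\<^sub>0 t / R\<^sub>1 t) * E\<^sub>1 g)"
 define \<rho> where "\<rho> = (\<lambda>(f :: 'a => complex, g :: 'a => complex, t). ennreal (R\<^sub>0 t / R\<^sub>1 t))"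
 have to0: "dominated_on X (\<lambda>(f, g, t). E\<^sub>0 f) S"
  by (rule dominated_on_le) (auto simp: S_def)
 have to1: "dominated_on X (\<lambda>(f, g, t). ennreal (R\<^sub>0 t / R\<^sub>1 t) * E\<^sub>1 g) S"
  by (rule dominated_on_le) (auto simp: S_def)
 have from0: "dominated_on X (\<lambda>(f, g, t). F f t) S"
  if "dominated_on Y\<^sub>0 (\<lambda>(f, t). F f t) (\<lambda>(f, t). E\<^sub>0 f)" for F
  using dominated_on_trans[OF dominated_on_reindex[OF that, of X "\<lambda>(f, g, t). (f, t)"], of S] to0
  by (auto simp: X_def Y\<^sub>0_def case_prod_beta')
 have from1: "dominated_on X (\<lambda>(f, g, t). F g t) S"
  if "dominated_on Y\<^sub>1 (\<lambda>(f, t). F f t) (\<lambda>(f, t). ennreal (R\<^sub>0 t / R\<^sub>1 t) * E\<^sub>1 f)" for F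
  using dominated_on_trans[OF dominated_on_reindex[OF that, of X "\<lambda>(f, g, t). (g, t)"], of S] to1
  by (auto simp: X_def Y\<^sub>1_def case_prod_beta')
 have scale1: "dominated_on Y\<^sub>1 (\<lambda>(f, t). ennreal (R\<^sub>0 t / R\<^sub>1 t) * F f t) (\<lambda>(f, t). ennreal (R\<^sub>0 t / R\<^sub>1 t) * E\<^sub>1 f)"
  if "dominated_on Y\<^sub>1 (\<lambda>(f, t). F f t) (\<lambda>(f, t). E\<^sub>1 f)" for F
  using dominated_on_mult[OF that, of "\<lambda>(f, t). ennreal (R\<^sub>0 t / R\<^sub>1 t)"] by (simp add: case_prod_beta')
 have G1: "dominated_on X (\<lambda>(f, g, t). ennreal (R\<^sub>0 t / R\<^sub>1 t) * L (\<lambda>x. f x + g x)) S"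
 proof -
  have "dominated_on Y\<^sub>0 (\<lambda>(f, t). ennreal (R\<^sub>0 t / R\<^sub>1 t) * L f) (\<lambda>(f, t). L f)"
  proof (rule dominated_onI[of "max c 1"])
   fix y assume "y \<in> Y\<^sub>0"
   then obtain f t where y: "y = (f, t)" and t: "0 < t" "t < 1" by (auto simp: Y\<^sub>0_def)
   then show "(case y of (f, t) => ennreal (R\<^sub>0 t / R\<^sub>1 t) * L f) \<le> ennreal (max c 1) * (case y of (f, t) => L f)"
    using c[OF t] by (auto simp: y intro!: mult_right_mono ennreal_leI)
  qed simp
  note 0 = from0[OF dominated_on_trans[OF this L0]]
  note 1 = from1[OF scale1[OF L1]]
  show ?thesis
   by (rule dominated_on_trans[OF dominated_on_le dominated_on_add[OF 0 1]])
     (use L_add in \<open>auto simp: distrib_left[symmetric] mult_left_mono\<close>)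
 qed
 have G2: "dominated_on X (\<lambda>(f, g, t). ennreal (R\<^sub>0 t) * \<omega> (\<lambda>x. f x + g x) t) S"
 proof -
  note 0 = from0[OF w0] and 1 = from1[OF scale1[OF w1]]
  have "ennreal (R\<^sub>0 t) * \<omega> (\<lambda>x. f x + g x) t \<le> ennreal (R\<^sub>0 t) * \<omega> f t + ennreal (R\<^sub>0 t / R\<^sub>1 t) * (ennreal (R\<^sub>1 t) * \<omega> g t)"
   if t: "0 < t" "t < 1" for f g t
   unfolding mult.assoc[symmetric] R[OF t] distrib_left[symmetric] by (intro mult_left_mono w_add) simp
  then show ?thesis
   by (intro dominated_on_trans[OF dominated_on_le dominated_on_add[OF 0 1]]) (auto simp: X_def)
 qed
 have G3: "dominated_on X (\<lambda>(f, g, t). n\<^sub>0 (\<lambda>x. f x + g x) t) S"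
  using dominated_on_trans[OF n0_add] dominated_on_add[OF from0[OF n00] from1[OF n01]] by (simp add: case_prod_beta')
 have G4: "dominated_on X (\<lambda>(f, g, t). ennreal (R\<^sub>0 t / R\<^sub>1 t) * n\<^sub>1 (\<lambda>x. f x + g x) t) S"
 proof -
  have "dominated_on X (\<lambda>y. \<rho> y * (case y of (f, g, t) => n\<^sub>1 (\<lambda>x. f x + g x) t)) (\<lambda>y. \<rho> y * (case y of (f, g, t) => n\<^sub>1 f t + n\<^sub>1 g t))"
   by (rule dominated_on_mult[OF n1_add])
  also have "dominated_on X ... S"
   using dominated_on_add[OF from0[OF n10] from1[OF scale1[OF n11]]]
   by (simp add: case_prod_beta' \<rho>_def distrib_left)
  finally show ?thesis by (simp add: case_prod_beta' \<rho>_def)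
 qed
 have "dominated_on X (\<lambda>(f, g, t). ?G (\<lambda>x. f x + g x) t) S"
  using dominated_on_add[OF dominated_on_add[OF dominated_on_add[OF G1 G2] G3] G4] by (simp add: case_prod_beta')
 then obtain C' where C': "C' > 0" "\<And>y. y \<in> X ==> (case y of (f, g, t) => ?G (\<lambda>x. f x + g x) t) \<le> ennreal C' * S y"
  by (rule dominated_onD) blast
 have low: "?G f t \<le> ennreal C' * ?K f t" if f: "A f < \<infinity>" and t: "0 < t" "t < 1" for f t
  unfolding K_functional_def
 proof (rule le_mult_Inf[OF C'(1)], clarsimp)
  fix f\<^sub>0 f\<^sub>1 assume "f = (\<lambda>x. f\<^sub>0 x + f\<^sub>1 x)" "E\<^sub>0 f\<^sub>0 < top" "E\<^sub>1 f\<^sub>1 < top"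
  then show "?G (\<lambda>x. f\<^sub>0 x + f\<^sub>1 x) t \<le> ennreal C' * (E\<^sub>0 f\<^sub>0 + ennreal (R\<^sub>0 t / R\<^sub>1 t) * E\<^sub>1 f\<^sub>1)"
   using C'(2)[of "(f\<^sub>0, f\<^sub>1, t)"] t by (simp add: X_def S_def)
 qed
 show ?thesis unfolding equivalent_on_iff_dominated_on
  by (intro conjI dominated_onI[OF C(1)] dominated_onI[OF C'(1)]) (use up low in auto)
qed

section \<open>Moduli of smoothness\<close>

text \<open>This later permits any order m of differences in the Besov norm, and parameters that
  agree only up to constants.\<close>

lemma K_functional_mono:
 assumes "dominated_on UNIV E\<^sub>0 E\<^sub>0'" "dominated_on UNIV E\<^sub>1 E\<^sub>1'" "c > 0"
 obtains C where "C > 0" "\<And>f t t'. 0 \<le> t' ==> t \<le> c * t' ==> K_functional t f E\<^sub>0 E\<^sub>1 \<le> ennreal C * K_functional t' f E\<^sub>0' E\<^sub>1'"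
proof -
 obtain A B where A: "A > 0" "\<And>f. E\<^sub>0 f \<le> ennreal A * E\<^sub>0' f" and B: "B > 0" "\<And>f. E\<^sub>1 f \<le> ennreal B * E\<^sub>1' f"
  using assms unfolding dominated_on_def by auto
 show thesis
 proof (rule that[of "A + c * B"])
  fix f t t' assume t: "0 \<le> t'" "t \<le> c * t'"
  show "K_functional t f E\<^sub>0 E\<^sub>1 \<le> ennreal (A + c * B) * K_functional t' f E\<^sub>0' E\<^sub>1'"
   unfolding K_functional_def[of t']
  proof (rule le_mult_Inf, goal_cases)
   case 1 then show ?case using A B assms by (simp add: add_pos_pos)
  next
   case (2 x)
   then obtain f\<^sub>0 f\<^sub>1 where x: "x = E\<^sub>0' f\<^sub>0 + ennreal t' * E\<^sub>1' f\<^sub>1" and f: "f = (\<lambda>x. f\<^sub>0 x + f\<^sub>1 x)"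
    and fin: "E\<^sub>0' f\<^sub>0 < \<infinity>" "E\<^sub>1' f\<^sub>1 < \<infinity>" by blast
   have "E\<^sub>0 f\<^sub>0 < \<infinity>" "E\<^sub>1 f\<^sub>1 < \<infinity>"
    using A(2)[of f\<^sub>0] B(2)[of f\<^sub>1] fin by (auto simp: ennreal_mult_less_top intro: le_less_trans)
   then have "K_functional t f E\<^sub>0 E\<^sub>1 \<le> E\<^sub>0 f\<^sub>0 + ennreal t * E\<^sub>1 f\<^sub>1"
    unfolding K_functional_def f by (intro Inf_lower) blast
   also have "... \<le> ennreal A * E\<^sub>0' f\<^sub>0 + ennreal (c * t') * (ennreal B * E\<^sub>1' f\<^sub>1)"
    by (intro add_mono mult_mono ennreal_leI t A B) auto
   also have "... = ennreal A * E\<^sub>0' f\<^sub>0 + ennreal (c * B) * (ennreal t' * E\<^sub>1' f\<^sub>1)"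
    using B assms t by (simp add: ennreal_mult mult_ac)
   also have "... \<le> ennreal (A + c * B) * E\<^sub>0' f\<^sub>0 + ennreal (A + c * B) * (ennreal t' * E\<^sub>1' f\<^sub>1)"
    using A B assms by (intro add_mono mult_right_mono ennreal_leI) auto
   finally show ?case by (simp add: x distrib_left)
  qed
 qed (use A B assms in \<open>simp add: add_pos_pos\<close>)
qed

section \<open>Finite differences\<close>

lemma fdiff_pow_add: "(fdiff h ^^ n) (\<lambda>x. f x + g x) = (\<lambda>x. (fdiff h ^^ n) f x + (fdiff h ^^ n) g x)"
 by (induction n) (auto simp: fdiff_def)

lemma fdiff_pow_diff: "(fdiff h ^^ n) (\<lambda>x. f x - g x) = (\<lambda>x. (fdiff h ^^ n) f x - (fdiff h ^^ n) g x)"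
 by (induction n) (auto simp: fdiff_def)

lemma fdiff_pow_shift: "(fdiff h ^^ n) (\<lambda>x. f (x + a)) = (\<lambda>x. (fdiff h ^^ n) f (x + a))"
 by (induction n) (auto simp: fdiff_def add_ac)

lemma fdiff_pow_Suc: "(fdiff h ^^ Suc n) f = (fdiff h ^^ n) (fdiff h f)"
 by (simp add: funpow_swap1)

lemma fdiff_double: "fdiff (2 *\<^sub>R h) f = (\<lambda>x. fdiff h f (x + h) + fdiff h f x)"
 by (auto simp: fdiff_def scaleR_2 add_ac)

lemma fdiff_pow_expand:
 "(fdiff h ^^ k) f x = (\<Sum>i\<le>k. (-1) ^ (k - i) * of_nat (k choose i) * f (x + real i *\<^sub>R h))"
proof (induction k arbitrary: x)
 case (Suc k)
 let ?c = "\<lambda>k i. (-1) ^ (k - i) * of_nat (k choose i) :: complex"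
 have "(fdiff h ^^ Suc k) f x = (fdiff h ^^ k) f (x + h) - (fdiff h ^^ k) f x"
  by (simp add: fdiff_def)
 also have "... = (\<Sum>i\<le>k. ?c k i * f (x + real (Suc i) *\<^sub>R h)) - (\<Sum>i\<le>k. ?c k i * f (x + real i *\<^sub>R h))"
  unfolding Suc.IH by (simp add: scaleR_add_left add_ac)
 also have "... = (\<Sum>i\<le>Suc k. ?c (Suc k) i * f (x + real i *\<^sub>R h))"
 proof -
  have c: "?c (Suc k) (Suc i) = ?c k i - ?c k (Suc i)" if "i \<le> k" for i
  proof (cases "i = k")
   case False
   then have "k - i = Suc (k - Suc i)" using that by simp
   then show ?thesis by (simp add: algebra_simps)
  qed (simp)
  have "(\<Sum>i\<le>Suc k. ?c (Suc k) i * f (x + real i *\<^sub>R h))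
   = ?c (Suc k) 0 * f x + (\<Sum>i\<le>k. ?c (Suc k) (Suc i) * f (x + real (Suc i) *\<^sub>R h))"
   by (subst sum.atMost_Suc_shift) simp
  also have "... = ?c (Suc k) 0 * f x + (\<Sum>i\<le>k. (?c k i - ?c k (Suc i)) * f (x + real (Suc i) *\<^sub>R h))"
   using c by (intro arg_cong2[where f="(+)"] sum.cong refl) (metis atMost_iff)
  also have "... = (\<Sum>i\<le>k. ?c k i * f (x + real (Suc i) *\<^sub>R h)) - (?c k 0 * f x + (\<Sum>i\<le>k. ?c k (Suc i) * f (x + real (Suc i) *\<^sub>R h)))"
   by (simp add: left_diff_distrib sum_subtractf)
  also have "?c k 0 * f x + (\<Sum>i\<le>k. ?c k (Suc i) * f (x + real (Suc i) *\<^sub>R h)) = (\<Sum>i\<le>Suc k. ?c k i * f (x + real i *\<^sub>R h))"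
   by (subst sum.atMost_Suc_shift) simp
  also have "... = (\<Sum>i\<le>k. ?c k i * f (x + real i *\<^sub>R h))" by simp
  finally show ?thesis by simp
 qed
 finally show ?case .
qed simp

text \<open>An extended seminorm, infinite outside the space. Inequalities suffice as assumptions:
  the inverse translation turns \<open>L_shift_le\<close> into an equality, and scaling by 0 gives
  the zero function the value 0.\<close>

locale translation_seminorm =
 fixes L :: "('a::euclidean_space => complex) => ennreal"
 assumes L_add: "L (\<lambda>x. f x + g x) \<le> L f + L g"
  and L_cmult: "L (\<lambda>x. c * f x) \<le> ennreal (norm c) * L f"
  and L_shift_le: "L (\<lambda>x. f (x + h)) \<le> L f"
begin

lemma L_shift: "L (\<lambda>x. f (x + h)) = L f"
 using L_shift_le[of f h] L_shift_le[of "\<lambda>x. f (x + h)" "- h"] by (auto intro: antisym)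

lemma L_zero: "L (\<lambda>x. 0) = 0"
 using L_cmult[of 0 "\<lambda>x. 0"] by simp

lemma L_diff: "L (\<lambda>x. f x - g x) \<le> L f + L g"
proof -
 have "L (\<lambda>x. f x - g x) = L (\<lambda>x. f x + (-1) * g x)" by simp
 also have "... \<le> L f + L (\<lambda>x. (-1) * g x)" by (rule L_add)
 also have "... \<le> L f + L g" using L_cmult[of "-1" g] by (intro add_mono) auto
 finally show ?thesis .
qed

lemma L_sum: "finite I ==> L (\<lambda>x. \<Sum>i\<in>I. f i x) \<le> (\<Sum>i\<in>I. L (f i))"
proof (induction I rule: finite_induct)
 case (insert i I)
 then show ?case using order.trans[OF L_add[of "f i" "\<lambda>x. \<Sum>i\<in>I. f i x"] add_left_mono] by simp
qed (simp add: L_zero)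

lemma L_fdiff_pow: "L ((fdiff h ^^ n) f) \<le> ennreal (2 ^ n) * L f"
proof (induction n)
 case (Suc n)
 have "L ((fdiff h ^^ Suc n) f) \<le> L (\<lambda>x. (fdiff h ^^ n) f (x + h)) + L ((fdiff h ^^ n) f)"
  using L_diff[of "\<lambda>x. (fdiff h ^^ n) f (x + h)" "(fdiff h ^^ n) f"] by (simp add: fdiff_def)
 also have "... = ennreal 2 * L ((fdiff h ^^ n) f)" by (simp add: L_shift mult_2)
 also have "... \<le> ennreal 2 * (ennreal (2 ^ n) * L f)" by (intro mult_left_mono Suc) simp
 finally show ?case by (simp add: ennreal_mult mult.assoc)
qed simp

lemma modulus_mono: "t \<le> u ==> modulus L k f t \<le> modulus L k f u"
 unfolding modulus_def by (intro SUP_subset_mono) auto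

lemma modulus_measurable [measurable]: "modulus L k f \<in> borel_measurable borel"
 by (rule borel_measurable_mono_ennreal) (rule modulus_mono)

lemma modulus_upper: "norm h \<le> t ==> L ((fdiff h ^^ k) f) \<le> modulus L k f t"
 unfolding modulus_def by (intro SUP_upper) auto

lemma modulus_add: "modulus L k (\<lambda>x. f x + g x) t \<le> modulus L k f t + modulus L k g t"
 unfolding modulus_def[of L k "\<lambda>x. f x + g x"] fdiff_pow_add
 by (rule SUP_least) (auto intro!: order.trans[OF L_add] add_mono modulus_upper)

lemma modulus_diff: "modulus L k (\<lambda>x. f x - g x) t \<le> modulus L k f t + modulus L k g t"
 unfolding modulus_def[of L k "\<lambda>x. f x - g x"] fdiff_pow_diff
 by (rule SUP_least) (auto intro!: order.trans[OF L_diff] add_mono modulus_upper)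

lemma modulus_le_norm: "modulus L k f t \<le> ennreal (2 ^ k) * L f"
 unfolding modulus_def by (rule SUP_least) (rule L_fdiff_pow)

lemma modulus_finite: "L f < \<infinity> ==> modulus L k f t < \<infinity>"
 using modulus_le_norm[of k f t] by (auto simp: ennreal_mult_less_top intro: le_less_trans)

text \<open>With E the translation by h, each factor of the difference with step 2h is (E + 1) times
  the one with step h, and E + 1 has norm at most 2.\<close>

lemma L_fdiff_double: "L ((fdiff (2 *\<^sub>R h) ^^ n) f) \<le> ennreal (2 ^ n) * L ((fdiff h ^^ n) f)"
proof (induction n arbitrary: f)
 case (Suc n)
 let ?F = "fdiff h f"
 have "L ((fdiff (2 *\<^sub>R h) ^^ Suc n) f) = L (\<lambda>x. (fdiff (2 *\<^sub>R h) ^^ n) ?F (x + h) + (fdiff (2 *\<^sub>R h) ^^ n) ?F x)"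
  unfolding fdiff_pow_Suc by (simp add: fdiff_double fdiff_pow_add fdiff_pow_shift)
 also have "... \<le> L ((fdiff (2 *\<^sub>R h) ^^ n) ?F) + L ((fdiff (2 *\<^sub>R h) ^^ n) ?F)"
  by (rule order.trans[OF L_add]) (simp add: L_shift)
 also have "... \<le> ennreal 2 * (ennreal (2 ^ n) * L ((fdiff h ^^ n) ?F))"
  using Suc[of ?F] by (simp add: mult_2 add_mono)
 finally show ?case unfolding fdiff_pow_Suc by (simp add: ennreal_mult mult.assoc)
qed simp

lemma modulus_double: "modulus L k f (2 * t) \<le> ennreal (2 ^ k) * modulus L k f t"
 unfolding modulus_def[of L k f "2 * t"]
proof (rule SUP_least)
 fix h :: 'a assume "h \<in> {h. norm h \<le> 2 * t}"
 then have h: "norm ((1/2) *\<^sub>R h) \<le> t" by simp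
 have "L ((fdiff h ^^ k) f) \<le> ennreal (2 ^ k) * L ((fdiff ((1/2) *\<^sub>R h) ^^ k) f)"
  using L_fdiff_double[where h="(1/2) *\<^sub>R h" and n=k and f=f] by simp
 also have "... \<le> ennreal (2 ^ k) * modulus L k f t" by (intro mult_left_mono modulus_upper h) simp
 finally show "L ((fdiff h ^^ k) f) \<le> ennreal (2 ^ k) * modulus L k f t" .
qed

text \<open>With E the translation by h, the left-hand side is (E + 1)^k - 2^k applied to the k-th
  difference, and (E + 1)^k - 2^k = (E - 1) \<Sum>_(i<k) 2^(k-1-i) (E + 1)^i. The last sum has norm
  at most k 2^(k-1), which is the constant.\<close>

lemma L_fdiff_double_minus:
 "L (\<lambda>x. (fdiff (2 *\<^sub>R h) ^^ k) f x - 2 ^ k * (fdiff h ^^ k) f x) \<le> ennreal (real k / 2 * 2 ^ k) * L ((fdiff h ^^ Suc k) f)"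
proof (induction k arbitrary: f)
 case 0 then show ?case by (simp add: L_zero)
next
 case (Suc k)
 let ?F = "fdiff h f" and ?E = "\<lambda>f x. (fdiff (2 *\<^sub>R h) ^^ k) f x - 2 ^ k * (fdiff h ^^ k) f x"
 have "(\<lambda>x. (fdiff (2 *\<^sub>R h) ^^ Suc k) f x - 2 ^ Suc k * (fdiff h ^^ Suc k) f x)
  = (\<lambda>x. ((?E ?F (x + h)) + ?E ?F x) + 2 ^ k * (fdiff h ^^ Suc (Suc k)) f x)"
 proof
  fix x
  have 3: "(fdiff h ^^ Suc (Suc k)) f x = (fdiff h ^^ k) ?F (x + h) - (fdiff h ^^ k) ?F x"
   by (subst funpow.simps) (simp add: fdiff_pow_Suc del: funpow.simps, simp add: fdiff_def)
  show "(fdiff (2 *\<^sub>R h) ^^ Suc k) f x - 2 ^ Suc k * (fdiff h ^^ Suc k) f x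
    = ((?E ?F (x + h)) + ?E ?F x) + 2 ^ k * (fdiff h ^^ Suc (Suc k)) f x"
   unfolding 3 unfolding fdiff_pow_Suc fdiff_double fdiff_pow_add fdiff_pow_shift by (simp add: algebra_simps)
 qed
 then have "L (\<lambda>x. (fdiff (2 *\<^sub>R h) ^^ Suc k) f x - 2 ^ Suc k * (fdiff h ^^ Suc k) f x)
   \<le> (L (\<lambda>x. ?E ?F (x + h)) + L (?E ?F)) + L (\<lambda>x. 2 ^ k * (fdiff h ^^ Suc (Suc k)) f x)"
  by (simp only:) (intro order.trans[OF L_add] add_mono order.refl)
 also have "... \<le> (ennreal (real k / 2 * 2 ^ k) * L ((fdiff h ^^ Suc k) ?F) + ennreal (real k / 2 * 2 ^ k) * L ((fdiff h ^^ Suc k) ?F))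
   + ennreal (2 ^ k) * L ((fdiff h ^^ Suc (Suc k)) f)"
 proof (intro add_mono)
  show "L (\<lambda>x. ?E ?F (x + h)) \<le> ennreal (real k / 2 * 2 ^ k) * L ((fdiff h ^^ Suc k) ?F)"
   unfolding L_shift[of "?E ?F" h] by (rule Suc.IH)
  show "L (?E ?F) \<le> ennreal (real k / 2 * 2 ^ k) * L ((fdiff h ^^ Suc k) ?F)" by (rule Suc.IH)
  show "L (\<lambda>x. 2 ^ k * (fdiff h ^^ Suc (Suc k)) f x) \<le> ennreal (2 ^ k) * L ((fdiff h ^^ Suc (Suc k)) f)"
   using L_cmult[of "2 ^ k" "(fdiff h ^^ Suc (Suc k)) f"] by (simp add: norm_power del: funpow.simps)
 qed
 also have "(fdiff h ^^ Suc k) ?F = (fdiff h ^^ Suc (Suc k)) f" by (rule fdiff_pow_Suc[symmetric])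
 also have "(ennreal (real k / 2 * 2 ^ k) * L ((fdiff h ^^ Suc (Suc k)) f) + ennreal (real k / 2 * 2 ^ k) * L ((fdiff h ^^ Suc (Suc k)) f))
   + ennreal (2 ^ k) * L ((fdiff h ^^ Suc (Suc k)) f) = ennreal (real (Suc k) / 2 * 2 ^ Suc k) * L ((fdiff h ^^ Suc (Suc k)) f)"
  unfolding distrib_right[symmetric] by (subst ennreal_plus[symmetric], simp, simp)+ (simp add: algebra_simps del: funpow.simps)
 finally show ?case .
qed

text \<open>The factor 2^(-k) at the doubled argument is the gain that drives both the comparison of
  Besov norms of different orders and Marchaud's inequality.\<close>

lemma modulus_step:
 "modulus L k f t \<le> ennreal (2 powr (- real k)) * modulus L k f (2 * t) + ennreal (real k / 2) * modulus L (Suc k) f t"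
 unfolding modulus_def[of L k f t]
proof (rule SUP_least)
 fix h :: 'a assume h: "h \<in> {h. norm h \<le> t}"
 have "L (\<lambda>x. 2 ^ k * (fdiff h ^^ k) f x) \<le> L ((fdiff (2 *\<^sub>R h) ^^ k) f) + L (\<lambda>x. (fdiff (2 *\<^sub>R h) ^^ k) f x - 2 ^ k * (fdiff h ^^ k) f x)"
  using L_diff[of "(fdiff (2 *\<^sub>R h) ^^ k) f" "\<lambda>x. (fdiff (2 *\<^sub>R h) ^^ k) f x - 2 ^ k * (fdiff h ^^ k) f x"] by simp
 also have "... \<le> modulus L k f (2 * t) + ennreal (real k / 2 * 2 ^ k) * modulus L (Suc k) f t"
  using h by (intro add_mono order.trans[OF L_fdiff_double_minus] mult_left_mono modulus_upper) auto
 finally have *: "L (\<lambda>x. 2 ^ k * (fdiff h ^^ k) f x) \<le> modulus L k f (2 * t) + ennreal (real k / 2 * 2 ^ k) * modulus L (Suc k) f t" .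
 have p: "2 powr (- real k) = 1 / 2 ^ k" by (simp add: powr_minus_divide powr_realpow)
 have "L ((fdiff h ^^ k) f) = L (\<lambda>x. (1 / 2 ^ k) * (2 ^ k * (fdiff h ^^ k) f x))" by simp
 also have "... \<le> ennreal (1 / 2 ^ k) * L (\<lambda>x. 2 ^ k * (fdiff h ^^ k) f x)"
  by (rule order.trans[OF L_cmult]) (simp add: norm_divide norm_power)
 also have "... \<le> ennreal (1 / 2 ^ k) * (modulus L k f (2 * t) + ennreal (real k / 2 * 2 ^ k) * modulus L (Suc k) f t)"
  by (intro mult_left_mono *) simp
 also have "... = ennreal (2 powr (- real k)) * modulus L k f (2 * t) + ennreal (real k / 2) * modulus L (Suc k) f t"
  by (simp add: p distrib_left mult.assoc[symmetric] ennreal_mult'[symmetric])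
 finally show "L ((fdiff h ^^ k) f) \<le> ennreal (2 powr (- real k)) * modulus L k f (2 * t) + ennreal (real k / 2) * modulus L (Suc k) f t" .
qed

lemma modulus_Suc_le: "modulus L (Suc k) f t \<le> ennreal 2 * modulus L k f t"
 unfolding modulus_def[of L "Suc k"]
proof (rule SUP_least)
 fix h :: 'a assume h: "h \<in> {h. norm h \<le> t}"
 have "L ((fdiff h ^^ Suc k) f) \<le> L (\<lambda>x. (fdiff h ^^ k) f (x + h)) + L ((fdiff h ^^ k) f)"
  using L_diff[of "\<lambda>x. (fdiff h ^^ k) f (x + h)" "(fdiff h ^^ k) f"] by (simp add: fdiff_def)
 also have "... \<le> ennreal 2 * modulus L k f t" using h by (simp add: L_shift mult_2 add_mono modulus_upper)
 finally show "L ((fdiff h ^^ Suc k) f) \<le> ennreal 2 * modulus L k f t" .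
qed

section \<open>Independence of the Besov quasi-norm from the order of differences\<close>

lemma besov_Suc_dominated:
 assumes "0 < q" shows "dominated_on UNIV (besov L (Suc k) s b q) (besov L k s b q)"
proof (rule dominated_onI[of 2])
 fix f
 have "log_integral (- s) b q 0 1 (modulus L (Suc k) f) \<le> log_integral (- s) b q 0 1 (\<lambda>t. ennreal 2 * modulus L k f t)"
  by (intro log_integral_mono assms modulus_Suc_le)
 also have "... = ennreal 2 * log_integral (- s) b q 0 1 (modulus L k f)"
  using assms by (intro log_integral_cmult) auto
 moreover have "L f \<le> ennreal 2 * L f" by (simp add: mult_2)
 ultimately show "besov L (Suc k) s b q f \<le> ennreal 2 * besov L k s b q f"
  unfolding besov_def distrib_left by (intro add_mono) auto
qed simp

lemma besov_dominated_Suc: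
 assumes q: "0 < q" and s: "s < real k"
 shows "dominated_on UNIV (besov L k s b q) (besov L (Suc k) s b q)"
proof -
 obtain C where C: "C > 0"
  "\<And>v w x. (\<And>t u. t \<le> u ==> w t \<le> w u) ==> (\<And>t. 0 < t ==> v t \<le> ennreal (2 ^ k) * x) ==>
    (\<And>t. 0 < t ==> w t \<le> ennreal (2 ^ Suc k) * x) ==> x < \<infinity> ==>
    (\<And>t. 0 < t ==> v t \<le> ennreal (2 powr (- real k)) * v (2 * t) + ennreal (real k / 2) * w t) ==>
    log_integral (- s) b q 0 1 v \<le> ennreal C * (x + log_integral (- s) b q 0 1 w)"
  using log_integral_raise_order[OF q s, of b] by metis
 show ?thesis
 proof (rule dominated_onI[of "1 + C"])
  fix f
  show "besov L k s b q f \<le> ennreal (1 + C) * besov L (Suc k) s b q f"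
  proof (cases "L f < \<infinity>")
   case True
   have "log_integral (- s) b q 0 1 (modulus L k f) \<le> ennreal C * (L f + log_integral (- s) b q 0 1 (modulus L (Suc k) f))"
    using True by (intro C(2) modulus_mono modulus_le_norm modulus_step)
   then have "besov L k s b q f \<le> besov L (Suc k) s b q f + ennreal C * besov L (Suc k) s b q f"
    unfolding besov_def by (intro add_mono) auto
   then show ?thesis using C(1) by (simp add: distrib_right)
  next
   case False
   then have "L f = top" by (simp add: not_less top_unique)
   then have "besov L (Suc k) s b q f = \<infinity>" by (simp add: besov_def)
   then show ?thesis using C(1) by (simp add: ennreal_mult_top)
  qed
 qed (use C in simp)
qed

lemma besov_dominated:
 assumes q: "0 < q" and s: "s < real k" "s < real m"
 shows "dominated_on UNIV (besov L k s b q) (besov L m s b q)"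
proof -
 have up: "dominated_on UNIV (besov L (n + i) s b q) (besov L n s b q)" for n i
 proof (induction i)
  case 0 then show ?case by (auto intro: dominated_on_le)
 next
  case (Suc i)
  then show ?case using dominated_on_trans[OF besov_Suc_dominated[OF q, of "n + i"]] by simp
 qed
 have down: "dominated_on UNIV (besov L n s b q) (besov L (n + i) s b q)" if "s < real n" for n i
 proof (induction i)
  case 0 then show ?case by (auto intro: dominated_on_le)
 next
  case (Suc i)
  then show ?case using dominated_on_trans[OF _ besov_dominated_Suc[OF q, of s "n + i"]] that by simp
 qed
 show ?thesis
 proof (cases "k \<le> m")
  case True then show ?thesis using down[OF s(1), of "m - k"] by simp
 next
  case False then show ?thesis using up[of m "k - m"] by simp
 qed
qed

text \<open>Marchaud's inequality for consecutive orders. After division by t^j,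
  \<open>modulus_step\<close> reads Z(t) \<le> Z(2t) + (j/2) t Y(t), where Y(t) = t^(-j-1)
  \<omega>_(j+1)(f,t) satisfies Y(2t) \<le> Y(t). On the way up to scale 1 the factors t + 2t + 4t +
  ... sum to at most 1.\<close>

lemma marchaud_step:
 assumes t: "0 < t" "t \<le> 1"
 shows "ennreal (1 / t ^ j) * modulus L j f t \<le> ennreal (4 ^ j) * L f + ennreal (real j / 2 / t ^ Suc j) * modulus L (Suc j) f t"
proof -
 define Z where "Z = (\<lambda>t. ennreal (1 / t ^ j) * modulus L j f t)"
 define Y where "Y = (\<lambda>t. ennreal (1 / t ^ Suc j) * modulus L (Suc j) f t)"
 have big: "Z t \<le> ennreal (4 ^ j) * L f" if "t \<ge> 1/2" for t
 proof -
  have "Z t \<le> ennreal (2 ^ j) * (ennreal (2 ^ j) * L f)"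
   unfolding Z_def
  proof (intro mult_mono ennreal_leI modulus_le_norm)
   have "1 / t \<le> 2" using that by (simp add: field_simps)
   then have "(1 / t) ^ j \<le> 2 ^ j" using that by (intro power_mono) auto
   then show "1 / t ^ j \<le> 2 ^ j" by (simp add: power_divide)
  qed auto
  then show ?thesis by (simp add: mult.assoc[symmetric] ennreal_mult'[symmetric] power_mult_distrib[symmetric])
 qed
 have rec: "Z t \<le> Z (2 * t) + ennreal (real j / 2 * t) * Y t" if "0 < t" for t
 proof -
  have "Z t \<le> ennreal (1 / t ^ j) * (ennreal (2 powr (- real j)) * modulus L j f (2 * t) + ennreal (real j / 2) * modulus L (Suc j) f t)"
   unfolding Z_def by (intro mult_left_mono modulus_step) auto
  also have "... = Z (2 * t) + ennreal (real j / 2 * t) * Y t"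
  proof -
   have 1: "1 / t ^ j * 2 powr (- real j) = 1 / (2 * t) ^ j"
    by (simp add: powr_minus_divide powr_realpow power_mult_distrib)
   have 2: "1 / t ^ j * (real j / 2) = real j / 2 * t * (1 / t ^ Suc j)"
    using that by simp
   show ?thesis unfolding Z_def Y_def distrib_left mult.assoc[symmetric]
    using that by (subst (1 2 3) ennreal_mult[symmetric]) (simp_all only: 1 2, simp_all)
  qed
  finally show ?thesis .
 qed
 have Y2: "Y (2 * t) \<le> Y t" if "0 < t" for t
 proof -
  have "Y (2 * t) \<le> ennreal (1 / (2 * t) ^ Suc j) * (ennreal (2 ^ Suc j) * modulus L (Suc j) f t)"
   unfolding Y_def by (intro mult_left_mono modulus_double) auto
  also have "... = Y t" unfolding Y_def using that
   by (simp add: mult.assoc[symmetric] ennreal_mult'[symmetric] power_mult_distrib)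
  finally show ?thesis .
 qed
 \<comment> \<open>The factor 1 - t reproduces itself under doubling: (1 - 2t) + t = 1 - t.\<close>
 have main: "(1/2) ^ n \<le> t ==> 0 < t ==> t \<le> 1 ==> Z t \<le> ennreal (4 ^ j) * L f + ennreal (real j / 2 * (1 - t)) * Y t" for n t
 proof (induction n arbitrary: t)
  case 0
  then show ?case using big[of t] by (auto intro: order.trans)
 next
  case (Suc n)
  show ?case
  proof (cases "t \<ge> 1/2")
   case True then show ?thesis using big[of t] by (auto intro: order.trans)
  next
   case False
   have "Z t \<le> Z (2 * t) + ennreal (real j / 2 * t) * Y t" using Suc by (intro rec) auto
   also have "... \<le> (ennreal (4 ^ j) * L f + ennreal (real j / 2 * (1 - 2 * t)) * Y (2 * t)) + ennreal (real j / 2 * t) * Y t"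
    using Suc False by (intro add_mono Suc.IH) auto
   also have "... \<le> (ennreal (4 ^ j) * L f + ennreal (real j / 2 * (1 - 2 * t)) * Y t) + ennreal (real j / 2 * t) * Y t"
    using Suc by (intro add_mono mult_left_mono Y2) auto
   also have "... = ennreal (4 ^ j) * L f + ennreal (real j / 2 * (1 - 2 * t) + real j / 2 * t) * Y t"
    using Suc False by (subst ennreal_plus) (auto simp: distrib_right add.assoc)
   also have "real j / 2 * (1 - 2 * t) + real j / 2 * t = real j / 2 * (1 - t)" by (simp add: field_simps)
   finally show ?thesis .
  qed
 qed
 obtain n where "(1/2) ^ n < t" using real_arch_pow_inv[of t "1/2"] t by auto
 then have "Z t \<le> ennreal (4 ^ j) * L f + ennreal (real j / 2 * (1 - t)) * Y t" using main[of n t] t by simp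
 also have "... \<le> ennreal (4 ^ j) * L f + ennreal (real j / 2) * Y t"
  using t by (intro add_mono mult_right_mono ennreal_leI) (auto intro!: mult_left_le)
 finally show ?thesis unfolding Z_def Y_def using t by (simp add: mult.assoc[symmetric] ennreal_mult'[symmetric])
qed

lemma marchaud:
 assumes "j \<le> k"
 obtains C where "C > 0" "\<And>f t. 0 < t ==> t \<le> 1 ==>
  ennreal (1 / t ^ j) * modulus L j f t \<le> ennreal C * (L f + ennreal (1 / t ^ k) * modulus L k f t)"
 using assms
proof (induction k arbitrary: thesis rule: dec_induct)
 case base
 show ?case
  by (rule base[of 1]) (auto simp: add_increasing)
next
 case (step n)
 obtain C where C: "C > 0" "\<And>f t. 0 < t ==> t \<le> 1 ==>
  ennreal (1 / t ^ j) * modulus L j f t \<le> ennreal C * (L f + ennreal (1 / t ^ n) * modulus L n f t)"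
  using step.IH by metis
 define D :: real where "D = 1 + 4 ^ n + real n / 2"
 have D: "D \<ge> 1 + 4 ^ n" "D \<ge> real n / 2" by (simp_all add: D_def add_nonneg_nonneg)
 have "D > 0" by (simp add: D_def add_pos_nonneg)
 show ?case
 proof (rule step.prems[of "C * D"])
  fix f t assume t: "0 < t" "t \<le> (1::real)"
  have "L f + ennreal (1 / t ^ n) * modulus L n f t \<le> L f + (ennreal (4 ^ n) * L f + ennreal (real n / 2 / t ^ Suc n) * modulus L (Suc n) f t)"
   by (intro add_mono marchaud_step t order.refl)
  also have "... = ennreal (1 + 4 ^ n) * L f + ennreal (real n / 2) * (ennreal (1 / t ^ Suc n) * modulus L (Suc n) f t)"
   using t by (simp add: distrib_right add.assoc mult.assoc[symmetric] ennreal_mult'[symmetric])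
  also have "... \<le> ennreal D * L f + ennreal D * (ennreal (1 / t ^ Suc n) * modulus L (Suc n) f t)"
   using D by (intro add_mono mult_right_mono ennreal_leI) auto
  finally have "ennreal C * (L f + ennreal (1 / t ^ n) * modulus L n f t) \<le> ennreal C * (ennreal D * (L f + ennreal (1 / t ^ Suc n) * modulus L (Suc n) f t))"
   unfolding distrib_left[symmetric] by (rule mult_left_mono) simp
  then show "ennreal (1 / t ^ j) * modulus L j f t \<le> ennreal (C * D) * (L f + ennreal (1 / t ^ Suc n) * modulus L (Suc n) f t)"
   using C(2)[OF t, of f] C(1) \<open>D > 0\<close> by (simp add: ennreal_mult mult.assoc del: power_Suc)
 qed (use C(1) \<open>D > 0\<close> in simp)
qed

text \<open>
 Mixed differences are controlled by \<open>k\<close>-th differences with a single step: in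
 \<open>\<Sum>\<^sub>i (-1)\<^sup>k\<^sup>-\<^sup>i (k choose i) \<Prod>\<^sub>j (1 - E\<^sup>a)\<close> with \<open>a = h\<^sub>j - i h\<^sub>j / j\<close>, where \<open>E\<close> denotes translation,
 only \<open>i = 0\<close> survives, whereas expanding the product gives \<open>2\<^sup>k\<close> pure differences.
\<close>

lemma mixed_difference_le_modulus:
 assumes "\<And>h. h \<in> set hs ==> norm h \<le> \<delta>" and "0 \<le> \<delta>"
 shows "L (foldr fdiff hs f) \<le> ennreal (2 ^ length hs) * modulus L (length hs) f (real (length hs) * \<delta>)"
proof -
 define k where "k = length hs"
 define c where "c = (\<lambda>i. (-1) ^ (k - i) * of_nat (k choose i) :: complex)"
 define G where "G = (\<lambda>i js. foldr (\<lambda>(a, b) F x. F x - F (x + (a + real i *\<^sub>R b))) js f)"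
 \<comment> \<open>v records the step accumulated so far. Each factor 1 - E^(a + i b) splits the sum
   in two, the second with v replaced by v + b and translated by a, which the seminorm does not see;
   with no factor left the sum is the k-th difference with step v.\<close>
 define \<Psi> where "\<Psi> = (\<lambda>js v x. \<Sum>i\<le>k. c i * G i js (x + real i *\<^sub>R v))"
 have \<Psi>_Cons: "\<Psi> ((a, b) # js) v = (\<lambda>x. \<Psi> js v x - \<Psi> js (v + b) (x + a))" for a b js v
  by (auto simp: \<Psi>_def G_def right_diff_distrib sum_subtractf scaleR_add_right add_ac)
 have \<Psi>: "L (\<Psi> js v) \<le> ennreal (2 ^ length js) * modulus L k f (norm v + (\<Sum>(a, b)\<leftarrow>js. norm b))" for js v
 proof (induction js arbitrary: v)
  case Nil
  have "\<Psi> [] v = (fdiff v ^^ k) f" by (auto simp: \<Psi>_def G_def c_def fdiff_pow_expand)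
  then show ?case using modulus_upper[of v "norm v" k f] by simp
 next
  case (Cons p js)
  obtain a b where p: "p = (a, b)" by (cases p)
  let ?M = "modulus L k f (norm v + (\<Sum>(a, b)\<leftarrow>p # js. norm b))"
  have "0 \<le> norm b" by simp
  have "L (\<Psi> (p # js) v) \<le> L (\<Psi> js v) + L (\<Psi> js (v + b))"
   unfolding p \<Psi>_Cons by (rule order.trans[OF L_diff]) (simp add: L_shift)
  also have "... \<le> ennreal (2 ^ length js) * ?M + ennreal (2 ^ length js) * ?M"
  proof -
   have S: "(\<Sum>(a, b)\<leftarrow>p # js. norm b) = norm b + (\<Sum>(a, b)\<leftarrow>js. norm b)" by (simp add: p)
   have "0 \<le> norm b" by simp
   with norm_triangle_ineq[of v b] have
    1: "norm v + (\<Sum>(a, b)\<leftarrow>js. norm b) \<le> norm v + (norm b + (\<Sum>(a, b)\<leftarrow>js. norm b))" and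
    2: "norm (v + b) + (\<Sum>(a, b)\<leftarrow>js. norm b) \<le> norm v + (norm b + (\<Sum>(a, b)\<leftarrow>js. norm b))"
    by linarith+
   show ?thesis unfolding S
    by (rule add_mono[OF order.trans[OF Cons.IH mult_left_mono[OF modulus_mono[OF 1]]]
       order.trans[OF Cons.IH mult_left_mono[OF modulus_mono[OF 2]]]]) simp_all
  qed
  also have "... = ennreal (2 ^ length (p # js)) * ?M"
  proof -
   have "ennreal (2 ^ length (p # js)) = ennreal (2 ^ length js) + ennreal (2 ^ length js)"
    by (subst ennreal_plus[symmetric]) simp_all
   then show ?thesis by (simp only: distrib_right)
  qed
  finally show ?case .
 qed
 \<comment> \<open>Positions start at 0, so entry j is the factor that vanishes at i = j + 1;
   together the entries kill all summands with 1 \<le> i \<le> k.\<close>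
 define js where "js = map (\<lambda>j. (hs ! j, - (1 / real (Suc j)) *\<^sub>R hs ! j)) [0..<k]"
 have fst_js: "map fst js = hs" by (auto simp: js_def k_def comp_def map_nth)
 have len: "length js = k" by (simp add: js_def)
 have zero: "G i js' = (\<lambda>x. 0)" if "(a, b) \<in> set js'" "a + real i *\<^sub>R b = 0" for i js' a b
  using that(1) unfolding G_def by (induction js') (auto simp: that(2))
 have "G i js = (\<lambda>x. 0)" if i: "1 \<le> i" "i \<le> k" for i
 proof (rule zero)
  show "(hs ! (i - 1), - (1 / real (Suc (i - 1))) *\<^sub>R hs ! (i - 1)) \<in> set js"
   using i by (auto simp: js_def)
  show "hs ! (i - 1) + real i *\<^sub>R (- (1 / real (Suc (i - 1))) *\<^sub>R hs ! (i - 1)) = 0"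
   using i by simp
 qed
 then have "\<Psi> js 0 = (\<lambda>x. \<Sum>i\<in>{0}. c i * G i js x)"
  unfolding \<Psi>_def by (intro ext sum.mono_neutral_cong_right) auto
 then have \<Psi>0: "\<Psi> js 0 = (\<lambda>x. c 0 * G 0 js x)" by simp
 have G0: "G 0 js' = (\<lambda>x. (-1) ^ length js' * foldr fdiff (map fst js') f x)" for js'
  unfolding G_def by (induction js') (auto simp: fdiff_def algebra_simps)
 have "\<Psi> js 0 = foldr fdiff hs f"
  unfolding \<Psi>0 G0 fst_js len c_def by (auto simp: mult.assoc[symmetric] power_add[symmetric] simp flip: power_mult_distrib)
 then have "L (foldr fdiff hs f) \<le> ennreal (2 ^ k) * modulus L k f (\<Sum>(a, b)\<leftarrow>js. norm b)"
  using \<Psi>[of js 0] by (simp add: len)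
 also have "... \<le> ennreal (2 ^ k) * modulus L k f (real k * \<delta>)"
 proof (intro mult_left_mono modulus_mono)
  have "(\<Sum>(a, b)\<leftarrow>js. norm b) \<le> (\<Sum>p\<leftarrow>js. \<delta>)"
  proof (rule sum_list_mono)
   fix p assume "p \<in> set js"
   then obtain j where j: "j < k" "p = (hs ! j, - (1 / real (Suc j)) *\<^sub>R hs ! j)" by (auto simp: js_def)
   have "norm (hs ! j) / real (Suc j) \<le> norm (hs ! j)" by (simp add: divide_le_eq algebra_simps)
   also have "... \<le> \<delta>" using j by (intro assms) (auto simp: k_def)
   finally show "(case p of (a, b) => norm b) \<le> \<delta>" by (simp add: j divide_inverse mult.commute)
  qed
  also have "... = real k * \<delta>" by (simp add: sum_list_triv len)
  finally show "(\<Sum>(a, b)\<leftarrow>js. norm b) \<le> real k * \<delta>" .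
 qed simp
 finally show ?thesis by (simp add: k_def)
qed

end

section \<open>Characteristic functions of the spaces\<close>

lemma equivalent_on_transfer:
 fixes F G F' G' :: "('a => complex) => real => ennreal"
 assumes eq: "equivalent_on A F G"
  and A: "\<And>f. A' f < \<infinity> ==> A f < \<infinity>"
  and \<phi>: "\<And>t. 0 < t ==> t < 1 ==> 0 < \<phi> t \<and> \<phi> t < (1::real)"
  and F: "dominated_on (below A') (\<lambda>(f, t). F f (\<phi> t)) (\<lambda>(f, t). F' f t)"
   "dominated_on (below A') (\<lambda>(f, t). F' f t) (\<lambda>(f, t). F f (\<phi> t))"
  and G: "dominated_on (below A') (\<lambda>(f, t). G f (\<phi> t)) (\<lambda>(f, t). G' f t)"
   "dominated_on (below A') (\<lambda>(f, t). G' f t) (\<lambda>(f, t). G f (\<phi> t))"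
 shows "equivalent_on A' F' G'"
proof -
 let ?X = "(below A')"
 have "dominated_on (below A) (\<lambda>(f, t). F f t) (\<lambda>(f, t). G f t)"
  "dominated_on (below A) (\<lambda>(f, t). G f t) (\<lambda>(f, t). F f t)"
  using eq unfolding equivalent_on_iff_dominated_on by auto
 from this[THEN dominated_on_reindex, of ?X "\<lambda>(f, t). (f, \<phi> t)"]
 have "dominated_on ?X (\<lambda>(f, t). F f (\<phi> t)) (\<lambda>(f, t). G f (\<phi> t))"
  "dominated_on ?X (\<lambda>(f, t). G f (\<phi> t)) (\<lambda>(f, t). F f (\<phi> t))"
  using A \<phi> by (auto simp: case_prod_beta')
 then show ?thesis unfolding equivalent_on_iff_dominated_on
  using F G by (meson dominated_on_trans)
qed

lemma ennreal_le_cmult_I: "x \<le> ennreal C * y ==> y \<le> z ==> x \<le> ennreal C * z"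
 by (meson mult_left_mono order.trans zero_le)

text \<open>
 \<open>characteristic k s b q t\<close> is comparable to \<open>1 + \<parallel>min(1, (u/t)\<^sup>k) u\<^sup>-\<^sup>s (1 - log u)\<^sup>b\<parallel>\<close>, the norm being
 that of \<open>L\<^sub>q(du/u)\<close> on \<open>(0, 1)\<close>.
\<close>

definition characteristic :: "nat => real => real => ennreal => real => real" where
 "characteristic k s b q t =
   weight (- s) (b + (if s = 0 \<or> s = real k then recip q else 0)) t"

text \<open>The interior case and the two limiting ones. For s = 0 the condition makes
  \<open>characteristic\<close> unbounded as t tends to 0; for s = k it makes the norm of (1 - ln
  u)^b over (0, t) finite.\<close>

definition admissible :: "nat => real => real => ennreal => bool" where
 "admissible k s b q \<longleftrightarrow> 1 \<le> k \<and> 0 < q \<and>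
   (0 < s \<and> s < real k \<or> s = 0 \<and> b > - recip q \<or> s = real k \<and> (b < - recip q \<or> q = \<infinity> \<and> b \<le> 0))"

lemma characteristic_pos: "0 < t ==> t < 1 ==> 0 < characteristic k s b q t"
 using ln_less_one[of t] by (simp add: characteristic_def)

lemma weight_le_characteristic:
 assumes "0 < t" "t < 1"
 shows "weight (- s) b t \<le> characteristic k s b q t"
 unfolding characteristic_def using assms recip_nonneg[of q]
 by (intro mult_left_mono powr_mono) auto

text \<open>Together with \<open>characteristic_upper\<close> this places the growth function
  between those of L_p and W^k, namely 1 and t^(-k). Both bounds follow from the slow variation of
  the logarithm between t and 1, or, in the respective limiting case, from the sign of its
  exponent.\<close>

lemma characteristic_lower:
 assumes "admissible k s b q"
 obtains c where "c > 0" "\<And>t. 0 < t ==> t < 1 ==> 1 \<le> c * characteristic k s b q t"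
proof (cases "s = 0")
 case True
 show ?thesis
 proof (rule that[of 1])
  fix t :: real assume t: "0 < t" "t < 1"
  show "1 \<le> 1 * characteristic k s b q t"
   using assms t True by (auto simp: characteristic_def admissible_def intro!: ge_one_powr_ge_zero)
 qed simp
next
 case False
 define e where "e = b + (if s = 0 \<or> s = real k then recip q else 0)"
 have "s > 0" using False assms by (auto simp: admissible_def)
 then obtain C where C: "C > 0" "\<And>u t. 0 < u ==> u \<le> t ==> t \<le> 1 ==> (1 - ln t) powr e \<le> C * (t / u) powr s * (1 - ln u) powr e"
  by (rule log_weight_compare[of s e]) (rule that)
 show ?thesis
 proof (rule that[OF C(1)])
  fix t :: real assume t: "0 < t" "t < 1"
  have "(1 - ln 1) powr e \<le> C * (1 / t) powr s * (1 - ln t) powr e" using t by (intro C) auto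
  also have "(1 / t) powr s = t powr (- s)" by (simp add: powr_divide powr_minus_divide)
  finally show "1 \<le> C * characteristic k s b q t"
   unfolding characteristic_def e_def by (simp add: mult.assoc)
 qed
qed

lemma characteristic_upper:
 assumes "admissible k s b q"
 obtains c where "c > 0" "\<And>t. 0 < t ==> t < 1 ==> t powr real k * characteristic k s b q t \<le> c"
proof (cases "s = real k")
 case True
 show ?thesis
 proof (rule that[of 1])
  fix t :: real assume t: "0 < t" "t < 1"
  have "b + recip q \<le> 0" using assms True by (auto simp: admissible_def recip_infinity[unfolded infinity_ennreal_def])
  then have "(1 - ln t) powr (b + recip q) \<le> (1 - ln t) powr 0"
   using t by (intro powr_mono) auto
  also have "... = 1" using ln_less_one[of t] t by simp
  finally show "t powr real k * characteristic k s b q t \<le> 1"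
   using t by (simp add: characteristic_def True mult.assoc[symmetric] flip: powr_add)
 qed simp
next
 case False
 define e where "e = b + (if s = 0 \<or> s = real k then recip q else 0)"
 have sk: "real k - s > 0" using False assms by (auto simp: admissible_def)
 then obtain C where C: "C > 0" "\<And>u t. 0 < u ==> u \<le> t ==> t \<le> 1 ==> (1 - ln u) powr e \<le> C * (t / u) powr (real k - s) * (1 - ln t) powr e"
  by (rule log_weight_compare[of "real k - s" e]) (rule that)
 show ?thesis
 proof (rule that[OF C(1)])
  fix t :: real assume t: "0 < t" "t < 1"
  have "(1 - ln t) powr e \<le> C * (1 / t) powr (real k - s) * (1 - ln 1) powr e" using t by (intro C) auto
  also have "(1 / t) powr (real k - s) = t powr (- (real k - s))" by (simp only: powr_divide powr_minus_divide powr_one_eq_one)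
  finally have "weight (real k - s) e t \<le> t powr (real k - s) * (C * t powr (- (real k - s)))"
   using t by (intro mult_left_mono) auto
  also have "... = C * (t powr (real k - s) * t powr (- (real k - s)))" by simp
  also have "t powr (real k - s) * t powr (- (real k - s)) = 1" using t by (simp flip: powr_add)
  finally have "weight (real k - s) e t \<le> C" by simp
  then show "t powr real k * characteristic k s b q t \<le> C"
   unfolding characteristic_def e_def by (simp add: mult.assoc[symmetric] flip: powr_add)
 qed
qed

text \<open>The modulus of a Sobolev function is at most a multiple of u^k, so this is its
  contribution over (0, t). \<open>weight_const_high\<close> is the counterpart over (t, 1) for a
  function of which only the norm is known.\<close>

lemma weight_power_low:
 assumes "admissible k s b q"
 obtains C where "C > 0" "\<And>t. 0 < t ==> t < 1 ==>
  log_integral (- s) b q 0 t (\<lambda>u. ennreal (u powr real k)) \<le> ennreal (C * (t powr real k * characteristic k s b q t))"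
proof -
 have q: "0 < q" using assms by (simp add: admissible_def)
 have *: "log_integral (- s) b q 0 t (\<lambda>u. ennreal (u powr real k)) \<le> log_integral (real k - s) b q 0 t (\<lambda>u. 1)" for t
 proof (rule log_integral_weight_mono[OF q])
  fix u :: real assume u: "0 < u" "u < t"
  have "u powr (- s) * u powr real k = u powr (real k - s)" unfolding powr_add[symmetric] by simp
  from this[symmetric] show "ennreal (weight (- s) b u) * ennreal (u powr real k) \<le> ennreal (weight (real k - s) b u) * 1"
   by (simp add: ennreal_mult[symmetric] mult_ac)
 qed
 show thesis
 proof (cases "s = real k")
  case True
  then have b: "b < - recip q \<or> q = \<infinity> \<and> b \<le> 0" using assms by (auto simp: admissible_def)
  obtain C where C: "C > 0" "\<And>t. 0 < t ==> t \<le> 1 ==> log_integral 0 b q 0 t (\<lambda>u. 1) \<le> ennreal (C * (1 - ln t) powr (b + recip q))"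
   by (rule log_integral_zero_low[OF q b]) (rule that)
  show thesis
  proof (rule that[OF C(1)])
   fix t :: real assume t: "0 < t" "t < 1"
   have "log_integral (- s) b q 0 t (\<lambda>u. ennreal (u powr real k)) \<le> ennreal (C * (1 - ln t) powr (b + recip q))"
    using *[of t] C(2)[of t] t True by (auto intro: order.trans)
   also have "(1 - ln t) powr (b + recip q) = t powr real k * characteristic k s b q t"
    using t by (simp add: characteristic_def True mult.assoc[symmetric] flip: powr_add)
   finally show "log_integral (- s) b q 0 t (\<lambda>u. ennreal (u powr real k)) \<le> ennreal (C * (t powr real k * characteristic k s b q t))" .
  qed
 next
  case False
  then have sk: "0 < real k - s" using assms by (auto simp: admissible_def)
  obtain C where C: "C > 0" "\<And>t. 0 < t ==> t \<le> 1 ==> log_integral (real k - s) b q 0 t (\<lambda>u. 1) \<le> ennreal (C * weight (real k - s) b t)"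
   by (rule log_integral_low[OF q sk]) (rule that)
  show thesis
  proof (rule that[OF C(1)])
   fix t :: real assume t: "0 < t" "t < 1"
   have "log_integral (- s) b q 0 t (\<lambda>u. ennreal (u powr real k)) \<le> ennreal (C * weight (real k - s) b t)"
    using *[of t] C(2)[of t] t by (auto intro: order.trans)
   also have "weight (real k - s) b t = t powr real k * weight (- s) b t"
    by (simp add: mult.assoc[symmetric] flip: powr_add)
   also have "ennreal (C * (t powr real k * weight (- s) b t)) \<le> ennreal (C * (t powr real k * characteristic k s b q t))"
    using C t by (intro ennreal_leI mult_left_mono weight_le_characteristic) auto
   finally show "log_integral (- s) b q 0 t (\<lambda>u. ennreal (u powr real k)) \<le> ennreal (C * (t powr real k * characteristic k s b q t))" .
  qed
 qed
qed

lemma weight_const_high: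
 assumes "admissible k s b q"
 obtains C where "C > 0" "\<And>t. 0 < t ==> t < 1 ==>
  log_integral (- s) b q t 1 (\<lambda>u. 1) \<le> ennreal (C * characteristic k s b q t)"
proof -
 have q: "0 < q" using assms by (simp add: admissible_def)
 show thesis
 proof (cases "s = 0")
  case True
  then have b: "b > - recip q" using assms by (auto simp: admissible_def)
  obtain C where C: "C > 0" "\<And>t. 0 < t ==> t < 1 ==> log_integral 0 b q t 1 (\<lambda>u. 1) \<le> ennreal (C * (1 - ln t) powr (b + recip q))"
   by (rule log_integral_zero_high[OF q b]) (rule that)
  show thesis by (rule that[OF C(1)]) (use C(2) in \<open>simp add: characteristic_def True\<close>)
 next
  case False
  then have s: "- s < 0" using assms by (auto simp: admissible_def)
  obtain C where C: "C > 0" "\<And>t. 0 < t ==> t < 1 ==> log_integral (- s) b q t 1 (\<lambda>u. 1) \<le> ennreal (C * weight (- s) b t)"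
   by (rule log_integral_high[OF q s]) (rule that)
  show thesis
  proof (rule that[OF C(1)])
   fix t :: real assume t: "0 < t" "t < 1"
   note C(2)[OF t]
   also have "ennreal (C * weight (- s) b t) \<le> ennreal (C * characteristic k s b q t)"
    using C t by (intro ennreal_leI mult_left_mono weight_le_characteristic) auto
   finally show "log_integral (- s) b q t 1 (\<lambda>u. 1) \<le> ennreal (C * characteristic k s b q t)" .
  qed
 qed
qed

context translation_seminorm
begin

abbreviation (input) low :: "nat => real => real => ennreal => ('a => complex) => real => ennreal" where
 "low k s b q f t \<equiv> log_integral (- s) b q 0 t (modulus L k f)"

abbreviation (input) high :: "nat => real => real => ennreal => ('a => complex) => real => ennreal" where
 "high k s b q f t \<equiv> log_integral (- s) b q t 1 (modulus L k f)"

text \<open>For s = 0 and finite q the growth function carries an extra power 1/q of the logarithm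
  which the integral over (0, t) does not see; symmetrically, s = k is excluded in
  \<open>high_absorbs\<close>.\<close>

lemma low_absorbs:
 assumes "admissible k s b q" "s \<noteq> 0"
 obtains C where "C > 0" "\<And>f t. L f < \<infinity> ==> 0 < t ==> t < 1 ==>
  ennreal (characteristic k s b q t) * modulus L k f t \<le> ennreal C * low k s b q f t"
proof -
 have q: "0 < q" using assms by (simp add: admissible_def)
 show thesis
 proof (cases "s = real k")
  case True
  then have b: "b < - recip q \<or> q = \<infinity> \<and> b \<le> 0" using assms by (auto simp: admissible_def)
  obtain C where C: "C > 0"
   "\<And>w t. (\<And>u v. u \<le> v ==> w u \<le> w v) ==> (\<And>u. 0 < u ==> w (2 * u) \<le> ennreal (2 ^ k) * w u) ==>
    w t < \<infinity> ==> 0 < t ==> t \<le> 1 ==>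
    ennreal (weight (- real k) (b + recip q) t) * w t \<le> ennreal C * log_integral (- real k) b q 0 t w"
   using absorb_low_limiting[OF q b, of k] by metis
  show thesis
  proof (rule that[OF C(1)])
   fix f t assume "L f < \<infinity>" "0 < t" "t < (1::real)"
   then show "ennreal (characteristic k s b q t) * modulus L k f t \<le> ennreal C * low k s b q f t"
    using C(2)[of "modulus L k f" t, OF modulus_mono modulus_double modulus_finite]
    by (simp add: characteristic_def True)
  qed
 next
  case False
  obtain C where C: "C > 0"
   "\<And>w t. (\<And>u v. u \<le> v ==> w u \<le> w v) ==> (\<And>u. 0 < u ==> w (2 * u) \<le> ennreal (2 ^ k) * w u) ==>
    w t < \<infinity> ==> 0 < t ==> t \<le> 1 ==>
    ennreal (weight (- s) b t) * w t \<le> ennreal C * log_integral (- s) b q 0 t w"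
   using absorb_low[OF q, of k "- s" b] by metis
  show thesis
  proof (rule that[OF C(1)])
   fix f t assume "L f < \<infinity>" "0 < t" "t < (1::real)"
   then show "ennreal (characteristic k s b q t) * modulus L k f t \<le> ennreal C * low k s b q f t"
    using C(2)[of "modulus L k f" t, OF modulus_mono modulus_double modulus_finite] False assms(2)
    by (simp add: characteristic_def)
  qed
 qed
qed

lemma high_absorbs:
 assumes "admissible k s b q" "s \<noteq> real k"
 obtains C where "C > 0" "\<And>f t. L f < \<infinity> ==> 0 < t ==> t < 1 ==>
  ennreal (characteristic k s b q t) * modulus L k f t \<le> ennreal C * (L f + high k s b q f t)"
proof -
 have q: "0 < q" using assms by (simp add: admissible_def)
 show thesis
 proof (cases "s = 0")
  case True
  then have b: "b > - recip q" using assms by (auto simp: admissible_def)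
  obtain C where C: "C > 0"
   "\<And>w t x. (\<And>u v. u \<le> v ==> w u \<le> w v) ==> w t \<le> ennreal (2 ^ k) * x ==> x < \<infinity> ==>
    0 < t ==> t < 1 ==>
    ennreal ((1 - ln t) powr (b + recip q)) * w t \<le> ennreal C * (x + log_integral 0 b q t 1 w)"
   using absorb_high_limiting[OF q b, of k] by metis
  show thesis
  proof (rule that[OF C(1)])
   fix f t assume "L f < \<infinity>" "0 < t" "t < (1::real)"
   then show "ennreal (characteristic k s b q t) * modulus L k f t \<le> ennreal C * (L f + high k s b q f t)"
    using C(2)[of "modulus L k f" t, OF modulus_mono modulus_le_norm]
    by (simp add: characteristic_def True)
  qed
 next
  case False
  obtain C where C: "C > 0"
   "\<And>w t x. (\<And>u v. u \<le> v ==> w u \<le> w v) ==> w t \<le> ennreal (2 ^ k) * x ==> x < \<infinity> ==>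
    0 < t ==> t < 1 ==>
    ennreal (weight (- s) b t) * w t \<le> ennreal C * (x + log_integral (- s) b q t 1 w)"
   using absorb_high[OF q, of k "- s" b] by metis
  show thesis
  proof (rule that[OF C(1)])
   fix f t assume "L f < \<infinity>" "0 < t" "t < (1::real)"
   then show "ennreal (characteristic k s b q t) * modulus L k f t \<le> ennreal C * (L f + high k s b q f t)"
    using C(2)[of "modulus L k f" t, OF modulus_mono modulus_le_norm] False assms(2)
    by (simp add: characteristic_def)
  qed
 qed
qed

lemma besov_finite_norm: "besov L m s b q f < \<infinity> ==> L f < \<infinity>"
 by (auto simp: besov_def)

text \<open>The Besov formula at s = k with differences of order k itself, which no longer exceeds
  the smoothness. For \<alpha> > 1/r, or r = \<infinity> and \<alpha> \<ge> 0, this is the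
  admissible limiting case with b = -\<alpha>.\<close>

lemma lip_eq_besov: "lip L k \<alpha> r = besov L k (real k) (- \<alpha>) r"
 by (auto simp: lip_def besov_def)

text \<open>Uses the side of t on which the modulus is absorbed: (0, t) unless s = 0, and (t, 1) in
  that case.\<close>

lemma characteristic_modulus_le_besov:
 assumes adm: "admissible k s b q"
 shows "dominated_on (below (besov L k s b q))
   (\<lambda>(f, t). ennreal (characteristic k s b q t) * modulus L k f t) (\<lambda>(f, t). besov L k s b q f)"
proof -
 have q: "0 < q" using adm by (simp add: admissible_def)
 have sub: "log_integral (- s) b q a c (modulus L k f) \<le> besov L k s b q f" if "0 \<le> a" "c \<le> 1" for a c f
  unfolding besov_def using that by (intro add_increasing log_integral_mono_interval q) auto
 show ?thesis
 proof (cases "s = 0")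
  case False
  then obtain C where C: "C > 0" "\<And>f t. L f < \<infinity> ==> 0 < t ==> t < 1 ==>
    ennreal (characteristic k s b q t) * modulus L k f t \<le> ennreal C * low k s b q f t"
   by (rule low_absorbs[OF adm]) (rule that)
  show ?thesis
   by (rule dominated_onI[OF C(1)]) (auto intro!: ennreal_le_cmult_I[OF C(2)] sub dest: besov_finite_norm[unfolded infinity_ennreal_def])
 next
  case True
  then have "s \<noteq> real k" using adm by (auto simp: admissible_def)
  then obtain C where C: "C > 0" "\<And>f t. L f < \<infinity> ==> 0 < t ==> t < 1 ==>
    ennreal (characteristic k s b q t) * modulus L k f t \<le> ennreal C * (L f + high k s b q f t)"
   by (rule high_absorbs[OF adm]) (rule that)
  have "L f + high k s b q f t \<le> besov L k s b q f" if "0 < t" for f t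
   unfolding besov_def using that by (intro add_left_mono log_integral_mono_interval q) auto
  then show ?thesis
   by (intro dominated_onI[OF C(1)]) (auto intro!: ennreal_le_cmult_I[OF C(2)] dest: besov_finite_norm[unfolded infinity_ennreal_def])
 qed
qed

end

section \<open>K-functionals and smoothing\<close>

text \<open>All that the formulas need to know about the spaces. The last two assumptions are the
  substance of the equivalence of K(t^k, f; L_p, W^k) with t^k L f + \<omega>_k(f, t).\<close>

locale smoothing_norm = translation_seminorm +
 fixes k :: nat
 assumes k_pos: "1 \<le> k"
  and norm_le_sobolev: "dominated_on UNIV L (sobolev L k)"
  and modulus_le_sobolev: "dominated_on (below (sobolev L k))
   (\<lambda>(f, t). ennreal (t powr (- real k)) * modulus L k f t) (\<lambda>(f, t). sobolev L k f)"
  and smoothing: "\<exists>g. dominated_on (below L)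
    (\<lambda>(f, t). L (\<lambda>x. f x - g f t x)) (\<lambda>(f, t). modulus L k f t) \<and>
   dominated_on (below L)
    (\<lambda>(f, t). sobolev L k (g f t)) (\<lambda>(f, t). L f + ennreal (t powr (- real k)) * modulus L k f t)"
begin

definition smooth :: "('a => complex) => real => 'a => complex" where
 "smooth = (SOME g. dominated_on (below L)
    (\<lambda>(f, t). L (\<lambda>x. f x - g f t x)) (\<lambda>(f, t). modulus L k f t) \<and>
   dominated_on (below L)
    (\<lambda>(f, t). sobolev L k (g f t)) (\<lambda>(f, t). L f + ennreal (t powr (- real k)) * modulus L k f t))"

lemma smooth_approx: "dominated_on (below L)
    (\<lambda>(f, t). L (\<lambda>x. f x - smooth f t x)) (\<lambda>(f, t). modulus L k f t)"
 and smooth_sobolev: "dominated_on (below L)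
    (\<lambda>(f, t). sobolev L k (smooth f t)) (\<lambda>(f, t). L f + ennreal (t powr (- real k)) * modulus L k f t)"
 using someI_ex[OF smoothing] unfolding smooth_def by auto

text \<open>Two regimes for the modulus at a scale u: that of f minus the smoothed function is
  controlled uniformly in u through its norm, that of the smoothed function through its Sobolev
  norm, with the decay u^k.\<close>

lemma smooth_bounds:
 obtains C where "C > 0"
  "\<And>f t u. L f < \<infinity> ==> 0 < t ==> t < 1 ==> L (\<lambda>x. f x - smooth f t x) \<le> ennreal C * modulus L k f t"
  "\<And>f t u. L f < \<infinity> ==> 0 < t ==> t < 1 ==> L (smooth f t) \<le> ennreal C * L f"
  "\<And>f t u. L f < \<infinity> ==> 0 < t ==> t < 1 ==> modulus L k (\<lambda>x. f x - smooth f t x) u \<le> ennreal C * modulus L k f t"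
  "\<And>f t u. L f < \<infinity> ==> 0 < t ==> t < 1 ==> 0 < u ==> u < 1 ==>
    modulus L k (smooth f t) u \<le> ennreal (u powr real k) * (ennreal C * (L f + ennreal (t powr (- real k)) * modulus L k f t))"
proof -
 obtain C1 where C1: "C1 > 0" "\<And>f t. L f < \<infinity> ==> 0 < t ==> t < 1 ==> L (\<lambda>x. f x - smooth f t x) \<le> ennreal C1 * modulus L k f t"
  using smooth_approx unfolding dominated_on_def by auto
 obtain C2 where C2: "C2 > 0" "\<And>f t. L f < \<infinity> ==> 0 < t ==> t < 1 ==> sobolev L k (smooth f t) \<le> ennreal C2 * (L f + ennreal (t powr (- real k)) * modulus L k f t)"
  using smooth_sobolev unfolding dominated_on_def by auto
 obtain C3 where C3: "C3 > 0" "\<And>f t. sobolev L k f < \<infinity> ==> 0 < t ==> t < 1 ==> ennreal (t powr (- real k)) * modulus L k f t \<le> ennreal C3 * sobolev L k f"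
  using modulus_le_sobolev unfolding dominated_on_def by auto
 define C where "C = C1 + (1 + C1 * 2 ^ k) + 2 ^ k * C1 + C3 * C2"
 have C: "C > 0" "C1 \<le> C" "1 + C1 * 2 ^ k \<le> C" "2 ^ k * C1 \<le> C" "C3 * C2 \<le> C"
  using C1(1) C2(1) C3(1) by (auto simp: C_def add_nonneg_nonneg add_pos_pos intro!: add_nonneg_nonneg add_pos_pos)
 show thesis
 proof (rule that[OF C(1)])
  fix f t assume f: "L f < \<infinity>" and t: "0 < t" "t < (1::real)"
  have a: "L (\<lambda>x. f x - smooth f t x) \<le> ennreal C1 * modulus L k f t" by (rule C1(2)[OF f t])
  also have "... \<le> ennreal C * modulus L k f t" using C by (intro mult_right_mono ennreal_leI) auto
  finally show "L (\<lambda>x. f x - smooth f t x) \<le> ennreal C * modulus L k f t" .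
  have "L (smooth f t) \<le> L f + L (\<lambda>x. f x - smooth f t x)"
   using L_diff[of f "\<lambda>x. f x - smooth f t x"] by simp
  also have "... \<le> L f + ennreal C1 * (ennreal (2 ^ k) * L f)"
   by (intro add_left_mono order.trans[OF a] mult_left_mono modulus_le_norm) simp
  also have "... = ennreal (1 + C1 * 2 ^ k) * L f"
   using C1 by (simp add: ennreal_plus ennreal_mult distrib_right mult.assoc del: ennreal_plus[symmetric])
  also have "... \<le> ennreal C * L f" using C by (intro mult_right_mono ennreal_leI) auto
  finally show "L (smooth f t) \<le> ennreal C * L f" .
  fix u :: real
  have "modulus L k (\<lambda>x. f x - smooth f t x) u \<le> ennreal (2 ^ k) * (ennreal C1 * modulus L k f t)"
   by (rule order.trans[OF modulus_le_norm]) (intro mult_left_mono a, simp)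
  also have "... = ennreal (2 ^ k * C1) * modulus L k f t" using C1 by (simp add: ennreal_mult mult.assoc)
  also have "... \<le> ennreal C * modulus L k f t" using C by (intro mult_right_mono ennreal_leI) auto
  finally show "modulus L k (\<lambda>x. f x - smooth f t x) u \<le> ennreal C * modulus L k f t" .
  assume u: "0 < u" "u < 1"
  let ?B = "L f + ennreal (t powr (- real k)) * modulus L k f t"
  have "?B < \<infinity>" using f modulus_finite[OF f, of k t] by (simp add: ennreal_mult_less_top)
  have sob: "sobolev L k (smooth f t) \<le> ennreal C2 * ?B" by (rule C2(2)[OF f t])
  also have "... < \<infinity>" using \<open>?B < \<infinity>\<close> by (auto simp: ennreal_mult_less_top)
  finally have fin: "sobolev L k (smooth f t) < \<infinity>" .
  have "ennreal (u powr (- real k)) * modulus L k (smooth f t) u \<le> ennreal C3 * (ennreal C2 * ?B)"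
   by (rule ennreal_le_cmult_I[OF C3(2)[OF fin u] sob])
  also have "... = ennreal (C3 * C2) * ?B" using C2 C3 by (simp add: ennreal_mult mult.assoc)
  also have "... \<le> ennreal C * ?B" using C by (intro mult_right_mono ennreal_leI) auto
  finally have "ennreal (u powr real k) * (ennreal (u powr (- real k)) * modulus L k (smooth f t) u) \<le> ennreal (u powr real k) * (ennreal C * ?B)"
   by (rule mult_left_mono) simp
  moreover have "ennreal (u powr real k) * (ennreal (u powr (- real k)) * modulus L k (smooth f t) u) = modulus L k (smooth f t) u"
   using u by (simp add: mult.assoc[symmetric] ennreal_mult'[symmetric] flip: powr_add)
  ultimately show "modulus L k (smooth f t) u \<le> ennreal (u powr real k) * (ennreal C * ?B)" by simp
 qed
qed

abbreviation (input) "D \<equiv> (below L)"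

lemma log_integral_modulus_add:
 assumes q: "0 < q" and h: "\<And>x u. modulus L k (h x) u \<le> modulus L k (f x) u + modulus L k (g x) u"
 shows "dominated_on X (\<lambda>x. log_integral s b q (a x) (c x) (modulus L k (h x)))
   (\<lambda>x. log_integral s b q (a x) (c x) (modulus L k (f x)) + log_integral s b q (a x) (c x) (modulus L k (g x)))"
proof -
 obtain A where A: "A > 0" "\<And>a c w w'. w \<in> borel_measurable borel ==> w' \<in> borel_measurable borel ==>
    log_integral s b q a c (\<lambda>u. w u + w' u) \<le> ennreal A * (log_integral s b q a c w + log_integral s b q a c w')"
  by (rule log_integral_add[OF q]) (rule that)
 show ?thesis
  by (rule dominated_onI[OF A(1)], rule order.trans[OF log_integral_mono[OF q h] A(2)]) measurable
qed

text \<open>The norm over (0, 1) is cut at t. For f - g_t the part over (t, 1) sees the constant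
  \<omega>_k(f, t), while over (0, t) the moduli of f and g_t are added. For g_t it is the other way
  round: the decay u^k serves over (0, t), and over (t, 1) the moduli of f and f - g_t are
  added.\<close>

lemma
 assumes adm: "admissible k s b q"
 shows besov_diff_smooth: "dominated_on D (\<lambda>(f, t). besov L k s b q (\<lambda>x. f x - smooth f t x))
   (\<lambda>(f, t). ennreal (characteristic k s b q t) * modulus L k f t
     + ennreal (t powr real k * characteristic k s b q t) * L f + low k s b q f t)"
  and besov_smooth: "dominated_on D (\<lambda>(f, t). besov L k s b q (smooth f t))
   (\<lambda>(f, t). L f + ennreal (characteristic k s b q t) * modulus L k f t + high k s b q f t)"
proof -
 let ?R = "characteristic k s b q"
 have q: "0 < q" using adm by (simp add: admissible_def)
 obtain C where C: "C > 0"
  "\<And>f t u. L f < \<infinity> ==> 0 < t ==> t < 1 ==> L (\<lambda>x. f x - smooth f t x) \<le> ennreal C * modulus L k f t"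
  "\<And>f t u. L f < \<infinity> ==> 0 < t ==> t < 1 ==> L (smooth f t) \<le> ennreal C * L f"
  "\<And>f t u. L f < \<infinity> ==> 0 < t ==> t < 1 ==> modulus L k (\<lambda>x. f x - smooth f t x) u \<le> ennreal C * modulus L k f t"
  "\<And>f t u. L f < \<infinity> ==> 0 < t ==> t < 1 ==> 0 < u ==> u < 1 ==>
    modulus L k (smooth f t) u \<le> ennreal (u powr real k) * (ennreal C * (L f + ennreal (t powr (- real k)) * modulus L k f t))"
  by (rule smooth_bounds) (rule that)
 obtain S where S: "S > 0" "\<And>a t c w. a < t ==> t < c ==> w \<in> borel_measurable borel ==>
    log_integral (- s) b q a c w \<le> ennreal S * (log_integral (- s) b q a t w + log_integral (- s) b q t c w + ennreal (weight (- s) b t) * w t)"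
  by (rule log_integral_split[OF q, of "- s" b]) (rule that)
 obtain P where P: "P > 0" "\<And>t. 0 < t ==> t < 1 ==>
  log_integral (- s) b q 0 t (\<lambda>u. ennreal (u powr real k)) \<le> ennreal (P * (t powr real k * ?R t))"
  by (rule weight_power_low[OF adm]) (rule that)
 obtain Q where Q: "Q > 0" "\<And>t. 0 < t ==> t < 1 ==> log_integral (- s) b q t 1 (\<lambda>u. 1) \<le> ennreal (Q * ?R t)"
  by (rule weight_const_high[OF adm]) (rule that)
 obtain c where c: "c > 0" "\<And>t. 0 < t ==> t < 1 ==> 1 \<le> c * ?R t" by (rule characteristic_lower[OF adm]) (rule that)
 obtain c' where c': "c' > 0" "\<And>t. 0 < t ==> t < 1 ==> t powr real k * ?R t \<le> c'" by (rule characteristic_upper[OF adm]) (rule that)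
 let ?w = "\<lambda>f t. ennreal (?R t) * modulus L k f t"
 have low_smooth: "dominated_on D (\<lambda>(f, t). low k s b q (smooth f t) t)
   (\<lambda>(f, t). ennreal (t powr real k * ?R t) * L f + ?w f t)"
 proof (rule dominated_on_belowI[of "C * P"])
  fix f t assume f: "L f < \<infinity>" and t: "0 < t" "t < (1::real)"
  let ?B = "L f + ennreal (t powr (- real k)) * modulus L k f t"
  have fin: "ennreal C * ?B < \<infinity>" using f modulus_finite[OF f, of k t] by (simp add: ennreal_mult_less_top)
  have "low k s b q (smooth f t) t \<le> log_integral (- s) b q 0 t (\<lambda>u. (ennreal C * ?B) * ennreal (u powr real k))"
   by (intro log_integral_mono q order.trans[OF C(5)[OF f t]]) (use t in \<open>auto simp: mult_ac\<close>)
  also have "... = (ennreal C * ?B) * log_integral (- s) b q 0 t (\<lambda>u. ennreal (u powr real k))"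
   using q fin by (intro log_integral_cmult) auto
  also have "... \<le> (ennreal C * ?B) * ennreal (P * (t powr real k * ?R t))"
   by (intro mult_left_mono P t) simp
  also have "... = ennreal (C * P) * (ennreal (t powr real k * ?R t) * ?B)"
   using C(1) P(1) characteristic_pos[OF t, of k s b q] by (simp add: ennreal_mult mult_ac)
  also have "ennreal (t powr real k * ?R t) * ?B = ennreal (t powr real k * ?R t) * L f + ?w f t"
  proof -
   have "t powr real k * ?R t * t powr (- real k) = ?R t" using t by (simp add: powr_minus)
   then have *: "ennreal (t powr real k * ?R t) * ennreal (t powr (- real k)) = ennreal (?R t)"
    by (metis ennreal_mult'' powr_ge_zero)
   show ?thesis by (simp only: distrib_left mult.assoc[symmetric] *)
  qed
  finally show "low k s b q (smooth f t) t \<le> ennreal (C * P) * (ennreal (t powr real k * ?R t) * L f + ?w f t)" .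
 qed (use C(1) P(1) in simp)
 have high_const: "dominated_on D (\<lambda>(f, t). log_integral (- s) b q t 1 (\<lambda>u. modulus L k f t)) (\<lambda>(f, t). ?w f t)"
 proof (rule dominated_on_belowI[OF Q(1)])
  fix f t assume f: "L f < \<infinity>" and t: "0 < t" "t < (1::real)"
  have "log_integral (- s) b q t 1 (\<lambda>u. modulus L k f t) = modulus L k f t * log_integral (- s) b q t 1 (\<lambda>u. 1)"
   using log_integral_const_le[OF q modulus_finite[OF f]] by simp
  also have "... \<le> modulus L k f t * ennreal (Q * ?R t)" by (intro mult_left_mono Q t) simp
  also have "... = ennreal Q * ?w f t" using Q(1) characteristic_pos[OF t, of k s b q] by (simp add: ennreal_mult mult_ac)
  finally show "log_integral (- s) b q t 1 (\<lambda>u. modulus L k f t) \<le> ennreal Q * ?w f t" .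
 qed
 have w_ge: "dominated_on D (\<lambda>(f, t). modulus L k f t) (\<lambda>(f, t). ?w f t)"
 proof (rule dominated_on_belowI[OF c(1)])
  fix f t assume t: "0 < t" "t < (1::real)"
  have "1 * modulus L k f t \<le> ennreal (c * ?R t) * modulus L k f t"
   using c(2)[OF t] by (intro mult_right_mono) (auto simp: ennreal_ge_1)
  then show "modulus L k f t \<le> ennreal c * ?w f t"
   using c(1) characteristic_pos[OF t, of k s b q] by (simp add: ennreal_mult mult.assoc)
 qed
 have point_w: "ennreal (weight (- s) b t) * x \<le> ennreal (?R t) * x" if "0 < t" "t < 1" for t x
  using that by (intro mult_right_mono ennreal_leI weight_le_characteristic) auto
 have high_diff: "dominated_on D (\<lambda>(f, t). high k s b q (\<lambda>x. f x - smooth f t x) t) (\<lambda>(f, t). ?w f t)"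
 proof (rule dominated_on_trans[OF dominated_on_belowI[OF C(1)] high_const])
  fix f t assume f: "L f < \<infinity>" and t: "0 < t" "t < (1::real)"
  have "high k s b q (\<lambda>x. f x - smooth f t x) t \<le> log_integral (- s) b q t 1 (\<lambda>u. ennreal C * modulus L k f t)"
   by (intro log_integral_mono q C f t)
  also have "... = ennreal C * log_integral (- s) b q t 1 (\<lambda>u. modulus L k f t)"
   using q by (intro log_integral_cmult) auto
  finally show "high k s b q (\<lambda>x. f x - smooth f t x) t \<le> ennreal C * log_integral (- s) b q t 1 (\<lambda>u. modulus L k f t)" .
 qed
 have split: "dominated_on D (\<lambda>(f, t). log_integral (- s) b q 0 1 (modulus L k (F f t)))
   (\<lambda>(f, t). low k s b q (F f t) t + high k s b q (F f t) t
    + ennreal (?R t) * modulus L k (F f t) t)" for F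
  by (rule dominated_onI[OF S(1)]) (auto intro!: ennreal_le_cmult_I[OF S(2)] add_left_mono point_w)
 have besovI: "dominated_on D (\<lambda>(f, t). besov L k s b q (F f t)) H"
  if "dominated_on D (\<lambda>(f, t). L (F f t)) H"
   "dominated_on D (\<lambda>(f, t). low k s b q (F f t) t) H"
   "dominated_on D (\<lambda>(f, t). high k s b q (F f t) t) H"
   "dominated_on D (\<lambda>(f, t). ennreal (?R t) * modulus L k (F f t) t) H" for F H
  using dominated_on_add[OF that(1) dominated_on_trans[OF split[of F]]] dominated_on_add[OF dominated_on_add[OF that(2) that(3)] that(4)]
  by (simp add: besov_def case_prod_beta')
 have wC: "ennreal (?R t) * x \<le> ennreal C * (ennreal (?R t) * y)" if "x \<le> ennreal C * y" for t x y
  using mult_left_mono[OF that, of "ennreal (?R t)"] by (simp add: mult.left_commute)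
 let ?H = "\<lambda>(f, t). ?w f t + ennreal (t powr real k * ?R t) * L f + low k s b q f t"
 have H: "dominated_on D (\<lambda>(f, t). ?w f t) ?H"
  by (rule dominated_on_le) (auto simp: add.assoc)
 show "dominated_on D (\<lambda>(f, t). besov L k s b q (\<lambda>x. f x - smooth f t x)) ?H"
 proof (rule besovI)
  have "dominated_on D (\<lambda>(f, t). L (\<lambda>x. f x - smooth f t x)) (\<lambda>(f, t). modulus L k f t)" by (rule smooth_approx)
  then show "dominated_on D (\<lambda>(f, t). L (\<lambda>x. f x - smooth f t x)) ?H"
   using w_ge H by (meson dominated_on_trans)
  show "dominated_on D (\<lambda>(f, t). high k s b q (\<lambda>x. f x - smooth f t x) t) ?H"
   using high_diff H by (meson dominated_on_trans)
  have "dominated_on D (\<lambda>(f, t). ennreal (?R t) * modulus L k (\<lambda>x. f x - smooth f t x) t) (\<lambda>(f, t). ?w f t)"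
   by (rule dominated_onI[OF C(1)]) (auto intro!: wC C)
  then show "dominated_on D (\<lambda>(f, t). ennreal (?R t) * modulus L k (\<lambda>x. f x - smooth f t x) t) ?H"
   using H by (meson dominated_on_trans)
  have "dominated_on D (\<lambda>(f, t). low k s b q f t) ?H"
   by (rule dominated_on_le) (auto simp: add_increasing)
  moreover have "dominated_on D (\<lambda>(f, t). low k s b q (smooth f t) t) ?H"
   by (rule dominated_on_trans[OF low_smooth dominated_on_le]) (auto simp: add_ac add_increasing)
  ultimately show "dominated_on D (\<lambda>(f, t). low k s b q (\<lambda>x. f x - smooth f t x) t) ?H"
   using dominated_on_trans[OF log_integral_modulus_add[OF q modulus_diff, where f = fst and a = "\<lambda>_. 0" and c = snd and g = "\<lambda>(f, t). smooth f t"]] dominated_on_add by (fastforce simp: case_prod_beta')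
 qed
 let ?J = "\<lambda>(f, t). L f + ?w f t + high k s b q f t"
 have J: "dominated_on D (\<lambda>(f, t). L f) ?J" "dominated_on D (\<lambda>(f, t). ?w f t) ?J"
   "dominated_on D (\<lambda>(f, t). high k s b q f t) ?J"
  by (rule dominated_on_le; auto simp: add_increasing add_increasing2 add.assoc)+
 show "dominated_on D (\<lambda>(f, t). besov L k s b q (smooth f t)) ?J"
 proof (rule besovI)
  have "dominated_on D (\<lambda>(f, t). L (smooth f t)) (\<lambda>(f, t). L f)"
   by (rule dominated_onI[OF C(1)]) (auto intro!: C)
  then show "dominated_on D (\<lambda>(f, t). L (smooth f t)) ?J" using J by (meson dominated_on_trans)
  have "dominated_on D (\<lambda>(f, t). ennreal (t powr real k * ?R t) * L f) (\<lambda>(f, t). L f)"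
   by (rule dominated_onI[OF c'(1)]) (auto intro!: mult_right_mono ennreal_leI c')
  then have "dominated_on D (\<lambda>(f, t). ennreal (t powr real k * ?R t) * L f) ?J" using J by (meson dominated_on_trans)
  then have "dominated_on D (\<lambda>(f, t). ennreal (t powr real k * ?R t) * L f + ?w f t) ?J"
   using dominated_on_add J(2) by (fastforce simp: case_prod_beta')
  then show "dominated_on D (\<lambda>(f, t). low k s b q (smooth f t) t) ?J"
   using low_smooth by (meson dominated_on_trans)
  have m: "modulus L k (smooth f t) u \<le> modulus L k f u + modulus L k (\<lambda>x. f x - smooth f t x) u" for f t u
   using modulus_diff[of k f "\<lambda>x. f x - smooth f t x" u] by simp
  have "dominated_on D (\<lambda>(f, t). ennreal (?R t) * modulus L k (smooth f t) t) (\<lambda>(f, t). ?w f t)"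
  proof (rule dominated_on_belowI[of "1 + C"])
   fix f t assume f: "L f < \<infinity>" and t: "0 < t" "t < (1::real)"
   have "modulus L k (smooth f t) t \<le> modulus L k f t + ennreal C * modulus L k f t"
    by (rule order.trans[OF m]) (intro add_left_mono C f t)
   also have "... = ennreal (1 + C) * modulus L k f t" using C(1) by (simp add: distrib_right)
   finally show "ennreal (?R t) * modulus L k (smooth f t) t \<le> ennreal (1 + C) * ?w f t"
    using mult_left_mono[of "modulus L k (smooth f t) t" "ennreal (1 + C) * modulus L k f t" "ennreal (?R t)"]
    by (simp add: mult.left_commute)
  qed (use C(1) in simp)
  then show "dominated_on D (\<lambda>(f, t). ennreal (?R t) * modulus L k (smooth f t) t) ?J"
   using J by (meson dominated_on_trans)
  have "dominated_on D (\<lambda>(f, t). high k s b q (smooth f t) t)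
   (\<lambda>(f, t). high k s b q f t + high k s b q (\<lambda>x. f x - smooth f t x) t)"
   unfolding case_prod_beta'
   by (rule log_integral_modulus_add[where f = fst and a = snd and c = "\<lambda>_. 1" and h = "\<lambda>z. smooth (fst z) (snd z)"
      and g = "\<lambda>z x. fst z x - smooth (fst z) (snd z) x", OF q m])
  moreover have "dominated_on D (\<lambda>(f, t). high k s b q f t + high k s b q (\<lambda>x. f x - smooth f t x) t) ?J"
   using dominated_on_add[OF J(3) dominated_on_trans[OF high_diff J(2)]] by (simp add: case_prod_beta')
  ultimately show "dominated_on D (\<lambda>(f, t). high k s b q (smooth f t) t) ?J"
   by (rule dominated_on_trans)
 qed
qed

end

text \<open>1 - (ln t)/k lies between (1 - ln t)/k and 1 - ln t, so passing to t^(1/k) changes the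
  logarithmic factor only by a constant.\<close>

lemma root_power_compare:
 fixes e :: real
 assumes "1 \<le> k"
 obtains c where "c > 0"
  "\<And>t. 0 < t ==> t < 1 ==> (1 - ln (t powr (1 / real k))) powr e \<le> c * (1 - ln t) powr e"
  "\<And>t. 0 < t ==> t < 1 ==> (1 - ln t) powr e \<le> c * (1 - ln (t powr (1 / real k))) powr e"
proof -
 define c where "c = real k powr \<bar>e\<bar>"
 have c: "c \<ge> 1" using assms by (simp add: c_def ge_one_powr_ge_zero)
 have cmp: "y powr e \<le> c * x powr e" "x powr e \<le> c * y powr e"
  if "0 < y" "y \<le> x" "x \<le> real k * y" for x y
 proof -
  have k: "(real k * y) powr e = real k powr e * y powr e" by (rule powr_mult)
  show "y powr e \<le> c * x powr e"
  proof (cases "e \<ge> 0")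
   case True
   then have "y powr e \<le> 1 * x powr e" using that by (auto intro!: powr_mono2)
   also have "... \<le> c * x powr e" using c by (intro mult_right_mono) auto
   finally show ?thesis .
  next
   case False
   have "(real k * y) powr e \<le> x powr e" using that False by (intro powr_mono2') auto
   then have "c * (real k powr e * y powr e) \<le> c * x powr e" using c k by (intro mult_left_mono) auto
   moreover have "c * real k powr e = 1" using False assms by (simp add: c_def flip: powr_add)
   ultimately show ?thesis by (simp add: mult.assoc[symmetric])
  qed
  show "x powr e \<le> c * y powr e"
  proof (cases "e \<ge> 0")
   case True
   have "x powr e \<le> (real k * y) powr e" using that True by (intro powr_mono2) auto
   then show ?thesis using True k by (simp add: c_def)
  next
   case False
   have "x powr e \<le> 1 * y powr e" using that False by (auto intro!: powr_mono2')
   also have "... \<le> c * y powr e" using c by (intro mult_right_mono) auto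
   finally show ?thesis .
  qed
 qed
 show thesis
 proof (rule that[of c])
  fix t :: real assume t: "0 < t" "t < 1"
  have l: "ln (t powr (1 / real k)) = ln t / real k" using t by (simp add: ln_powr)
  have "ln t < 0" using t by simp
  then have "ln t \<le> ln t / real k" "ln t / real k < 0" using assms by (auto simp: field_simps divide_neg_pos mult_le_cancel_left)
  moreover have "1 - ln t \<le> real k * (1 - ln t / real k)" using assms by (simp add: right_diff_distrib)
  ultimately show "(1 - ln (t powr (1 / real k))) powr e \<le> c * (1 - ln t) powr e"
   "(1 - ln t) powr e \<le> c * (1 - ln (t powr (1 / real k))) powr e"
   unfolding l by (intro cmp; simp)+
 qed (use c in auto)
qed

section \<open>K-functionals of the couples, before absorption of the modulus\<close>

context smoothing_norm
begin

lemma log_integral_add_modulus: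
 assumes "0 < q"
 shows "dominated_on X (\<lambda>(f, g, t). log_integral s b q (a t) (c t) (modulus L k (\<lambda>x. f x + g x)))
   (\<lambda>(f, g, t). log_integral s b q (a t) (c t) (modulus L k f) + log_integral s b q (a t) (c t) (modulus L k g))"
 using log_integral_modulus_add[OF assms modulus_add, where f = fst and g = "\<lambda>x. fst (snd x)" and a = "\<lambda>x. a (snd (snd x))" and c = "\<lambda>x. c (snd (snd x))"]
 by (simp add: case_prod_beta')

lemma low_le_besov: "0 < q ==> t \<le> 1 ==> low k s b q f t \<le> besov L k s b q f"
 unfolding besov_def by (intro add_increasing log_integral_mono_interval) auto

lemma high_le_besov: "0 < q ==> 0 \<le> t ==> high k s b q f t \<le> besov L k s b q f"
 unfolding besov_def by (intro add_increasing log_integral_mono_interval) auto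

lemma norm_le_besov: "L f \<le> besov L k s b q f"
 unfolding besov_def by simp

text \<open>L_p has growth function 1 and a norm without a part over (0, t), hence
  \<open>R\<^sub>0\<close> is 1 and \<open>n\<^sub>0\<close> is 0. In this and the next two such
  proofs the case numbers follow the hypotheses of \<open>K_functional_equivalent\<close>: 5 and 6
  are subadditivity, 7 the splitting, 8 the ratio, 9 to 12 the norm and the modulus, 13 to 16 the
  integrals.\<close>

lemma K_norm_besov:
 assumes adm: "admissible k s b q"
 shows "equivalent_on L (\<lambda>f t. K_functional (1 / characteristic k s b q t) f L (besov L k s b q))
  (\<lambda>f t. ennreal (1 / characteristic k s b q t) * L f + ennreal 1 * modulus L k f t + 0
    + ennreal (1 / characteristic k s b q t) * high k s b q f t)"
proof (rule K_functional_equivalent[where R\<^sub>0="\<lambda>_. 1" and R\<^sub>1="characteristic k s b q" and n\<^sub>0="\<lambda>_ _. 0"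
   and n\<^sub>1="\<lambda>f t. high k s b q f t" and \<omega>="modulus L k"], goal_cases)
 have q: "0 < q" using adm by (simp add: admissible_def)
 let ?R = "characteristic k s b q"
 case 7
 show ?case
  by (intro exI[of _ smooth] conjI besov_smooth[OF adm] dominated_on_trans[OF smooth_approx dominated_on_le]) auto
 obtain c where c: "c > 0" "\<And>t. 0 < t ==> t < 1 ==> 1 \<le> c * ?R t" by (rule characteristic_lower[OF adm]) (rule that)
 case 8
 show ?case
  using c characteristic_pos by (auto intro!: exI[of _ c] simp: pos_divide_le_eq)
 case 6
 show ?case
  by (rule log_integral_add_modulus[OF q])
 case 11
 show ?case
  by (rule dominated_onI[of "2 ^ k"]) (auto simp: modulus_le_norm)
 case 12
 show ?case
  by (rule characteristic_modulus_le_besov[OF adm])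
 obtain C where C: "C > 0" "\<And>t. 0 < t ==> t < 1 ==> log_integral (- s) b q t 1 (\<lambda>u. 1) \<le> ennreal (C * ?R t)"
  by (rule weight_const_high[OF adm]) (rule that)
 case 15
 show ?case
 proof (rule dominated_on_belowI[of "2 ^ k * C"])
  fix f t assume f: "L f < \<infinity>" and t: "0 < t" "t < (1::real)"
  have fin: "ennreal (2 ^ k) * L f < \<infinity>" using f by (simp add: ennreal_mult_less_top)
  have "high k s b q f t \<le> log_integral (- s) b q t 1 (\<lambda>u. ennreal (2 ^ k) * L f)"
   by (intro log_integral_mono q modulus_le_norm)
  also have "... = ennreal (2 ^ k) * L f * log_integral (- s) b q t 1 (\<lambda>u. 1)"
   by (rule log_integral_const_le[OF q fin, symmetric])
  also have "... \<le> ennreal (2 ^ k) * L f * ennreal (C * ?R t)" by (intro mult_left_mono C t) simp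
  finally have "ennreal (1 / ?R t) * high k s b q f t \<le> ennreal (1 / ?R t) * (ennreal (2 ^ k) * L f * ennreal (C * ?R t))"
   by (rule mult_left_mono) simp
  also have "... = (ennreal (1 / ?R t) * ennreal (C * ?R t)) * (ennreal (2 ^ k) * L f)" by (simp only: mult_ac)
  also have "ennreal (1 / ?R t) * ennreal (C * ?R t) = ennreal C"
   using characteristic_pos[OF t, of k s b q] C(1) by (subst ennreal_mult[symmetric]) auto
  finally show "ennreal (1 / ?R t) * high k s b q f t \<le> ennreal (2 ^ k * C) * L f"
   using C(1) by (simp add: ennreal_mult mult_ac)
 qed (use C in simp)
 case 16
 show ?case
  by (rule dominated_on_le) (auto intro: high_le_besov q)
qed (auto intro!: dominated_on_le L_add modulus_add norm_le_besov characteristic_pos)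

text \<open>W^k has growth function t^(-k) and contributes no integral over (t, 1), hence
  \<open>n\<^sub>1\<close> is 0. The parameter is bounded by
  \<open>characteristic_upper\<close>.\<close>

lemma K_besov_sobolev:
 assumes adm: "admissible k s b q"
 shows "equivalent_on (besov L k s b q)
  (\<lambda>f t. K_functional (characteristic k s b q t / t powr (- real k)) f (besov L k s b q) (sobolev L k))
  (\<lambda>f t. ennreal (characteristic k s b q t / t powr (- real k)) * L f + ennreal (characteristic k s b q t) * modulus L k f t
    + low k s b q f t + ennreal (characteristic k s b q t / t powr (- real k)) * 0)"
proof (rule K_functional_equivalent[where R\<^sub>0="characteristic k s b q" and R\<^sub>1="\<lambda>t. t powr (- real k)" and n\<^sub>1="\<lambda>_ _. 0"
   and n\<^sub>0="\<lambda>f t. low k s b q f t" and \<omega>="modulus L k"], goal_cases)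
 have q: "0 < q" using adm by (simp add: admissible_def)
 let ?R = "characteristic k s b q"
 have div: "?R t / t powr (- real k) = t powr real k * ?R t" for t
  by (simp add: powr_minus divide_inverse)
 case 7
 show ?case
  unfolding div using besov_diff_smooth[OF adm] smooth_sobolev by (intro exI[of _ smooth] conjI) auto
 obtain c where c: "c > 0" "\<And>t. 0 < t ==> t < 1 ==> t powr real k * ?R t \<le> c" by (rule characteristic_upper[OF adm]) (rule that)
 case 8
 show ?case
  unfolding div using c by auto
 case 5
 show ?case
  by (rule log_integral_add_modulus[OF q])
 case 10
 show ?case
  using dominated_on_reindex[OF norm_le_sobolev, of _ fst] by (auto simp: case_prod_beta')
 case 12
 show ?case
  by (rule modulus_le_sobolev)
 case 11
 show ?case
  by (rule characteristic_modulus_le_besov[OF adm])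
 case 13
 show ?case
  by (rule dominated_on_le) (auto intro: low_le_besov q)
 obtain C where C: "C > 0" "\<And>t. 0 < t ==> t < 1 ==> log_integral (- s) b q 0 t (\<lambda>u. ennreal (u powr real k)) \<le> ennreal (C * (t powr real k * ?R t))"
  by (rule weight_power_low[OF adm]) (rule that)
 obtain M where M: "M > 0" "\<And>f t. sobolev L k f < \<infinity> ==> 0 < t ==> t < 1 ==> ennreal (t powr (- real k)) * modulus L k f t \<le> ennreal M * sobolev L k f"
  using modulus_le_sobolev unfolding dominated_on_def by auto
 case 14
 show ?case
 proof (rule dominated_on_belowI[of "M * C"])
  fix f t assume f: "sobolev L k f < \<infinity>" and t: "0 < t" "t < (1::real)"
  have m: "modulus L k f u \<le> ennreal M * sobolev L k f * ennreal (u powr real k)" if u: "0 < u" "u < 1" for u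
  proof -
   have "ennreal (u powr real k) * (ennreal (u powr (- real k)) * modulus L k f u) \<le> ennreal (u powr real k) * (ennreal M * sobolev L k f)"
    by (intro mult_left_mono M f u) simp
   moreover have "ennreal (u powr real k) * (ennreal (u powr (- real k)) * modulus L k f u) = modulus L k f u"
    using u by (simp add: mult.assoc[symmetric] ennreal_mult'[symmetric] flip: powr_add)
   ultimately show ?thesis by (simp add: mult_ac)
  qed
  have fin: "ennreal M * sobolev L k f < \<infinity>" using f by (simp add: ennreal_mult_less_top)
  have "low k s b q f t \<le> log_integral (- s) b q 0 t (\<lambda>u. ennreal M * sobolev L k f * ennreal (u powr real k))"
   using t by (intro log_integral_mono q m) auto
  also have "... = ennreal M * sobolev L k f * log_integral (- s) b q 0 t (\<lambda>u. ennreal (u powr real k))"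
   using q fin by (intro log_integral_cmult) auto
  also have "... \<le> ennreal M * sobolev L k f * ennreal (C * (t powr real k * ?R t))" by (intro mult_left_mono C t) simp
  also have "... = ennreal (M * C) * (ennreal (?R t / t powr (- real k)) * sobolev L k f)"
   unfolding div using M(1) C(1) characteristic_pos[OF t, of k s b q] by (simp add: ennreal_mult mult_ac)
  finally show "low k s b q f t \<le> ennreal (M * C) * (ennreal (?R t / t powr (- real k)) * sobolev L k f)" .
 qed (use M C in simp)
qed (auto intro!: dominated_on_le L_add modulus_add norm_le_besov characteristic_pos dest: besov_finite_norm[unfolded infinity_ennreal_def])

text \<open>Turns a pointwise bound for w into a norm bound with the quotient of two weights. In
  \<open>K_besov_lip\<close> this estimates the B^0 part over (0, t) by the Lip norm and the Lip
  part over (t, 1) by the B^0 norm.\<close>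

lemma weight_cross:
 assumes \<omega>: "\<And>u. 0 < u ==> u < 1 ==> ennreal (weight \<sigma> \<beta> u) * w u \<le> x"
  and q: "0 < q" and x: "x < \<infinity>" and a: "0 \<le> a" "c \<le> 1"
 shows "log_integral s b q a c w \<le> x * log_integral (s - \<sigma>) (b - \<beta>) q a c (\<lambda>u. 1)"
proof -
 have "log_integral s b q a c w \<le> log_integral (s - \<sigma>) (b - \<beta>) q a c (\<lambda>u. x)"
 proof (rule log_integral_weight_mono[OF q])
  fix u assume "a < u" "u < c"
  then have u: "0 < u" "u < 1" using a by auto
  have 1: "u powr s = u powr (s - \<sigma>) * u powr \<sigma>" "(1 - ln u) powr b = (1 - ln u) powr (b - \<beta>) * (1 - ln u) powr \<beta>"
   unfolding powr_add[symmetric] by simp_all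
  have "ennreal (weight s b u) * w u
    = ennreal (weight (s - \<sigma>) (b - \<beta>) u) * (ennreal (weight \<sigma> \<beta> u) * w u)"
   unfolding 1 by (simp add: ennreal_mult mult_ac)
  also have "... \<le> ennreal (weight (s - \<sigma>) (b - \<beta>) u) * x"
   using u by (intro mult_left_mono \<omega>) auto
  finally show "ennreal (weight s b u) * w u \<le> ennreal (weight (s - \<sigma>) (b - \<beta>) u) * x" .
 qed
 then show ?thesis using log_integral_const_le[OF q x] by simp
qed

lemma K_besov_lip:
 assumes adm0: "admissible k 0 b q" and adm1: "admissible k (real k) \<beta> r"
 shows "equivalent_on (besov L k 0 b q)
  (\<lambda>f t. K_functional (characteristic k 0 b q t / characteristic k (real k) \<beta> r t) f (besov L k 0 b q) (besov L k (real k) \<beta> r))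
  (\<lambda>f t. ennreal (characteristic k 0 b q t / characteristic k (real k) \<beta> r t) * L f + ennreal (characteristic k 0 b q t) * modulus L k f t
    + low k 0 b q f t
    + ennreal (characteristic k 0 b q t / characteristic k (real k) \<beta> r t) * log_integral (- real k) \<beta> r t 1 (modulus L k f))"
proof (rule K_functional_equivalent[where R\<^sub>0="characteristic k 0 b q" and R\<^sub>1="characteristic k (real k) \<beta> r"
   and n\<^sub>1="\<lambda>f t. log_integral (- real k) \<beta> r t 1 (modulus L k f)"
   and n\<^sub>0="\<lambda>f t. low k 0 b q f t" and \<omega>="modulus L k"], goal_cases)
 have q: "0 < q" and r: "0 < r" using adm0 adm1 by (simp_all add: admissible_def)
 let ?R0 = "characteristic k 0 b q" and ?R1 = "characteristic k (real k) \<beta> r"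
 have R0: "?R0 t = (1 - ln t) powr (b + recip q)" if "0 < t" for t using that by (simp add: characteristic_def)
 have R1: "?R1 t = weight (- real k) (\<beta> + recip r) t" for t by (simp add: characteristic_def)
 have ratio: "?R0 t / ?R1 t = t powr real k * (1 - ln t) powr (b + recip q - \<beta> - recip r)" if t: "0 < t" "t < 1" for t
 proof -
  have "(1 - ln t) powr (b + recip q - \<beta> - recip r) = (1 - ln t) powr ((b + recip q) - (\<beta> + recip r))" by (simp add: algebra_simps)
  also have "... = (1 - ln t) powr (b + recip q) / (1 - ln t) powr (\<beta> + recip r)" by (rule powr_diff)
  finally show ?thesis using t by (simp add: R0 R1 powr_minus field_simps)
 qed
 obtain c0 where c0: "c0 > 0" "\<And>t. 0 < t ==> t < 1 ==> t powr real k * ?R0 t \<le> c0" by (rule characteristic_upper[OF adm0]) (rule that)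
 obtain c1 where c1: "c1 > 0" "\<And>t. 0 < t ==> t < 1 ==> t powr real k * ?R1 t \<le> c1" by (rule characteristic_upper[OF adm1]) (rule that)
 have up: "dominated_on D (\<lambda>(f, t). ennreal (t powr real k * ?R0 t) * L f) (\<lambda>(f, t). ennreal (?R0 t / ?R1 t) * L f)"
 proof (rule dominated_on_belowI[OF c1(1)])
  fix f t assume t: "0 < t" "t < (1::real)"
  have p: "0 < ?R0 t" "0 < ?R1 t" using characteristic_pos[OF t] by auto
  have "t powr real k * ?R0 t = (t powr real k * ?R1 t) * (?R0 t / ?R1 t)" using p by simp
  also have "... \<le> c1 * (?R0 t / ?R1 t)" using p by (intro mult_right_mono c1 t) auto
  finally have "ennreal (t powr real k * ?R0 t) * L f \<le> ennreal (c1 * (?R0 t / ?R1 t)) * L f"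
   by (intro mult_right_mono ennreal_leI) auto
  moreover have "ennreal (c1 * (?R0 t / ?R1 t)) = ennreal c1 * ennreal (?R0 t / ?R1 t)"
   using c1(1) p by (intro ennreal_mult) auto
  ultimately show "ennreal (t powr real k * ?R0 t) * L f \<le> ennreal c1 * (ennreal (?R0 t / ?R1 t) * L f)"
   by (simp only: mult.assoc)
 qed
 have up_diff: "dominated_on D (\<lambda>(f, t). besov L k 0 b q (\<lambda>x. f x - smooth f t x)) (\<lambda>(f, t). ennreal (?R0 t) * modulus L k f t + ennreal (?R0 t / ?R1 t) * L f + low k 0 b q f t)"
 proof (rule dominated_on_trans[OF besov_diff_smooth[OF adm0]])
  let ?H = "\<lambda>(f, t). ennreal (?R0 t) * modulus L k f t + ennreal (?R0 t / ?R1 t) * L f + low k 0 b q f t"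
  have "dominated_on D (\<lambda>(f, t). ennreal (?R0 t) * modulus L k f t) ?H" by (rule dominated_on_le) (auto simp: add.assoc)
  moreover have "dominated_on D (\<lambda>(f, t). ennreal (t powr real k * ?R0 t) * L f) ?H"
   by (rule dominated_on_trans[OF up dominated_on_le]) (auto simp: add_increasing add_increasing2)
  moreover have "dominated_on D (\<lambda>(f, t). low k 0 b q f t) ?H" by (rule dominated_on_le) (auto simp: add_increasing)
  ultimately show "dominated_on D (\<lambda>(f, t). ennreal (?R0 t) * modulus L k f t + ennreal (t powr real k * ?R0 t) * L f + low k 0 b q f t) ?H"
   using dominated_on_add[OF dominated_on_add] by (fastforce simp: case_prod_beta')
 qed
 case 7
 show ?case
  using up_diff besov_smooth[OF adm1] by blast
 \<comment> \<open>R_0/R_1 is t^k times a power of 1 - ln t. Order k + 1 puts the smoothness k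
   strictly inside (0, k + 1), so \<open>characteristic\<close> acquires no extra logarithm there
   and \<open>characteristic_lower\<close> yields the bound.\<close>
 obtain d where d: "d > 0" "\<And>t. 0 < t ==> t < 1 ==> 1 \<le> d * characteristic (Suc k) (real k) (- (b + recip q - \<beta> - recip r)) 1 t"
 proof (rule characteristic_lower)
  show "admissible (Suc k) (real k) (- (b + recip q - \<beta> - recip r)) 1" using k_pos by (simp add: admissible_def)
 qed (rule that)
 case 8
 show ?case
 proof (intro exI[of _ d] allI impI)
  fix t :: real assume t: "0 < t \<and> t < 1"
  have l: "1 - ln t > 0" using ln_less_one[of t] t by auto
  have "1 \<le> d * weight (- real k) (- (b + recip q - \<beta> - recip r)) t"
   using d(2)[of t] t k_pos by (simp add: characteristic_def)
  also have "... = d / (t powr real k * (1 - ln t) powr (b + recip q - \<beta> - recip r))"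
   by (simp only: powr_minus divide_inverse inverse_mult_distrib)
  finally show "?R0 t / ?R1 t \<le> d" using t l by (simp add: ratio pos_le_divide_eq)
 qed
 case 5
 show ?case
  by (rule log_integral_add_modulus[OF q])
 case 6
 show ?case
  by (rule log_integral_add_modulus[OF r])
 note w0 = characteristic_modulus_le_besov[OF adm0] and w1 = characteristic_modulus_le_besov[OF adm1]
 case 11
 show ?case by (rule w0)
 case 12
 show ?case by (rule w1)
 case 13
 show ?case
  by (rule dominated_on_le) (auto intro: low_le_besov[OF q, of _ 0, simplified])
 case 16
 show ?case
  by (rule dominated_on_le) (auto intro: high_le_besov r)
 obtain M0 where M0: "M0 > 0" "\<And>f t. besov L k 0 b q f < \<infinity> ==> 0 < t ==> t < 1 ==> ennreal (?R0 t) * modulus L k f t \<le> ennreal M0 * besov L k 0 b q f"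
  using w0 unfolding dominated_on_def by auto
 obtain M1 where M1: "M1 > 0" "\<And>f t. besov L k (real k) \<beta> r f < \<infinity> ==> 0 < t ==> t < 1 ==> ennreal (?R1 t) * modulus L k f t \<le> ennreal M1 * besov L k (real k) \<beta> r f"
  using w1 unfolding dominated_on_def by auto
 have kp: "0 < real k" "- real k < 0" using k_pos by auto
 obtain P where P: "P > 0" "\<And>t. 0 < t ==> t \<le> 1 ==> log_integral (real k) (b - (\<beta> + recip r)) q 0 t (\<lambda>u. 1) \<le> ennreal (P * (t powr real k * (1 - ln t) powr (b - (\<beta> + recip r))))"
  by (rule log_integral_low[OF q kp(1)]) (rule that)
 obtain Q where Q: "Q > 0" "\<And>t. 0 < t ==> t < 1 ==> log_integral (- real k) (\<beta> - (b + recip q)) r t 1 (\<lambda>u. 1) \<le> ennreal (Q * weight (- real k) (\<beta> - (b + recip q)) t)"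
  by (rule log_integral_high[OF r kp(2)]) (rule that)
 case 14
 show ?case
 proof (rule dominated_on_belowI[of "M1 * P"])
  fix f t assume f: "besov L k (real k) \<beta> r f < \<infinity>" and t: "0 < t" "t < (1::real)"
  let ?x = "ennreal M1 * besov L k (real k) \<beta> r f"
  have "low k 0 b q f t \<le> ?x * log_integral (- 0 - (- real k)) (b - (\<beta> + recip r)) q 0 t (\<lambda>u. 1)"
   by (rule weight_cross) (use q f t M1(2)[OF f] in \<open>auto simp: R1 ennreal_mult_less_top\<close>)
  also have "... \<le> ?x * ennreal (P * (t powr real k * (1 - ln t) powr (b - (\<beta> + recip r))))"
   using P(2)[of t] t by (intro mult_left_mono) auto
  \<comment> \<open>The logarithmic exponent falls short of that of R_0/R_1 by 1/q, which is
    harmless since 1 - ln t \<ge> 1.\<close>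
  also have "... \<le> ?x * ennreal (P * (?R0 t / ?R1 t))"
   unfolding ratio[OF t] using P(1) t recip_nonneg[of q]
   by (intro mult_left_mono ennreal_leI powr_mono) auto
  also have "... = ennreal (M1 * P) * (ennreal (?R0 t / ?R1 t) * besov L k (real k) \<beta> r f)"
   using M1(1) P(1) characteristic_pos[OF t] by (simp add: ennreal_mult less_imp_le mult_ac del: times_divide_eq_right)
  finally show "low k 0 b q f t \<le> ennreal (M1 * P) * (ennreal (?R0 t / ?R1 t) * besov L k (real k) \<beta> r f)" .
 qed (use M1 P in simp)
 case 15
 show ?case
 proof (rule dominated_on_belowI[of "M0 * Q"])
  fix f t assume f: "besov L k 0 b q f < \<infinity>" and t: "0 < t" "t < (1::real)"
  let ?x = "ennreal M0 * besov L k 0 b q f"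
  have l: "1 - ln t > 0" using ln_less_one[of t] t by auto
  have p: "0 < ?R0 t" "0 < ?R1 t" using characteristic_pos[OF t] by auto
  have "log_integral (- real k) \<beta> r t 1 (modulus L k f) \<le> ?x * log_integral (- real k - 0) (\<beta> - (b + recip q)) r t 1 (\<lambda>u. 1)"
   by (rule weight_cross) (use r f t M0(2)[OF f] in \<open>auto simp: R0 ennreal_mult_less_top\<close>)
  also have "... \<le> ?x * ennreal (Q * weight (- real k) (\<beta> - (b + recip q)) t)"
   using Q(2)[of t] t by (intro mult_left_mono) auto
  also have "... \<le> ?x * ennreal (Q * (?R1 t / ?R0 t))"
  proof (intro mult_left_mono ennreal_leI)
   have "(1 - ln t) powr (\<beta> - (b + recip q)) \<le> (1 - ln t) powr (\<beta> + recip r - (b + recip q))"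
    using t recip_nonneg[of r] by (intro powr_mono) auto
   also have "... = (1 - ln t) powr (\<beta> + recip r) / (1 - ln t) powr (b + recip q)" by (rule powr_diff)
   finally have "weight (- real k) (\<beta> - (b + recip q)) t \<le> t powr (- real k) * ((1 - ln t) powr (\<beta> + recip r) / (1 - ln t) powr (b + recip q))"
    by (rule mult_left_mono) simp
   then show "weight (- real k) (\<beta> - (b + recip q)) t \<le> ?R1 t / ?R0 t" using t by (simp add: R0 R1)
  qed (use Q in auto)
  finally have "ennreal (?R0 t / ?R1 t) * log_integral (- real k) \<beta> r t 1 (modulus L k f) \<le> ennreal (?R0 t / ?R1 t) * (?x * ennreal (Q * (?R1 t / ?R0 t)))"
   by (rule mult_left_mono) simp
  also have "... = (ennreal (?R0 t / ?R1 t) * ennreal (Q * (?R1 t / ?R0 t))) * ?x" by (simp only: mult_ac)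
  also have "ennreal (?R0 t / ?R1 t) * ennreal (Q * (?R1 t / ?R0 t)) = ennreal Q"
   using p Q(1) by (subst ennreal_mult[symmetric]) auto
  also have "ennreal Q * ?x = ennreal (M0 * Q) * besov L k 0 b q f" using M0 Q by (simp add: ennreal_mult mult_ac)
  finally show "(ennreal (?R0 t / ?R1 t) * log_integral (- real k) \<beta> r t 1 (modulus L k f)) \<le> ennreal (M0 * Q) * (besov L k 0 b q f)" .
 qed (use M0 Q in simp)
qed (auto intro!: dominated_on_le L_add modulus_add norm_le_besov characteristic_pos dest: besov_finite_norm[unfolded infinity_ennreal_def])

end

section \<open>Change of norms and parameters, and absorption of the modulus\<close>

lemma equivalent_on_cong:
 assumes "equivalent_on A F G"
  and "\<And>f t. A f < \<infinity> ==> 0 < t ==> t < 1 ==> F f t = F' f t \<and> G f t = G' f t"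
 shows "equivalent_on A F' G'"
proof -
 obtain C where C: "C > 0" and *: "\<And>f t. A f < \<infinity> \<and> 0 < t \<and> t < 1 ==> F f t \<le> ennreal C * G f t \<and> G f t \<le> ennreal C * F f t"
  using assms(1) unfolding equivalent_on_def by blast
 have "F' f t \<le> ennreal C * G' f t \<and> G' f t \<le> ennreal C * F' f t" if "A f < \<infinity> \<and> 0 < t \<and> t < 1" for f t
  using *[OF that] assms(2)[of f t] that by simp
 then show ?thesis unfolding equivalent_on_def using C by blast
qed

text \<open>Three changes at once: equivalent norms (another order of differences), the substitution
  t \<mapsto> \<phi> t, and a parameter w t comparable to the computed one.\<close>

lemma K_functional_transfer:
 fixes G G' :: "('a => complex) => real => ennreal"
 assumes eq: "equivalent_on A (\<lambda>f t. K_functional (\<rho> t) f E\<^sub>0 E\<^sub>1) G"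
  and E0: "dominated_on UNIV E\<^sub>0 E\<^sub>0'" "dominated_on UNIV E\<^sub>0' E\<^sub>0"
  and E1: "dominated_on UNIV E\<^sub>1 E\<^sub>1'" "dominated_on UNIV E\<^sub>1' E\<^sub>1"
  and A: "\<And>f. A' f < \<infinity> ==> A f < \<infinity>"
  and \<phi>: "\<And>t. 0 < t ==> t < 1 ==> 0 < \<phi> t \<and> \<phi> t < (1::real)"
  and c: "c > 0" and cmp: "\<And>t. 0 < t ==> t < 1 ==> 0 \<le> \<rho> (\<phi> t) \<and> 0 \<le> w t \<and> \<rho> (\<phi> t) \<le> c * w t \<and> w t \<le> c * \<rho> (\<phi> t)"
  and G: "dominated_on (below A') (\<lambda>(f, t). G f (\<phi> t)) (\<lambda>(f, t). G' f t)"
   "dominated_on (below A') (\<lambda>(f, t). G' f t) (\<lambda>(f, t). G f (\<phi> t))"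
 shows "equivalent_on A' (\<lambda>f t. K_functional (w t) f E\<^sub>0' E\<^sub>1') G'"
proof (rule equivalent_on_transfer[OF eq A \<phi> _ _ G])
 obtain C where C: "C > 0" "\<And>f t t'. 0 \<le> t' ==> t \<le> c * t' ==> K_functional t f E\<^sub>0 E\<^sub>1 \<le> ennreal C * K_functional t' f E\<^sub>0' E\<^sub>1'"
  by (rule K_functional_mono[OF E0(1) E1(1) c]) (rule that)
 show "dominated_on (below A') (\<lambda>(f, t). K_functional (\<rho> (\<phi> t)) f E\<^sub>0 E\<^sub>1) (\<lambda>(f, t). K_functional (w t) f E\<^sub>0' E\<^sub>1')"
  by (rule dominated_onI[OF C(1)]) (use cmp in \<open>auto intro!: C(2)\<close>)
 obtain C' where C': "C' > 0" "\<And>f t t'. 0 \<le> t' ==> t \<le> c * t' ==> K_functional t f E\<^sub>0' E\<^sub>1' \<le> ennreal C' * K_functional t' f E\<^sub>0 E\<^sub>1"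
  by (rule K_functional_mono[OF E0(2) E1(2) c]) (rule that)
 show "dominated_on (below A') (\<lambda>(f, t). K_functional (w t) f E\<^sub>0' E\<^sub>1') (\<lambda>(f, t). K_functional (\<rho> (\<phi> t)) f E\<^sub>0 E\<^sub>1)"
  by (rule dominated_onI[OF C'(1)]) (use cmp in \<open>auto intro!: C'(2)\<close>)
qed

lemma dominated_on_refl: "dominated_on X F F"
 by (rule dominated_on_le) simp

lemma dominated_on_finite: "dominated_on UNIV E E' ==> E' f < \<infinity> ==> E f < \<infinity>"
 unfolding dominated_on_def by (metis UNIV_I ennreal_less_top ennreal_mult_less_top infinity_ennreal_def le_less_trans)

context smoothing_norm
begin

text \<open>The modulus term of \<open>K_norm_besov\<close> is absorbed by the integral, which is
  possible as s \<noteq> k. The map \<phi> will be t^(1/k) for 0 < s < k and the identity for s =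
  0.\<close>

lemma K_norm_besov_high:
 assumes adm: "admissible k s b q" and s: "s \<noteq> real k"
  and m: "dominated_on UNIV (besov L k s b q) (besov L m s b q)" "dominated_on UNIV (besov L m s b q) (besov L k s b q)"
  and \<phi>: "\<And>t. 0 < t ==> t < 1 ==> 0 < \<phi> t \<and> \<phi> t < (1::real)"
  and c: "c > 0" and cmp: "\<And>t. 0 < t ==> t < 1 ==> 0 \<le> w t \<and> 1 / characteristic k s b q (\<phi> t) \<le> c * w t \<and> w t \<le> c * (1 / characteristic k s b q (\<phi> t))"
 shows "equivalent_on L (\<lambda>f t. K_functional (w t) f L (besov L m s b q))
   (\<lambda>f t. ennreal (w t) * L f + ennreal (w t) * log_integral (- s) b q (\<phi> t) 1 (modulus L k f))"
proof (rule K_functional_transfer[OF K_norm_besov[OF adm] dominated_on_refl dominated_on_refl m _ \<phi> c])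
 let ?R = "characteristic k s b q"
 let ?I = "\<lambda>f t. log_integral (- s) b q (\<phi> t) 1 (modulus L k f)"
 show "0 \<le> 1 / ?R (\<phi> t) \<and> 0 \<le> w t \<and> 1 / ?R (\<phi> t) \<le> c * w t \<and> w t \<le> c * (1 / ?R (\<phi> t))" if "0 < t" "t < 1" for t
  using cmp[OF that] characteristic_pos \<phi>[OF that] by (simp add: less_imp_le)
 obtain C where C: "C > 0" "\<And>f t. L f < \<infinity> ==> 0 < t ==> t < 1 ==>
  ennreal (?R t) * modulus L k f t \<le> ennreal C * (L f + high k s b q f t)"
  by (rule high_absorbs[OF adm s]) (rule that)
 show "dominated_on D (\<lambda>(f, t). ennreal (1 / ?R (\<phi> t)) * L f + ennreal 1 * modulus L k f (\<phi> t) + 0 + ennreal (1 / ?R (\<phi> t)) * ?I f t)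
   (\<lambda>(f, t). ennreal (w t) * L f + ennreal (w t) * ?I f t)"
 proof (rule dominated_on_belowI[of "(1 + C) * c"])
  fix f t assume f: "L f < \<infinity>" and t: "0 < t" "t < (1::real)"
  let ?\<rho> = "1 / ?R (\<phi> t)"
  have R: "?R (\<phi> t) > 0" using characteristic_pos \<phi>[OF t] by simp
  have "modulus L k f (\<phi> t) = ennreal ?\<rho> * (ennreal (?R (\<phi> t)) * modulus L k f (\<phi> t))"
   using R by (simp add: mult.assoc[symmetric] ennreal_mult'[symmetric])
  also have "... \<le> ennreal ?\<rho> * (ennreal C * (L f + ?I f t))"
   using \<phi>[OF t] by (intro mult_left_mono C f) auto
  finally have "ennreal ?\<rho> * L f + ennreal 1 * modulus L k f (\<phi> t) + 0 + ennreal ?\<rho> * ?I f t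
   \<le> ennreal ?\<rho> * L f + ennreal ?\<rho> * (ennreal C * (L f + ?I f t)) + ennreal ?\<rho> * ?I f t"
   by (simp add: add_mono)
  also have "... = ennreal (1 + C) * (ennreal ?\<rho> * (L f + ?I f t))"
   using C(1) by (simp add: distrib_left distrib_right add_ac mult_ac)
  also have "... \<le> ennreal (1 + C) * (ennreal (c * w t) * (L f + ?I f t))"
   using cmp[OF t] by (intro mult_left_mono mult_right_mono ennreal_leI) auto
  also have "... = ennreal ((1 + C) * c) * (ennreal (w t) * L f + ennreal (w t) * ?I f t)"
  proof -
   have e: "ennreal ((1 + C) * c) = ennreal (1 + C) * ennreal c" "ennreal (c * w t) = ennreal c * ennreal (w t)"
    by (rule ennreal_mult; use cmp[OF t] c C(1) in simp)+
   show ?thesis by (simp only: e distrib_left mult.assoc)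
  qed
  finally show "ennreal ?\<rho> * L f + ennreal 1 * modulus L k f (\<phi> t) + 0 + ennreal ?\<rho> * ?I f t
   \<le> ennreal ((1 + C) * c) * (ennreal (w t) * L f + ennreal (w t) * ?I f t)" .
 qed (use C(1) c in simp)
 show "dominated_on D (\<lambda>(f, t). ennreal (w t) * L f + ennreal (w t) * ?I f t)
   (\<lambda>(f, t). ennreal (1 / ?R (\<phi> t)) * L f + ennreal 1 * modulus L k f (\<phi> t) + 0 + ennreal (1 / ?R (\<phi> t)) * ?I f t)"
 proof (rule dominated_on_belowI[OF c])
  fix f t assume t: "0 < t" "t < (1::real)"
  let ?\<rho> = "1 / ?R (\<phi> t)"
  have R: "?R (\<phi> t) > 0" using characteristic_pos \<phi>[OF t] by simp
  have "ennreal (w t) * L f + ennreal (w t) * ?I f t \<le> ennreal (c * ?\<rho>) * L f + ennreal (c * ?\<rho>) * ?I f t"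
   using cmp[OF t] by (intro add_mono mult_right_mono ennreal_leI) auto
  also have "ennreal (c * ?\<rho>) = ennreal c * ennreal ?\<rho>" using c R by (intro ennreal_mult) auto
  also have "ennreal c * ennreal ?\<rho> * L f + ennreal c * ennreal ?\<rho> * ?I f t = ennreal c * (ennreal ?\<rho> * L f + ennreal ?\<rho> * ?I f t)"
   by (simp only: distrib_left mult.assoc)
  also have "... \<le> ennreal c * (ennreal ?\<rho> * L f + ennreal 1 * modulus L k f (\<phi> t) + 0 + ennreal ?\<rho> * ?I f t)"
   by (intro mult_left_mono add_mono) auto
  finally show "ennreal (w t) * L f + ennreal (w t) * ?I f t \<le> ennreal c * (ennreal ?\<rho> * L f + ennreal 1 * modulus L k f (\<phi> t) + 0 + ennreal ?\<rho> * ?I f t)" .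
 qed
qed

text \<open>Counterpart over (0, t), where s \<noteq> 0 allows the absorption. The map \<phi> will
  be t^(1/k) for 0 < s < k and the identity for s = k.\<close>

lemma K_besov_sobolev_low:
 assumes adm: "admissible k s b q" and s: "s \<noteq> 0"
  and m: "dominated_on UNIV (besov L k s b q) (besov L m s b q)" "dominated_on UNIV (besov L m s b q) (besov L k s b q)"
  and \<phi>: "\<And>t. 0 < t ==> t < 1 ==> 0 < \<phi> t \<and> \<phi> t < (1::real)"
  and c: "c > 0" and cmp: "\<And>t. 0 < t ==> t < 1 ==> 0 \<le> w t \<and> characteristic k s b q (\<phi> t) / \<phi> t powr (- real k) \<le> c * w t \<and>
    w t \<le> c * (characteristic k s b q (\<phi> t) / \<phi> t powr (- real k))"
 shows "equivalent_on (besov L m s b q) (\<lambda>f t. K_functional (w t) f (besov L m s b q) (sobolev L k))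
   (\<lambda>f t. ennreal (w t) * L f + log_integral (- s) b q 0 (\<phi> t) (modulus L k f))"
proof (rule K_functional_transfer[OF K_besov_sobolev[OF adm] m dominated_on_refl dominated_on_refl dominated_on_finite[OF m(1)] \<phi> c])
 let ?R = "characteristic k s b q"
 let ?I = "\<lambda>f t. log_integral (- s) b q 0 (\<phi> t) (modulus L k f)"
 let ?\<rho> = "\<lambda>t. ?R (\<phi> t) / \<phi> t powr (- real k)"
 let ?D = "(below (besov L m s b q))"
 have R: "?\<rho> t \<ge> 0" if "0 < t" "t < 1" for t using characteristic_pos[of "\<phi> t" k s b q] \<phi>[OF that] by simp
 show "0 \<le> ?\<rho> t \<and> 0 \<le> w t \<and> ?\<rho> t \<le> c * w t \<and> w t \<le> c * ?\<rho> t" if "0 < t" "t < 1" for t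
  using cmp[OF that] R[OF that] by simp
 obtain C where C: "C > 0" "\<And>f t. L f < \<infinity> ==> 0 < t ==> t < 1 ==>
  ennreal (?R t) * modulus L k f t \<le> ennreal C * low k s b q f t"
  by (rule low_absorbs[OF adm s]) (rule that)
 show "dominated_on ?D (\<lambda>(f, t). ennreal (?\<rho> t) * L f + ennreal (?R (\<phi> t)) * modulus L k f (\<phi> t) + ?I f t + ennreal (?\<rho> t) * 0)
   (\<lambda>(f, t). ennreal (w t) * L f + ?I f t)"
 proof (rule dominated_on_belowI[of "c + (1 + C)"])
  fix f t assume "besov L m s b q f < \<infinity>" and t: "0 < t" "t < (1::real)"
  then have f: "L f < \<infinity>" using besov_finite_norm by auto
  have "ennreal (?\<rho> t) * L f + ennreal (?R (\<phi> t)) * modulus L k f (\<phi> t) + ?I f t + ennreal (?\<rho> t) * 0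
   \<le> ennreal (c * w t) * L f + ennreal C * ?I f t + ?I f t + 0"
   using cmp[OF t] \<phi>[OF t] by (intro add_mono mult_right_mono ennreal_leI C f) auto
  also have "... = ennreal c * (ennreal (w t) * L f) + ennreal (1 + C) * ?I f t"
   using c C(1) cmp[OF t] by (simp add: ennreal_mult distrib_right mult.assoc add_ac)
  also have "... \<le> ennreal (c + (1 + C)) * (ennreal (w t) * L f) + ennreal (c + (1 + C)) * ?I f t"
   using c C(1) by (rule_tac add_mono; intro mult_right_mono ennreal_leI) auto
  finally show "ennreal (?\<rho> t) * L f + ennreal (?R (\<phi> t)) * modulus L k f (\<phi> t) + ?I f t + ennreal (?\<rho> t) * 0
   \<le> ennreal (c + (1 + C)) * (ennreal (w t) * L f + ?I f t)" by (simp only: distrib_left)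
 qed (use c C(1) in simp)
 show "dominated_on ?D (\<lambda>(f, t). ennreal (w t) * L f + ?I f t)
   (\<lambda>(f, t). ennreal (?\<rho> t) * L f + ennreal (?R (\<phi> t)) * modulus L k f (\<phi> t) + ?I f t + ennreal (?\<rho> t) * 0)"
 proof (rule dominated_on_belowI[of "1 + c"])
  fix f t assume t: "0 < t" "t < (1::real)"
  have "ennreal (w t) * L f + ?I f t \<le> ennreal (c * ?\<rho> t) * L f + ?I f t"
   using cmp[OF t] by (intro add_mono mult_right_mono ennreal_leI) auto
  also have "ennreal (c * ?\<rho> t) = ennreal c * ennreal (?\<rho> t)" using c R[OF t] by (intro ennreal_mult) auto
  also have "ennreal c * ennreal (?\<rho> t) * L f + ?I f t \<le> ennreal (1 + c) * (ennreal (?\<rho> t) * L f) + ennreal (1 + c) * ?I f t"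
  proof (rule add_mono)
   show "ennreal c * ennreal (?\<rho> t) * L f \<le> ennreal (1 + c) * (ennreal (?\<rho> t) * L f)"
    unfolding mult.assoc using c by (intro mult_right_mono ennreal_leI) auto
   have "1 * ?I f t \<le> ennreal (1 + c) * ?I f t" using c by (intro mult_right_mono) (auto simp: ennreal_ge_1)
   then show "?I f t \<le> ennreal (1 + c) * ?I f t" by simp
  qed
  also have "... = ennreal (1 + c) * (ennreal (?\<rho> t) * L f + 0 + ?I f t + 0)" by (simp add: distrib_left)
  also have "... \<le> ennreal (1 + c) * (ennreal (?\<rho> t) * L f + ennreal (?R (\<phi> t)) * modulus L k f (\<phi> t) + ?I f t + ennreal (?\<rho> t) * 0)"
   by (intro mult_left_mono add_mono) auto
  finally show "ennreal (w t) * L f + ?I f t \<le> ennreal (1 + c) * (ennreal (?\<rho> t) * L f + ennreal (?R (\<phi> t)) * modulus L k f (\<phi> t) + ?I f t + ennreal (?\<rho> t) * 0)" .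
 qed (use c in simp)
qed

lemma root_in_unit: "0 < t ==> t < 1 ==> 0 < t powr (1 / real k) \<and> t powr (1 / real k) < 1"
 using k_pos powr_less_mono2[of "1 / real k" t 1] by auto

end

section \<open>Test functions\<close>

abbreviation (input) unit_mean :: "(real => 'b::{banach,second_countable_topology}) => 'b" where
 "unit_mean F \<equiv> \<integral>u. indicator {0..1} u *\<^sub>R F u \<partial>lborel"

abbreviation (input) pairing :: "('a::euclidean_space => real) => ('a => 'b::{banach,second_countable_topology}) => 'b" where
 "pairing \<phi> f \<equiv> \<integral>x. \<phi> x *\<^sub>R f x \<partial>lborel"

lemma partials_append: "partials (bs @ cs) \<phi> = partials bs (partials cs \<phi>)"
 by (simp add: partials_def)

lemma partials_Nil [simp]: "partials [] \<phi> = \<phi>"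
 by (simp add: partials_def)

lemma partials_Cons: "partials (b # bs) \<phi> = (\<lambda>x. frechet_derivative (partials bs \<phi>) (at x) b)"
 by (simp add: partials_def)

lemma test_function_differentiable: "\<phi> \<in> test_functions ==> \<phi> differentiable (at x)"
 unfolding test_functions_def by (auto dest!: spec[of _ "[]"])

lemma test_function_continuous: "\<phi> \<in> test_functions ==> continuous_on A \<phi>"
 by (meson continuous_at_imp_continuous_on differentiable_imp_continuous_within test_function_differentiable)

lemma test_function_measurable: "\<phi> \<in> test_functions ==> \<phi> \<in> borel_measurable borel"
 by (intro borel_measurable_continuous_onI test_function_continuous)

lemma test_function_partials:
 assumes \<phi>: "\<phi> \<in> test_functions" and bs: "set bs \<subseteq> Basis"
 shows "partials bs \<phi> \<in> test_functions"
proof -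
 have supp: "closure {x. partials bs \<phi> x \<noteq> 0} \<subseteq> closure {x. \<phi> x \<noteq> 0}"
  using bs
 proof (induction bs)
  case (Cons b bs)
  let ?\<psi> = "partials bs \<phi>"
  have "partials (b # bs) \<phi> x = 0" if "x \<notin> closure {x. ?\<psi> x \<noteq> 0}" for x
  proof -
   have d: "?\<psi> differentiable (at x)" using \<phi> Cons by (auto simp: test_functions_def)
   have "frechet_derivative ?\<psi> (at x) = frechet_derivative (\<lambda>x. 0) (at x)"
    by (rule frechet_derivative_transform_within_open[OF d, of "- closure {x. ?\<psi> x \<noteq> 0}"])
      (use that closure_subset[of "{x. ?\<psi> x \<noteq> 0}"] in \<open>auto simp: open_Compl\<close>)
   then show ?thesis by (simp add: partials_Cons)
  qed
  then have "{x. partials (b # bs) \<phi> x \<noteq> 0} \<subseteq> closure {x. ?\<psi> x \<noteq> 0}" by blast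
  then have "closure {x. partials (b # bs) \<phi> x \<noteq> 0} \<subseteq> closure {x. ?\<psi> x \<noteq> 0}"
   by (simp add: closure_minimal)
  then show ?case using Cons by auto
 qed simp
 have "compact (closure {x. partials bs \<phi> x \<noteq> 0})"
 proof -
  have "compact (closure {x. partials bs \<phi> x \<noteq> 0} \<inter> closure {x. \<phi> x \<noteq> 0})"
   using \<phi> by (intro closed_Int_compact) (auto simp: test_functions_def)
  then show ?thesis using supp by (simp add: inf.absorb1)
 qed
 then show ?thesis
  using \<phi> bs unfolding test_functions_def by (auto simp flip: partials_append)
qed

lemma test_function_bounded_support:
 assumes "\<phi> \<in> test_functions"
 obtains R where "R > 0" "\<And>x. \<phi> x \<noteq> 0 ==> norm x \<le> R"
proof -
 have "bounded (closure {x. \<phi> x \<noteq> 0})" using assms by (auto simp: test_functions_def compact_imp_bounded)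
 then obtain R where R: "R > 0" "\<And>x. x \<in> closure {x. \<phi> x \<noteq> 0} ==> norm x \<le> R" by (auto simp: bounded_pos)
 then show thesis using closure_subset[of "{x. \<phi> x \<noteq> 0}"] by (intro that[of R]) auto
qed

lemma test_function_bounded:
 assumes "\<phi> \<in> test_functions"
 obtains B where "B > 0" "\<And>x. \<bar>\<phi> x\<bar> \<le> B"
proof -
 have "compact (\<phi> ` closure {x. \<phi> x \<noteq> 0})"
  using assms by (intro compact_continuous_image test_function_continuous) (auto simp: test_functions_def)
 then obtain B where B: "B > 0" "\<And>y. y \<in> \<phi> ` closure {x. \<phi> x \<noteq> 0} ==> norm y \<le> B"
  by (metis bounded_pos compact_imp_bounded)
 have "\<bar>\<phi> x\<bar> \<le> B" for x
 proof (cases "\<phi> x = 0")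
  case False
  then have "x \<in> closure {x. \<phi> x \<noteq> 0}" using closure_subset[of "{x. \<phi> x \<noteq> 0}"] by auto
  then show ?thesis using B(2)[of "\<phi> x"] by auto
 qed (use B in auto)
 then show thesis using B by (intro that[of B]) auto
qed

lemma frechet_derivative_shift:
 fixes \<phi> :: "'a::real_normed_vector => real"
 assumes "\<And>x. \<phi> differentiable (at x)"
 shows "(\<lambda>x. \<phi> (x + a)) differentiable (at x)" "frechet_derivative (\<lambda>x. \<phi> (x + a)) (at x) = frechet_derivative \<phi> (at (x + a))"
proof -
 have "(\<phi> has_derivative frechet_derivative \<phi> (at (x + a))) (at (x + a))"
  using assms frechet_derivative_works by blast
 then have d: "((\<lambda>x. \<phi> (x + a)) has_derivative frechet_derivative \<phi> (at (x + a))) (at x)"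
  by (auto intro!: derivative_eq_intros has_derivative_compose[of "\<lambda>x. x + a" "\<lambda>x. x" x UNIV \<phi> "frechet_derivative \<phi> (at (x + a))"])
 then show "(\<lambda>x. \<phi> (x + a)) differentiable (at x)" by (auto simp: differentiable_def)
 show "frechet_derivative (\<lambda>x. \<phi> (x + a)) (at x) = frechet_derivative \<phi> (at (x + a))"
  using frechet_derivative_at[OF d] by simp
qed

lemma partials_shift:
 assumes \<phi>: "\<phi> \<in> test_functions" and bs: "set bs \<subseteq> Basis"
 shows "partials bs (\<lambda>x. \<phi> (x + a)) = (\<lambda>x. partials bs \<phi> (x + a))"
 using bs
proof (induction bs)
 case (Cons b bs)
 then show ?case using test_function_differentiable[OF test_function_partials[OF \<phi>, of bs]]
  by (simp add: partials_Cons frechet_derivative_shift)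
qed simp

lemma test_function_shift:
 assumes \<phi>: "\<phi> \<in> test_functions"
 shows "(\<lambda>x. \<phi> (x + a)) \<in> test_functions"
proof -
 have "partials bs (\<lambda>x. \<phi> (x + a)) differentiable at x" if "set bs \<subseteq> Basis" for bs x
  unfolding partials_shift[OF \<phi> that]
  by (rule frechet_derivative_shift) (rule test_function_differentiable[OF test_function_partials[OF \<phi> that]])
 moreover have "compact (closure {x. \<phi> (x + a) \<noteq> 0})"
 proof -
  have "{x. \<phi> (x + a) \<noteq> 0} = (\<lambda>x. - a + x) ` {x. \<phi> x \<noteq> 0}"
   by (auto simp: image_iff intro!: exI[of _ "_ + a"])
  then have "closure {x. \<phi> (x + a) \<noteq> 0} = (\<lambda>x. - a + x) ` closure {x. \<phi> x \<noteq> 0}"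
   by (simp add: closure_translation_subtract)
  then show ?thesis using \<phi> by (auto simp: test_functions_def intro!: compact_continuous_image continuous_intros)
 qed
 ultimately show ?thesis by (auto simp: test_functions_def)
qed

lemma differentiable_along_line:
 fixes \<phi> :: "'a::real_normed_vector => real"
 assumes "\<And>x. \<phi> differentiable (at x)"
 shows "((\<lambda>t. \<phi> (y + t *\<^sub>R h)) has_real_derivative frechet_derivative \<phi> (at (y + t *\<^sub>R h)) h) (at t)"
proof -
 have "((\<lambda>t. y + t *\<^sub>R h) has_vector_derivative h) (at t)"
  by (auto intro!: derivative_eq_intros)
 moreover have "(\<phi> has_derivative frechet_derivative \<phi> (at (y + t *\<^sub>R h))) (at (y + t *\<^sub>R h))"
  using assms frechet_derivative_works by blast
 ultimately show ?thesis
  using vector_derivative_diff_chain_within[of "\<lambda>t. y + t *\<^sub>R h" h t UNIV \<phi> "frechet_derivative \<phi> (at (y + t *\<^sub>R h))"]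
  by (simp add: has_real_derivative_iff_has_vector_derivative comp_def has_derivative_at_withinI)
qed

lemma frechet_derivative_Basis:
 fixes \<phi> :: "'a::euclidean_space => real"
 assumes "\<phi> differentiable (at x)"
 shows "frechet_derivative \<phi> (at x) h = (\<Sum>b\<in>Basis. (h \<bullet> b) * frechet_derivative \<phi> (at x) b)"
proof -
 have l: "linear (frechet_derivative \<phi> (at x))" using assms by (rule linear_frechet_derivative)
 have "frechet_derivative \<phi> (at x) h = frechet_derivative \<phi> (at x) (\<Sum>b\<in>Basis. (h \<bullet> b) *\<^sub>R b)"
  by (simp add: euclidean_representation)
 also have "... = (\<Sum>b\<in>Basis. (h \<bullet> b) * frechet_derivative \<phi> (at x) b)"
  by (simp add: linear_sum[OF l] linear_scale[OF l])
 finally show ?thesis .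
qed

lemma test_function_FTC:
 assumes \<phi>: "\<phi> \<in> test_functions"
 shows "\<phi> (x + h) - \<phi> x = unit_mean (\<lambda>u. \<Sum>b\<in>Basis. (h \<bullet> b) * partials [b] \<phi> (x + u *\<^sub>R h))"
proof -
 have "unit_mean (\<lambda>u. \<Sum>b\<in>Basis. (h \<bullet> b) * partials [b] \<phi> (x + u *\<^sub>R h))
   = \<phi> (x + 1 *\<^sub>R h) - \<phi> (x + 0 *\<^sub>R h)"
 proof (rule integral_FTC_Icc)
  fix u :: real assume "0 \<le> u" "u \<le> 1"
  show "((\<lambda>u. \<phi> (x + u *\<^sub>R h)) has_vector_derivative (\<Sum>b\<in>Basis. (h \<bullet> b) * partials [b] \<phi> (x + u *\<^sub>R h))) (at u within {0..1})"
   using differentiable_along_line[OF test_function_differentiable[OF \<phi>], of x h u]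
    frechet_derivative_Basis[OF test_function_differentiable[OF \<phi>], of "x + u *\<^sub>R h" h]
   by (simp add: has_real_derivative_iff_has_vector_derivative partials_Cons has_vector_derivative_at_within)
 next
  have "continuous_on UNIV (partials [b] \<phi>)" if "b \<in> Basis" for b
   using that by (intro test_function_continuous test_function_partials \<phi>) auto
  then have "continuous_on {0..1} (\<lambda>u. partials [b] \<phi> (x + u *\<^sub>R h))" if "b \<in> Basis" for b
   by (rule continuous_on_compose2) (use that in \<open>auto intro!: continuous_intros\<close>)
  then show "continuous_on {0..1} (\<lambda>u. \<Sum>b\<in>Basis. (h \<bullet> b) * partials [b] \<phi> (x + u *\<^sub>R h))"
   by (rule_tac continuous_on_sum) (rule continuous_on_mult[OF continuous_on_const])
 qed simp
 then show ?thesis by simp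
qed

text \<open>Schwarz's theorem; differentiability of all iterated partials makes the second ones
  continuous. The mixed second difference over a small square is evaluated by two applications of
  the mean value theorem in either order, and the intermediate points converge to x as the square
  shrinks.\<close>

lemma partials_swap:
 assumes \<phi>: "\<phi> \<in> test_functions" and ab: "a \<in> Basis" "b \<in> Basis"
 shows "partials [a, b] \<phi> = partials [b, a] \<phi>"
proof
 fix x
 have second_difference: "\<exists>s t. 0 < s \<and> s < \<epsilon> \<and> 0 < t \<and> t < \<epsilon> \<and>
   \<phi> (x + \<epsilon> *\<^sub>R a + \<epsilon> *\<^sub>R b) - \<phi> (x + \<epsilon> *\<^sub>R b) - (\<phi> (x + \<epsilon> *\<^sub>R a) - \<phi> x) = \<epsilon> * (\<epsilon> * partials [a, b] \<phi> (x + s *\<^sub>R a + t *\<^sub>R b))"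
  if \<epsilon>: "0 < \<epsilon>" and ab: "a \<in> Basis" "b \<in> Basis" for \<epsilon> a b
 proof -
  let ?g = "\<lambda>t. \<phi> ((x + \<epsilon> *\<^sub>R a) + t *\<^sub>R b) - \<phi> (x + t *\<^sub>R b)"
  note d = differentiable_along_line[OF test_function_differentiable[OF \<phi>]]
  have d': "((\<lambda>t. partials [b] \<phi> (y + t *\<^sub>R a)) has_real_derivative partials [a, b] \<phi> (y + t *\<^sub>R a)) (at t)" for y t
   using differentiable_along_line[OF test_function_differentiable[OF test_function_partials[OF \<phi>, of "[b]"]], of y a t] ab
   by (simp add: partials_Cons)
  have "(?g has_real_derivative partials [b] \<phi> ((x + \<epsilon> *\<^sub>R a) + t *\<^sub>R b) - partials [b] \<phi> (x + t *\<^sub>R b)) (at t)" for t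
   unfolding partials_Cons partials_Nil by (rule DERIV_diff[OF d d])
  then obtain t where t: "0 < t" "t < \<epsilon>" "?g \<epsilon> - ?g 0 = (\<epsilon> - 0) * (partials [b] \<phi> ((x + \<epsilon> *\<^sub>R a) + t *\<^sub>R b) - partials [b] \<phi> (x + t *\<^sub>R b))"
   using MVT2[OF \<epsilon>, of ?g "\<lambda>t. partials [b] \<phi> ((x + \<epsilon> *\<^sub>R a) + t *\<^sub>R b) - partials [b] \<phi> (x + t *\<^sub>R b)"] by auto
  obtain s where s: "0 < s" "s < \<epsilon>" "partials [b] \<phi> ((x + t *\<^sub>R b) + \<epsilon> *\<^sub>R a) - partials [b] \<phi> ((x + t *\<^sub>R b) + 0 *\<^sub>R a) = (\<epsilon> - 0) * partials [a, b] \<phi> ((x + t *\<^sub>R b) + s *\<^sub>R a)"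
   using MVT2[OF \<epsilon>, of "\<lambda>s. partials [b] \<phi> ((x + t *\<^sub>R b) + s *\<^sub>R a)" "\<lambda>s. partials [a, b] \<phi> ((x + t *\<^sub>R b) + s *\<^sub>R a)"] d' by auto
  have "?g \<epsilon> - ?g 0 = \<epsilon> * (\<epsilon> * partials [a, b] \<phi> (x + s *\<^sub>R a + t *\<^sub>R b))"
   using t(3) s(3) by (simp add: add_ac)
  then show ?thesis using t(1,2) s(1,2) by (intro exI[of _ s] exI[of _ t]) simp
 qed
 have "\<forall>n. \<exists>p q. norm (p - x) \<le> 2 / real (Suc n) \<and> norm (q - x) \<le> 2 / real (Suc n) \<and> partials [a, b] \<phi> p = partials [b, a] \<phi> q"
 proof
  fix n
  define \<epsilon> where "\<epsilon> = 1 / real (Suc n)"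
  have \<epsilon>: "\<epsilon> > 0" by (simp add: \<epsilon>_def)
  obtain s t where st: "0 < s" "s < \<epsilon>" "0 < t" "t < \<epsilon>"
   "\<phi> (x + \<epsilon> *\<^sub>R a + \<epsilon> *\<^sub>R b) - \<phi> (x + \<epsilon> *\<^sub>R b) - (\<phi> (x + \<epsilon> *\<^sub>R a) - \<phi> x) = \<epsilon> * (\<epsilon> * partials [a, b] \<phi> (x + s *\<^sub>R a + t *\<^sub>R b))"
   using second_difference[OF \<epsilon> ab] by blast
  obtain s' t' where st': "0 < s'" "s' < \<epsilon>" "0 < t'" "t' < \<epsilon>"
   "\<phi> (x + \<epsilon> *\<^sub>R b + \<epsilon> *\<^sub>R a) - \<phi> (x + \<epsilon> *\<^sub>R a) - (\<phi> (x + \<epsilon> *\<^sub>R b) - \<phi> x) = \<epsilon> * (\<epsilon> * partials [b, a] \<phi> (x + s' *\<^sub>R b + t' *\<^sub>R a))"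
   using second_difference[OF \<epsilon> ab(2) ab(1)] by blast
  have "\<epsilon> * (\<epsilon> * partials [a, b] \<phi> (x + s *\<^sub>R a + t *\<^sub>R b)) = \<epsilon> * (\<epsilon> * partials [b, a] \<phi> (x + s' *\<^sub>R b + t' *\<^sub>R a))"
   unfolding st(5)[symmetric] st'(5)[symmetric] by (simp add: add_ac)
  then have eq: "partials [a, b] \<phi> (x + s *\<^sub>R a + t *\<^sub>R b) = partials [b, a] \<phi> (x + s' *\<^sub>R b + t' *\<^sub>R a)"
   using \<epsilon> by simp
  have "norm (x + s *\<^sub>R a + t *\<^sub>R b - x) \<le> 2 * \<epsilon>" "norm (x + s' *\<^sub>R b + t' *\<^sub>R a - x) \<le> 2 * \<epsilon>"
   using norm_triangle_ineq[of "s *\<^sub>R a" "t *\<^sub>R b"] norm_triangle_ineq[of "s' *\<^sub>R b" "t' *\<^sub>R a"] st st' ab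
   by (auto simp: add_ac)
  then show "\<exists>p q. norm (p - x) \<le> 2 / real (Suc n) \<and> norm (q - x) \<le> 2 / real (Suc n) \<and> partials [a, b] \<phi> p = partials [b, a] \<phi> q"
   using eq unfolding \<epsilon>_def by (intro exI[of _ "x + s *\<^sub>R a + t *\<^sub>R b"] exI[of _ "x + s' *\<^sub>R b + t' *\<^sub>R a"]) simp
 qed
 then obtain p q where pq: "\<And>n. norm (p n - x) \<le> 2 / real (Suc n)" "\<And>n. norm (q n - x) \<le> 2 / real (Suc n)"
  "\<And>n. partials [a, b] \<phi> (p n) = partials [b, a] \<phi> (q n)" by metis
 have lim: "(\<lambda>n. 2 / real (Suc n)) \<longlonglongrightarrow> 0" using LIMSEQ_Suc[OF lim_const_over_n[of 2]] by simp
 have p: "p \<longlonglongrightarrow> x" by (rule LIM_zero_cancel, rule Lim_null_comparison[OF _ lim]) (use pq in auto)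
 have q: "q \<longlonglongrightarrow> x" by (rule LIM_zero_cancel, rule Lim_null_comparison[OF _ lim]) (use pq in auto)
 have c: "isCont (partials [a, b] \<phi>) x" "isCont (partials [b, a] \<phi>) x"
  using ab by (auto intro!: differentiable_imp_continuous_within test_function_differentiable test_function_partials \<phi>)
 have "(\<lambda>n. partials [a, b] \<phi> (p n)) \<longlonglongrightarrow> partials [a, b] \<phi> x" by (rule isCont_tendsto_compose[OF c(1) p])
 moreover have "(\<lambda>n. partials [a, b] \<phi> (p n)) \<longlonglongrightarrow> partials [b, a] \<phi> x" unfolding pq(3) by (rule isCont_tendsto_compose[OF c(2) q])
 ultimately show "partials [a, b] \<phi> x = partials [b, a] \<phi> x" by (rule LIMSEQ_unique)
qed

lemma partials_move:
 assumes \<phi>: "\<phi> \<in> test_functions" and "b \<in> Basis" "set bs \<subseteq> Basis"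
 shows "partials (b # bs) \<phi> = partials (bs @ [b]) \<phi>"
 using assms(3)
proof (induction bs)
 case (Cons c bs)
 have "partials (b # c # bs) \<phi> = partials [b, c] (partials bs \<phi>)" by (simp add: partials_append[symmetric])
 also have "... = partials [c, b] (partials bs \<phi>)"
  using Cons assms by (intro partials_swap test_function_partials) auto
 also have "... = partials [c] (partials (b # bs) \<phi>)" by (simp add: partials_append[symmetric])
 also have "... = partials [c] (partials (bs @ [b]) \<phi>)" using Cons by simp
 finally show ?case by (simp add: partials_append[symmetric])
qed simp

lemma partials_permute:
 assumes "mset bs = mset cs" "set bs \<subseteq> Basis" "\<phi> \<in> test_functions"
 shows "partials bs \<phi> = partials cs \<phi>"
 using assms
proof (induction bs arbitrary: cs \<phi>)
 case (Cons b bs)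
 then have "b \<in> set cs" by (metis list.set_intros(1) mset_eq_setD)
 then obtain cs1 cs2 where cs: "cs = cs1 @ b # cs2" by (meson split_list)
 have "set cs \<subseteq> Basis" using Cons.prems by (metis mset_eq_setD)
 then have B: "b \<in> Basis" "set cs1 \<subseteq> Basis" "set cs2 \<subseteq> Basis" "set bs \<subseteq> Basis" using cs Cons.prems by auto
 have "partials (b # bs) \<phi> = partials [b] (partials bs \<phi>)" by (simp add: partials_append[symmetric])
 also have "partials bs \<phi> = partials (cs1 @ cs2) \<phi>" using Cons.prems cs B by (intro Cons.IH) auto
 also have "partials [b] (partials (cs1 @ cs2) \<phi>) = partials (b # cs1) (partials cs2 \<phi>)" by (simp add: partials_append[symmetric])
 also have "... = partials (cs1 @ [b]) (partials cs2 \<phi>)" using B by (intro partials_move test_function_partials Cons.prems)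
 also have "... = partials cs \<phi>" by (simp add: cs partials_append[symmetric])
 finally show ?case .
qed simp

lemma count_list_eq_imp_mset_eq: "(\<And>b. count_list bs b = count_list cs b) ==> mset bs = mset cs"
 by (simp add: multiset_eq_iff count_mset)

lemma ex_list_of_counts:
 assumes "finite A" "\<And>b. b \<notin> A ==> \<beta> b = (0::nat)"
 shows "\<exists>bs. \<forall>b. count_list bs b = \<beta> b"
 using assms
proof (induction A arbitrary: \<beta> rule: finite_induct)
 case empty
 then show ?case by (intro exI[of _ "[]"]) auto
next
 case (insert a A)
 have "\<And>b. b \<notin> A ==> (\<beta>(a := 0)) b = 0" using insert.prems by auto
 then obtain bs where bs: "\<forall>b. count_list bs b = (\<beta>(a := 0)) b"
  using insert.IH[of "\<beta>(a := 0)"] by blast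
 have "count_list (replicate n a @ bs) b = (if a = b then n else 0) + count_list bs b" for n b
  by (induction n) auto
 then show ?case using bs by (intro exI[of _ "replicate (\<beta> a) a @ bs"]) auto
qed

lemma multi_partial_eq_partials:
 assumes "\<phi> \<in> test_functions" "set bs \<subseteq> Basis"
 shows "multi_partial (count_list bs) \<phi> = partials bs \<phi>"
proof -
 define cs where "cs = (SOME cs. \<forall>b. count_list cs b = count_list bs b)"
 have "\<forall>b. count_list cs b = count_list bs b" unfolding cs_def by (rule someI[of _ bs]) simp
 then have "mset bs = mset cs" by (intro count_list_eq_imp_mset_eq) auto
 then show ?thesis unfolding multi_partial_def cs_def[symmetric] using assms by (metis partials_permute)
qed

section \<open>The fundamental lemma of the calculus of variations\<close>

text \<open>The polynomial in 1/y closes this family under differentiation: with z = 1/y, the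
  derivative replaces P by z^2 (P - P').\<close>

definition exp_bump :: "real poly => real => real" where
 "exp_bump P y = (if y > 0 then poly P (1 / y) * exp (- (1 / y)) else 0)"

lemma exp_bump_smult: "exp_bump (smult c P) y = c * exp_bump P y"
 by (simp add: exp_bump_def)

lemma poly_times_exp_tendsto_0: "((\<lambda>z. poly P z * exp (- z)) \<longlongrightarrow> (0::real)) at_top"
proof -
 have "((\<lambda>z. \<Sum>i\<le>degree P. coeff P i * (z ^ i / exp z)) \<longlongrightarrow> (\<Sum>i\<le>degree P. coeff P i * 0)) at_top"
  by (intro tendsto_intros tendsto_power_div_exp_0)
 then show ?thesis by (simp add: poly_altdef exp_minus divide_inverse sum_distrib_right mult.assoc)
qed

lemma exp_bump_tendsto_0: "(exp_bump P \<longlongrightarrow> 0) (at 0)"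
proof (rule filterlim_split_at)
 show "(exp_bump P \<longlongrightarrow> 0) (at_left 0)"
  by (rule tendsto_eventually) (auto simp: exp_bump_def eventually_at_left_field intro!: exI[of _ "-1"])
 have "filterlim (\<lambda>y::real. 1 / y) at_top (at_right 0)"
  using filterlim_inverse_at_top_right by (simp add: inverse_eq_divide)
 then have "((\<lambda>y. poly P (1 / y) * exp (- (1 / y))) \<longlongrightarrow> 0) (at_right 0)"
  by (rule filterlim_compose[OF poly_times_exp_tendsto_0])
 then show "(exp_bump P \<longlongrightarrow> 0) (at_right 0)"
  by (rule Lim_transform_eventually) (auto simp: exp_bump_def eventually_at_right_field intro!: exI[of _ 1])
qed

lemma exp_bump_deriv: "(exp_bump P has_real_derivative exp_bump ([:0, 0, 1:] * (P - pderiv P)) y) (at y)"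
proof -
 consider "y < 0" | "y = 0" | "y > 0" by linarith
 then show ?thesis
 proof cases
  case 1
  have "((\<lambda>_. 0) has_real_derivative 0) (at y)" by simp
  then have "(exp_bump P has_real_derivative 0) (at y)"
   by (rule has_field_derivative_transform_within_open[of _ _ _ "{..<0}"]) (use 1 in \<open>auto simp: exp_bump_def\<close>)
  then show ?thesis using 1 by (simp add: exp_bump_def)
 next
  case 2
  \<comment> \<open>At 0 the difference quotient is again a member of the family, with the
    polynomial z P, and so tends to 0.\<close>
  have "(\<lambda>h. (exp_bump P (0 + h) - exp_bump P 0) / h) = exp_bump ([:0, 1:] * P)"
   by (auto simp: exp_bump_def fun_eq_iff field_simps)
  then show ?thesis using exp_bump_tendsto_0[of "[:0, 1:] * P"] 2
   by (simp add: DERIV_def) (simp add: exp_bump_def)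
 next
  case 3
  have "((\<lambda>y. poly P (1 / y) * exp (- (1 / y))) has_real_derivative exp_bump ([:0, 0, 1:] * (P - pderiv P)) y) (at y)"
   using 3 by (auto intro!: derivative_eq_intros simp: exp_bump_def field_simps power2_eq_square)
  then show ?thesis
   by (rule has_field_derivative_transform_within_open[of _ _ _ "{0<..}"]) (use 3 in \<open>auto simp: exp_bump_def\<close>)
 qed
qed

text \<open>Finite orders allow closure under products to be proved by induction: the Leibniz rule
  multiplies derivatives by factors of which only the lower order is used.\<close>

primrec times_differentiable :: "nat => ('a::euclidean_space => real) => bool" where
 "times_differentiable 0 f \<longleftrightarrow> (\<forall>x. f differentiable (at x))"
| "times_differentiable (Suc n) f \<longleftrightarrow> (\<forall>x. f differentiable (at x)) \<and>
   (\<forall>b\<in>Basis. times_differentiable n (\<lambda>x. frechet_derivative f (at x) b))"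

lemma times_differentiable_decrease: "times_differentiable (Suc n) f ==> times_differentiable n f"
 by (induction n arbitrary: f) auto

lemma times_differentiable_add:
 "times_differentiable n f ==> times_differentiable n g ==> times_differentiable n (\<lambda>x. f x + g x)"
proof (induction n arbitrary: f g)
 case (Suc n)
 then have d: "f differentiable (at x)" "g differentiable (at x)" for x by auto
 have "frechet_derivative (\<lambda>x. f x + g x) (at x) = (\<lambda>h. frechet_derivative f (at x) h + frechet_derivative g (at x) h)" for x
  by (rule frechet_derivative_at[symmetric], rule has_derivative_add)
    (use d frechet_derivative_works in blast)+
 then show ?case using Suc d by (auto intro!: derivative_intros)
qed (auto intro!: derivative_intros)

lemma times_differentiable_mult:
 "times_differentiable n f ==> times_differentiable n g ==> times_differentiable n (\<lambda>x. f x * g x)"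
proof (induction n arbitrary: f g)
 case (Suc n)
 then have d: "f differentiable (at x)" "g differentiable (at x)" for x by auto
 have "frechet_derivative (\<lambda>x. f x * g x) (at x) = (\<lambda>h. f x * frechet_derivative g (at x) h + frechet_derivative f (at x) h * g x)" for x
  by (rule frechet_derivative_at[symmetric], rule has_derivative_mult)
    (use d frechet_derivative_works in blast)+
 then show ?case using Suc d times_differentiable_decrease[OF Suc.prems(1)] times_differentiable_decrease[OF Suc.prems(2)]
  by (auto intro!: derivative_intros times_differentiable_add)
qed (auto intro!: derivative_intros)

lemma times_differentiable_const: "times_differentiable n (\<lambda>x. c)"
 by (induction n arbitrary: c) auto

lemma times_differentiable_prod:
 "finite I ==> (\<And>i. i \<in> I ==> times_differentiable n (f i)) ==> times_differentiable n (\<lambda>x. \<Prod>i\<in>I. f i x)"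
 by (induction I rule: finite_induct) (auto intro: times_differentiable_mult times_differentiable_const)

lemma times_differentiable_exp_bump: "times_differentiable n (\<lambda>x. exp_bump P (x \<bullet> v + c))"
proof (induction n arbitrary: P)
 case 0
 have "((\<lambda>x. exp_bump P (x \<bullet> v + c)) has_derivative (\<lambda>h. (h \<bullet> v) * exp_bump ([:0, 0, 1:] * (P - pderiv P)) (x \<bullet> v + c))) (at x)" for x
  by (rule DERIV_compose_FDERIV[OF exp_bump_deriv]) (auto intro!: derivative_eq_intros)
 then show ?case by (auto simp: differentiable_def)
next
 case (Suc n)
 let ?P' = "[:0, 0, 1:] * (P - pderiv P)"
 have d: "((\<lambda>x. exp_bump P (x \<bullet> v + c)) has_derivative (\<lambda>h. (h \<bullet> v) * exp_bump ?P' (x \<bullet> v + c))) (at x)" for x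
  by (rule DERIV_compose_FDERIV[OF exp_bump_deriv]) (auto intro!: derivative_eq_intros)
 have "frechet_derivative (\<lambda>x. exp_bump P (x \<bullet> v + c)) (at x) b = exp_bump (smult (b \<bullet> v) ?P') (x \<bullet> v + c)" for x b
  unfolding frechet_derivative_at[OF d[of x], symmetric] exp_bump_smult ..
 moreover have "(\<lambda>x. exp_bump P (x \<bullet> v + c)) differentiable (at x)" for x using d by (rule differentiableI)
 ultimately show ?case using Suc by (simp only: times_differentiable.simps) blast
qed

lemma times_differentiable_partials:
 assumes "times_differentiable (length bs) f" "set bs \<subseteq> Basis"
 shows "partials bs f differentiable (at x)"
 using assms
proof (induction bs arbitrary: f rule: rev_induct)
 case Nil then show ?case by simp
next
 case (snoc b bs)
 then have "partials bs (partials [b] f) differentiable (at x)"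
  by (intro snoc.IH) (auto simp: partials_Cons)
 then show ?case by (simp add: partials_append)
qed

text \<open>The factor \<open>real (Suc n)\<close> steepens the edges: at a point of the open box
  every factor tends to 1, and outside the box one factor is 0.\<close>

definition box_bump :: "nat => 'a::euclidean_space => 'a => 'a => real" where
 "box_bump n A B x = (\<Prod>b\<in>Basis. exp_bump 1 (real (Suc n) * (x \<bullet> b - A \<bullet> b)) * exp_bump 1 (real (Suc n) * (B \<bullet> b - x \<bullet> b)))"

lemma box_bump_zero:
 assumes "x \<notin> box A B" shows "box_bump n A B x = 0"
proof -
 obtain b where b: "b \<in> Basis" "\<not> (A \<bullet> b < x \<bullet> b \<and> x \<bullet> b < B \<bullet> b)" using assms by (auto simp: mem_box)
 then have "exp_bump 1 (real (Suc n) * (x \<bullet> b - A \<bullet> b)) * exp_bump 1 (real (Suc n) * (B \<bullet> b - x \<bullet> b)) = 0"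
  by (auto simp: exp_bump_def zero_less_mult_iff)
 then show ?thesis unfolding box_bump_def using b by (intro prod_zero) auto
qed

lemma box_bump_le: "0 \<le> box_bump n A B x" "box_bump n A B x \<le> 1"
proof -
 have e: "0 \<le> exp_bump 1 y" "exp_bump 1 y \<le> 1" for y by (auto simp: exp_bump_def)
 show "0 \<le> box_bump n A B x" unfolding box_bump_def by (intro prod_nonneg mult_nonneg_nonneg e ballI)
 show "box_bump n A B x \<le> 1" unfolding box_bump_def by (intro prod_le_1 conjI mult_nonneg_nonneg mult_le_one e)
qed

lemma box_bump_test: "box_bump n A B \<in> test_functions"
proof -
 have 1: "(\<lambda>x. exp_bump 1 (real (Suc n) * (x \<bullet> b - A \<bullet> b))) = (\<lambda>x. exp_bump 1 (x \<bullet> (real (Suc n) *\<^sub>R b) + (- (real (Suc n) * (A \<bullet> b)))))"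
  "(\<lambda>x. exp_bump 1 (real (Suc n) * (B \<bullet> b - x \<bullet> b))) = (\<lambda>x. exp_bump 1 (x \<bullet> (- real (Suc n) *\<^sub>R b) + real (Suc n) * (B \<bullet> b)))" for b
  by (simp_all add: algebra_simps)
 have "times_differentiable m (box_bump n A B)" for m
  unfolding box_bump_def
  by (intro times_differentiable_prod times_differentiable_mult) (simp_all only: 1 times_differentiable_exp_bump finite_Basis)
 then have "partials bs (box_bump n A B) differentiable (at x)" if "set bs \<subseteq> Basis" for bs x
  using that by (intro times_differentiable_partials) auto
 moreover have "closure {x. box_bump n A B x \<noteq> 0} \<subseteq> cbox A B"
  using box_bump_zero box_subset_cbox[of A B] by (intro closure_minimal) blast+
 then have "compact (closure {x. box_bump n A B x \<noteq> 0})"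
  by (meson bounded_cbox bounded_subset closed_closure compact_eq_bounded_closed)
 ultimately show ?thesis by (auto simp: test_functions_def)
qed

lemma box_bump_tendsto: "(\<lambda>n. box_bump n A B x) \<longlonglongrightarrow> indicator (box A B) x"
proof (cases "x \<in> box A B")
 case False then show ?thesis by (simp add: box_bump_zero)
next
 case True
 have e: "(\<lambda>n. exp_bump 1 (real (Suc n) * y)) \<longlonglongrightarrow> 1" if "y > 0" for y
 proof -
  have "(\<lambda>n. (1 / y) / real (Suc n)) \<longlonglongrightarrow> 0" using LIMSEQ_Suc[OF lim_const_over_n] .
  then have "(\<lambda>n. exp (- ((1 / y) / real (Suc n)))) \<longlonglongrightarrow> exp (- 0)" by (intro tendsto_intros)
  moreover have "exp_bump 1 (real (Suc n) * y) = exp (- ((1 / y) / real (Suc n)))" for n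
   using that by (simp add: exp_bump_def mult.commute del: of_nat_Suc)
  ultimately show ?thesis by simp
 qed
 have "(\<lambda>n. box_bump n A B x) \<longlonglongrightarrow> (\<Prod>b\<in>(Basis::'a set). 1 * 1)"
  unfolding box_bump_def using True by (intro tendsto_intros e) (auto simp: mem_box)
 then show ?thesis using True by simp
qed

text \<open>The Borel counterpart of \<open>locally_integrable\<close>: Borel functions stay jointly
  measurable after inserting x + u h, as Fubini's theorem requires.\<close>

definition loc_integrable :: "('a::euclidean_space => complex) => bool" where
 "loc_integrable f \<longleftrightarrow> f \<in> borel_measurable borel \<and>
   (\<forall>K. compact K \<longrightarrow> (\<integral>\<^sup>+x. indicator K x * ennreal (norm (f x)) \<partial>lborel) < \<infinity>)"

lemma loc_integrable_borel: "loc_integrable f ==> f \<in> borel_measurable borel"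
 by (simp add: loc_integrable_def)

lemma loc_integrable_cbox:
 assumes "loc_integrable f" "compact K"
 shows "integrable lborel (\<lambda>x. indicator K x *\<^sub>R f x)"
proof -
 have [measurable]: "f \<in> borel_measurable borel" "K \<in> sets borel"
  using assms by (auto simp: loc_integrable_def intro: borel_compact)
 have "(\<integral>\<^sup>+x. ennreal (norm (indicator K x *\<^sub>R f x)) \<partial>lborel) = (\<integral>\<^sup>+x. indicator K x * ennreal (norm (f x)) \<partial>lborel)"
  by (intro nn_integral_cong) (auto simp: indicator_def)
 then show ?thesis using assms by (intro integrableI_bounded) (auto simp: loc_integrable_def)
qed

lemma loc_integrable_times:
 fixes \<phi> :: "'a::euclidean_space => real"
 assumes f: "loc_integrable f" and [measurable]: "\<phi> \<in> borel_measurable borel"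
  and B: "\<And>x. \<bar>\<phi> x\<bar> \<le> B" and R: "\<And>x. \<phi> x \<noteq> 0 ==> norm x \<le> R"
 shows "integrable lborel (\<lambda>x. \<phi> x *\<^sub>R f x)"
proof (rule Bochner_Integration.integrable_bound)
 show "integrable lborel (\<lambda>x. B *\<^sub>R (indicator (cball 0 R) x *\<^sub>R f x))"
  by (rule integrable_scaleR_right[OF loc_integrable_cbox[OF f compact_cball]])
 have [measurable]: "f \<in> borel_measurable borel" using f by (rule loc_integrable_borel)
 show "(\<lambda>x. \<phi> x *\<^sub>R f x) \<in> borel_measurable lborel" by measurable
 have "B \<ge> 0" using B[of 0] by linarith
 then show "AE x in lborel. norm (\<phi> x *\<^sub>R f x) \<le> norm (B *\<^sub>R (indicator (cball 0 R) x *\<^sub>R f x))"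
 proof (intro AE_I2)
  fix x show "norm (\<phi> x *\<^sub>R f x) \<le> norm (B *\<^sub>R (indicator (cball 0 R) x *\<^sub>R f x))"
   using B[of x] R[of x] \<open>B \<ge> 0\<close> by (cases "\<phi> x = 0") (auto intro!: mult_right_mono)
 qed
qed

lemma test_function_times_integrable:
 assumes "\<phi> \<in> test_functions" "loc_integrable f"
 shows "integrable lborel (\<lambda>x. \<phi> x *\<^sub>R f x)"
proof -
 obtain R where "\<And>x. \<phi> x \<noteq> 0 ==> norm x \<le> R" using test_function_bounded_support[OF assms(1)] by metis
 moreover obtain B where "\<And>x. \<bar>\<phi> x\<bar> \<le> B" using test_function_bounded[OF assms(1)] by metis
 ultimately show ?thesis by (intro loc_integrable_times[of f \<phi> B R] assms test_function_measurable)
qed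

lemma loc_integrable_diff:
 assumes "loc_integrable f" "loc_integrable g" shows "loc_integrable (\<lambda>x. f x - g x)"
 unfolding loc_integrable_def
proof (intro conjI allI impI)
 have [measurable]: "f \<in> borel_measurable borel" "g \<in> borel_measurable borel" using assms by (auto simp: loc_integrable_def)
 show "(\<lambda>x. f x - g x) \<in> borel_measurable borel" by measurable
 fix K :: "'a set" assume K: "compact K"
 then have [measurable]: "K \<in> sets borel" by (rule borel_compact)
 have "(\<integral>\<^sup>+x. indicator K x * ennreal (norm (f x - g x)) \<partial>lborel) \<le> (\<integral>\<^sup>+x. indicator K x * ennreal (norm (f x)) + indicator K x * ennreal (norm (g x)) \<partial>lborel)"
  by (intro nn_integral_mono) (auto simp: indicator_def norm_triangle_ineq4 simp flip: ennreal_plus intro!: ennreal_leI)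
 also have "... = (\<integral>\<^sup>+x. indicator K x * ennreal (norm (f x)) \<partial>lborel) + (\<integral>\<^sup>+x. indicator K x * ennreal (norm (g x)) \<partial>lborel)"
  by (rule nn_integral_add) measurable
 also have "... < \<infinity>" using assms K by (auto simp: loc_integrable_def)
 finally show "(\<integral>\<^sup>+x. indicator K x * ennreal (norm (f x - g x)) \<partial>lborel) < \<infinity>" .
qed

text \<open>The positive and the negative part of g are densities of two finite measures that agree
  on boxes, an intersection-stable generator; so the measures, and then the densities,
  agree.\<close>

lemma AE_zero_if_box_integrals_zero:
 fixes g :: "'a::euclidean_space => real"
 assumes g: "integrable lborel g" and zero: "\<And>a b. (\<integral>x. indicator (box a b) x * g x \<partial>lborel) = 0"
 shows "AE x in lborel. g x = 0"
proof -
 let ?p = "\<lambda>x. ennreal (g x)" and ?m = "\<lambda>x. ennreal (- g x)"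
 have [measurable]: "g \<in> borel_measurable borel" using g by simp
 have fin: "(\<integral>\<^sup>+x. ?p x \<partial>lborel) < \<infinity>" "(\<integral>\<^sup>+x. ?m x \<partial>lborel) < \<infinity>"
  using g by (auto simp: real_integrable_def less_top)
 have le: "(\<integral>\<^sup>+x. ?p x * indicator S x \<partial>lborel) < \<infinity>" "(\<integral>\<^sup>+x. ?m x * indicator S x \<partial>lborel) < \<infinity>" for S :: "'a set"
  by (rule le_less_trans[OF nn_integral_mono fin(1)], simp add: indicator_def)
    (rule le_less_trans[OF nn_integral_mono fin(2)], simp add: indicator_def)
 have eq: "(\<integral>\<^sup>+x. ?p x * indicator (box a b) x \<partial>lborel) = (\<integral>\<^sup>+x. ?m x * indicator (box a b) x \<partial>lborel)" for a b
 proof -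
  let ?h = "\<lambda>x. indicator (box a b) x * g x"
  have h: "integrable lborel ?h" using integrable_mult_indicator[OF _ g, of "box a b"] by simp
  have "(\<integral>\<^sup>+x. ennreal (?h x) \<partial>lborel) = (\<integral>\<^sup>+x. ?p x * indicator (box a b) x \<partial>lborel)"
   "(\<integral>\<^sup>+x. ennreal (- ?h x) \<partial>lborel) = (\<integral>\<^sup>+x. ?m x * indicator (box a b) x \<partial>lborel)"
   by (intro nn_integral_cong; auto simp: indicator_def)+
  then have "0 = enn2real (\<integral>\<^sup>+x. ?p x * indicator (box a b) x \<partial>lborel) - enn2real (\<integral>\<^sup>+x. ?m x * indicator (box a b) x \<partial>lborel)"
   using real_lebesgue_integral_def[OF h] zero[of a b] by simp
  then show ?thesis using le by (metis diff_eq_diff_eq ennreal_enn2real eq_iff_diff_eq_0 infinity_ennreal_def)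
 qed
 have "density lborel ?p = density lborel ?m"
 proof (rule measure_eqI_generator_eq[where E="range (\<lambda>(a, b). box a b)" and \<Omega>=UNIV and A="\<lambda>n. box (- (real n *\<^sub>R One)) (real n *\<^sub>R One)"])
  show "Int_stable (range (\<lambda>(a, b). box a b :: 'a set))"
   by (auto simp: Int_stable_def Int_interval(1) box_Int_box)
  show "emeasure (density lborel ?p) X = emeasure (density lborel ?m) X" if "X \<in> range (\<lambda>(a, b). box a b)" for X
   using that eq by (auto simp: emeasure_density)
  show "sets (density lborel ?p) = sigma_sets UNIV (range (\<lambda>(a, b). box a b))"
   "sets (density lborel ?m) = sigma_sets UNIV (range (\<lambda>(a, b). box a b))"
   by (simp_all add: borel_eq_box)
  show "(\<Union>n. box (- (real n *\<^sub>R One)) (real n *\<^sub>R One) :: 'a set) = UNIV"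
   using UN_box_eq_UNIV by simp
  show "emeasure (density lborel ?p) (box (- (real i *\<^sub>R One)) (real i *\<^sub>R One)) \<noteq> \<infinity>" for i
   using le(1)[of "box (- (real i *\<^sub>R One)) (real i *\<^sub>R One)"] by (simp add: emeasure_density)
 qed auto
 then have "AE x in lborel. ?p x = ?m x"
  using fin by (subst (asm) finite_density_unique) auto
 then show ?thesis by eventually_elim (metis ennreal_eq_0_iff ennreal_neg linear neg_0_le_iff_le neg_le_0_iff_le order_antisym)
qed

text \<open>By dominated convergence of \<open>box_bump\<close> all integrals of f over boxes
  vanish. Restriction to large cubes makes f integrable, and real and imaginary parts are treated
  separately.\<close>

lemma fundamental_lemma:
 assumes f: "loc_integrable f" and zero: "\<And>\<phi>. \<phi> \<in> test_functions ==> (pairing \<phi> f) = 0"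
 shows "AE x in lborel. f x = 0"
proof -
 have [measurable]: "f \<in> borel_measurable borel" using f by (rule loc_integrable_borel)
 have box: "(\<integral>x. indicator (box A B) x *\<^sub>R f x \<partial>lborel) = 0" for A B
 proof -
  have "(\<lambda>n. \<integral>x. box_bump n A B x *\<^sub>R f x \<partial>lborel) \<longlonglongrightarrow> (\<integral>x. indicator (box A B) x *\<^sub>R f x \<partial>lborel)"
  proof (rule integral_dominated_convergence[where w="\<lambda>x. norm (indicator (cbox A B) x *\<^sub>R f x)"])
   show "integrable lborel (\<lambda>x. norm (indicator (cbox A B) x *\<^sub>R f x))"
    by (intro integrable_norm loc_integrable_cbox f compact_cbox)
   show "AE x in lborel. (\<lambda>n. box_bump n A B x *\<^sub>R f x) \<longlonglongrightarrow> indicator (box A B) x *\<^sub>R f x"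
    by (intro AE_I2 tendsto_intros box_bump_tendsto)
   show "(\<lambda>x. box_bump n A B x *\<^sub>R f x) \<in> borel_measurable lborel" for n
    using test_function_measurable[OF box_bump_test[of n A B]] by measurable
   show "AE x in lborel. norm (box_bump n A B x *\<^sub>R f x) \<le> norm (indicator (cbox A B) x *\<^sub>R f x)" for n
   proof (intro AE_I2)
    fix x
    show "norm (box_bump n A B x *\<^sub>R f x) \<le> norm (indicator (cbox A B) x *\<^sub>R f x)"
     using box_bump_le[where n=n and A=A and B=B and x=x] box_bump_zero[of x A B n] subsetD[OF box_subset_cbox, of x A B]
     by (cases "x \<in> box A B") (auto intro!: mult_left_le_one_le)
   qed
  qed measurable
  then show ?thesis using zero[OF box_bump_test] by (simp add: LIMSEQ_const_iff)
 qed
 have "AE x in lborel. x \<in> box (- (real n *\<^sub>R One)) (real n *\<^sub>R One) \<longrightarrow> f x = 0" for n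
 proof -
  let ?Q = "box (- (real n *\<^sub>R One)) (real n *\<^sub>R One) :: 'a set"
  let ?h = "\<lambda>x. indicator ?Q x *\<^sub>R f x"
  have h: "integrable lborel ?h"
  proof (rule Bochner_Integration.integrable_bound)
   show "integrable lborel (\<lambda>x. indicator (cbox (- (real n *\<^sub>R One)) (real n *\<^sub>R One)) x *\<^sub>R f x)"
    by (intro loc_integrable_cbox f compact_cbox)
   show "AE x in lborel. norm (?h x) \<le> norm (indicator (cbox (- (real n *\<^sub>R One)) (real n *\<^sub>R One)) x *\<^sub>R f x)"
    using box_subset_cbox by (intro AE_I2) (auto simp: indicator_def)
  qed measurable
  have hb: "(\<integral>x. indicator (box a b) x *\<^sub>R ?h x \<partial>lborel) = 0" for a b
  proof -
   obtain c d where cd: "box a b \<inter> ?Q = box c d" unfolding box_Int_box by blast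
   have "(\<integral>x. indicator (box a b) x *\<^sub>R ?h x \<partial>lborel) = (\<integral>x. indicator (box c d) x *\<^sub>R f x \<partial>lborel)"
    unfolding cd[symmetric] by (intro Bochner_Integration.integral_cong) (auto simp: indicator_def)
   then show ?thesis using box by simp
  qed
  have hbi: "integrable lborel (\<lambda>x. indicator (box a b) x *\<^sub>R ?h x)" for a b
   by (rule integrable_mult_indicator[OF _ h]) simp
  have "AE x in lborel. Re (?h x) = 0"
  proof (rule AE_zero_if_box_integrals_zero)
   show "integrable lborel (\<lambda>x. Re (?h x))" by (rule integrable_Re[OF h])
   show "(\<integral>x. indicator (box a b) x * Re (?h x) \<partial>lborel) = 0" for a b
    using integral_Re[OF hbi[of a b]] hb[of a b] by (simp add: mult.assoc)
  qed
  moreover have "AE x in lborel. Im (?h x) = 0"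
  proof (rule AE_zero_if_box_integrals_zero)
   show "integrable lborel (\<lambda>x. Im (?h x))" by (rule integrable_Im[OF h])
   show "(\<integral>x. indicator (box a b) x * Im (?h x) \<partial>lborel) = 0" for a b
    using integral_Im[OF hbi[of a b]] hb[of a b] by (simp add: mult.assoc)
  qed
  ultimately show ?thesis by eventually_elim (auto simp: complex_eq_iff)
 qed
 then have "AE x in lborel. \<forall>n. x \<in> box (- (real n *\<^sub>R One)) (real n *\<^sub>R One) \<longrightarrow> f x = 0"
  by (subst AE_all_countable) blast
 then show ?thesis
 proof eventually_elim
  case (elim x)
  have "x \<in> (\<Union>n::nat. box (- (real n *\<^sub>R One)) (real n *\<^sub>R One))" by (simp only: UN_box_eq_UNIV UNIV_I)
  then obtain n :: nat where "x \<in> box (- (real n *\<^sub>R One)) (real n *\<^sub>R One)" by (rule UN_E)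
  then show ?case using elim by blast
 qed
qed

section \<open>Lebesgue norms\<close>

text \<open>
 The Young function of \<open>L\<^sub>p\<close>: for \<open>B > 0\<close>, \<open>\<parallel>f\<parallel>\<^sub>p \<le> B\<close> holds iff \<open>\<integral> lp_young p (\<bar>f\<bar> / B) \<le> 1\<close>.
 This covers \<open>p = \<infinity>\<close> as well, so that convexity arguments need no case distinction.
\<close>

definition lp_young :: "ennreal => real => ennreal" where
 "lp_young p y = (if p = \<infinity> then (if y > 1 then \<infinity> else 0) else ennreal (y powr enn2real p))"

lemma lp_young_measurable [measurable]: "lp_young p \<in> borel_measurable borel"
 unfolding lp_young_def by (cases "p = \<infinity>") measurable

lemma lp_exponent_ge_1: "1 \<le> p ==> p \<noteq> \<infinity> ==> 1 \<le> enn2real p"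
 by (cases p) (auto simp: ennreal_1[symmetric] ennreal_le_iff simp del: ennreal_1)

lemma lp_young_0: "1 \<le> p ==> lp_young p 0 = 0"
 using lp_exponent_ge_1[of p] by (auto simp: lp_young_def)

lemma lp_young_mono: "1 \<le> p ==> 0 \<le> x ==> x \<le> y ==> lp_young p x \<le> lp_young p y"
 using lp_exponent_ge_1[of p] by (auto simp: lp_young_def intro!: ennreal_leI powr_mono2)

lemma le_one_plus_lp_young: "1 \<le> p ==> 0 \<le> x ==> ennreal x \<le> 1 + lp_young p x"
proof (cases "x \<le> 1")
 case True
 then have "ennreal x \<le> 1" by (simp add: ennreal_le_1)
 then show ?thesis by (simp add: add_increasing2)
next
 case False
 assume "1 \<le> p" "0 \<le> x"
 have "ennreal x \<le> lp_young p x"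
 proof (cases "p = \<infinity>")
  case False
  have "x powr 1 \<le> x powr enn2real p"
   using \<open>\<not> x \<le> 1\<close> lp_exponent_ge_1[OF \<open>1 \<le> p\<close> False] by (intro powr_mono) auto
  then show ?thesis using False \<open>\<not> x \<le> 1\<close> by (auto simp: lp_young_def intro!: ennreal_leI)
 qed (use False in \<open>simp add: lp_young_def\<close>)
 then show ?thesis by (simp add: add_increasing)
qed

lemma lp_young_infinity:
 assumes "p = \<infinity>" "B > 0"
 shows "lp_young p (y / B) = (if y \<le> B then 0 else \<infinity>)"
 using assms by (simp add: lp_young_def)

lemma lp_young_finite: "p \<noteq> \<infinity> ==> lp_young p y = ennreal (y powr enn2real p)"
 by (simp add: lp_young_def)

section \<open>Convexity inequalities for the Young function\<close>

lemma powr_bernoulli: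
 fixes z a :: real
 assumes "1 \<le> a" "0 \<le> z"
 shows "1 + a * (z - 1) \<le> z powr a"
proof (cases "z = 0")
 case False
 have "z powr a - 1 powr a \<ge> a * (z - 1)"
 proof (rule convex_on_imp_above_tangent[where A="{0<..}" and f="\<lambda>x. x powr a"])
  show "convex_on {0<..} (\<lambda>x. x powr a)" using assms by (intro powr_convex)
  show "((\<lambda>x. x powr a) has_real_derivative a) (at 1 within {0<..})"
   by (auto intro!: derivative_eq_intros)
 qed (use assms False in \<open>auto simp: interior_open\<close>)
 then show ?thesis by simp
qed (use assms in auto)

text \<open>The tangent line at m. Convexity and Jensen's inequality both follow by averaging with m
  the mean, where the linear term cancels.\<close>

lemma powr_above_tangent:
 fixes y m a :: real
 assumes "1 \<le> a" "0 \<le> y" "0 < m"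
 shows "m powr a + a * m powr (a - 1) * (y - m) \<le> y powr a"
proof -
 have "m powr a * (1 + a * (y / m - 1)) \<le> m powr a * (y / m) powr a"
  using powr_bernoulli[of a "y / m"] assms by (intro mult_left_mono) auto
 also have "... = y powr a" using assms powr_mult[of m "y / m" a] by simp
 also have "m powr a * (1 + a * (y / m - 1)) = m powr a + a * m powr (a - 1) * (y - m)"
  using assms by (simp add: powr_diff field_simps)
 finally show ?thesis .
qed

lemma lp_young_convex:
 assumes p: "1 \<le> p" and "0 \<le> \<alpha>" "0 \<le> \<beta>" "\<alpha> + \<beta> = 1" "0 \<le> x" "0 \<le> y"
 shows "lp_young p (\<alpha> * x + \<beta> * y) \<le> ennreal \<alpha> * lp_young p x + ennreal \<beta> * lp_young p y"
proof (cases "p = \<infinity>")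
 case True
 show ?thesis
 proof (cases "\<alpha> * x + \<beta> * y > 1")
  case gt: True
  then have "(\<alpha> > 0 \<and> x > 1) \<or> (\<beta> > 0 \<and> y > 1)"
   using assms mult_left_mono[of x 1 \<alpha>] mult_left_mono[of y 1 \<beta>] by (smt (verit) mult_eq_0_iff)
  then show ?thesis using True by (auto simp: lp_young_def ennreal_mult_top)
 qed (simp add: lp_young_def True)
next
 case False
 define a where "a = enn2real p"
 have a: "1 \<le> a" using lp_exponent_ge_1[OF p False] by (simp add: a_def)
 define m where "m = \<alpha> * x + \<beta> * y"
 have "m powr a \<le> \<alpha> * x powr a + \<beta> * y powr a"
 proof (cases "m = 0")
  case True then show ?thesis using assms by simp
 next
  case False
  moreover have "m \<ge> 0" using assms by (simp add: m_def)
  ultimately have "m > 0" by linarith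
  have "\<alpha> * (m powr a + a * m powr (a - 1) * (x - m)) + \<beta> * (m powr a + a * m powr (a - 1) * (y - m)) \<le> \<alpha> * x powr a + \<beta> * y powr a"
   using assms \<open>m > 0\<close> a by (intro add_mono mult_left_mono powr_above_tangent) auto
  also have "\<alpha> * (m powr a + a * m powr (a - 1) * (x - m)) + \<beta> * (m powr a + a * m powr (a - 1) * (y - m))
    = (\<alpha> + \<beta>) * m powr a + a * m powr (a - 1) * ((\<alpha> * x + \<beta> * y) - (\<alpha> + \<beta>) * m)" by (simp add: algebra_simps)
  also have "... = m powr a" using assms by (simp add: m_def)
  finally show ?thesis .
 qed
 then show ?thesis using False assms
  by (simp add: lp_young_def a_def m_def ennreal_leI flip: ennreal_mult ennreal_plus)
qed

text \<open>Jensen's inequality, including p = \<infinity>, where the right-hand side is 0 or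
  \<infinity> according to whether the norm of F is at most B almost everywhere on the unit
  interval.\<close>

lemma lp_young_jensen:
 fixes F :: "real => complex"
 assumes p: "1 \<le> p" and B: "B > 0" and [measurable]: "F \<in> borel_measurable borel"
 shows "lp_young p (norm (unit_mean F) / B) \<le> (\<integral>\<^sup>+u\<in>{0..1}. lp_young p (norm (F u) / B) \<partial>lborel)"
proof (cases "integrable lborel (\<lambda>u. indicator {0..1} u *\<^sub>R F u)")
 \<comment> \<open>A non-integrable function has Bochner integral 0, so the left-hand side
   vanishes.\<close>
 case False
 then show ?thesis using lp_young_0[OF p] by (simp add: not_integrable_integral_eq)
next
 case True
 define I where "I = (\<integral>u. indicator {0..1} u * norm (F u) \<partial>lborel)"
 have i: "integrable lborel (\<lambda>u. indicator {0..1} u * norm (F u))"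
  using integrable_norm[OF True] by (simp add: mult.commute)
 have "norm (unit_mean F) \<le> (\<integral>u. norm (indicator {0..1} u *\<^sub>R F u) \<partial>lborel)"
  by (rule integral_norm_bound)
 also have "... = I" unfolding I_def by (intro Bochner_Integration.integral_cong) (auto simp: indicator_def)
 finally have I: "norm (unit_mean F) \<le> I" .
 have "I \<ge> 0" unfolding I_def by (intro integral_nonneg_AE AE_I2) auto
 have one: "(\<integral>u. indicator {0..1} u \<partial>(lborel::real measure)) = (1::real)" by simp
 have "lp_young p (I / B) \<le> (\<integral>\<^sup>+u\<in>{0..1}. lp_young p (norm (F u) / B) \<partial>lborel)"
 proof (cases "p = \<infinity>")
  case inf: True
  show ?thesis
  proof (cases "(\<integral>\<^sup>+u\<in>{0..1}. lp_young p (norm (F u) / B) \<partial>lborel) = \<infinity>")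
   case False
   then have "AE u in lborel. lp_young p (norm (F u) / B) * indicator {0..1} u \<noteq> \<infinity>"
    by (intro nn_integral_PInf_AE) auto
   then have "AE u in lborel. indicator {0..1} u * norm (F u) \<le> B * indicator {0..1} u"
    unfolding lp_young_infinity[OF inf B]
    by eventually_elim (auto simp: indicator_def ennreal_top_mult split: if_splits)
   then have "I \<le> (\<integral>u. B * indicator {0..1} u \<partial>(lborel::real measure))"
    unfolding I_def by (rule integral_mono_AE[OF i, rotated]) auto
   also have "... = B" by simp
   finally show ?thesis using B by (simp add: lp_young_def inf)
  qed simp
 next
  case fin: False
  define a where "a = enn2real p"
  have a: "1 \<le> a" using lp_exponent_ge_1[OF p fin] by (simp add: a_def)
  show ?thesis
  proof (cases "I = 0 \<or> (\<integral>\<^sup>+u\<in>{0..1}. lp_young p (norm (F u) / B) \<partial>lborel) = \<infinity>")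
   case True then show ?thesis using lp_young_0[OF p] by auto
  next
   case False
   define m where "m = I / B"
   have m: "m > 0" using False \<open>I \<ge> 0\<close> B by (simp add: m_def)
   have nn: "(\<integral>\<^sup>+u\<in>{0..1}. lp_young p (norm (F u) / B) \<partial>lborel) = (\<integral>\<^sup>+u. ennreal (indicator {0..1} u * (norm (F u) / B) powr a) \<partial>lborel)"
    unfolding lp_young_finite[OF fin] by (intro nn_integral_cong) (auto simp: a_def indicator_def)
   have j: "integrable lborel (\<lambda>u. indicator {0..1} u * (norm (F u) / B) powr a)"
    using False nn by (intro integrableI_nonneg) (auto simp: less_top)
   have "m powr a = (\<integral>u. indicator {0..1} u * m powr a + a * m powr (a - 1) * (indicator {0..1} u * norm (F u) / B - indicator {0..1} u * m) \<partial>lborel)"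
   proof -
    have "(\<integral>u. indicator {0..1} u * m powr a + a * m powr (a - 1) * (indicator {0..1} u * norm (F u) / B - indicator {0..1} u * m) \<partial>lborel)
      = m powr a + a * m powr (a - 1) * (I / B - m)"
     using i by (simp add: I_def)
    then show ?thesis by (simp add: m_def)
   qed
   also have "... \<le> (\<integral>u. indicator {0..1} u * (norm (F u) / B) powr a \<partial>lborel)"
   proof (intro integral_mono)
    show "integrable lborel (\<lambda>u. indicator {0..1} u * m powr a + a * m powr (a - 1) * (indicator {0..1} u * norm (F u) / B - indicator {0..1} u * m))"
     using i by simp
    show "indicator {0..1} u * m powr a + a * m powr (a - 1) * (indicator {0..1} u * norm (F u) / B - indicator {0..1} u * m) \<le> indicator {0..1} u * (norm (F u) / B) powr a" for u
     using powr_above_tangent[OF a, of "norm (F u) / B" m] m B by (cases "u \<in> {0..1}") simp_all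
   qed (rule j)
   finally have "ennreal (m powr a) \<le> ennreal (\<integral>u. indicator {0..1} u * (norm (F u) / B) powr a \<partial>lborel)"
    by (rule ennreal_leI)
   also have "... = (\<integral>\<^sup>+u\<in>{0..1}. lp_young p (norm (F u) / B) \<partial>lborel)"
    unfolding nn by (intro nn_integral_eq_integral[symmetric] j) auto
   finally show ?thesis unfolding lp_young_finite[OF fin] by (simp add: a_def m_def)
  qed
 qed
 moreover have "norm (unit_mean F) / B \<le> I / B"
  using I B by (intro divide_right_mono) auto
 then have "lp_young p (norm (unit_mean F) / B) \<le> lp_young p (I / B)"
  using B by (intro lp_young_mono p) auto
 ultimately show ?thesis by (rule order.trans[rotated])
qed

section \<open>Lebesgue norms over a cell of periods\<close>

definition periodic :: "'a::euclidean_space set => ('a => 'b) => bool" where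
 "periodic P f \<longleftrightarrow> (\<forall>v\<in>P. \<forall>x. f (x + v) = f x)"

lemma periodic_shift: "periodic P f ==> periodic P (\<lambda>x. f (x + h))"
 by (simp add: periodic_def) (metis add.assoc add.commute)

lemma lebesgue_measurable_shift:
 fixes f :: "'a::euclidean_space => 'b::topological_space"
 assumes "f \<in> borel_measurable lebesgue" shows "(\<lambda>x. f (x + h)) \<in> borel_measurable lebesgue"
proof (rule borel_measurableI)
 fix S :: "'b set" assume "open S"
 then have "f -` S \<in> sets lebesgue" using measurable_sets[OF assms, of S] by simp
 then have "(\<lambda>x. - h + x) ` (f -` S) \<in> sets lebesgue" by (rule lebesgue_sets_translation)
 also have "(\<lambda>x. - h + x) ` (f -` S) = (\<lambda>x. f (x + h)) -` S"
  by (auto simp: image_iff intro!: exI[of _ "_ + h"] bexI[of _ "_ + h"])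
 finally show "(\<lambda>x. f (x + h)) -` S \<inter> space lebesgue \<in> sets lebesgue" by simp
qed

lemma AE_lborel_shift:
 assumes "AE x in lborel. P x" shows "AE x in lborel. P (x + (h::'a::euclidean_space))"
proof -
 obtain N where N: "N \<in> null_sets lborel" "{x. \<not> P x} \<subseteq> N"
  using assms by (auto simp: eventually_ae_filter)
 have "{x. x - (- h) \<in> N} \<in> null_sets lborel" by (rule null_sets_translation[OF N(1)])
 then show ?thesis using N(2) by (intro AE_I'[of "{x. x - (- h) \<in> N}"]) auto
qed

text \<open>Space and torus at once: P is the set of periods and Q a period cell, the whole space if
  there are no periods. The norm sees only Q, so shifts and compact sets reaching beyond Q have to
  be controlled through periodicity.\<close>

locale lp_setting =
 fixes P :: "'a::euclidean_space set" and Q :: "'a set" and p :: ennreal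
 assumes Q_borel [measurable]: "Q \<in> sets borel" and p: "1 \<le> p"
  and nn_integral_shift: "\<And>(F :: 'a => ennreal) h. F \<in> borel_measurable lebesgue ==> periodic P F ==>
   (\<integral>\<^sup>+x\<in>Q. F (x + h) \<partial>lebesgue) = (\<integral>\<^sup>+x\<in>Q. F x \<partial>lebesgue)"
  and nn_integral_local: "\<And>K. compact K ==> \<exists>C<\<infinity>. \<forall>F :: 'a => ennreal. F \<in> borel_measurable lebesgue \<longrightarrow> periodic P F \<longrightarrow>
   (\<integral>\<^sup>+x\<in>K. F x \<partial>lebesgue) \<le> C * (\<integral>\<^sup>+x\<in>Q. F x \<partial>lebesgue)"
  and borel_representative: "\<And>f :: 'a => complex. f \<in> borel_measurable lebesgue ==> periodic P f ==>
   \<exists>f'\<in>borel_measurable borel. periodic P f' \<and> (AE x in lborel. f x = f' x)"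
begin

definition V :: "('a => complex) set" where
 "V = {f. f \<in> borel_measurable lebesgue \<and> periodic P f}"

definition L :: "('a => complex) => ennreal" where
 "L f = (if f \<in> V then lp_norm (lebesgue_on Q) p f else \<infinity>)"

lemma Q_lebesgue: "Q \<in> sets lebesgue"
 using Q_borel by simp

lemma L_le_iff:
 assumes f: "f \<in> V" and B: "B > 0"
 shows "L f \<le> ennreal B \<longleftrightarrow> (\<integral>\<^sup>+x\<in>Q. lp_young p (norm (f x) / B) \<partial>lebesgue) \<le> 1"
proof -
 have fm [measurable]: "f \<in> borel_measurable lebesgue" using f by (simp add: V_def)
 have fQ: "(\<lambda>x. ennreal (norm (f x))) \<in> borel_measurable (lebesgue_on Q)"
  by (rule measurable_restrict_space1) measurable
 show ?thesis
 proof (cases "p = \<infinity>")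
  case True
  have L_esssup: "L f = esssup (lebesgue_on Q) (\<lambda>x. ennreal (norm (f x)))"
   unfolding L_def lp_norm_def if_P[OF f] if_P[OF True] ..
  have "L f \<le> ennreal B \<longleftrightarrow> (AE x in lebesgue_on Q. ennreal (norm (f x)) \<le> ennreal B)"
   unfolding L_esssup
  proof
   assume "esssup (lebesgue_on Q) (\<lambda>x. ennreal (norm (f x))) \<le> ennreal B"
   with esssup_AE[of "\<lambda>x. ennreal (norm (f x))" "lebesgue_on Q"] show "AE x in lebesgue_on Q. ennreal (norm (f x)) \<le> ennreal B"
    by (auto elim: eventually_mono intro: order.trans)
  next
   assume "AE x in lebesgue_on Q. ennreal (norm (f x)) \<le> ennreal B"
   then show "esssup (lebesgue_on Q) (\<lambda>x. ennreal (norm (f x))) \<le> ennreal B" by (rule esssup_I[OF fQ])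
  qed
  also have "... \<longleftrightarrow> (AE x in lebesgue. x \<in> Q \<longrightarrow> norm (f x) \<le> B)"
   using B by (subst AE_restrict_space_iff) (auto simp: Q_lebesgue)
  also have "... \<longleftrightarrow> (\<integral>\<^sup>+x\<in>Q. lp_young p (norm (f x) / B) \<partial>lebesgue) \<le> 1"
  proof
   assume "AE x in lebesgue. x \<in> Q \<longrightarrow> norm (f x) \<le> B"
   then have "AE x in lebesgue. lp_young p (norm (f x) / B) * indicator Q x = 0"
    unfolding lp_young_infinity[OF True B] by eventually_elim (auto simp: indicator_def)
   from nn_integral_cong_AE[OF this] show "(\<integral>\<^sup>+x\<in>Q. lp_young p (norm (f x) / B) \<partial>lebesgue) \<le> 1" by simp
  next
   assume le: "(\<integral>\<^sup>+x\<in>Q. lp_young p (norm (f x) / B) \<partial>lebesgue) \<le> 1"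
   have "(\<lambda>x. lp_young p (norm (f x) / B) * indicator Q x) \<in> borel_measurable lebesgue"
    using Q_lebesgue by measurable
   moreover have "(\<integral>\<^sup>+x\<in>Q. lp_young p (norm (f x) / B) \<partial>lebesgue) \<noteq> \<infinity>" using le by (auto simp: top_unique)
   ultimately have "AE x in lebesgue. lp_young p (norm (f x) / B) * indicator Q x \<noteq> \<infinity>"
    by (rule nn_integral_PInf_AE)
   then show "AE x in lebesgue. x \<in> Q \<longrightarrow> norm (f x) \<le> B"
    unfolding lp_young_infinity[OF True B]
    by eventually_elim (auto simp: ennreal_top_mult split: if_splits)
  qed
  finally show ?thesis .
 next
  case False
  define a where "a = enn2real p"
  have a: "1 \<le> a" using lp_exponent_ge_1[OF p False] by (simp add: a_def)
  have r: "recip p = 1 / a" using recip_pos[of p] p False by (auto simp: a_def intro: less_le_trans[OF zero_less_one])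
  let ?I = "\<integral>\<^sup>+x\<in>Q. ennreal (norm (f x) powr a) \<partial>lebesgue"
  have "L f = epowr ?I (1 / a)"
  proof -
   have "(\<integral>\<^sup>+x. epowr (ennreal (norm (f x))) a \<partial>lebesgue_on Q) = ?I"
    by (subst nn_integral_restrict_space) (auto simp: Q_lebesgue epowr_ennreal)
   then show ?thesis using f False r by (simp add: L_def lp_norm_def a_def)
  qed
  moreover have "epowr ?I (1 / a) \<le> ennreal B \<longleftrightarrow> ?I \<le> ennreal (B powr a)"
  proof
   assume "epowr ?I (1 / a) \<le> ennreal B"
   then have "epowr (epowr ?I (1 / a)) a \<le> epowr (ennreal B) a" using a by (intro epowr_mono) auto
   then show "?I \<le> ennreal (B powr a)" using a B by (simp add: epowr_epowr epowr_one epowr_ennreal)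
  next
   assume "?I \<le> ennreal (B powr a)"
   then have "epowr ?I (1 / a) \<le> epowr (ennreal (B powr a)) (1 / a)" using a by (intro epowr_mono) auto
   then show "epowr ?I (1 / a) \<le> ennreal B" using a B by (simp add: epowr_ennreal powr_powr)
  qed
  moreover have "(\<integral>\<^sup>+x\<in>Q. lp_young p (norm (f x) / B) \<partial>lebesgue) = ennreal (1 / B powr a) * ?I"
  proof -
   have "(\<integral>\<^sup>+x\<in>Q. lp_young p (norm (f x) / B) \<partial>lebesgue) = (\<integral>\<^sup>+x. ennreal (1 / B powr a) * (ennreal (norm (f x) powr a) * indicator Q x) \<partial>lebesgue)"
    unfolding lp_young_finite[OF False]
    by (intro nn_integral_cong) (auto simp: a_def powr_divide indicator_def simp flip: ennreal_mult)
   also have "... = ennreal (1 / B powr a) * ?I"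
   proof (rule nn_integral_cmult)
    have [measurable]: "Q \<in> sets lebesgue" by (rule Q_lebesgue)
    show "(\<lambda>x. ennreal (norm (f x) powr a) * indicator Q x) \<in> borel_measurable lebesgue" by measurable
   qed
   finally show ?thesis .
  qed
  moreover have "?I \<le> ennreal (B powr a) \<longleftrightarrow> ennreal (1 / B powr a) * ?I \<le> 1"
  proof
   assume "?I \<le> ennreal (B powr a)"
   then have "ennreal (1 / B powr a) * ?I \<le> ennreal (1 / B powr a) * ennreal (B powr a)" by (rule mult_left_mono) simp
   then show "ennreal (1 / B powr a) * ?I \<le> 1" using B by (simp flip: ennreal_mult)
  next
   assume "ennreal (1 / B powr a) * ?I \<le> 1"
   then have "ennreal (B powr a) * (ennreal (1 / B powr a) * ?I) \<le> ennreal (B powr a) * 1" by (rule mult_left_mono) simp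
   then show "?I \<le> ennreal (B powr a)" using B by (simp add: mult.assoc[symmetric] flip: ennreal_mult)
  qed
  ultimately show ?thesis by simp
 qed
qed

lemma L_finite_V: "L f < \<infinity> ==> f \<in> V"
 by (auto simp: L_def split: if_splits)

text \<open>The characterisation \<open>L_le_iff\<close> needs B > 0, whereas the norm may vanish.
  So estimates are proved for every positive bound B of the norm, and B is then lowered to
  it.\<close>

lemma L_leI:
 assumes "\<And>B. B > 0 ==> L f \<le> ennreal B ==> x \<le> ennreal (c * B)" and c: "0 < c"
 shows "x \<le> ennreal c * L f"
proof (cases "L f = \<infinity>")
 case True then show ?thesis using c by (simp add: ennreal_mult_top)
next
 case False
 show ?thesis
 proof (rule ennreal_le_epsilon)
  fix e :: real assume e: "0 < e"
  define B where "B = enn2real (L f) + e / c"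
  have B: "B > 0" "L f \<le> ennreal B" "c * B = c * enn2real (L f) + e"
   using False e c by (simp_all add: B_def add_nonneg_pos distrib_left ennreal_plus less_top add_increasing2)
  have "x \<le> ennreal (c * B)" by (rule assms(1)[OF B(1,2)])
  also have "... = ennreal c * ennreal (enn2real (L f)) + ennreal e" unfolding B(3) using c e by (simp add: ennreal_mult)
  also have "ennreal (enn2real (L f)) = L f" using False by (simp add: less_top)
  finally show "x \<le> ennreal c * L f + ennreal e" .
 qed
qed

lemma V_add: "f \<in> V ==> g \<in> V ==> (\<lambda>x. f x + g x) \<in> V"
 by (auto simp: V_def periodic_def)

lemma V_diff: "f \<in> V ==> g \<in> V ==> (\<lambda>x. f x - g x) \<in> V"
 by (auto simp: V_def periodic_def)

lemma V_cmult: "f \<in> V ==> (\<lambda>x. c * f x) \<in> V"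
 by (auto simp: V_def periodic_def)

lemma V_shift: "f \<in> V ==> (\<lambda>x. f (x + h)) \<in> V"
 by (auto simp: V_def lebesgue_measurable_shift periodic_shift)

lemma L_AE_eq:
 assumes "f \<in> V" "g \<in> V" "AE x in lborel. f x = g x"
 shows "L f = L g"
proof -
 have *: "L f \<le> L g" if "f \<in> V" "g \<in> V" "AE x in lborel. f x = g x" for f g
 proof -
  have "L f \<le> ennreal B" if "B > 0" "L g \<le> ennreal B" for B
  proof -
   have "(\<integral>\<^sup>+x\<in>Q. lp_young p (norm (f x) / B) \<partial>lebesgue) = (\<integral>\<^sup>+x\<in>Q. lp_young p (norm (g x) / B) \<partial>lebesgue)"
    using AE_completion[OF \<open>AE x in lborel. f x = g x\<close>] by (intro nn_integral_cong_AE) (auto elim!: eventually_mono)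
   then show ?thesis using that \<open>f \<in> V\<close> \<open>g \<in> V\<close> by (simp add: L_le_iff)
  qed
  then show ?thesis using L_leI[of g "L f" 1] by simp
 qed
 have "AE x in lborel. g x = f x" using assms(3) by eventually_elim simp
 then show ?thesis using *[of f g] *[of g f] assms by (intro antisym) blast+
qed

sublocale translation_seminorm L
proof
 fix f g :: "'a => complex" and c :: complex and h :: 'a
 show "L (\<lambda>x. f x + g x) \<le> L f + L g"
 proof (cases "L f = \<infinity> \<or> L g = \<infinity>")
  case False
  then have V: "f \<in> V" "g \<in> V" using L_finite_V by (auto simp: less_top[symmetric])
  then have [measurable]: "f \<in> borel_measurable lebesgue" "g \<in> borel_measurable lebesgue" by (auto simp: V_def)
  \<comment> \<open>Minkowski's inequality from convexity: (f + g)/(A + B) is the combination of f/A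
    and g/B with weights A/(A + B) and B/(A + B).\<close>
  have step: "L (\<lambda>x. f x + g x) \<le> ennreal A + ennreal B" if A: "A > 0" "L f \<le> ennreal A" and B: "B > 0" "L g \<le> ennreal B" for A B
  proof -
   have "(\<integral>\<^sup>+x\<in>Q. lp_young p (norm (f x + g x) / (A + B)) \<partial>lebesgue)
     \<le> (\<integral>\<^sup>+x. ennreal (A / (A + B)) * (lp_young p (norm (f x) / A) * indicator Q x) + ennreal (B / (A + B)) * (lp_young p (norm (g x) / B) * indicator Q x) \<partial>lebesgue)"
   proof (intro nn_integral_mono)
    fix x
    have "norm (f x + g x) / (A + B) \<le> (norm (f x) + norm (g x)) / (A + B)"
     using A B norm_triangle_ineq by (intro divide_right_mono) auto
    also have "... = A / (A + B) * (norm (f x) / A) + B / (A + B) * (norm (g x) / B)"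
     using A B by (simp add: add_divide_distrib)
    finally have "lp_young p (norm (f x + g x) / (A + B)) \<le> lp_young p (A / (A + B) * (norm (f x) / A) + B / (A + B) * (norm (g x) / B))"
     using A B by (intro lp_young_mono p) auto
    also have "... \<le> ennreal (A / (A + B)) * lp_young p (norm (f x) / A) + ennreal (B / (A + B)) * lp_young p (norm (g x) / B)"
     using A B by (intro lp_young_convex p) (auto simp: add_divide_distrib[symmetric])
    finally show "lp_young p (norm (f x + g x) / (A + B)) * indicator Q x \<le> ennreal (A / (A + B)) * (lp_young p (norm (f x) / A) * indicator Q x) + ennreal (B / (A + B)) * (lp_young p (norm (g x) / B) * indicator Q x)"
     by (auto simp: indicator_def)
   qed
   also have "... = ennreal (A / (A + B)) * (\<integral>\<^sup>+x\<in>Q. lp_young p (norm (f x) / A) \<partial>lebesgue) + ennreal (B / (A + B)) * (\<integral>\<^sup>+x\<in>Q. lp_young p (norm (g x) / B) \<partial>lebesgue)"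
   proof -
    have [measurable]: "Q \<in> sets lebesgue" by (rule Q_lebesgue)
    have m: "(\<lambda>x. lp_young p (norm (f x) / A) * indicator Q x) \<in> borel_measurable lebesgue"
     "(\<lambda>x. lp_young p (norm (g x) / B) * indicator Q x) \<in> borel_measurable lebesgue"
     by measurable
    show ?thesis
     using nn_integral_add[of "\<lambda>x. ennreal (A / (A + B)) * (lp_young p (norm (f x) / A) * indicator Q x)" lebesgue
       "\<lambda>x. ennreal (B / (A + B)) * (lp_young p (norm (g x) / B) * indicator Q x)"] m
     by (simp only: nn_integral_cmult[OF m(1)] nn_integral_cmult[OF m(2)] borel_measurable_times_ennreal borel_measurable_const)
   qed
   also have "... \<le> ennreal (A / (A + B)) * 1 + ennreal (B / (A + B)) * 1"
    using A B V by (intro add_mono mult_left_mono) (auto simp: L_le_iff[symmetric])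
   also have "... = 1" using A B by (simp add: add_divide_distrib[symmetric] flip: ennreal_plus)
   finally show ?thesis using A B V L_le_iff[OF V_add[OF V], of "A + B"] by simp
  qed
  have step2: "L (\<lambda>x. f x + g x) \<le> ennreal A + L g" if A: "A > 0" "L f \<le> ennreal A" for A
  proof (rule ennreal_le_epsilon)
   fix e :: real assume "0 < e"
   have "L g \<le> ennreal (enn2real (L g) + e)" using False \<open>0 < e\<close> by (simp add: ennreal_plus less_top add_increasing2)
   then have "L (\<lambda>x. f x + g x) \<le> ennreal A + ennreal (enn2real (L g) + e)"
    using \<open>0 < e\<close> by (intro step A) (auto intro: add_nonneg_pos)
   then show "L (\<lambda>x. f x + g x) \<le> ennreal A + L g + ennreal e" using False \<open>0 < e\<close> by (simp add: ennreal_plus less_top add.assoc)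
  qed
  show ?thesis
  proof (rule ennreal_le_epsilon)
   fix e :: real assume "0 < e"
   have "L f \<le> ennreal (enn2real (L f) + e)" using False \<open>0 < e\<close> by (simp add: ennreal_plus less_top add_increasing2)
   then have "L (\<lambda>x. f x + g x) \<le> ennreal (enn2real (L f) + e) + L g"
    using \<open>0 < e\<close> by (intro step2) (auto intro: add_nonneg_pos)
   then show "L (\<lambda>x. f x + g x) \<le> L f + L g + ennreal e" using False \<open>0 < e\<close> by (simp add: ennreal_plus less_top add_ac)
  qed
 qed auto
 show "L (\<lambda>x. c * f x) \<le> ennreal (norm c) * L f"
 proof (cases "c = 0")
  case True
  have 0: "(\<lambda>x. 0) \<in> V" by (auto simp: V_def periodic_def)
  have "L (\<lambda>x. 0) \<le> 0"
  proof (rule ennreal_le_epsilon)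
   fix e :: real assume "0 < e"
   then show "L (\<lambda>x. 0) \<le> 0 + ennreal e" using L_le_iff[OF 0, of e] lp_young_0[OF p] by simp
  qed
  then show ?thesis using True by simp
 next
  case False
  show ?thesis
  proof (rule L_leI)
   fix B assume B: "B > 0" "L f \<le> ennreal B"
   then have V: "f \<in> V" by (intro L_finite_V) (auto intro: le_less_trans)
   have "L (\<lambda>x. c * f x) \<le> ennreal (norm c * B) \<longleftrightarrow> L f \<le> ennreal B"
    using False B V L_le_iff[OF V_cmult[OF V], of "norm c * B" c] L_le_iff[OF V B(1)] by (simp add: norm_mult)
   then show "L (\<lambda>x. c * f x) \<le> ennreal (norm c * B)" using B by simp
  qed (use False in simp)
 qed
 have "L (\<lambda>x. f (x + h)) \<le> ennreal 1 * L f"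
 proof (rule L_leI)
  fix B assume B: "B > 0" "L f \<le> ennreal B"
  then have V: "f \<in> V" by (intro L_finite_V) (auto intro: le_less_trans)
  then have [measurable]: "f \<in> borel_measurable lebesgue" by (simp add: V_def)
  have "(\<integral>\<^sup>+x\<in>Q. lp_young p (norm (f (x + h)) / B) \<partial>lebesgue) = (\<integral>\<^sup>+x\<in>Q. lp_young p (norm (f x) / B) \<partial>lebesgue)"
   by (rule nn_integral_shift) (use V in \<open>auto simp: V_def periodic_def\<close>)
  then show "L (\<lambda>x. f (x + h)) \<le> ennreal (1 * B)"
   using B L_le_iff[OF V B(1)] L_le_iff[OF V_shift[OF V] B(1)] by simp
 qed simp
 then show "L (\<lambda>x. f (x + h)) \<le> L f" by simp
qed

text \<open>The integral of the Young function is finite over every compact set by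
  \<open>nn_integral_local\<close>, and \<open>le_one_plus_lp_young\<close> turns this into local
  integrability.\<close>

lemma L_finite_loc_integrable:
 assumes f: "L f < \<infinity>" "f \<in> borel_measurable borel" shows "loc_integrable f"
 unfolding loc_integrable_def
proof (intro conjI allI impI)
 show "f \<in> borel_measurable borel" by fact
 note [measurable] = f(2)
 have V: "f \<in> V" using f by (intro L_finite_V)
 fix K :: "'a set" assume K: "compact K"
 then have [measurable]: "K \<in> sets borel" by (rule borel_compact)
 define B where "B = enn2real (L f) + 1"
 have B: "B > 0" "L f \<le> ennreal B" using f by (auto simp: B_def add_nonneg_pos ennreal_plus less_top add_increasing2)
 obtain C where C: "C < \<infinity>" "\<And>F :: 'a => ennreal. F \<in> borel_measurable lebesgue ==> periodic P F ==> (\<integral>\<^sup>+x\<in>K. F x \<partial>lebesgue) \<le> C * (\<integral>\<^sup>+x\<in>Q. F x \<partial>lebesgue)"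
  using nn_integral_local[OF K] by metis
 have fin: "(\<integral>\<^sup>+x\<in>K. lp_young p (norm (f x) / B) \<partial>lebesgue) < \<infinity>"
 proof -
  have "(\<integral>\<^sup>+x\<in>K. lp_young p (norm (f x) / B) \<partial>lebesgue) \<le> C * (\<integral>\<^sup>+x\<in>Q. lp_young p (norm (f x) / B) \<partial>lebesgue)"
   by (rule C(2)) (use V in \<open>auto simp: V_def periodic_def\<close>)
  also have "... \<le> C * 1" using B L_le_iff[OF V B(1)] by (intro mult_left_mono) auto
  finally show ?thesis using C(1) by (auto intro: le_less_trans)
 qed
 have "(\<integral>\<^sup>+x. indicator K x * ennreal (norm (f x)) \<partial>lborel) \<le> (\<integral>\<^sup>+x. ennreal B * (indicator K x + lp_young p (norm (f x) / B) * indicator K x) \<partial>lborel)"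
 proof (intro nn_integral_mono)
  fix x
  have "ennreal (norm (f x)) = ennreal B * ennreal (norm (f x) / B)" using B by (simp flip: ennreal_mult)
  also have "... \<le> ennreal B * (1 + lp_young p (norm (f x) / B))"
   using B by (intro mult_left_mono le_one_plus_lp_young p) auto
  finally show "indicator K x * ennreal (norm (f x)) \<le> ennreal B * (indicator K x + lp_young p (norm (f x) / B) * indicator K x)"
   by (auto simp: indicator_def)
 qed
 also have "... = ennreal B * (emeasure lborel K + (\<integral>\<^sup>+x\<in>K. lp_young p (norm (f x) / B) \<partial>lborel))"
  by (subst nn_integral_cmult; (subst nn_integral_add)?) auto
 also have "... < \<infinity>"
  using fin emeasure_compact_finite[OF K] unfolding nn_integral_completion by (auto simp: ennreal_mult_less_top)
 finally show "(\<integral>\<^sup>+x. indicator K x * ennreal (norm (f x)) \<partial>lborel) < \<infinity>" .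
qed

text \<open>Minkowski's inequality for an average over the unit interval: Jensen's inequality at
  each x, then Tonelli's theorem, for which joint Borel measurability is assumed.\<close>

lemma L_average:
 fixes F :: "'a => real => complex"
 assumes F [measurable]: "(\<lambda>(x, u). F x u) \<in> borel_measurable (borel \<Otimes>\<^sub>M borel)"
  and per: "\<And>u. periodic P (\<lambda>x. F x u)" and B: "\<And>u. 0 \<le> u ==> u \<le> 1 ==> L (\<lambda>x. F x u) \<le> B"
 shows "L (\<lambda>x. \<integral>u. indicator {0..1} u *\<^sub>R F x u \<partial>lborel) \<le> B"
proof (cases "B = \<infinity>")
 case False
 let ?A = "\<lambda>x. \<integral>u. indicator {0..1} u *\<^sub>R F x u \<partial>lborel"
 have Am: "?A \<in> borel_measurable borel" by measurable
 have "?A \<in> borel_measurable lebesgue" using Am by (intro measurable_completion) simp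
 then have A: "?A \<in> V" using per by (auto simp: V_def periodic_def)
 have FV: "(\<lambda>x. F x u) \<in> V" for u
 proof -
  have "(\<lambda>x. F x u) \<in> borel_measurable lborel" by measurable
  then have "(\<lambda>x. F x u) \<in> borel_measurable lebesgue" by (rule measurable_completion)
  then show ?thesis using per by (auto simp: V_def)
 qed
 show ?thesis
 proof (rule ennreal_le_epsilon)
  fix e :: real assume e: "0 < e"
  define b where "b = enn2real B + e"
  have b: "b > 0" "ennreal b = B + ennreal e" using e False by (auto simp: b_def add_nonneg_pos ennreal_plus less_top)
  have "(\<integral>\<^sup>+x\<in>Q. lp_young p (norm (?A x) / b) \<partial>lborel) \<le> (\<integral>\<^sup>+x. (\<integral>\<^sup>+u. lp_young p (norm (F x u) / b) * indicator {0..1} u * indicator Q x \<partial>lborel) \<partial>lborel)"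
  proof (intro nn_integral_mono)
   fix x
   have "lp_young p (norm (?A x) / b) * indicator Q x \<le> (\<integral>\<^sup>+u\<in>{0..1}. lp_young p (norm (F x u) / b) \<partial>lborel) * indicator Q x"
    by (intro mult_right_mono lp_young_jensen p b) auto
   also have "... = (\<integral>\<^sup>+u. lp_young p (norm (F x u) / b) * indicator {0..1} u * indicator Q x \<partial>lborel)"
    by (rule nn_integral_multc[symmetric]) measurable
   finally show "lp_young p (norm (?A x) / b) * indicator Q x \<le> (\<integral>\<^sup>+u. lp_young p (norm (F x u) / b) * indicator {0..1} u * indicator Q x \<partial>lborel)" .
  qed
  also have "... = (\<integral>\<^sup>+u. (\<integral>\<^sup>+x. lp_young p (norm (F x u) / b) * indicator {0..1} u * indicator Q x \<partial>lborel) \<partial>lborel)"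
   by (rule lborel_pair.Fubini'[symmetric]) measurable
  also have "... \<le> (\<integral>\<^sup>+u. indicator {0..1::real} u \<partial>lborel)"
  proof (intro nn_integral_mono)
   fix u :: real
   show "(\<integral>\<^sup>+x. lp_young p (norm (F x u) / b) * indicator {0..1} u * indicator Q x \<partial>lborel) \<le> indicator {0..1} u"
   proof (cases "u \<in> {0..1}")
    case True
    have "L (\<lambda>x. F x u) \<le> B" using True by (intro B) auto
    also have "B \<le> ennreal b" using b by simp
    finally show ?thesis using True L_le_iff[OF FV b(1), of u] by (simp add: nn_integral_completion)
   qed simp
  qed
  also have "... = 1" by simp
  finally show "L ?A \<le> B + ennreal e" using L_le_iff[OF A b(1)] b(2) by (simp add: nn_integral_completion)
 qed
qed simp

end

section \<open>Steklov means and weak derivatives\<close>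

lemma cball_sets_borel [measurable]: "cball (x::'a::euclidean_space) r \<in> sets borel"
 by simp

lemma nn_integral_lborel_shift:
 fixes f :: "'a::euclidean_space => ennreal"
 assumes [measurable]: "f \<in> borel_measurable borel"
 shows "(\<integral>\<^sup>+x. f (x + h) \<partial>lborel) = (\<integral>\<^sup>+x. f x \<partial>lborel)"
proof -
 have "(\<integral>\<^sup>+x. f x \<partial>lborel) = (\<integral>\<^sup>+x. f x \<partial>distr lborel borel ((+) h))" by (simp add: lborel_distr_plus)
 also have "... = (\<integral>\<^sup>+x. f (h + x) \<partial>lborel)" by (rule nn_integral_distr) auto
 finally show ?thesis by (simp add: add.commute)
qed

lemma integral_lborel_shift:
 fixes f :: "'a::euclidean_space => complex"
 assumes [measurable]: "f \<in> borel_measurable borel"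
 shows "(\<integral>x. f (x + h) \<partial>lborel) = (\<integral>x. f x \<partial>lborel)"
proof -
 have "(\<integral>x. f x \<partial>lborel) = (\<integral>x. f x \<partial>distr lborel borel ((+) h))" by (simp add: lborel_distr_plus)
 also have "... = (\<integral>x. f (h + x) \<partial>lborel)" by (rule integral_distr) auto
 finally show ?thesis by (simp add: add.commute)
qed

lemma loc_integrable_add:
 assumes "loc_integrable f" "loc_integrable g" shows "loc_integrable (\<lambda>x. f x + g x)"
proof -
 have "loc_integrable (\<lambda>x. 0 - g x)"
  by (rule loc_integrable_diff) (use assms in \<open>auto simp: loc_integrable_def\<close>)
 then show ?thesis using loc_integrable_diff[OF assms(1)] by fastforce
qed

lemma loc_integrable_cmult:
 assumes "loc_integrable f" shows "loc_integrable (\<lambda>x. c * f x)"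
 unfolding loc_integrable_def
proof (intro conjI allI impI)
 have [measurable]: "f \<in> borel_measurable borel" using assms by (rule loc_integrable_borel)
 show "(\<lambda>x. c * f x) \<in> borel_measurable borel" by measurable
 fix K :: "'a set" assume K: "compact K"
 then have [measurable]: "K \<in> sets borel" by (rule borel_compact)
 have "(\<integral>\<^sup>+x. indicator K x * ennreal (norm (c * f x)) \<partial>lborel) = (\<integral>\<^sup>+x. ennreal (norm c) * (indicator K x * ennreal (norm (f x))) \<partial>lborel)"
  by (intro nn_integral_cong) (auto simp: norm_mult ennreal_mult mult_ac)
 also have "... = ennreal (norm c) * (\<integral>\<^sup>+x. indicator K x * ennreal (norm (f x)) \<partial>lborel)"
  by (rule nn_integral_cmult) measurable
 finally show "(\<integral>\<^sup>+x. indicator K x * ennreal (norm (c * f x)) \<partial>lborel) < \<infinity>"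
  using assms K by (auto simp: loc_integrable_def ennreal_mult_less_top)
qed

lemma loc_integrable_shift_bound:
 assumes f: "loc_integrable f" and h: "norm h \<le> r"
 shows "(\<integral>\<^sup>+x. indicator (cball 0 R) x * ennreal (norm (f (x + h))) \<partial>lborel)
  \<le> (\<integral>\<^sup>+x. indicator (cball 0 (R + r)) x * ennreal (norm (f x)) \<partial>lborel)"
proof -
 have [measurable]: "f \<in> borel_measurable borel" using f by (rule loc_integrable_borel)
 have "(\<integral>\<^sup>+x. indicator (cball 0 R) x * ennreal (norm (f (x + h))) \<partial>lborel)
   \<le> (\<integral>\<^sup>+x. indicator (cball 0 (R + r)) (x + h) * ennreal (norm (f (x + h))) \<partial>lborel)"
  using h by (intro nn_integral_mono) (auto simp: indicator_def intro: order.trans[OF norm_triangle_ineq])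
 also have "... = (\<integral>\<^sup>+x. indicator (cball 0 (R + r)) x * ennreal (norm (f x)) \<partial>lborel)"
  by (rule nn_integral_lborel_shift) measurable
 finally show ?thesis .
qed

lemma loc_integrable_shift:
 assumes f: "loc_integrable f" shows "loc_integrable (\<lambda>x. f (x + h))"
 unfolding loc_integrable_def
proof (intro conjI allI impI)
 have [measurable]: "f \<in> borel_measurable borel" using f by (rule loc_integrable_borel)
 show "(\<lambda>x. f (x + h)) \<in> borel_measurable borel" by measurable
 fix K :: "'a set" assume K: "compact K"
 then obtain R where R: "K \<subseteq> cball 0 R" using bounded_subset_ballD[OF compact_imp_bounded[OF K], of 0] ball_subset_cball by (metis order.trans)
 have "(\<integral>\<^sup>+x. indicator K x * ennreal (norm (f (x + h))) \<partial>lborel) \<le> (\<integral>\<^sup>+x. indicator (cball 0 R) x * ennreal (norm (f (x + h))) \<partial>lborel)"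
  using R by (intro nn_integral_mono mult_right_mono) (auto simp: indicator_def)
 also have "... \<le> (\<integral>\<^sup>+x. indicator (cball 0 (R + norm h)) x * ennreal (norm (f x)) \<partial>lborel)"
  by (rule loc_integrable_shift_bound[OF f order_refl])
 also have "... < \<infinity>" using f compact_cball[of 0 "R + norm h"] by (auto simp: loc_integrable_def)
 finally show "(\<integral>\<^sup>+x. indicator K x * ennreal (norm (f (x + h))) \<partial>lborel) < \<infinity>" .
qed

definition steklov :: "'a::euclidean_space => ('a => complex) => 'a => complex" where
 "steklov h f x = unit_mean (\<lambda>u. f (x + u *\<^sub>R h))"

lemma steklov_zero: "steklov 0 f = f"
 by (auto simp: steklov_def fun_eq_iff)

lemma steklov_measurable:
 assumes [measurable]: "f \<in> borel_measurable borel" shows "steklov h f \<in> borel_measurable borel"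
 unfolding steklov_def by measurable

text \<open>Where the section is not integrable the mean is 0 by convention and not additive.
  Tonelli's theorem on balls of integer radius shows that such points form a null set.\<close>

lemma steklov_AE_integrable:
 assumes f: "loc_integrable f"
 shows "AE x in lborel. integrable lborel (\<lambda>u. indicator {0..1} u *\<^sub>R f (x + u *\<^sub>R h))"
proof -
 have [measurable]: "f \<in> borel_measurable borel" using f by (rule loc_integrable_borel)
 let ?I = "\<lambda>x. \<integral>\<^sup>+u. indicator {0..1} u * ennreal (norm (f (x + u *\<^sub>R h))) \<partial>lborel"
 have "AE x in lborel. indicator (cball 0 (real n)) x * ?I x \<noteq> \<infinity>" for n
 proof (rule nn_integral_PInf_AE)
  show "(\<lambda>x. indicator (cball 0 (real n)) x * ?I x) \<in> borel_measurable lborel" by measurable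
  let ?C = "\<integral>\<^sup>+x. indicator (cball 0 (real n + norm h)) x * ennreal (norm (f x)) \<partial>lborel"
  have "(\<integral>\<^sup>+x. indicator (cball 0 (real n)) x * ?I x \<partial>lborel)
    = (\<integral>\<^sup>+x. (\<integral>\<^sup>+u. indicator (cball 0 (real n)) x * (indicator {0..1} u * ennreal (norm (f (x + u *\<^sub>R h)))) \<partial>lborel) \<partial>lborel)"
   by (intro nn_integral_cong nn_integral_cmult[symmetric]) measurable
  also have "... = (\<integral>\<^sup>+u. (\<integral>\<^sup>+x. indicator (cball 0 (real n)) x * (indicator {0..1} u * ennreal (norm (f (x + u *\<^sub>R h)))) \<partial>lborel) \<partial>lborel)"
   by (rule lborel_pair.Fubini'[symmetric]) measurable
  also have "... \<le> (\<integral>\<^sup>+u. ?C * indicator {0..1::real} u \<partial>lborel)"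
  proof (intro nn_integral_mono)
   fix u :: real
   show "(\<integral>\<^sup>+x. indicator (cball 0 (real n)) x * (indicator {0..1} u * ennreal (norm (f (x + u *\<^sub>R h)))) \<partial>lborel) \<le> ?C * indicator {0..1} u"
   proof (cases "u \<in> {0..1}")
    case True
    then have "norm (u *\<^sub>R h) \<le> norm h" by (simp add: mult_left_le_one_le)
    from loc_integrable_shift_bound[OF f this, of "real n"] show ?thesis using True by simp
   qed simp
  qed
  also have "... = ?C" by (simp add: nn_integral_cmult)
  also have "... < \<infinity>" using f compact_cball[of 0 "real n + norm h"] by (auto simp: loc_integrable_def)
  finally show "(\<integral>\<^sup>+x. indicator (cball 0 (real n)) x * ?I x \<partial>lborel) \<noteq> \<infinity>" by simp
 qed
 then have "AE x in lborel. \<forall>n. indicator (cball 0 (real n)) x * ?I x \<noteq> \<infinity>" by (subst AE_all_countable) blast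
 then show ?thesis
 proof eventually_elim
  case (elim x)
  obtain n where "norm x \<le> real n" using real_arch_simple by blast
  then have fin: "?I x \<noteq> \<infinity>" using elim[rule_format, of n] by simp
  have "(\<integral>\<^sup>+u. ennreal (norm (indicator {0..1} u *\<^sub>R f (x + u *\<^sub>R h))) \<partial>lborel) = ?I x"
   by (intro nn_integral_cong) (auto simp: indicator_def)
  then show ?case using fin by (intro integrableI_bounded) (auto simp: less_top)
 qed
qed

text \<open>One integrability statement for both exchanges of integrals in
  \<open>steklov_dual\<close>: h = 0 leaves the translation on f, h' = 0 leaves it on the test
  function.\<close>

lemma integrable_average_kernel:
 fixes \<phi> :: "'a::euclidean_space => real"
 assumes f: "loc_integrable f" and [measurable]: "\<phi> \<in> borel_measurable borel"
  and B: "\<And>x. \<bar>\<phi> x\<bar> \<le> B" and R: "\<And>x. \<phi> x \<noteq> 0 ==> norm x \<le> R"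
 shows "integrable (lborel \<Otimes>\<^sub>M lborel) (\<lambda>(x, u). (indicator {0..1} u * \<phi> (x + u *\<^sub>R h)) *\<^sub>R f (x + u *\<^sub>R h'))"
proof (rule integrableI_bounded)
 have [measurable]: "f \<in> borel_measurable borel" using f by (rule loc_integrable_borel)
 show "(\<lambda>(x, u). (indicator {0..1} u * \<phi> (x + u *\<^sub>R h)) *\<^sub>R f (x + u *\<^sub>R h')) \<in> borel_measurable (lborel \<Otimes>\<^sub>M lborel)"
  by measurable
 have "B \<ge> 0" using B[of 0] by linarith
 let ?r = "R + norm h"
 let ?C = "\<integral>\<^sup>+x. indicator (cball 0 (?r + norm h')) x * ennreal (norm (f x)) \<partial>lborel"
 have "(\<integral>\<^sup>+z. ennreal (norm (case z of (x, u) => (indicator {0..1} u * \<phi> (x + u *\<^sub>R h)) *\<^sub>R f (x + u *\<^sub>R h'))) \<partial>(lborel \<Otimes>\<^sub>M lborel))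
   = (\<integral>\<^sup>+u. (\<integral>\<^sup>+x. ennreal (norm ((indicator {0..1} u * \<phi> (x + u *\<^sub>R h)) *\<^sub>R f (x + u *\<^sub>R h'))) \<partial>lborel) \<partial>lborel)"
  by (subst lborel_pair.nn_integral_snd[symmetric]) (auto simp: case_prod_beta')
 also have "... \<le> (\<integral>\<^sup>+u. ennreal B * ?C * indicator {0..1::real} u \<partial>lborel)"
 proof (intro nn_integral_mono)
  fix u :: real
  show "(\<integral>\<^sup>+x. ennreal (norm ((indicator {0..1} u * \<phi> (x + u *\<^sub>R h)) *\<^sub>R f (x + u *\<^sub>R h'))) \<partial>lborel) \<le> ennreal B * ?C * indicator {0..1} u"
  proof (cases "u \<in> {0..1}")
   case True
   then have u: "norm (u *\<^sub>R h') \<le> norm h'" "norm (u *\<^sub>R h) \<le> norm h" by (simp_all add: mult_left_le_one_le)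
   have "(\<integral>\<^sup>+x. ennreal (norm ((indicator {0..1} u * \<phi> (x + u *\<^sub>R h)) *\<^sub>R f (x + u *\<^sub>R h'))) \<partial>lborel)
     \<le> (\<integral>\<^sup>+x. ennreal B * (indicator (cball 0 ?r) x * ennreal (norm (f (x + u *\<^sub>R h')))) \<partial>lborel)"
   proof (intro nn_integral_mono)
    fix x
    show "ennreal (norm ((indicator {0..1} u * \<phi> (x + u *\<^sub>R h)) *\<^sub>R f (x + u *\<^sub>R h'))) \<le> ennreal B * (indicator (cball 0 ?r) x * ennreal (norm (f (x + u *\<^sub>R h'))))"
    proof (cases "\<phi> (x + u *\<^sub>R h) = 0")
     case False
     then have "norm (x + u *\<^sub>R h) \<le> R" by (rule R)
     then have "norm x \<le> ?r" using norm_triangle_ineq4[of "x + u *\<^sub>R h" "u *\<^sub>R h"] u(2) by simp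
     moreover have "\<bar>\<phi> (x + u *\<^sub>R h)\<bar> * norm (f (x + u *\<^sub>R h')) \<le> B * norm (f (x + u *\<^sub>R h'))"
      by (intro mult_right_mono B) simp
     ultimately show ?thesis using True \<open>B \<ge> 0\<close> by (simp add: ennreal_leI flip: ennreal_mult)
    qed simp
   qed
   also have "... = ennreal B * (\<integral>\<^sup>+x. indicator (cball 0 ?r) x * ennreal (norm (f (x + u *\<^sub>R h'))) \<partial>lborel)"
    by (rule nn_integral_cmult) measurable
   also have "... \<le> ennreal B * ?C" by (intro mult_left_mono loc_integrable_shift_bound[OF f u(1)]) simp
   finally show ?thesis using True by simp
  qed simp
 qed
 also have "... = ennreal B * ?C" by (simp add: nn_integral_cmult)
 also have "... < \<infinity>" using f compact_cball[of 0 "?r + norm h'"] by (auto simp: loc_integrable_def ennreal_mult_less_top)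
 finally show "(\<integral>\<^sup>+z. ennreal (norm (case z of (x, u) => (indicator {0..1} u * \<phi> (x + u *\<^sub>R h)) *\<^sub>R f (x + u *\<^sub>R h'))) \<partial>(lborel \<Otimes>\<^sub>M lborel)) < \<infinity>" .
qed

lemma test_function_line_integrable:
 assumes \<phi>: "\<phi> \<in> test_functions"
 shows "integrable lborel (\<lambda>u. indicator {0..1::real} u *\<^sub>R \<phi> (x - u *\<^sub>R h))"
proof (rule borel_integrable_compact)
 have "continuous_on {0..1} (\<lambda>u::real. x - u *\<^sub>R h)" by (intro continuous_intros)
 from continuous_on_compose2[OF test_function_continuous[OF \<phi>, of UNIV] this]
 show "continuous_on {0..1::real} (\<lambda>u. \<phi> (x - u *\<^sub>R h))" by simp
qed simp

text \<open>Both pairings equal the same average of pairings with translated test functions, so a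
  Steklov mean can be moved to the test function with the opposite translation.\<close>

lemma steklov_dual:
 assumes \<phi>: "\<phi> \<in> test_functions" and f: "loc_integrable f"
 shows "pairing \<phi> (steklov h f) = unit_mean (\<lambda>u. pairing (\<lambda>x. \<phi> (x - u *\<^sub>R h)) f)"
  and "pairing (\<lambda>x. unit_mean (\<lambda>u. \<phi> (x - u *\<^sub>R h))) f = unit_mean (\<lambda>u. pairing (\<lambda>x. \<phi> (x - u *\<^sub>R h)) f)"
proof -
 obtain R where R: "\<And>x. \<phi> x \<noteq> 0 ==> norm x \<le> R" using test_function_bounded_support[OF \<phi>] by metis
 obtain B where B: "\<And>x. \<bar>\<phi> x\<bar> \<le> B" using test_function_bounded[OF \<phi>] by metis
 have [measurable]: "f \<in> borel_measurable borel" "\<phi> \<in> borel_measurable borel"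
  using f \<phi> by (auto intro: loc_integrable_borel test_function_measurable)
 have i1: "integrable (lborel \<Otimes>\<^sub>M lborel) (\<lambda>(x, u). (indicator {0..1} u * \<phi> x) *\<^sub>R f (x + u *\<^sub>R h))"
  using integrable_average_kernel[OF f _ B R, where h = 0 and h' = h] by simp
 have "pairing \<phi> (steklov h f) = (\<integral>x. (\<integral>u. (indicator {0..1} u * \<phi> x) *\<^sub>R f (x + u *\<^sub>R h) \<partial>lborel) \<partial>lborel)"
  unfolding steklov_def
  by (intro Bochner_Integration.integral_cong refl) (simp add: mult.commute flip: integral_scaleR_right)
 also have "... = (\<integral>u. (\<integral>x. (indicator {0..1} u * \<phi> x) *\<^sub>R f (x + u *\<^sub>R h) \<partial>lborel) \<partial>lborel)"
  by (rule lborel_pair.Fubini_integral[OF i1, symmetric])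
 also have "... = unit_mean (\<lambda>u. pairing (\<lambda>x. \<phi> (x - u *\<^sub>R h)) f)"
 proof (intro Bochner_Integration.integral_cong refl)
  fix u :: real
  have "pairing \<phi> (\<lambda>x. f (x + u *\<^sub>R h)) = pairing (\<lambda>x. \<phi> (x - u *\<^sub>R h)) f"
   using integral_lborel_shift[of "\<lambda>x. \<phi> (x - u *\<^sub>R h) *\<^sub>R f x" "u *\<^sub>R h"] by simp
  then show "(\<integral>x. (indicator {0..1} u * \<phi> x) *\<^sub>R f (x + u *\<^sub>R h) \<partial>lborel) = indicator {0..1} u *\<^sub>R (pairing (\<lambda>x. \<phi> (x - u *\<^sub>R h)) f)"
   by (simp flip: scaleR_scaleR)
 qed
 finally show "pairing \<phi> (steklov h f) = unit_mean (\<lambda>u. pairing (\<lambda>x. \<phi> (x - u *\<^sub>R h)) f)" .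
 have i2: "integrable (lborel \<Otimes>\<^sub>M lborel) (\<lambda>(x, u). (indicator {0..1} u * \<phi> (x - u *\<^sub>R h)) *\<^sub>R f x)"
  using integrable_average_kernel[where \<phi> = \<phi> and h = "- h" and h' = 0, OF f _ B R] by simp
 have "unit_mean (\<lambda>u. pairing (\<lambda>x. \<phi> (x - u *\<^sub>R h)) f) = (\<integral>u. (\<integral>x. (indicator {0..1} u * \<phi> (x - u *\<^sub>R h)) *\<^sub>R f x \<partial>lborel) \<partial>lborel)"
  by (intro Bochner_Integration.integral_cong refl) (simp flip: scaleR_scaleR)
 also have "... = (\<integral>x. (\<integral>u. (indicator {0..1} u * \<phi> (x - u *\<^sub>R h)) *\<^sub>R f x \<partial>lborel) \<partial>lborel)"
  by (rule lborel_pair.Fubini_integral[OF i2])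
 also have "... = pairing (\<lambda>x. unit_mean (\<lambda>u. \<phi> (x - u *\<^sub>R h))) f"
 proof (intro Bochner_Integration.integral_cong refl)
  fix x
  have "integrable lborel (\<lambda>u. indicator {0..1} u *\<^sub>R \<phi> (x - u *\<^sub>R h))"
   by (rule test_function_line_integrable[OF \<phi>])
  then show "(\<integral>u. (indicator {0..1} u * \<phi> (x - u *\<^sub>R h)) *\<^sub>R f x \<partial>lborel) = unit_mean (\<lambda>u. \<phi> (x - u *\<^sub>R h)) *\<^sub>R f x"
   by simp
 qed
 finally show "pairing (\<lambda>x. unit_mean (\<lambda>u. \<phi> (x - u *\<^sub>R h))) f = unit_mean (\<lambda>u. pairing (\<lambda>x. \<phi> (x - u *\<^sub>R h)) f)" by simp
qed

text \<open>The weak form of writing f(x + h) - f(x) as the mean of the derivative along h. The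
  derivative is thrown on \<phi>, so f need only be locally integrable. It yields both the
  derivative of a Steklov mean and the bound of differences by gradients.\<close>

lemma integral_test_fdiff:
 assumes \<phi>: "\<phi> \<in> test_functions" and f: "loc_integrable f"
 shows "pairing \<phi> (fdiff h f) = - (\<Sum>b\<in>Basis. (h \<bullet> b) *\<^sub>R (pairing (partials [b] \<phi>) (steklov h f)))"
proof -
 have [measurable]: "f \<in> borel_measurable borel" "\<phi> \<in> borel_measurable borel"
  using f \<phi> by (auto intro: loc_integrable_borel test_function_measurable)
 let ?\<psi> = "\<lambda>b x. \<integral>u. indicator {0..1} u *\<^sub>R partials [b] \<phi> (x - u *\<^sub>R h) \<partial>lborel"
 have \<phi>b: "partials [b] \<phi> \<in> test_functions" if "b \<in> Basis" for b using that by (intro test_function_partials \<phi>) simp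
 have sh: "(\<lambda>x. \<phi> (x - h)) \<in> test_functions" using test_function_shift[OF \<phi>, of "- h"] by simp
 have FTC: "\<phi> (x - h) - \<phi> x = - (\<Sum>b\<in>Basis. (h \<bullet> b) * ?\<psi> b x)" for x
 proof -
  have i: "integrable lborel (\<lambda>u. indicator {0..1} u *\<^sub>R partials [b] \<phi> (x - u *\<^sub>R h))" if "b \<in> Basis" for b
   by (rule test_function_line_integrable[OF \<phi>b[OF that]])
  have "\<phi> (x - h) - \<phi> x = (\<integral>u. (\<Sum>b\<in>Basis. - (h \<bullet> b) * (indicator {0..1} u *\<^sub>R partials [b] \<phi> (x - u *\<^sub>R h))) \<partial>lborel)"
  proof -
   have "\<phi> (x + - h) - \<phi> x = unit_mean (\<lambda>u. \<Sum>b\<in>Basis. (- h \<bullet> b) * partials [b] \<phi> (x + u *\<^sub>R - h))"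
    by (rule test_function_FTC[OF \<phi>])
   also have "... = (\<integral>u. (\<Sum>b\<in>Basis. - (h \<bullet> b) * (indicator {0..1} u *\<^sub>R partials [b] \<phi> (x - u *\<^sub>R h))) \<partial>lborel)"
    by (intro Bochner_Integration.integral_cong refl, unfold real_scaleR_def sum_distrib_left, intro sum.cong refl) simp
   finally show ?thesis by (simp only: add_uminus_conv_diff)
  qed
  also have "... = (\<Sum>b\<in>Basis. - (h \<bullet> b) * ?\<psi> b x)"
   using i by (subst Bochner_Integration.integral_sum) auto
  finally show ?thesis by (simp add: sum_negf)
 qed
 have "pairing \<phi> (fdiff h f) = pairing \<phi> (\<lambda>x. f (x + h)) - pairing \<phi> f"
  unfolding fdiff_def scaleR_diff_right
  by (intro Bochner_Integration.integral_diff test_function_times_integrable \<phi> f loc_integrable_shift)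
 also have "pairing \<phi> (\<lambda>x. f (x + h)) = pairing (\<lambda>x. \<phi> (x - h)) f"
  using integral_lborel_shift[of "\<lambda>x. \<phi> (x - h) *\<^sub>R f x" h] by simp
 also have "pairing (\<lambda>x. \<phi> (x - h)) f - pairing \<phi> f = pairing (\<lambda>x. (\<phi> (x - h) - \<phi> x)) f"
  unfolding scaleR_diff_left
  by (rule Bochner_Integration.integral_diff[symmetric]) (intro test_function_times_integrable \<phi> f sh)+
 also have "... = (\<integral>x. (\<Sum>b\<in>Basis. - (h \<bullet> b) *\<^sub>R (?\<psi> b x *\<^sub>R f x)) \<partial>lborel)"
  unfolding FTC by (simp add: sum_negf scaleR_sum_left)
 also have "... = (\<Sum>b\<in>Basis. - (h \<bullet> b) *\<^sub>R (pairing (?\<psi> b) f))"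
 proof (subst Bochner_Integration.integral_sum)
  fix b :: 'a assume b: "b \<in> Basis"
  obtain R where R: "\<And>x. partials [b] \<phi> x \<noteq> 0 ==> norm x \<le> R" using test_function_bounded_support[OF \<phi>b[OF b]] by metis
  obtain B where B: "\<And>x. \<bar>partials [b] \<phi> x\<bar> \<le> B" using test_function_bounded[OF \<phi>b[OF b]] by metis
  have [measurable]: "partials [b] \<phi> \<in> borel_measurable borel" by (rule test_function_measurable[OF \<phi>b[OF b]])
  have "B \<ge> 0" using B[of 0] by linarith
  have "integrable lborel (\<lambda>x. ?\<psi> b x *\<^sub>R f x)"
  proof (rule loc_integrable_times[OF f, where B=B and R="R + norm h"])
   fix x
   have i: "integrable lborel (\<lambda>u. indicator {0..1} u *\<^sub>R partials [b] \<phi> (x - u *\<^sub>R h))"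
    by (rule test_function_line_integrable[OF \<phi>b[OF b]])
   have "\<bar>?\<psi> b x\<bar> \<le> (\<integral>u. norm (indicator {0..1} u *\<^sub>R partials [b] \<phi> (x - u *\<^sub>R h)) \<partial>lborel)"
    using integral_norm_bound[of lborel "\<lambda>u. indicator {0..1} u *\<^sub>R partials [b] \<phi> (x - u *\<^sub>R h)"] by simp
   also have "... \<le> (\<integral>u. B * indicator {0..1::real} u \<partial>lborel)"
    proof (rule integral_mono[OF integrable_norm[OF i]])
    show "integrable lborel (\<lambda>u. B * indicator {0..1::real} u)"
     by (intro integrable_mult_right integrable_real_indicator) auto
   qed (use B in \<open>auto simp: indicator_def\<close>)
   finally show "\<bar>?\<psi> b x\<bar> \<le> B" by simp
   assume nz: "?\<psi> b x \<noteq> 0"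
   show "norm x \<le> R + norm h"
   proof (rule ccontr)
    assume "\<not> norm x \<le> R + norm h"
    then have "indicator {0..1} u *\<^sub>R partials [b] \<phi> (x - u *\<^sub>R h) = 0" for u :: real
    proof (cases "u \<in> {0..1}")
     case True
     then have "norm (u *\<^sub>R h) \<le> norm h" by (simp add: mult_left_le_one_le)
     then have "norm (x - u *\<^sub>R h) > R" using norm_triangle_ineq2[of x "u *\<^sub>R h"] \<open>\<not> norm x \<le> R + norm h\<close> by linarith
     then show ?thesis using R[of "x - u *\<^sub>R h"] by auto
    qed simp
    then have "?\<psi> b x = (\<integral>u. 0 \<partial>(lborel :: real measure))" by (intro Bochner_Integration.integral_cong refl) blast
    then show False using nz by (simp only: integral_zero)
   qed
  qed measurable
  then show "integrable lborel (\<lambda>x. - (h \<bullet> b) *\<^sub>R (?\<psi> b x *\<^sub>R f x))" by (intro integrable_scaleR_right)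
 qed (simp only: integral_scaleR_right)
 also have "... = (\<Sum>b\<in>Basis. - (h \<bullet> b) *\<^sub>R (pairing (partials [b] \<phi>) (steklov h f)))"
  by (intro sum.cong refl) (simp only: steklov_dual[OF \<phi>b f])
 finally show ?thesis by (simp add: sum_negf)
qed

text \<open>Lists of directions instead of multi-indices let derivatives be taken one at a time; by
  \<open>weak_deriv_permute\<close> their order is irrelevant.\<close>

definition weak_deriv :: "'a::euclidean_space list => ('a => complex) => ('a => complex) => bool" where
 "weak_deriv bs f g \<longleftrightarrow> (\<forall>\<phi>\<in>test_functions.
   (pairing (partials bs \<phi>) f) = (- 1) ^ length bs * pairing \<phi> g)"

lemma weak_derivD: "weak_deriv bs f g ==> \<phi> \<in> test_functions ==>
 (pairing (partials bs \<phi>) f) = (- 1) ^ length bs * pairing \<phi> g"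
 by (simp add: weak_deriv_def)

lemma weak_deriv_Nil: "weak_deriv [] f f"
 by (simp add: weak_deriv_def)

lemma weak_deriv_permute:
 assumes "weak_deriv bs f g" "mset bs = mset cs" "set bs \<subseteq> Basis"
 shows "weak_deriv cs f g"
 using assms partials_permute[OF assms(2,3)] by (simp add: weak_deriv_def mset_eq_length[OF assms(2)])

lemma weak_deriv_Cons:
 assumes "weak_deriv [b] f g" "weak_deriv bs g h" "set bs \<subseteq> Basis"
 shows "weak_deriv (b # bs) f h"
 unfolding weak_deriv_def
proof
 fix \<phi> :: "'a => real" assume \<phi>: "\<phi> \<in> test_functions"
 have "pairing (partials (b # bs) \<phi>) f = pairing (partials [b] (partials bs \<phi>)) f"
  by (simp add: partials_append[symmetric])
 also have "... = - pairing (partials bs \<phi>) g"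
  using weak_derivD[OF assms(1) test_function_partials[OF \<phi> assms(3)]] by simp
 also have "... = (- 1) ^ length (b # bs) * pairing \<phi> h"
  using weak_derivD[OF assms(2) \<phi>] by simp
 finally show "pairing (partials (b # bs) \<phi>) f = (- 1) ^ length (b # bs) * pairing \<phi> h" .
qed

lemma weak_deriv_steklov:
 assumes w: "weak_deriv bs f g" and f: "loc_integrable f" and g: "loc_integrable g" and bs: "set bs \<subseteq> Basis"
 shows "weak_deriv bs (steklov h f) (steklov h g)"
 unfolding weak_deriv_def
proof
 fix \<phi> :: "'a => real" assume \<phi>: "\<phi> \<in> test_functions"
 have "pairing (partials bs \<phi>) (steklov h f) = unit_mean (\<lambda>u. pairing (\<lambda>x. partials bs \<phi> (x - u *\<^sub>R h)) f)"
  by (rule steklov_dual(1)[OF test_function_partials[OF \<phi> bs] f])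
 also have "... = unit_mean (\<lambda>u. (- 1) ^ length bs * pairing (\<lambda>x. \<phi> (x - u *\<^sub>R h)) g)"
 proof (intro Bochner_Integration.integral_cong refl arg_cong2[where f="(*\<^sub>R)"])
  fix u :: real
  show "pairing (\<lambda>x. partials bs \<phi> (x - u *\<^sub>R h)) f = (- 1) ^ length bs * pairing (\<lambda>x. \<phi> (x - u *\<^sub>R h)) g"
   using weak_derivD[OF w test_function_shift[OF \<phi>, of "- u *\<^sub>R h"]] partials_shift[OF \<phi> bs, of "- u *\<^sub>R h"] by simp
 qed
 also have "... = (- 1) ^ length bs * unit_mean (\<lambda>u. pairing (\<lambda>x. \<phi> (x - u *\<^sub>R h)) g)"
  by (simp flip: mult_scaleR_right)
 also have "... = (- 1) ^ length bs * pairing \<phi> (steklov h g)"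
  by (simp add: steklov_dual(1)[OF \<phi> g])
 finally show "pairing (partials bs \<phi>) (steklov h f) = (- 1) ^ length bs * pairing \<phi> (steklov h g)" .
qed

lemma weak_deriv_of_steklov:
 assumes f: "loc_integrable f" and b: "b \<in> Basis" and c: "c \<noteq> 0"
 shows "weak_deriv [b] (steklov (c *\<^sub>R b) f) (\<lambda>x. of_real (1 / c) * fdiff (c *\<^sub>R b) f x)"
 unfolding weak_deriv_def
proof
 fix \<phi> :: "'a => real" assume \<phi>: "\<phi> \<in> test_functions"
 have "(\<Sum>b'\<in>Basis. ((c *\<^sub>R b) \<bullet> b') *\<^sub>R (pairing (partials [b'] \<phi>) (steklov (c *\<^sub>R b) f)))
  = (\<Sum>b'\<in>Basis. if b' = b then c *\<^sub>R (pairing (partials [b'] \<phi>) (steklov (c *\<^sub>R b) f)) else 0)"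
  using b by (intro sum.cong refl) (auto simp: inner_Basis)
 also have "... = c *\<^sub>R (pairing (partials [b] \<phi>) (steklov (c *\<^sub>R b) f))"
  using b by (simp add: sum.delta)
 finally have "pairing \<phi> (fdiff (c *\<^sub>R b) f) = - (c *\<^sub>R (pairing (partials [b] \<phi>) (steklov (c *\<^sub>R b) f)))"
  using integral_test_fdiff[OF \<phi> f, of "c *\<^sub>R b"] by simp
 moreover have "pairing \<phi> (\<lambda>x. of_real (1 / c) * fdiff (c *\<^sub>R b) f x) = of_real (1 / c) * pairing \<phi> (fdiff (c *\<^sub>R b) f)"
  by (simp only: mult_scaleR_right[symmetric] integral_mult_right_zero)
 ultimately show "pairing (partials [b] \<phi>) (steklov (c *\<^sub>R b) f) = (- 1) ^ length [b] * pairing \<phi> (\<lambda>x. of_real (1 / c) * fdiff (c *\<^sub>R b) f x)"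
  using c by (simp add: scaleR_conv_of_real)
qed

lemma weak_deriv_add:
 assumes "weak_deriv bs f f'" "weak_deriv bs g g'" "set bs \<subseteq> Basis"
  "loc_integrable f" "loc_integrable f'" "loc_integrable g" "loc_integrable g'"
 shows "weak_deriv bs (\<lambda>x. f x + g x) (\<lambda>x. f' x + g' x)"
 using assms by (auto simp: weak_deriv_def scaleR_add_right test_function_times_integrable test_function_partials distrib_left)

lemma weak_deriv_cmult:
 assumes "weak_deriv bs f f'" shows "weak_deriv bs (\<lambda>x. c * f x) (\<lambda>x. c * f' x)"
 using assms by (auto simp: weak_deriv_def simp flip: mult_scaleR_right)

lemma weak_deriv_shift:
 assumes w: "weak_deriv bs f g" and m [measurable]: "f \<in> borel_measurable borel" "g \<in> borel_measurable borel" and bs: "set bs \<subseteq> Basis"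
 shows "weak_deriv bs (\<lambda>x. f (x + h)) (\<lambda>x. g (x + h))"
 unfolding weak_deriv_def
proof
 fix \<phi> :: "'a => real" assume \<phi>: "\<phi> \<in> test_functions"
 have [measurable]: "\<phi> \<in> borel_measurable borel" "partials bs \<phi> \<in> borel_measurable borel"
  using \<phi> bs by (auto intro!: test_function_measurable test_function_partials)
 have "pairing (partials bs \<phi>) (\<lambda>x. f (x + h)) = pairing (\<lambda>x. partials bs \<phi> (x - h)) f"
  using integral_lborel_shift[of "\<lambda>x. partials bs \<phi> (x - h) *\<^sub>R f x" h] by simp
 also have "... = (- 1) ^ length bs * pairing (\<lambda>x. \<phi> (x - h)) g"
  using weak_derivD[OF w test_function_shift[OF \<phi>, of "- h"]] partials_shift[OF \<phi> bs, of "- h"] by simp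
 also have "pairing (\<lambda>x. \<phi> (x - h)) g = pairing \<phi> (\<lambda>x. g (x + h))"
  using integral_lborel_shift[of "\<lambda>x. \<phi> (x - h) *\<^sub>R g x" h] by simp
 finally show "pairing (partials bs \<phi>) (\<lambda>x. f (x + h)) = (- 1) ^ length bs * pairing \<phi> (\<lambda>x. g (x + h))" .
qed

lemma loc_integrable_fdiff: "loc_integrable f ==> loc_integrable (fdiff h f)"
 unfolding fdiff_def by (intro loc_integrable_diff loc_integrable_shift)

lemma weak_deriv_fdiff:
 assumes w: "weak_deriv bs f g" and f: "loc_integrable f" and g: "loc_integrable g" and bs: "set bs \<subseteq> Basis"
 shows "weak_deriv bs (fdiff h f) (fdiff h g)"
proof -
 have 1: "weak_deriv bs (\<lambda>x. f (x + h)) (\<lambda>x. g (x + h))"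
  by (rule weak_deriv_shift[OF w loc_integrable_borel[OF f] loc_integrable_borel[OF g] bs])
 have 2: "weak_deriv bs (\<lambda>x. - 1 * f x) (\<lambda>x. - 1 * g x)" by (rule weak_deriv_cmult[OF w])
 have "weak_deriv bs (\<lambda>x. f (x + h) + - 1 * f x) (\<lambda>x. g (x + h) + - 1 * g x)"
  by (rule weak_deriv_add[OF 1 2 bs]) (intro loc_integrable_shift loc_integrable_cmult f g)+
 then show ?thesis by (simp add: fdiff_def)
qed

lemma weak_deriv_fdiff_pow:
 assumes "weak_deriv bs f g" "loc_integrable f" "loc_integrable g" "set bs \<subseteq> Basis"
 shows "weak_deriv bs ((fdiff h ^^ n) f) ((fdiff h ^^ n) g) \<and> loc_integrable ((fdiff h ^^ n) f) \<and> loc_integrable ((fdiff h ^^ n) g)"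
 using assms by (induction n) (auto intro: weak_deriv_fdiff loc_integrable_fdiff)

section \<open>Smoothing by Steklov means\<close>

lemma foldr_fdiff_add: "foldr fdiff hs (\<lambda>x. f x + g x) = (\<lambda>x. foldr fdiff hs f x + foldr fdiff hs g x)"
 by (induction hs) (auto simp: fdiff_def)

lemma foldr_fdiff_cmult: "foldr fdiff hs (\<lambda>x. c * f x) = (\<lambda>x. c * foldr fdiff hs f x)"
 by (induction hs) (auto simp: fdiff_def algebra_simps)

lemma foldr_fdiff_zero: "foldr fdiff hs (\<lambda>x. 0) = (\<lambda>x. 0)"
 by (induction hs) (auto simp: fdiff_def)

lemma foldr_fdiff_sum: "finite J ==> foldr fdiff hs (\<lambda>x. \<Sum>j\<in>J. g j x) = (\<lambda>x. \<Sum>j\<in>J. foldr fdiff hs (g j) x)"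
 by (induction J rule: finite_induct) (simp_all add: foldr_fdiff_zero foldr_fdiff_add)

lemma foldr_fdiff_replicate: "foldr fdiff (replicate n h) f = (fdiff h ^^ n) f"
 by (induction n) auto

lemma loc_integrable_foldr_fdiff: "loc_integrable f ==> loc_integrable (foldr fdiff hs f)"
 by (induction hs) (auto intro: loc_integrable_fdiff)

text \<open>The identity holds only almost everywhere: the mean of a difference is the difference of
  the means at points where both sections are integrable.\<close>

lemma steklov_foldr_fdiff:
 assumes f: "loc_integrable f"
 shows "AE x in lborel. foldr fdiff hs (steklov h f) x = steklov h (foldr fdiff hs f) x"
proof (induction hs)
 case (Cons v hs)
 define G where "G = foldr fdiff hs f"
 have G: "loc_integrable G" unfolding G_def by (rule loc_integrable_foldr_fdiff[OF f])
 note IH = Cons.IH[folded G_def] and I = steklov_AE_integrable[OF G, of h]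
 from IH I AE_lborel_shift[OF IH, of v] AE_lborel_shift[OF I, of v] show ?case
 proof eventually_elim
  case (elim x)
  have "steklov h (fdiff v G) x = (\<integral>u. indicator {0..1} u *\<^sub>R G (x + v + u *\<^sub>R h) - indicator {0..1} u *\<^sub>R G (x + u *\<^sub>R h) \<partial>lborel)"
   unfolding steklov_def fdiff_def by (simp only: scaleR_diff_right add_ac)
  also have "... = steklov h G (x + v) - steklov h G x"
   unfolding steklov_def by (rule Bochner_Integration.integral_diff) (use elim in auto)
  finally show ?case using elim by (simp add: fdiff_def[of _ "foldr fdiff hs (steklov h f)"] G_def)
 qed
qed simp

lemma weak_deriv_sum:
 assumes "finite J" "set bs \<subseteq> Basis"
  "\<And>j. j \<in> J ==> weak_deriv bs (f j) (g j) \<and> loc_integrable (f j) \<and> loc_integrable (g j)"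
 shows "weak_deriv bs (\<lambda>x. \<Sum>j\<in>J. f j x) (\<lambda>x. \<Sum>j\<in>J. g j x) \<and> loc_integrable (\<lambda>x. \<Sum>j\<in>J. f j x) \<and> loc_integrable (\<lambda>x. \<Sum>j\<in>J. g j x)"
 using assms(1,3)
proof (induction J rule: finite_induct)
 case empty
 show ?case by (simp add: weak_deriv_def loc_integrable_def)
next
 case (insert j J)
 have "weak_deriv bs (\<lambda>x. f j x + (\<Sum>j\<in>J. f j x)) (\<lambda>x. g j x + (\<Sum>j\<in>J. g j x))"
  by (rule weak_deriv_add) (use insert assms(2) in auto)
 moreover have "loc_integrable (\<lambda>x. f j x + (\<Sum>j\<in>J. f j x))" "loc_integrable (\<lambda>x. g j x + (\<Sum>j\<in>J. g j x))"
  by (intro loc_integrable_add; use insert in auto)+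
 ultimately show ?case using insert by simp
qed

lemma sum_choose_le: "(\<Sum>j\<in>{1..k}. real (k choose j)) \<le> 2 ^ k"
proof -
 have "(\<Sum>j\<in>{1..k}. real (k choose j)) \<le> (\<Sum>j\<le>k. real (k choose j))" by (intro sum_mono2) auto
 also have "... = real (\<Sum>j\<le>k. k choose j)" by simp
 also have "... = 2 ^ k" unfolding choose_row_sum by simp
 finally show ?thesis .
qed

section \<open>Approximation by combinations of Steklov means\<close>

context lp_setting begin

definition Bor :: "('a => complex) set" where
 "Bor = {f \<in> borel_measurable borel. L f < \<infinity>}"

lemma Bor_loc_integrable: "f \<in> Bor ==> loc_integrable f"
 by (auto simp: Bor_def intro: L_finite_loc_integrable)

lemma Bor_V: "f \<in> Bor ==> f \<in> V"
 by (auto simp: Bor_def intro: L_finite_V)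

lemma Bor_cmult: "f \<in> Bor ==> (\<lambda>x. c * f x) \<in> Bor"
 using L_cmult[of c f] by (auto simp: Bor_def ennreal_mult_less_top intro: le_less_trans)

lemma Bor_sum: "finite J ==> (\<And>j. j \<in> J ==> f j \<in> Bor) ==> (\<lambda>x. \<Sum>j\<in>J. f j x) \<in> Bor"
 using L_sum[of J f] by (auto simp: Bor_def intro!: borel_measurable_sum le_less_trans[OF L_sum] simp: less_top)

lemma Bor_fdiff: assumes "f \<in> Bor" shows "fdiff h f \<in> Bor"
proof -
 have [measurable]: "f \<in> borel_measurable borel" using assms by (simp add: Bor_def)
 have "fdiff h f \<in> borel_measurable borel" unfolding fdiff_def by measurable
 then show ?thesis using assms L_fdiff_pow[of 1 h f] by (auto simp: Bor_def ennreal_mult_less_top intro: le_less_trans)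
qed

lemma Bor_foldr_fdiff: "f \<in> Bor ==> foldr fdiff hs f \<in> Bor"
 by (induction hs) (auto intro: Bor_fdiff)

lemma L_steklov:
 assumes f: "f \<in> Bor" shows "L (steklov h f) \<le> L f"
 unfolding steklov_def[abs_def]
proof (rule L_average)
 have [measurable]: "f \<in> borel_measurable borel" using f by (simp add: Bor_def)
 show "(\<lambda>(x, u). f (x + u *\<^sub>R h)) \<in> borel_measurable (borel \<Otimes>\<^sub>M borel)" by measurable
 show "periodic P (\<lambda>x. f (x + u *\<^sub>R h))" for u using Bor_V[OF f] by (auto simp: V_def intro: periodic_shift)
qed (simp add: L_shift)

lemma Bor_steklov: assumes "f \<in> Bor" shows "steklov h f \<in> Bor"
 using assms L_steklov[OF assms, of h] steklov_measurable[of f h] by (auto simp: Bor_def intro: le_less_trans)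

lemma Bor_steklov_pow: "f \<in> Bor ==> (steklov h ^^ n) f \<in> Bor"
 by (induction n) (auto intro: Bor_steklov)

lemma L_foldr_fdiff_steklov:
 assumes f: "f \<in> Bor" shows "L (foldr fdiff hs (steklov h f)) \<le> L (foldr fdiff hs f)"
proof -
 have "L (foldr fdiff hs (steklov h f)) = L (steklov h (foldr fdiff hs f))"
  by (intro L_AE_eq steklov_foldr_fdiff Bor_V Bor_loc_integrable Bor_foldr_fdiff Bor_steklov f)
 also have "... \<le> L (foldr fdiff hs f)" by (intro L_steklov Bor_foldr_fdiff f)
 finally show ?thesis .
qed

lemma L_foldr_fdiff_steklov_pow:
 "f \<in> Bor ==> L (foldr fdiff hs ((steklov h ^^ n) f)) \<le> L (foldr fdiff hs f)"
proof (induction n)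
 case (Suc n)
 then show ?case using order.trans[OF L_foldr_fdiff_steklov[OF Bor_steklov_pow[OF Suc.prems]] Suc.IH] by simp
qed simp

text \<open>All summands share the averaging variable: one mean along j h, with the same u for every
  j, turns the combination into the average over u of the one with v + u in place of v. After n
  rounds it is an average of k-th differences with steps (v + u_1 + ... + u_n) h.\<close>

lemma L_steklov_combination:
 assumes f: "f \<in> Bor" and v: "0 \<le> v"
 shows "L (\<lambda>x. \<Sum>j\<le>k. (-1) ^ (k - j) * of_nat (k choose j) * (steklov (real j *\<^sub>R h) ^^ n) f (x + real j *\<^sub>R v *\<^sub>R h))
  \<le> modulus L k f ((v + real n) * norm h)"
 using v
proof (induction n arbitrary: v)
 case 0
 have "(\<lambda>x. \<Sum>j\<le>k. (-1) ^ (k - j) * of_nat (k choose j) * f (x + real j *\<^sub>R v *\<^sub>R h)) = (fdiff (v *\<^sub>R h) ^^ k) f"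
  by (simp add: fun_eq_iff fdiff_pow_expand)
 then show ?case using modulus_upper[of "v *\<^sub>R h" "v * norm h" k f] 0 by simp
next
 case (Suc n)
 define c where "c = (\<lambda>j. (-1) ^ (k - j) * of_nat (k choose j) :: complex)"
 define G where "G = (\<lambda>j. (steklov (real j *\<^sub>R h) ^^ n) f)"
 have G: "G j \<in> Bor" for j unfolding G_def by (rule Bor_steklov_pow[OF f])
 then have [measurable]: "G j \<in> borel_measurable borel" for j by (simp add: Bor_def)
 let ?H = "\<lambda>x u. \<Sum>j\<le>k. c j * G j (x + real j *\<^sub>R (v + u) *\<^sub>R h)"
 let ?A = "\<lambda>x. \<Sum>j\<le>k. c j * (steklov (real j *\<^sub>R h) (G j)) (x + real j *\<^sub>R v *\<^sub>R h)"
 have Gper: "periodic P (\<lambda>x. G j (x + w))" for j w using Bor_V[OF G[of j]] by (auto simp: V_def intro: periodic_shift)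
 have per: "periodic P (\<lambda>x. ?H x u)" for u
  using Gper unfolding periodic_def by (simp add: add.assoc cong: sum.cong)
 have shiftV: "(\<lambda>x. steklov (real j *\<^sub>R h) (G j) (x + w)) \<in> Bor" for j w
 proof -
  have [measurable]: "steklov (real j *\<^sub>R h) (G j) \<in> borel_measurable borel" using Bor_steklov[OF G] by (simp add: Bor_def)
  show ?thesis using Bor_steklov[OF G, of "real j *\<^sub>R h" j] by (simp add: Bor_def L_shift)
 qed
 have "AE x in lborel. \<forall>j. integrable lborel (\<lambda>u. indicator {0..1} u *\<^sub>R G j (x + real j *\<^sub>R v *\<^sub>R h + u *\<^sub>R real j *\<^sub>R h))"
  using AE_lborel_shift[OF steklov_AE_integrable[OF Bor_loc_integrable[OF G]]] by (subst AE_all_countable) blast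
 then have AE: "AE x in lborel. ?A x = unit_mean (?H x)"
 proof eventually_elim
  case (elim x)
  have e: "x + real j *\<^sub>R (v + u) *\<^sub>R h = x + real j *\<^sub>R v *\<^sub>R h + u *\<^sub>R real j *\<^sub>R h" for j u
   by (simp add: algebra_simps)
  have "unit_mean (?H x) = (\<integral>u. (\<Sum>j\<le>k. c j * (indicator {0..1} u *\<^sub>R G j (x + real j *\<^sub>R v *\<^sub>R h + u *\<^sub>R real j *\<^sub>R h))) \<partial>lborel)"
   unfolding e scaleR_sum_right mult_scaleR_right ..
  also have "... = ?A x"
   unfolding steklov_def
   by (subst Bochner_Integration.integral_sum; (intro integrable_mult_right elim[rule_format])?)
    (simp only: integral_mult_right_zero)
  finally show ?case by simp
 qed
 have "L ?A = L (\<lambda>x. \<integral>u. indicator {0..1} u *\<^sub>R ?H x u \<partial>lborel)"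
 proof (rule L_AE_eq[OF _ _ AE])
  show "?A \<in> V" by (intro Bor_V Bor_sum Bor_cmult shiftV) simp
  have "(\<lambda>x. \<integral>u. indicator {0..1} u *\<^sub>R ?H x u \<partial>lborel) \<in> borel_measurable lborel" by measurable
  then have "(\<lambda>x. \<integral>u. indicator {0..1} u *\<^sub>R ?H x u \<partial>lborel) \<in> borel_measurable lebesgue" by (rule measurable_completion)
  then show "(\<lambda>x. \<integral>u. indicator {0..1} u *\<^sub>R ?H x u \<partial>lborel) \<in> V" using per by (auto simp: V_def periodic_def)
 qed
 also have "... \<le> modulus L k f ((v + real (Suc n)) * norm h)"
 proof (rule L_average)
  show "(\<lambda>(x, u). ?H x u) \<in> borel_measurable (borel \<Otimes>\<^sub>M borel)" by measurable
  fix u :: real assume u: "0 \<le> u" "u \<le> 1"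
  have "L (\<lambda>x. ?H x u) \<le> modulus L k f ((v + u + real n) * norm h)"
   using Suc.IH[of "v + u"] Suc.prems u by (simp add: c_def G_def)
  also have "... \<le> modulus L k f ((v + real (Suc n)) * norm h)"
   using u by (intro modulus_mono mult_right_mono) auto
  finally show "L (\<lambda>x. ?H x u) \<le> modulus L k f ((v + real (Suc n)) * norm h)" .
 qed (rule per)
 finally show ?case by (simp add: c_def G_def)
qed

text \<open>The full alternating sum is multiplied by (-1)^k, which makes its summand j = 0 equal to
  f; the other summands are then moved to the opposite side. Averaging k times along h admits k
  derivatives in that direction.\<close>

definition smoother :: "nat => 'a => ('a => complex) => 'a => complex" where
 "smoother k h f x = (\<Sum>j\<in>{1..k}. (- ((-1) ^ k) * (-1) ^ (k - j) * of_nat (k choose j)) * (steklov (real j *\<^sub>R h) ^^ k) f x)"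

lemma Bor_smoother: "f \<in> Bor ==> smoother k h f \<in> Bor"
 unfolding smoother_def[abs_def] by (intro Bor_sum Bor_cmult Bor_steklov_pow) auto

lemma L_smoother_diff:
 assumes f: "f \<in> Bor" shows "L (\<lambda>x. f x - smoother k h f x) \<le> modulus L k f (real k * norm h)"
proof -
 let ?S = "\<lambda>x. \<Sum>j\<le>k. (-1) ^ (k - j) * of_nat (k choose j) * (steklov (real j *\<^sub>R h) ^^ k) f (x + real j *\<^sub>R 0 *\<^sub>R h)"
 have s0: "(steklov 0 ^^ k) f = f" by (induction k) (auto simp: steklov_zero)
 have "f x - smoother k h f x = (-1) ^ k * ?S x" for x
 proof -
  have "?S x = (-1) ^ k * f x + (\<Sum>j\<in>{1..k}. (-1) ^ (k - j) * of_nat (k choose j) * (steklov (real j *\<^sub>R h) ^^ k) f x)"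
   unfolding atMost_atLeast0 by (subst sum.atLeast_Suc_atMost) (simp_all add: s0)
  then have "(-1) ^ k * ?S x = (-1) ^ k * (-1) ^ k * f x + (\<Sum>j\<in>{1..k}. (-1) ^ k * ((-1) ^ (k - j) * of_nat (k choose j) * (steklov (real j *\<^sub>R h) ^^ k) f x))"
   by (simp only: distrib_left sum_distrib_left mult.assoc)
  also have "(-1) ^ k * (-1) ^ k = (1::complex)" by (simp flip: power_mult_distrib)
  finally show ?thesis by (simp add: smoother_def sum_negf mult.assoc)
 qed
 then have "L (\<lambda>x. f x - smoother k h f x) = L (\<lambda>x. (-1) ^ k * ?S x)" by simp
 also have "... \<le> ennreal (norm ((-1::complex) ^ k)) * L ?S" by (rule L_cmult)
 also have "... = L ?S" by (simp add: norm_power)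
 also have "... \<le> modulus L k f (real k * norm h)" using L_steklov_combination[OF f, where v = 0 and k = k and h = h and n = k] by simp
 finally show ?thesis .
qed

text \<open>Differences commute with Steklov means almost everywhere and the means are contractions,
  so the binomial coefficients alone count; they sum to at most 2^k.\<close>

lemma L_foldr_fdiff_smoother:
 assumes f: "f \<in> Bor" shows "L (foldr fdiff hs (smoother k h f)) \<le> ennreal (2 ^ k) * L (foldr fdiff hs f)"
proof -
 define c where "c = (\<lambda>j. - ((-1) ^ k) * (-1) ^ (k - j) * of_nat (k choose j) :: complex)"
 have nc: "norm (c j) = real (k choose j)" for j by (simp add: c_def norm_mult norm_power)
 have "foldr fdiff hs (smoother k h f) = (\<lambda>x. \<Sum>j\<in>{1..k}. c j * foldr fdiff hs ((steklov (real j *\<^sub>R h) ^^ k) f) x)"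
  unfolding smoother_def[abs_def] c_def by (simp only: foldr_fdiff_sum[OF finite_atLeastAtMost] foldr_fdiff_cmult)
 then have "L (foldr fdiff hs (smoother k h f)) \<le> (\<Sum>j\<in>{1..k}. L (\<lambda>x. c j * foldr fdiff hs ((steklov (real j *\<^sub>R h) ^^ k) f) x))"
  by (simp add: L_sum)
 also have "... \<le> (\<Sum>j\<in>{1..k}. ennreal (real (k choose j)) * L (foldr fdiff hs f))"
  by (intro sum_mono order.trans[OF L_cmult] mult_mono L_foldr_fdiff_steklov_pow f) (auto simp: nc)
 also have "... = ennreal (\<Sum>j\<in>{1..k}. real (k choose j)) * L (foldr fdiff hs f)"
  by (simp add: sum_distrib_right flip: sum_ennreal)
 also have "... \<le> ennreal (2 ^ k) * L (foldr fdiff hs f)"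
  by (intro mult_right_mono ennreal_leI sum_choose_le) simp
 finally show ?thesis .
qed

lemma modulus_smoother: "f \<in> Bor ==> modulus L k (smoother k h f) t \<le> ennreal (2 ^ k) * modulus L k f t"
 unfolding modulus_def[of L k "smoother k h f"] foldr_fdiff_replicate[symmetric]
proof (rule SUP_least)
 fix v :: 'a assume "f \<in> Bor" "v \<in> {h. norm h \<le> t}"
 then show "L (foldr fdiff (replicate k v) (smoother k h f)) \<le> ennreal (2 ^ k) * modulus L k f t"
  using modulus_upper[of v t k f]
  by (intro order.trans[OF L_foldr_fdiff_smoother] mult_left_mono) (auto simp: foldr_fdiff_replicate)
qed

lemma Bor_foldr_smoother: "f \<in> Bor ==> foldr (smoother k) hs f \<in> Bor"
 by (induction hs) (auto intro: Bor_smoother)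

lemma modulus_foldr_smoother:
 "f \<in> Bor ==> modulus L k (foldr (smoother k) hs f) t \<le> ennreal (2 ^ (k * length hs)) * modulus L k f t"
proof (induction hs)
 case (Cons h hs)
 have "modulus L k (foldr (smoother k) (h # hs) f) t \<le> ennreal (2 ^ k) * modulus L k (foldr (smoother k) hs f) t"
  using Cons.prems by (simp add: modulus_smoother Bor_foldr_smoother)
 also have "... \<le> ennreal (2 ^ k) * (ennreal (2 ^ (k * length hs)) * modulus L k f t)"
  by (intro mult_left_mono Cons.IH Cons.prems) simp
 also have "... = ennreal (2 ^ (k * length (h # hs))) * modulus L k f t"
  by (simp add: mult.assoc[symmetric] power_add flip: ennreal_mult)
 finally show ?case .
qed simp

text \<open>Telescoping over the steps. A further smoother applied to G costs the modulus of G,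
  which every earlier smoother has enlarged by at most 2^k.\<close>

lemma L_foldr_smoother_diff:
 assumes f: "f \<in> Bor" and "\<And>h. h \<in> set hs ==> real k * norm h \<le> t"
 shows "L (\<lambda>x. f x - foldr (smoother k) hs f x) \<le> ennreal (real (length hs) * 2 ^ (k * length hs)) * modulus L k f t"
 using assms(2)
proof (induction hs)
 case (Cons h hs)
 let ?G = "foldr (smoother k) hs f" and ?M = "modulus L k f t"
 have "L (\<lambda>x. f x - foldr (smoother k) (h # hs) f x) = L (\<lambda>x. (f x - ?G x) + (?G x - smoother k h ?G x))" by simp
 also have "... \<le> L (\<lambda>x. f x - ?G x) + L (\<lambda>x. ?G x - smoother k h ?G x)" by (rule L_add)
 also have "... \<le> ennreal (real (length hs) * 2 ^ (k * length hs)) * ?M + ennreal (2 ^ (k * length hs)) * ?M"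
 proof (intro add_mono Cons.IH Cons.prems)
  have "L (\<lambda>x. ?G x - smoother k h ?G x) \<le> modulus L k ?G (real k * norm h)" by (intro L_smoother_diff Bor_foldr_smoother f)
  also have "... \<le> modulus L k ?G t" using Cons.prems by (intro modulus_mono) simp
  also have "... \<le> ennreal (2 ^ (k * length hs)) * ?M" by (rule modulus_foldr_smoother[OF f])
  finally show "L (\<lambda>x. ?G x - smoother k h ?G x) \<le> ennreal (2 ^ (k * length hs)) * ?M" .
 qed simp
 also have "... = ennreal (real (length (h # hs)) * 2 ^ (k * length hs)) * ?M"
  by (simp add: algebra_simps flip: distrib_right)
 also have "... \<le> ennreal (real (length (h # hs)) * 2 ^ (k * length (h # hs))) * ?M"
  by (intro mult_right_mono ennreal_leI mult_left_mono power_increasing) auto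
 finally show ?case .
qed (simp add: L_zero)

end

section \<open>Lists of directions against the multi-indices of the Sobolev norm\<close>

lemma loc_integrable_locally_integrable:
 assumes f: "loc_integrable f" shows "locally_integrable f"
 unfolding locally_integrable_def set_integrable_def
proof (intro allI impI)
 fix K :: "'a set" assume K: "compact K"
 have [measurable]: "f \<in> borel_measurable borel" using f by (rule loc_integrable_borel)
 have [measurable]: "K \<in> sets borel" using K by (rule borel_compact)
 have m: "(\<lambda>x. indicator K x *\<^sub>R f x) \<in> borel_measurable lborel" by measurable
 have "(\<integral>\<^sup>+x. ennreal (norm (indicator K x *\<^sub>R f x)) \<partial>lborel) = (\<integral>\<^sup>+x. indicator K x * ennreal (norm (f x)) \<partial>lborel)"
  by (intro nn_integral_cong) (auto simp: indicator_def)
 then have "integrable lborel (\<lambda>x. indicator K x *\<^sub>R f x)"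
  using f K m by (intro integrableI_bounded) (auto simp: loc_integrable_def)
 then show "integrable lebesgue (\<lambda>x. indicator K x *\<^sub>R f x)" using integrable_completion[OF m] by simp
qed

lemma has_weak_derivative_iff_weak_deriv:
 assumes f: "loc_integrable f" and g: "loc_integrable g" and bs: "set bs \<subseteq> Basis"
 shows "has_weak_derivative f (count_list bs) g \<longleftrightarrow> weak_deriv bs f g"
proof -
 have len: "(\<Sum>b\<in>Basis. count_list bs b) = length bs" by (rule sum_count_set[OF bs finite_Basis])
 have i: "(LINT x|lebesgue. \<phi> x *\<^sub>R h x) = pairing \<phi> h" if "\<phi> \<in> test_functions" "loc_integrable h" for \<phi> :: "'a => real" and h
 proof -
  have [measurable]: "\<phi> \<in> borel_measurable borel" "h \<in> borel_measurable borel"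
   using that by (auto intro: test_function_measurable loc_integrable_borel)
  show ?thesis by (rule integral_completion) measurable
 qed
 show ?thesis
  unfolding has_weak_derivative_def weak_deriv_def len
  using f g loc_integrable_locally_integrable bs
  by (auto simp: multi_partial_eq_partials i test_function_partials)
qed

lemma finite_multi_indices: "finite (multi_indices k :: ('a::euclidean_space => nat) set)"
proof (rule finite_subset)
 show "(multi_indices k :: ('a => nat) set) \<subseteq> {\<beta>. \<forall>b. (b \<in> Basis \<longrightarrow> \<beta> b \<in> {..k}) \<and> (b \<notin> Basis \<longrightarrow> \<beta> b = 0)}"
 proof
  fix \<beta> :: "'a => nat" assume \<beta>: "\<beta> \<in> multi_indices k"
  have "\<beta> b \<le> k" if "b \<in> Basis" for b
  proof -
   have "\<beta> b \<le> (\<Sum>b\<in>Basis. \<beta> b)" using that by (intro member_le_sum) auto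
   then show ?thesis using \<beta> by (simp add: multi_indices_def)
  qed
  then show "\<beta> \<in> {\<beta>. \<forall>b. (b \<in> Basis \<longrightarrow> \<beta> b \<in> {..k}) \<and> (b \<notin> Basis \<longrightarrow> \<beta> b = 0)}"
   using \<beta> by (simp add: multi_indices_def)
 qed
qed (intro finite_set_of_finite_funs; simp)

lemma multi_indices_list:
 assumes "\<beta> \<in> multi_indices k"
 obtains bs where "count_list bs = \<beta>" "set bs \<subseteq> Basis" "length bs \<le> k"
proof -
 obtain bs where bs: "\<And>b. count_list bs b = \<beta> b"
  using ex_list_of_counts[of Basis \<beta>] assms by (auto simp: multi_indices_def)
 have "set bs \<subseteq> Basis" using assms bs by (auto simp: multi_indices_def) (metis count_list_0_iff)
 moreover have "(\<Sum>b\<in>Basis. count_list bs b) = length bs" by (rule sum_count_set[OF calculation finite_Basis])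
 ultimately show ?thesis using assms by (intro that[of bs]) (auto simp: bs fun_eq_iff multi_indices_def)
qed

section \<open>Derivatives of the smoothed function\<close>

context lp_setting begin

definition diff_sup :: "real => ('a => complex) => 'a list => nat => ennreal" where
 "diff_sup \<delta> f hs n = (SUP hs'\<in>{hs'. length hs' = n \<and> (\<forall>h\<in>set hs'. norm h \<le> \<delta>)}. L (foldr fdiff (hs @ hs') f))"

text \<open>
 The multiset \<open>m\<close> records the directions in which \<open>g\<close> has been averaged. The bound is
 kept for all further differences, so that the next average can trade one of them for a derivative.
\<close>

definition smoothed :: "real => real => ('a => complex) => ('a => complex) => 'a multiset => real => bool" where
 "smoothed \<tau> \<delta> f g m B \<longleftrightarrow> g \<in> Bor \<and> (\<forall>bs. mset bs \<subseteq># m \<longrightarrow> (\<exists>G\<in>Bor. weak_deriv bs g G \<and>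
   (\<forall>hs. L (foldr fdiff hs G) \<le> ennreal (B * (1 / \<tau>) ^ length bs) * diff_sup \<delta> f hs (length bs))))"

lemma smoothed_refl: "f \<in> Bor ==> smoothed \<tau> \<delta> f f {#} 1"
 by (auto simp: smoothed_def diff_sup_def intro!: bexI[of _ f] weak_deriv_Nil)

text \<open>If b does not occur in bs, the new mean only acts as a contraction. If it does, the mean
  is spent on one derivative in direction b, which becomes a difference with step c b divided by c:
  c \<ge> \<tau> gives the factor 1/\<tau>, and c \<le> \<delta> makes the step admissible in
  \<open>diff_sup\<close>.\<close>

lemma smoothed_steklov:
 assumes g: "smoothed \<tau> \<delta> f g m B" and \<tau>: "0 < \<tau>" "\<tau> \<le> c" "c \<le> \<delta>" and b: "b \<in> Basis" and m: "set_mset m \<subseteq> Basis" and B: "0 \<le> B"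
 shows "smoothed \<tau> \<delta> f (steklov (c *\<^sub>R b) g) (add_mset b m) B"
 unfolding smoothed_def
proof (intro conjI allI impI)
 have gB: "g \<in> Bor" using g by (simp add: smoothed_def)
 then show "steklov (c *\<^sub>R b) g \<in> Bor" by (rule Bor_steklov)
 fix bs assume bs: "mset bs \<subseteq># add_mset b m"
 show "\<exists>G\<in>Bor. weak_deriv bs (steklov (c *\<^sub>R b) g) G \<and>
   (\<forall>hs. L (foldr fdiff hs G) \<le> ennreal (B * (1 / \<tau>) ^ length bs) * diff_sup \<delta> f hs (length bs))"
 proof (cases "b \<in> set bs")
  case False
  then have "count (mset bs) x \<le> count m x" for x
   using mset_subset_eq_count[OF bs, of x] by (cases "x = b") (auto simp: count_eq_zero_iff[THEN iffD2])
  then have sub: "mset bs \<subseteq># m" by (auto simp: subseteq_mset_def)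
  then have "set bs \<subseteq> Basis" using m set_mset_mono by fastforce
  obtain G where G: "G \<in> Bor" "weak_deriv bs g G" "\<And>hs. L (foldr fdiff hs G) \<le> ennreal (B * (1 / \<tau>) ^ length bs) * diff_sup \<delta> f hs (length bs)"
   using g sub by (auto simp: smoothed_def)
  show ?thesis
  proof (intro bexI[of _ "steklov (c *\<^sub>R b) G"] conjI allI)
   show "weak_deriv bs (steklov (c *\<^sub>R b) g) (steklov (c *\<^sub>R b) G)"
    by (intro weak_deriv_steklov G Bor_loc_integrable gB \<open>set bs \<subseteq> Basis\<close>)
   show "L (foldr fdiff hs (steklov (c *\<^sub>R b) G)) \<le> ennreal (B * (1 / \<tau>) ^ length bs) * diff_sup \<delta> f hs (length bs)" for hs
    by (rule order.trans[OF L_foldr_fdiff_steklov[OF G(1)] G(3)])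
  qed (intro Bor_steklov G)
 next
  case True
  define cs where "cs = remove1 b bs"
  have cs: "mset (b # cs) = mset bs" using True by (simp add: cs_def)
  then have len: "length bs = Suc (length cs)" using mset_eq_length[OF cs] by simp
  have sub: "mset cs \<subseteq># m" using bs unfolding cs[symmetric] by simp
  then have csB: "set cs \<subseteq> Basis" using m set_mset_mono by fastforce
  obtain G where G: "G \<in> Bor" "weak_deriv cs g G" "\<And>hs. L (foldr fdiff hs G) \<le> ennreal (B * (1 / \<tau>) ^ length cs) * diff_sup \<delta> f hs (length cs)"
   using g sub by (auto simp: smoothed_def)
  let ?G = "\<lambda>x. of_real (1 / c) * fdiff (c *\<^sub>R b) G x"
  show ?thesis
  proof (intro bexI[of _ ?G] conjI allI)
   have "weak_deriv (b # cs) (steklov (c *\<^sub>R b) g) ?G"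
   proof (rule weak_deriv_Cons[OF weak_deriv_of_steklov _ csB])
    show "weak_deriv cs (\<lambda>x. of_real (1 / c) * fdiff (c *\<^sub>R b) g x) ?G"
     by (intro weak_deriv_cmult weak_deriv_fdiff G csB Bor_loc_integrable gB)
   qed (use \<tau> b Bor_loc_integrable[OF gB] in auto)
   then show "weak_deriv bs (steklov (c *\<^sub>R b) g) ?G" using csB b by (intro weak_deriv_permute[OF _ cs]) auto
   fix hs
   have "L (foldr fdiff hs ?G) \<le> ennreal (1 / c) * L (foldr fdiff (hs @ [c *\<^sub>R b]) G)"
    unfolding foldr_fdiff_cmult using L_cmult[of "of_real (1 / c)" "foldr fdiff (hs @ [c *\<^sub>R b]) G"] \<tau> by (simp add: norm_divide)
   also have "... \<le> ennreal (1 / \<tau>) * (ennreal (B * (1 / \<tau>) ^ length cs) * diff_sup \<delta> f (hs @ [c *\<^sub>R b]) (length cs))"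
    using \<tau> by (intro mult_mono G(3) ennreal_leI) (auto simp: frac_le)
   also have "... = ennreal (B * (1 / \<tau>) ^ length bs) * diff_sup \<delta> f (hs @ [c *\<^sub>R b]) (length cs)"
    using \<tau> B by (simp add: len mult.assoc[symmetric] mult_ac flip: ennreal_mult)
   also have "... \<le> ennreal (B * (1 / \<tau>) ^ length bs) * diff_sup \<delta> f hs (length bs)"
   proof (rule mult_left_mono)
    show "diff_sup \<delta> f (hs @ [c *\<^sub>R b]) (length cs) \<le> diff_sup \<delta> f hs (length bs)"
     unfolding diff_sup_def
    proof (rule SUP_least)
     fix hs' :: "'a list" assume "hs' \<in> {hs'. length hs' = length cs \<and> (\<forall>h\<in>set hs'. norm h \<le> \<delta>)}"
     then have "c *\<^sub>R b # hs' \<in> {hs'. length hs' = length bs \<and> (\<forall>h\<in>set hs'. norm h \<le> \<delta>)}"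
      using \<tau> b by (auto simp: len)
     then have "L (foldr fdiff (hs @ (c *\<^sub>R b # hs')) f) \<le> (SUP hs'\<in>{hs'. length hs' = length bs \<and> (\<forall>h\<in>set hs'. norm h \<le> \<delta>)}. L (foldr fdiff (hs @ hs') f))"
      by (rule SUP_upper)
     then show "L (foldr fdiff ((hs @ [c *\<^sub>R b]) @ hs') f) \<le> (SUP hs'\<in>{hs'. length hs' = length bs \<and> (\<forall>h\<in>set hs'. norm h \<le> \<delta>)}. L (foldr fdiff (hs @ hs') f))"
      by simp
    qed
   qed simp
   finally show "L (foldr fdiff hs ?G) \<le> ennreal (B * (1 / \<tau>) ^ length bs) * diff_sup \<delta> f hs (length bs)" .
  qed (intro Bor_cmult Bor_fdiff G)
 qed
qed

lemma smoothed_steklov_pow: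
 assumes "smoothed \<tau> \<delta> f g m B" "0 < \<tau>" "\<tau> \<le> c" "c \<le> \<delta>" "b \<in> Basis" "set_mset m \<subseteq> Basis" "0 \<le> B"
 shows "smoothed \<tau> \<delta> f ((steklov (c *\<^sub>R b) ^^ n) g) (m + replicate_mset n b) B"
proof (induction n)
 case (Suc n)
 have "set_mset (m + replicate_mset n b) \<subseteq> Basis" using assms by (auto split: if_splits)
 from smoothed_steklov[OF Suc assms(2-5) this assms(7)] show ?case by simp
qed (use assms in simp)

lemma smoothed_sum:
 assumes J: "finite J" and g: "\<And>j. j \<in> J ==> smoothed \<tau> \<delta> f (g j) m B"
  and a: "(\<Sum>j\<in>J. norm (a j)) * B \<le> B'" and B: "0 \<le> B" and \<tau>: "0 < \<tau>" and m: "set_mset m \<subseteq> Basis"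
 shows "smoothed \<tau> \<delta> f (\<lambda>x. \<Sum>j\<in>J. a j * g j x) m B'"
 unfolding smoothed_def
proof (intro conjI allI impI)
 have gB: "g j \<in> Bor" if "j \<in> J" for j using g[OF that] by (simp add: smoothed_def)
 then show "(\<lambda>x. \<Sum>j\<in>J. a j * g j x) \<in> Bor" using J by (intro Bor_sum Bor_cmult)
 fix bs assume bs: "mset bs \<subseteq># m"
 then have bsB: "set bs \<subseteq> Basis" using m set_mset_mono by fastforce
 have "\<forall>j\<in>J. \<exists>G. G \<in> Bor \<and> weak_deriv bs (g j) G \<and> (\<forall>hs. L (foldr fdiff hs G) \<le> ennreal (B * (1 / \<tau>) ^ length bs) * diff_sup \<delta> f hs (length bs))"
  using g bs unfolding smoothed_def by blast
 then obtain G where G: "\<And>j. j \<in> J ==> G j \<in> Bor" "\<And>j. j \<in> J ==> weak_deriv bs (g j) (G j)"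
  "\<And>j hs. j \<in> J ==> L (foldr fdiff hs (G j)) \<le> ennreal (B * (1 / \<tau>) ^ length bs) * diff_sup \<delta> f hs (length bs)"
  by (auto dest!: bchoice)
 show "\<exists>G\<in>Bor. weak_deriv bs (\<lambda>x. \<Sum>j\<in>J. a j * g j x) G \<and>
   (\<forall>hs. L (foldr fdiff hs G) \<le> ennreal (B' * (1 / \<tau>) ^ length bs) * diff_sup \<delta> f hs (length bs))"
 proof (intro bexI[of _ "\<lambda>x. \<Sum>j\<in>J. a j * G j x"] conjI allI)
  show "weak_deriv bs (\<lambda>x. \<Sum>j\<in>J. a j * g j x) (\<lambda>x. \<Sum>j\<in>J. a j * G j x)"
   using weak_deriv_sum[OF J bsB, of "\<lambda>j x. a j * g j x" "\<lambda>j x. a j * G j x"] G gB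
   by (simp add: weak_deriv_cmult Bor_loc_integrable Bor_cmult)
  fix hs
  let ?b = "B * (1 / \<tau>) ^ length bs" and ?D = "diff_sup \<delta> f hs (length bs)"
  have b: "0 \<le> ?b" using B \<tau> by simp
  have "L (foldr fdiff hs (\<lambda>x. \<Sum>j\<in>J. a j * G j x)) \<le> (\<Sum>j\<in>J. L (\<lambda>x. a j * foldr fdiff hs (G j) x))"
   by (simp add: foldr_fdiff_sum[OF J] foldr_fdiff_cmult L_sum[OF J])
  also have "... \<le> (\<Sum>j\<in>J. ennreal (norm (a j)) * (ennreal ?b * ?D))"
   by (intro sum_mono order.trans[OF L_cmult] mult_left_mono G) auto
  also have "... = ennreal ((\<Sum>j\<in>J. norm (a j)) * ?b) * ?D"
   using b by (simp add: ennreal_mult sum_nonneg sum_distrib_right mult.assoc flip: sum_ennreal)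
  also have "... \<le> ennreal (B' * (1 / \<tau>) ^ length bs) * ?D"
   using mult_right_mono[OF a, of "(1 / \<tau>) ^ length bs"] \<tau> by (intro mult_right_mono ennreal_leI) (auto simp: mult.assoc)
  finally show "L (foldr fdiff hs (\<lambda>x. \<Sum>j\<in>J. a j * G j x)) \<le> ennreal (B' * (1 / \<tau>) ^ length bs) * ?D" .
 qed (intro Bor_sum Bor_cmult J G)
qed

text \<open>A smoother uses the steps j \<tau> with 1 \<le> j \<le> k, which is why two lengths
  \<tau> and \<delta> \<ge> k \<tau> are carried along. The factor 2^k bounds the sum of its
  coefficients.\<close>

lemma smoothed_smoother:
 assumes g: "smoothed \<tau> \<delta> f g m B" and \<tau>: "0 < \<tau>" "real k * \<tau> \<le> \<delta>" and b: "b \<in> Basis" and m: "set_mset m \<subseteq> Basis" and B: "0 \<le> B"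
 shows "smoothed \<tau> \<delta> f (smoother k (\<tau> *\<^sub>R b) g) (m + replicate_mset k b) (2 ^ k * B)"
 unfolding smoother_def[abs_def]
proof (rule smoothed_sum)
 fix j assume j: "j \<in> {1..k}"
 have 1: "\<tau> \<le> real j * \<tau>" using j \<tau> by simp
 have "real j * \<tau> \<le> real k * \<tau>" using j \<tau> by (intro mult_right_mono) auto
 then have 2: "real j * \<tau> \<le> \<delta>" using \<tau> by linarith
 show "smoothed \<tau> \<delta> f ((steklov (real j *\<^sub>R \<tau> *\<^sub>R b) ^^ k) g) (m + replicate_mset k b) B"
  using smoothed_steklov_pow[OF g \<tau>(1) 1 2 b m B] by simp
next
 have "(\<Sum>j\<in>{1..k}. norm (- ((-1) ^ k) * (-1) ^ (k - j) * of_nat (k choose j) :: complex)) = (\<Sum>j\<in>{1..k}. real (k choose j))"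
  by (simp add: norm_mult norm_power)
 then show "(\<Sum>j\<in>{1..k}. norm (- ((-1) ^ k) * (-1) ^ (k - j) * of_nat (k choose j) :: complex)) * B \<le> 2 ^ k * B"
  using sum_choose_le[of k] B by (simp add: mult_right_mono)
qed (use assms in \<open>auto split: if_splits\<close>)

lemma smoothed_foldr_smoother:
 assumes f: "f \<in> Bor" and \<tau>: "0 < \<tau>" "real k * \<tau> \<le> \<delta>" and cs: "set cs \<subseteq> Basis"
 shows "smoothed \<tau> \<delta> f (foldr (smoother k) (map ((*\<^sub>R) \<tau>) cs) f) (repeat_mset k (mset cs)) (2 ^ (k * length cs))"
 using cs
proof (induction cs)
 case (Cons c cs)
 have "repeat_mset k (mset (c # cs)) = repeat_mset k (mset cs) + replicate_mset k c"
  by (rule multiset_eqI) (simp add: algebra_simps)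
 moreover have "set_mset (repeat_mset k (mset cs)) \<subseteq> Basis"
 proof
  fix b assume "b \<in># repeat_mset k (mset cs)"
  then have "0 < count (mset cs) b" unfolding count_greater_zero_iff[symmetric] by simp
  then show "b \<in> Basis" using Cons.prems unfolding count_greater_zero_iff by auto
 qed
 ultimately show ?case
  using smoothed_smoother[OF Cons.IH \<tau>, of c] Cons.prems unfolding \<open>repeat_mset k (mset (c # cs)) = _\<close> by (simp add: power_add)
qed (simp add: smoothed_refl f)

lemma diff_sup_le_modulus:
 assumes "0 \<le> \<delta>" "real n * \<delta> \<le> t"
 shows "diff_sup \<delta> f [] n \<le> ennreal (2 ^ n) * modulus L n f t"
 unfolding diff_sup_def
proof (rule SUP_least)
 fix hs' :: "'a list" assume hs: "hs' \<in> {hs'. length hs' = n \<and> (\<forall>h\<in>set hs'. norm h \<le> \<delta>)}"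
 have "L (foldr fdiff hs' f) \<le> ennreal (2 ^ length hs') * modulus L (length hs') f (real (length hs') * \<delta>)"
  by (rule mixed_difference_le_modulus) (use hs assms in auto)
 also have "... \<le> ennreal (2 ^ n) * modulus L n f t" using hs assms by (auto intro!: mult_left_mono modulus_mono)
 finally show "L (foldr fdiff ([] @ hs') f) \<le> ennreal (2 ^ n) * modulus L n f t" by simp
qed

definition dirs :: "'a list" where
 "dirs = (SOME cs. set cs = Basis \<and> distinct cs)"

lemma dirs: "set dirs = Basis" "distinct dirs"
 using someI_ex[OF finite_distinct_list[OF finite_Basis]] unfolding dirs_def by auto

text \<open>One factor k in t / k^2 bounds the Steklov steps j \<tau> by t/k; the other lets a mixed
  difference with up to k such steps be measured by the modulus at t.\<close>

definition smoothing_of :: "nat => ('a => complex) => real => 'a => complex" where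
 "smoothing_of k f t = foldr (smoother k) (map ((*\<^sub>R) (t / real (k * k))) dirs) f"

lemma L_smoothing_of:
 assumes "f \<in> Bor" "0 < t"
 shows "L (\<lambda>x. f x - smoothing_of k f t x) \<le> ennreal (real (length dirs) * 2 ^ (k * length dirs)) * modulus L k f t"
proof -
 have "L (\<lambda>x. f x - smoothing_of k f t x) \<le> ennreal (real (length (map ((*\<^sub>R) (t / real (k * k))) dirs)) * 2 ^ (k * length (map ((*\<^sub>R) (t / real (k * k))) dirs))) * modulus L k f t"
  unfolding smoothing_of_def
 proof (rule L_foldr_smoother_diff[OF assms(1)])
  fix h assume "h \<in> set (map ((*\<^sub>R) (t / real (k * k))) dirs)"
  then obtain b where b: "b \<in> Basis" "h = (t / real (k * k)) *\<^sub>R b" by (auto simp: dirs)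
  then have "real k * norm h = t / real k" using assms by simp
  also have "... \<le> t" using assms by (cases "k = 0") (auto simp: divide_le_eq)
  finally show "real k * norm h \<le> t" .
 qed
 then show ?thesis by simp
qed

lemma sobolev_smoothing_of:
 assumes k: "1 \<le> k"
 obtains C where "C > 0" "\<And>f t. f \<in> Bor ==> 0 < t ==> t \<le> 1 ==>
  sobolev L k (smoothing_of k f t) \<le> ennreal C * (L f + ennreal (1 / t ^ k) * modulus L k f t)"
proof -
 have "\<forall>n. \<exists>C>0. n \<le> k \<longrightarrow> (\<forall>f t. 0 < t \<longrightarrow> t \<le> 1 \<longrightarrow> ennreal (1 / t ^ n) * modulus L n f t \<le> ennreal C * (L f + ennreal (1 / t ^ k) * modulus L k f t))"
 proof
  fix n
  show "\<exists>C>0. n \<le> k \<longrightarrow> (\<forall>f t. 0 < t \<longrightarrow> t \<le> 1 \<longrightarrow> ennreal (1 / t ^ n) * modulus L n f t \<le> ennreal C * (L f + ennreal (1 / t ^ k) * modulus L k f t))"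
  proof (cases "n \<le> k")
   case True
   obtain C where "C > 0" "\<And>f t. 0 < t ==> t \<le> 1 ==> ennreal (1 / t ^ n) * modulus L n f t \<le> ennreal C * (L f + ennreal (1 / t ^ k) * modulus L k f t)"
    by (rule marchaud[OF True]) (rule that)
   then show ?thesis by (intro exI[of _ C]) blast
  qed (auto intro: exI[of _ 1])
 qed
 then obtain C where C: "\<And>n. 0 < C n"
  "\<And>n f t. n \<le> k ==> 0 < t ==> t \<le> 1 ==> ennreal (1 / t ^ n) * modulus L n f t \<le> ennreal (C n) * (L f + ennreal (1 / t ^ k) * modulus L k f t)"
  by metis
 define D where "D = (\<Sum>n\<le>k. C n)"
 \<comment> \<open>2^(k d) comes from the smoothers in d directions, (2 k^2)^k from the powers of
   1/\<tau> = k^2/t and from the factor 2^n for mixed differences, D from Marchaud's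
   inequality.\<close>
 define A where "A = 2 ^ (k * length dirs) * (2 * real (k * k)) ^ k * D"
 have D: "0 \<le> D" "n \<le> k ==> C n \<le> D" for n
  unfolding D_def by (auto intro!: sum_nonneg member_le_sum less_imp_le[OF C(1)])
 have A: "0 \<le> A" unfolding A_def using D by simp
 have main: "sobolev L k (smoothing_of k f t) \<le> ennreal (real (card (multi_indices k :: ('a => nat) set)) * A) * (L f + ennreal (1 / t ^ k) * modulus L k f t)"
  if f: "f \<in> Bor" and t: "0 < t" "t \<le> 1" for f t
 proof -
  let ?R = "L f + ennreal (1 / t ^ k) * modulus L k f t" and ?g = "smoothing_of k f t"
  define \<tau> where "\<tau> = t / real (k * k)"
  have \<tau>: "0 < \<tau>" "real k * \<tau> = t / real k" using t k by (simp_all add: \<tau>_def)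
  have sm: "smoothed \<tau> (t / real k) f ?g (repeat_mset k (mset dirs)) (2 ^ (k * length dirs))"
   unfolding smoothing_of_def \<tau>_def[symmetric] using \<tau> by (intro smoothed_foldr_smoother f) (auto simp: dirs)
  then have g: "?g \<in> Bor" by (simp add: smoothed_def)
  have each: "(INF G\<in>{G. has_weak_derivative ?g \<beta> G}. L G) \<le> ennreal A * ?R" if \<beta>: "\<beta> \<in> multi_indices k" for \<beta>
  proof -
   obtain bs where bs: "count_list bs = \<beta>" "set bs \<subseteq> Basis" "length bs \<le> k" by (rule multi_indices_list[OF \<beta>])
   let ?n = "length bs"
   \<comment> \<open>Every direction was averaged k times, enough for any multi-index of order at
     most k.\<close>
   have "mset bs \<subseteq># repeat_mset k (mset dirs)"
    unfolding subseteq_mset_def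
   proof
    fix b
    show "count (mset bs) b \<le> count (repeat_mset k (mset dirs)) b"
    proof (cases "b \<in> Basis")
     case True
     then have "count (mset dirs) b = 1" using dirs by (simp add: distinct_count_atmost_1)
     moreover have "count (mset bs) b \<le> k" using bs(3) count_le_size[of "mset bs" b] by simp
     ultimately show ?thesis by simp
    next
     case False
     then have "count (mset bs) b = 0" using bs(2) by (auto simp: count_eq_zero_iff)
     then show ?thesis by (simp only: le0)
    qed
   qed
   then obtain G where G: "G \<in> Bor" "weak_deriv bs ?g G"
    "\<And>hs. L (foldr fdiff hs G) \<le> ennreal (2 ^ (k * length dirs) * (1 / \<tau>) ^ ?n) * diff_sup (t / real k) f hs ?n"
    using sm unfolding smoothed_def by blast
   have "has_weak_derivative ?g \<beta> G"
    using has_weak_derivative_iff_weak_deriv[OF Bor_loc_integrable[OF g] Bor_loc_integrable[OF G(1)] bs(2)] G(2) by (simp add: bs(1))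
   then have "(INF G\<in>{G. has_weak_derivative ?g \<beta> G}. L G) \<le> L G" by (intro INF_lower) simp
   also have "... \<le> ennreal (2 ^ (k * length dirs) * (1 / \<tau>) ^ ?n) * diff_sup (t / real k) f [] ?n" using G(3)[of "[]"] by simp
   also have "... \<le> ennreal (2 ^ (k * length dirs) * (1 / \<tau>) ^ ?n) * (ennreal (2 ^ ?n) * modulus L ?n f t)"
   proof (intro mult_left_mono diff_sup_le_modulus)
    have "real ?n * t \<le> real k * t" using bs(3) t by (intro mult_right_mono) auto
    then show "real ?n * (t / real k) \<le> t" using k by (simp add: field_simps)
   qed (use t in auto)
   also have "... = ennreal (2 ^ (k * length dirs) * (2 * real (k * k)) ^ ?n) * (ennreal (1 / t ^ ?n) * modulus L ?n f t)"
   proof -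
    have "2 ^ (k * length dirs) * (1 / \<tau>) ^ ?n * 2 ^ ?n = 2 ^ (k * length dirs) * (2 * real (k * k)) ^ ?n * (1 / t ^ ?n)"
     by (simp add: \<tau>_def power_divide power_mult_distrib)
    then show ?thesis using \<tau> t by (simp only: mult.assoc[symmetric] ennreal_mult[symmetric] zero_le_mult_iff)
     (subst (1 2) ennreal_mult[symmetric]; simp)
   qed
   also have "... \<le> ennreal (2 ^ (k * length dirs) * (2 * real (k * k)) ^ k) * (ennreal D * ?R)"
   proof (rule mult_mono)
    have "1 * 1 \<le> real k * real k" using k by (intro mult_mono) auto
    then show "ennreal (2 ^ (k * length dirs) * (2 * real (k * k)) ^ ?n) \<le> ennreal (2 ^ (k * length dirs) * (2 * real (k * k)) ^ k)"
     using bs(3) by (intro ennreal_leI mult_left_mono power_increasing) auto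
    have "ennreal (1 / t ^ ?n) * modulus L ?n f t \<le> ennreal (C ?n) * ?R" by (rule C(2)[OF bs(3) t])
    also have "... \<le> ennreal D * ?R" using D(2)[OF bs(3)] by (intro mult_right_mono ennreal_leI) auto
    finally show "ennreal (1 / t ^ ?n) * modulus L ?n f t \<le> ennreal D * ?R" .
   qed simp_all
   also have "... = ennreal A * ?R" unfolding A_def using D(1) by (subst (2) ennreal_mult) (auto simp: mult.assoc)
   finally show ?thesis .
  qed
  have "sobolev L k ?g \<le> (\<Sum>\<beta>\<in>(multi_indices k :: ('a => nat) set). ennreal A * ?R)"
  proof -
   have "L ?g < \<infinity>" using g by (simp add: Bor_def)
   then have "sobolev L k ?g = (\<Sum>\<beta>\<in>multi_indices k. INF G\<in>{G. has_weak_derivative ?g \<beta> G}. L G)" by (simp add: sobolev_def)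
   also have "... \<le> (\<Sum>\<beta>\<in>(multi_indices k :: ('a => nat) set). ennreal A * ?R)" by (rule sum_mono) (rule each)
   finally show ?thesis .
  qed
  also have "... = ennreal (real (card (multi_indices k :: ('a => nat) set)) * A) * ?R"
   using A by (simp add: ennreal_mult ennreal_of_nat_eq_real_of_nat mult.assoc)
  finally show ?thesis .
 qed
 show ?thesis
 proof (rule that[of "real (card (multi_indices k :: ('a => nat) set)) * A + 1"])
  fix f t assume "f \<in> Bor" "0 < t" "t \<le> (1::real)"
  from main[OF this] show "sobolev L k (smoothing_of k f t) \<le> ennreal (real (card (multi_indices k :: ('a => nat) set)) * A + 1) * (L f + ennreal (1 / t ^ k) * modulus L k f t)"
   by (rule order.trans) (intro mult_right_mono ennreal_leI; simp)
 qed (use A in \<open>simp add: add_nonneg_pos\<close>)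
qed

lemma Bor_representative:
 assumes "f \<in> V" shows "\<exists>f'\<in>borel_measurable borel. f' \<in> V \<and> (AE x in lborel. f x = f' x)"
proof -
 obtain f' where f': "f' \<in> borel_measurable borel" "periodic P f'" "AE x in lborel. f x = f' x"
  using borel_representative[of f] assms by (auto simp: V_def)
 have "f' \<in> borel_measurable lebesgue" using f'(1) by (intro measurable_completion) simp
 then show ?thesis using f' by (auto simp: V_def)
qed

lemma Bor_representative':
 assumes "L f < \<infinity>" shows "\<exists>f'. f' \<in> Bor \<and> (AE x in lborel. f x = f' x)"
proof -
 have f: "f \<in> V" by (rule L_finite_V[OF assms])
 then obtain f' where f': "f' \<in> borel_measurable borel" "f' \<in> V" "AE x in lborel. f x = f' x" using Bor_representative by blast
 then have "L f' = L f" using L_AE_eq[OF f f'(2,3)] by simp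
 then show ?thesis using f' assms by (auto simp: Bor_def)
qed

lemma V_fdiff: "f \<in> V ==> fdiff h f \<in> V"
 unfolding fdiff_def by (intro V_diff V_shift)

lemma modulus_AE_eq:
 assumes "f \<in> V" "g \<in> V" "AE x in lborel. f x = g x"
 shows "modulus L k f t = modulus L k g t"
proof -
 have "(fdiff h ^^ n) f \<in> V \<and> (fdiff h ^^ n) g \<in> V \<and> (AE x in lborel. (fdiff h ^^ n) f x = (fdiff h ^^ n) g x)" for n h
 proof (induction n)
  case (Suc n)
  then have AE: "AE x in lborel. (fdiff h ^^ n) f x = (fdiff h ^^ n) g x" by blast
  from AE AE_lborel_shift[OF AE, of h] have "AE x in lborel. (fdiff h ^^ Suc n) f x = (fdiff h ^^ Suc n) g x"
   by eventually_elim (simp add: fdiff_def)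
  then show ?case using Suc by (auto intro: V_fdiff)
 qed (use assms in auto)
 then have "L ((fdiff h ^^ k) f) = L ((fdiff h ^^ k) g)" for h by (intro L_AE_eq) blast+
 then show ?thesis by (simp add: modulus_def)
qed

text \<open>The means are formed of a Borel representative r f; norm and moduli do not see the
  change on a null set.\<close>

lemma smoothing:
 assumes k: "1 \<le> k"
 shows "\<exists>g. dominated_on (below L)
    (\<lambda>(f, t). L (\<lambda>x. f x - g f t x)) (\<lambda>(f, t). modulus L k f t) \<and>
   dominated_on (below L)
    (\<lambda>(f, t). sobolev L k (g f t)) (\<lambda>(f, t). L f + ennreal (t powr (- real k)) * modulus L k f t)"
proof -
 obtain r where r: "\<And>f. L f < \<infinity> ==> r f \<in> Bor \<and> (AE x in lborel. f x = r f x)" using Bor_representative' by metis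
 have rL: "L (r f) = L f" "modulus L k (r f) t = modulus L k f t" if "L f < \<infinity>" for f t
  using L_AE_eq[of f "r f"] modulus_AE_eq[of f "r f"] r[OF that] L_finite_V[OF that] Bor_V by auto
 obtain C where C: "C > 0" "\<And>f t. f \<in> Bor ==> 0 < t ==> t \<le> 1 ==>
  sobolev L k (smoothing_of k f t) \<le> ennreal C * (L f + ennreal (1 / t ^ k) * modulus L k f t)"
  by (rule sobolev_smoothing_of[OF k]) (rule that)
 let ?D = "real (length dirs) * 2 ^ (k * length dirs) + 1" and ?g = "\<lambda>f. smoothing_of k (r f)"
 have 1: "L (\<lambda>x. f x - ?g f t x) \<le> ennreal ?D * modulus L k f t" if "L f < \<infinity>" "0 < t" "t < 1" for f t
 proof -
  have rf: "r f \<in> Bor" using r[OF that(1)] by blast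
  have AE: "AE x in lborel. f x - ?g f t x = r f x - ?g f t x" using r[OF that(1)] by auto
  have "L (\<lambda>x. f x - ?g f t x) = L (\<lambda>x. r f x - ?g f t x)"
   by (rule L_AE_eq[OF _ _ AE]; intro V_diff L_finite_V that(1) Bor_V rf)
    (simp_all add: smoothing_of_def Bor_foldr_smoother Bor_V rf)
  also have "... \<le> ennreal (real (length dirs) * 2 ^ (k * length dirs)) * modulus L k f t"
   using L_smoothing_of[OF rf that(2), of k] rL[OF that(1)] by simp
  also have "... \<le> ennreal ?D * modulus L k f t" by (intro mult_right_mono ennreal_leI) simp_all
  finally show ?thesis .
 qed
 have 2: "sobolev L k (?g f t) \<le> ennreal C * (L f + ennreal (t powr (- real k)) * modulus L k f t)" if "L f < \<infinity>" "0 < t" "t < 1" for f t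
 proof -
  have "t powr (- real k) = 1 / t ^ k" using that by (simp add: powr_minus_divide powr_realpow)
  then show ?thesis using C(2)[of "r f" t] r[OF that(1)] rL[OF that(1)] that by simp
 qed
 have "?D > 0" by (simp add: add_nonneg_pos)
 then show ?thesis
  using 1 2 C(1) unfolding dominated_on_def
  by (intro exI[of _ ?g] conjI exI[of _ ?D] exI[of _ C]) auto
qed

end

section \<open>Estimates by Sobolev norms\<close>

lemma weak_deriv_unique:
 assumes f: "loc_integrable f" "loc_integrable g" and eq: "\<And>\<phi>. \<phi> \<in> test_functions ==> (pairing \<phi> f) = pairing \<phi> g"
 shows "AE x in lborel. f x = g x"
proof -
 have "AE x in lborel. f x - g x = 0"
 proof (rule fundamental_lemma[OF loc_integrable_diff[OF f]])
  fix \<phi> :: "'a => real" assume \<phi>: "\<phi> \<in> test_functions"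
  show "pairing \<phi> (\<lambda>x. f x - g x) = 0"
   unfolding scaleR_diff_right
   by (subst Bochner_Integration.integral_diff[OF test_function_times_integrable[OF \<phi> f(1)] test_function_times_integrable[OF \<phi> f(2)]])
    (simp add: eq[OF \<phi>])
 qed
 then show ?thesis by simp
qed

context lp_setting begin

lemma has_weak_derivative_imp_weak_deriv:
 assumes w: "has_weak_derivative f (count_list bs) g" and bs: "set bs \<subseteq> Basis"
  and f: "f \<in> V" "f' \<in> Bor" "AE x in lborel. f x = f' x" and g: "g \<in> V" "g' \<in> Bor" "AE x in lborel. g x = g' x"
 shows "weak_deriv bs f' g'"
 unfolding weak_deriv_def
proof
 fix \<phi> :: "'a => real" assume \<phi>: "\<phi> \<in> test_functions"
 have eq: "(LINT x|lebesgue. \<psi> x *\<^sub>R F x) = pairing \<psi> F'"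
  if \<psi>: "\<psi> \<in> test_functions" and F: "F \<in> V" "F' \<in> Bor" "AE x in lborel. F x = F' x" for \<psi> :: "'a => real" and F F'
 proof -
  have [measurable]: "\<psi> \<in> borel_measurable borel" "F' \<in> borel_measurable borel" "F \<in> borel_measurable lebesgue"
   using \<psi> F by (auto intro: test_function_measurable simp: Bor_def V_def)
  have \<psi>m: "\<psi> \<in> borel_measurable lebesgue" by (intro measurable_completion) simp
  have m: "(\<lambda>x. \<psi> x *\<^sub>R F' x) \<in> borel_measurable lborel" by measurable
  have m2: "(\<lambda>x. \<psi> x *\<^sub>R F x) \<in> borel_measurable lebesgue" using \<psi>m by measurable
  have "(LINT x|lebesgue. \<psi> x *\<^sub>R F x) = (LINT x|lebesgue. \<psi> x *\<^sub>R F' x)"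
   using AE_completion[OF F(3)] by (intro integral_cong_AE m2 measurable_completion[OF m]) (auto elim!: eventually_mono)
  also have "... = pairing \<psi> F'" by (rule integral_completion[OF m])
  finally show ?thesis .
 qed
 have "(\<Sum>b\<in>Basis. count_list bs b) = length bs" by (rule sum_count_set[OF bs finite_Basis])
 then have "(LINT x|lebesgue. partials bs \<phi> x *\<^sub>R f x) = (-1) ^ length bs * (LINT x|lebesgue. \<phi> x *\<^sub>R g x)"
  using w \<phi> by (simp add: has_weak_derivative_def multi_partial_eq_partials[OF \<phi> bs] flip: multi_partial_eq_partials[OF \<phi> bs])
 then show "pairing (partials bs \<phi>) f' = (-1) ^ length bs * pairing \<phi> g'"
  by (simp only: eq[OF \<phi> g] eq[OF test_function_partials[OF \<phi> bs] f])
qed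

text \<open>The infima in \<open>sobolev\<close> are approached up to e, by one Borel function per
  list of directions. All are derivatives of the same representative f', so they are also
  derivatives of one another, as \<open>L_fdiff_pow_le_derivatives\<close> exploits.\<close>

lemma sobolev_derivatives:
 assumes f: "sobolev L k f < \<infinity>" and e: "0 < e"
 obtains f' G where "f' \<in> Bor" "AE x in lborel. f x = f' x"
  "\<And>bs. set bs \<subseteq> Basis ==> length bs \<le> k ==> G bs \<in> Bor \<and> weak_deriv bs f' (G bs) \<and>
   L (G bs) \<le> sobolev L k f + ennreal e"
proof -
 have Lf: "L f < \<infinity>" using f by (auto simp: sobolev_def split: if_splits)
 obtain f' where f': "f' \<in> Bor" "AE x in lborel. f x = f' x" using Bor_representative'[OF Lf] by blast
 have "\<exists>G\<in>Bor. weak_deriv bs f' G \<and> L G \<le> sobolev L k f + ennreal e" if bs: "set bs \<subseteq> Basis" "length bs \<le> k" for bs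
 proof -
  let ?I = "INF g\<in>{g. has_weak_derivative f (count_list bs) g}. L g"
  have "(\<Sum>b\<in>Basis. count_list bs b) = length bs" by (rule sum_count_set[OF bs(1) finite_Basis])
  then have mi: "count_list bs \<in> multi_indices k" using bs by (auto simp: multi_indices_def count_list_0_iff)
  have "?I \<le> (\<Sum>\<beta>\<in>multi_indices k. INF g\<in>{g. has_weak_derivative f \<beta> g}. L g)"
   by (rule member_le_sum[OF mi _ finite_multi_indices]) simp
  also have "... = sobolev L k f" using Lf by (simp add: sobolev_def)
  finally have I: "?I \<le> sobolev L k f" .
  also have "... < sobolev L k f + ennreal e" using f e by (cases "sobolev L k f") (auto simp flip: ennreal_plus simp: ennreal_less_iff)
  finally obtain g where g: "has_weak_derivative f (count_list bs) g" "L g < sobolev L k f + ennreal e"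
   by (auto simp: INF_less_iff)
  have "L g < \<infinity>" using g(2) by (rule less_le_trans) simp
  then obtain g' where g': "g' \<in> Bor" "AE x in lborel. g x = g' x" using Bor_representative' by blast
  have V: "f \<in> V" "g \<in> V" using Lf \<open>L g < \<infinity>\<close> by (auto intro: L_finite_V)
  have "L g' = L g" using L_AE_eq[OF V(2) Bor_V[OF g'(1)] g'(2)] by simp
  then show ?thesis
   using has_weak_derivative_imp_weak_deriv[OF g(1) bs(1) V(1) f' V(2) g'] g g'(1) by (intro bexI[of _ g']) auto
 qed
 then obtain G where "\<And>bs. set bs \<subseteq> Basis ==> length bs \<le> k ==> G bs \<in> Bor \<and> weak_deriv bs f' (G bs) \<and> L (G bs) \<le> sobolev L k f + ennreal e"
  by metis
 then show ?thesis by (rule that[OF f'])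
qed

text \<open>The multi-index 0 contributes an infimum over functions with the same pairings as f; by
  the fundamental lemma those of finite norm equal f almost everywhere.\<close>

lemma norm_le_sobolev: "L f \<le> sobolev L k f"
proof (cases "sobolev L k f < \<infinity>")
 case True
 show ?thesis
 proof (rule ennreal_le_epsilon)
  fix e :: real assume "0 < e"
  obtain f' G where f': "f' \<in> Bor" "AE x in lborel. f x = f' x"
   and G: "\<And>bs. set bs \<subseteq> Basis ==> length bs \<le> k ==> G bs \<in> Bor \<and> weak_deriv bs f' (G bs) \<and> L (G bs) \<le> sobolev L k f + ennreal e"
   by (rule sobolev_derivatives[OF True \<open>0 < e\<close>]) (rule that)
  have G0: "G [] \<in> Bor" "weak_deriv [] f' (G [])" "L (G []) \<le> sobolev L k f + ennreal e" using G[of "[]"] by auto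
  have AE: "AE x in lborel. f' x = G [] x"
   by (rule weak_deriv_unique) (use G0 f' Bor_loc_integrable in \<open>auto simp: weak_deriv_def\<close>)
  have "L f < \<infinity>" using True by (auto simp: sobolev_def split: if_splits)
  then have "L f = L f'" by (intro L_AE_eq L_finite_V Bor_V f') auto
  also have "... = L (G [])" by (intro L_AE_eq Bor_V f' G0 AE)
  finally show "L f \<le> sobolev L k f + ennreal e" using G0(3) by simp
 qed
next
 case False
 then have "sobolev L k f = top" by (simp add: less_top[symmetric])
 then show ?thesis by simp
qed

text \<open>Almost everywhere the difference equals the sum over b of (h \<bullet> b) times the
  Steklov mean of g b along h, because both have the same pairings with test functions. The means
  are contractions.\<close>

lemma L_fdiff_le_gradient:
 assumes f: "f \<in> Bor" and g: "\<And>b. b \<in> Basis ==> g b \<in> Bor \<and> weak_deriv [b] f (g b)"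
 shows "L (fdiff h f) \<le> (\<Sum>b\<in>Basis. ennreal \<bar>h \<bullet> b\<bar> * L (g b))"
proof -
 let ?S = "\<lambda>x. \<Sum>b\<in>Basis. of_real (h \<bullet> b) * steklov h (g b) x"
 have S: "?S \<in> Bor" using g by (intro Bor_sum Bor_cmult Bor_steklov) auto
 have AE: "AE x in lborel. fdiff h f x = ?S x"
 proof (rule weak_deriv_unique)
  fix \<phi> :: "'a => real" assume \<phi>: "\<phi> \<in> test_functions"
  have "pairing \<phi> (fdiff h f) = - (\<Sum>b\<in>Basis. (h \<bullet> b) *\<^sub>R (pairing (partials [b] \<phi>) (steklov h f)))"
   by (rule integral_test_fdiff[OF \<phi> Bor_loc_integrable[OF f]])
  also have "... = (\<Sum>b\<in>Basis. (h \<bullet> b) *\<^sub>R (pairing \<phi> (steklov h (g b))))"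
   unfolding sum_negf[symmetric]
  proof (rule sum.cong)
   fix b :: 'a assume b: "b \<in> Basis"
   have "weak_deriv [b] (steklov h f) (steklov h (g b))"
    using g[OF b] b by (intro weak_deriv_steklov Bor_loc_integrable f) auto
   from weak_derivD[OF this \<phi>] show "- ((h \<bullet> b) *\<^sub>R (pairing (partials [b] \<phi>) (steklov h f))) = (h \<bullet> b) *\<^sub>R (pairing \<phi> (steklov h (g b)))"
    by simp
  qed simp
  also have "... = (\<integral>x. (\<Sum>b\<in>Basis. (h \<bullet> b) *\<^sub>R (\<phi> x *\<^sub>R steklov h (g b) x)) \<partial>lborel)"
  proof (subst Bochner_Integration.integral_sum)
   fix b :: 'a assume "b \<in> Basis"
   then have "loc_integrable (steklov h (g b))" using g by (intro Bor_loc_integrable Bor_steklov) simp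
   then show "integrable lborel (\<lambda>x. (h \<bullet> b) *\<^sub>R (\<phi> x *\<^sub>R steklov h (g b) x))"
    by (intro integrable_scaleR_right test_function_times_integrable \<phi>)
  qed (simp only: integral_scaleR_right)
  also have "... = pairing \<phi> ?S"
   by (intro Bochner_Integration.integral_cong refl, unfold scaleR_sum_right, intro sum.cong refl)
    (simp only: scaleR_conv_of_real mult.left_commute)
  finally show "pairing \<phi> (fdiff h f) = pairing \<phi> ?S" .
 qed (intro Bor_loc_integrable Bor_fdiff f S)+
 have "L (fdiff h f) = L ?S" by (intro L_AE_eq Bor_V Bor_fdiff f S AE)
 also have "... \<le> (\<Sum>b\<in>Basis. L (\<lambda>x. of_real (h \<bullet> b) * steklov h (g b) x))" by (rule L_sum) simp
 also have "... \<le> (\<Sum>b\<in>Basis. ennreal \<bar>h \<bullet> b\<bar> * L (g b))"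
 proof (rule sum_mono)
  fix b :: 'a assume "b \<in> Basis"
  then have "ennreal (norm (of_real (h \<bullet> b) :: complex)) * L (steklov h (g b)) \<le> ennreal \<bar>h \<bullet> b\<bar> * L (g b)"
   using g by (auto intro!: mult_left_mono L_steklov)
  then show "L (\<lambda>x. of_real (h \<bullet> b) * steklov h (g b) x) \<le> ennreal \<bar>h \<bullet> b\<bar> * L (g b)"
   by (rule order.trans[OF L_cmult])
 qed
 finally show ?thesis .
qed

lemma L_fdiff_pow_le_derivatives:
 assumes G: "\<And>bs. set bs \<subseteq> Basis ==> length bs \<le> k ==> G bs \<in> Bor \<and> weak_deriv bs f (G bs) \<and> L (G bs) \<le> M"
  and bs: "set bs \<subseteq> Basis" "length bs + n \<le> k"
 shows "L ((fdiff h ^^ n) (G bs)) \<le> ennreal ((real DIM('a) * norm h) ^ n) * M"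
 using bs
proof (induction n arbitrary: bs)
 case 0
 then show ?case using G[of bs] by simp
next
 case (Suc n)
 let ?M = "ennreal ((real DIM('a) * norm h) ^ n) * M"
 have "G bs \<in> Bor" using G Suc.prems by simp
 have powB: "(fdiff h ^^ n) f \<in> Bor" if "f \<in> Bor" for f using Bor_foldr_fdiff[OF that, of "replicate n h"] unfolding foldr_fdiff_replicate .
 \<comment> \<open>Lists grow at the end because \<open>partials (bs @ [b])\<close> takes the
   derivative in direction b first: testing G bs with the b-derivative of \<phi> gives the claim up
   to the sign (-1)^(length bs), which cancels.\<close>
 have step: "weak_deriv [b] (G bs) (G (bs @ [b]))" if b: "b \<in> Basis" for b
  unfolding weak_deriv_def
 proof
  fix \<phi> :: "'a => real" assume \<phi>: "\<phi> \<in> test_functions"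
  have \<psi>: "partials [b] \<phi> \<in> test_functions" using b by (intro test_function_partials \<phi>) simp
  have w: "weak_deriv bs f (G bs)" "weak_deriv (bs @ [b]) f (G (bs @ [b]))" using G[of bs] G[of "bs @ [b]"] Suc.prems b by auto
  have "(-1) ^ length bs * pairing (partials [b] \<phi>) (G bs) = (-1) ^ length (bs @ [b]) * pairing \<phi> (G (bs @ [b]))"
   unfolding weak_derivD[OF w(1) \<psi>, symmetric] weak_derivD[OF w(2) \<phi>, symmetric] partials_append ..
  then show "pairing (partials [b] \<phi>) (G bs) = (-1) ^ length [b] * pairing \<phi> (G (bs @ [b]))"
   unfolding length_append power_add mult.assoc by (rule mult_left_cancel[THEN iffD1, rotated]) simp
 qed
 have "L ((fdiff h ^^ Suc n) (G bs)) \<le> (\<Sum>b\<in>Basis. ennreal \<bar>h \<bullet> b\<bar> * L ((fdiff h ^^ n) (G (bs @ [b]))))"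
  unfolding funpow.simps comp_def
 proof (rule L_fdiff_le_gradient[OF powB[OF \<open>G bs \<in> Bor\<close>]])
  fix b :: 'a assume b: "b \<in> Basis"
  then have "G (bs @ [b]) \<in> Bor" using G Suc.prems by simp
  then show "(fdiff h ^^ n) (G (bs @ [b])) \<in> Bor \<and> weak_deriv [b] ((fdiff h ^^ n) (G bs)) ((fdiff h ^^ n) (G (bs @ [b])))"
   using weak_deriv_fdiff_pow[OF step[OF b] Bor_loc_integrable[OF \<open>G bs \<in> Bor\<close>] Bor_loc_integrable[of "G (bs @ [b])"], where h = h and n = n] powB b by simp
 qed
 also have "... \<le> (\<Sum>b\<in>(Basis :: 'a set). ennreal (norm h) * ?M)"
 proof (intro sum_mono mult_mono ennreal_leI Suc.IH)
  fix b :: 'a assume "b \<in> Basis"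
  then show "\<bar>h \<bullet> b\<bar> \<le> norm h" by (rule Basis_le_norm)
 qed (use Suc.prems in auto)
 also have "... = ennreal ((real DIM('a) * norm h) ^ Suc n) * M"
  by (simp add: ennreal_of_nat_eq_real_of_nat mult.assoc[symmetric] flip: ennreal_mult)
 finally show ?case .
qed

lemma modulus_le_sobolev:
 assumes t: "0 \<le> t"
 shows "modulus L k f t \<le> ennreal ((real DIM('a) * t) ^ k) * sobolev L k f"
proof (cases "sobolev L k f < \<infinity>")
 case True
 let ?c = "(real DIM('a) * t) ^ k"
 have Lf: "L f < \<infinity>" using True by (auto simp: sobolev_def split: if_splits)
 have main: "modulus L k f t \<le> ennreal ?c * (sobolev L k f + ennreal e)" if e: "0 < e" for e
 proof -
  obtain f' G where f': "f' \<in> Bor" "AE x in lborel. f x = f' x"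
   and G: "\<And>bs. set bs \<subseteq> Basis ==> length bs \<le> k ==> G bs \<in> Bor \<and> weak_deriv bs f' (G bs) \<and> L (G bs) \<le> sobolev L k f + ennreal e"
   by (rule sobolev_derivatives[OF True e]) (rule that)
  have G0: "G [] \<in> Bor" "weak_deriv [] f' (G [])" using G[of "[]"] by auto
  have AE: "AE x in lborel. f' x = G [] x"
   by (rule weak_deriv_unique) (use G0 f' Bor_loc_integrable in \<open>auto simp: weak_deriv_def\<close>)
  have "modulus L k f t = modulus L k f' t" by (intro modulus_AE_eq L_finite_V Lf Bor_V f')
  also have "... = modulus L k (G []) t" by (intro modulus_AE_eq Bor_V f' G0 AE)
  also have "... \<le> ennreal ?c * (sobolev L k f + ennreal e)"
   unfolding modulus_def
  proof (rule SUP_least)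
   fix h :: 'a assume h: "h \<in> {h. norm h \<le> t}"
   have "L ((fdiff h ^^ k) (G [])) \<le> ennreal ((real DIM('a) * norm h) ^ k) * (sobolev L k f + ennreal e)"
    by (rule L_fdiff_pow_le_derivatives[OF G]) auto
   also have "... \<le> ennreal ?c * (sobolev L k f + ennreal e)"
    using h by (intro mult_right_mono ennreal_leI power_mono mult_left_mono) auto
   finally show "L ((fdiff h ^^ k) (G [])) \<le> ennreal ?c * (sobolev L k f + ennreal e)" .
  qed
  finally show ?thesis .
 qed
 have c: "0 \<le> ?c" using t by simp
 show ?thesis
 proof (rule ennreal_le_epsilon)
  fix e :: real assume e: "0 < e"
  \<comment> \<open>The denominator is c + 1 since c itself vanishes for t = 0 and k > 0.\<close>
  have "modulus L k f t \<le> ennreal ?c * (sobolev L k f + ennreal (e / (?c + 1)))" using c e by (intro main) (simp add: add_nonneg_pos)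
  also have "... = ennreal ?c * sobolev L k f + ennreal (?c * (e / (?c + 1)))" using c e by (simp add: distrib_left flip: ennreal_mult)
  also have "... \<le> ennreal ?c * sobolev L k f + ennreal e"
  proof (intro add_left_mono ennreal_leI)
   have "?c * e \<le> e * (?c + 1)" using e by (simp add: algebra_simps)
   then show "?c * (e / (?c + 1)) \<le> e" using c by (simp add: pos_divide_le_eq add_nonneg_pos)
  qed
  finally show "modulus L k f t \<le> ennreal ?c * sobolev L k f + ennreal e" .
 qed
next
 case False
 show ?thesis
 \<comment> \<open>With the Sobolev norm infinite, the right-hand side is 0 in the first case, as
   zero times infinity is 0. There the modulus vanishes by itself, 0 being the only step.\<close>
 proof (cases "t = 0 \<and> k \<noteq> 0")
  case True
  then have "(fdiff 0 ^^ k) f = (\<lambda>x. 0)" by (cases k) (auto simp: fdiff_def)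
  then have "modulus L k f t \<le> 0" unfolding modulus_def using True by (intro SUP_least) (auto simp: L_zero)
  then show ?thesis by simp
 next
  case F: False
  then have "0 < (real DIM('a) * t) ^ k" using t by (cases "k = 0") auto
  moreover have "sobolev L k f = top" using False by (simp add: less_top[symmetric])
  ultimately show ?thesis using F by (auto simp: ennreal_mult_top)
 qed
qed

lemma smoothing_norm:
 assumes k: "1 \<le> k" shows "smoothing_norm L k"
proof unfold_locales
 show "dominated_on UNIV L (sobolev L k)"
  unfolding dominated_on_def using norm_le_sobolev by (auto intro!: exI[of _ 1])
 show "dominated_on (below (sobolev L k))
   (\<lambda>(f, t). ennreal (t powr (- real k)) * modulus L k f t) (\<lambda>(f, t). sobolev L k f)"
  unfolding dominated_on_def
 proof (intro exI[of _ "real DIM('a) ^ k"] conjI ballI)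
  fix z :: "('a => complex) \<times> real" assume "z \<in> (below (sobolev L k))"
  then obtain f t where z: "z = (f, t)" "0 < t" by auto
  have "ennreal (t powr (- real k)) * modulus L k f t \<le> ennreal (t powr (- real k)) * (ennreal ((real DIM('a) * t) ^ k) * sobolev L k f)"
   using z by (intro mult_left_mono modulus_le_sobolev) auto
  also have "... = ennreal (t powr (- real k) * (real DIM('a) * t) ^ k) * sobolev L k f"
   using z by (simp add: ennreal_mult mult.assoc)
  also have "t powr (- real k) * (real DIM('a) * t) ^ k = real DIM('a) ^ k"
   using z by (simp add: powr_minus_divide powr_realpow power_mult_distrib)
  finally show "(case z of (f, t) => ennreal (t powr (- real k)) * modulus L k f t) \<le> ennreal (real DIM('a) ^ k) * (case z of (f, t) => sobolev L k f)"
   by (simp add: z)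
 qed simp
qed (use k smoothing in auto)

end

section \<open>Euclidean space and the torus\<close>

text \<open>Inherited from \<open>lborel\<close> through a Borel representative, the exceptional
  null set being translated along.\<close>

lemma nn_integral_lebesgue_shift:
 fixes F :: "'a::euclidean_space => ennreal"
 assumes "F \<in> borel_measurable lebesgue"
 shows "(\<integral>\<^sup>+x. F (x + h) \<partial>lebesgue) = (\<integral>\<^sup>+x. F x \<partial>lebesgue)"
proof -
 obtain F' where F': "F' \<in> borel_measurable lborel" "AE x in lborel. F x = F' x"
  using completion_ex_borel_measurable[OF assms] by blast
 have "(\<integral>\<^sup>+x. F (x + h) \<partial>lborel) = (\<integral>\<^sup>+x. F' (x + h) \<partial>lborel)"
  by (rule nn_integral_cong_AE[OF AE_lborel_shift[OF F'(2)]])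
 also have "... = (\<integral>\<^sup>+x. F' x \<partial>lborel)" using F'(1) by (intro nn_integral_lborel_shift) simp
 also have "... = (\<integral>\<^sup>+x. F x \<partial>lborel)" using F'(2) by (intro nn_integral_cong_AE) (auto elim!: eventually_mono)
 finally show ?thesis by (simp add: nn_integral_completion)
qed

lemma lebesgue_complex_borel_representative:
 fixes f :: "'a::euclidean_space => complex"
 assumes "f \<in> borel_measurable lebesgue"
 obtains f' where "f' \<in> borel_measurable borel" "AE x in lborel. f x = f' x"
proof -
 have "(\<lambda>x. Re (f x)) \<in> borel_measurable lebesgue" "(\<lambda>x. Im (f x)) \<in> borel_measurable lebesgue" using assms by measurable
 then obtain a b where ab: "a \<in> borel_measurable lborel" "AE x in lborel. Re (f x) = a x"
  "b \<in> borel_measurable lborel" "AE x in lborel. Im (f x) = b x"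
  using completion_ex_borel_measurable_real by metis
 have [measurable]: "a \<in> borel_measurable borel" "b \<in> borel_measurable borel" using ab by simp_all
 have "(\<lambda>x. of_real (a x) + \<i> * of_real (b x) :: complex) \<in> borel_measurable borel" by measurable
 moreover have "AE x in lborel. f x = of_real (a x) + \<i> * of_real (b x)" using ab(2,4) by eventually_elim (simp add: complex_eq_iff)
 ultimately show ?thesis by (rule that)
qed

lemma lp_setting_space:
 assumes p: "1 \<le> p" shows "lp_setting {} (UNIV :: 'a::euclidean_space set) p"
proof
 show "(\<integral>\<^sup>+x\<in>UNIV. F (x + h) \<partial>lebesgue) = (\<integral>\<^sup>+x\<in>UNIV. F x \<partial>lebesgue)"
  if "F \<in> borel_measurable lebesgue" for F :: "'a => ennreal" and h
  using nn_integral_lebesgue_shift[OF that] by simp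
 show "\<exists>C<\<infinity>. \<forall>F :: 'a => ennreal. F \<in> borel_measurable lebesgue \<longrightarrow> periodic {} F \<longrightarrow>
   (\<integral>\<^sup>+x\<in>K. F x \<partial>lebesgue) \<le> C * (\<integral>\<^sup>+x\<in>UNIV. F x \<partial>lebesgue)" for K
  by (intro exI[of _ 1]) (auto intro!: nn_integral_mono simp: indicator_def)
 show "\<exists>f'\<in>borel_measurable borel. periodic {} f' \<and> (AE x in lborel. f x = f' x)"
  if "f \<in> borel_measurable lebesgue" for f :: "'a => complex"
  using lebesgue_complex_borel_representative[OF that] by (metis periodic_def empty_iff)
qed (use p in auto)

lemma Lp_space_eq: "1 \<le> p ==> Lp_space p = lp_setting.L {} (UNIV :: 'a::euclidean_space set) p"
 by (auto simp: fun_eq_iff Lp_space_def lp_setting.L_def lp_setting.V_def[OF lp_setting_space] lp_setting_space periodic_def lebesgue_on_UNIV_eq)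

section \<open>Periodic functions\<close>

abbreviation (input) torus_periods :: "'a::euclidean_space set" where
 "torus_periods \<equiv> (\<lambda>b. (2 * pi) *\<^sub>R b) ` Basis"

abbreviation (input) torus_cell :: "'a::euclidean_space set" where
 "torus_cell \<equiv> {x. \<forall>b\<in>Basis. 0 \<le> x \<bullet> b \<and> x \<bullet> b < 2 * pi}"

lemma periodic_multiple:
 assumes "\<And>x. F (x + v) = F (x :: 'a::real_vector)"
 shows "F (x + of_int z *\<^sub>R v) = F x"
proof (induction z rule: int_induct[where k = 0])
 case (step1 i)
 then show ?case using assms[of "x + of_int i *\<^sub>R v"] by (simp add: algebra_simps)
next
 case (step2 i)
 have "x + of_int (i - 1) *\<^sub>R v + v = x + of_int i *\<^sub>R v" by (simp add: algebra_simps)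
 then show ?case using assms[of "x + of_int (i - 1) *\<^sub>R v"] step2(2) by (simp only:)
qed simp

text \<open>In dimension one the cell is the slab 0 \<le> x \<bullet> e < 2 pi. A shift is reduced
  modulo the period to some r in [0, 2 pi); the slab from r to r + 2 pi is cut at 2 pi and the
  protruding part moved back. A compact set is covered by finitely many cells, whence the local
  bound.\<close>

lemma lp_setting_torus:
 assumes dim: "DIM('a::euclidean_space) = 1" and p: "1 \<le> p"
 shows "lp_setting (torus_periods :: 'a set) torus_cell p"
proof -
 obtain e :: 'a where e: "Basis = {e}" using dim by (rule card_1_singletonE)
 then have ee: "e \<bullet> e = 1" using inner_same_Basis[of e] by (simp add: e)
 define w where "w = 2 * pi"
 have w: "w > 0" by (simp add: w_def)
 define v where "v = w *\<^sub>R e"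
 have ve: "v \<bullet> e = w" by (simp add: v_def ee)
 define S where "S = (\<lambda>a b. {x :: 'a. a \<le> x \<bullet> e \<and> x \<bullet> e < b})"
 have S [measurable]: "S a b \<in> sets borel" for a b unfolding S_def by measurable
 have Q: "torus_cell = S 0 w" by (simp add: e S_def w_def)
 have per: "periodic torus_periods F \<longleftrightarrow> (\<forall>x. F (x + v) = F x)" for F :: "'a => 'b"
  by (simp add: periodic_def e v_def w_def)
 have shiftS: "(\<integral>\<^sup>+x\<in>S a b. F (x + h) \<partial>lebesgue) = (\<integral>\<^sup>+x\<in>S (a + h \<bullet> e) (b + h \<bullet> e). F x \<partial>lebesgue)"
  if "F \<in> borel_measurable lebesgue" for F :: "'a => ennreal" and a b h
 proof -
  have [measurable]: "F \<in> borel_measurable lebesgue" "S (a + h \<bullet> e) (b + h \<bullet> e) \<in> sets lebesgue" using that S by auto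
  have "(\<integral>\<^sup>+x\<in>S a b. F (x + h) \<partial>lebesgue) = (\<integral>\<^sup>+x. F (x + h) * indicator (S (a + h \<bullet> e) (b + h \<bullet> e)) (x + h) \<partial>lebesgue)"
   by (intro nn_integral_cong) (auto simp: S_def indicator_def inner_add_left)
  also have "... = (\<integral>\<^sup>+x\<in>S (a + h \<bullet> e) (b + h \<bullet> e). F x \<partial>lebesgue)"
   by (rule nn_integral_lebesgue_shift) measurable
  finally show ?thesis .
 qed
 have tile: "(\<integral>\<^sup>+x\<in>S (of_int z * w + a) (of_int z * w + b). F x \<partial>lebesgue) = (\<integral>\<^sup>+x\<in>S a b. F x \<partial>lebesgue)"
  if "F \<in> borel_measurable lebesgue" "\<forall>x. F (x + v) = F x" for F :: "'a => ennreal" and z a b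
  using shiftS[OF that(1), of "of_int z *\<^sub>R v" a b] periodic_multiple[of F v] that(2) by (simp add: ve add.commute)
 have split: "(\<integral>\<^sup>+x\<in>S a c. F x \<partial>lebesgue) = (\<integral>\<^sup>+x\<in>S a b. F x \<partial>lebesgue) + (\<integral>\<^sup>+x\<in>S b c. F x \<partial>lebesgue)"
  if "F \<in> borel_measurable lebesgue" "a \<le> b" "b \<le> c" for F :: "'a => ennreal" and a b c
 proof -
  have [measurable]: "F \<in> borel_measurable lebesgue" "S a b \<in> sets lebesgue" "S b c \<in> sets lebesgue" using that S by auto
  have "(\<integral>\<^sup>+x\<in>S a c. F x \<partial>lebesgue) = (\<integral>\<^sup>+x. F x * indicator (S a b) x + F x * indicator (S b c) x \<partial>lebesgue)"
   using that by (intro nn_integral_cong) (auto simp: S_def indicator_def)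
  also have "... = (\<integral>\<^sup>+x\<in>S a b. F x \<partial>lebesgue) + (\<integral>\<^sup>+x\<in>S b c. F x \<partial>lebesgue)"
   by (rule nn_integral_add) measurable
  finally show ?thesis .
 qed
 show ?thesis
  unfolding lp_setting_def Q
 proof (intro conjI allI impI)
  show "S 0 w \<in> sets borel" "1 \<le> p" by (rule S, rule p)
 next
  fix F :: "'a => ennreal" and h :: 'a
  assume F: "F \<in> borel_measurable lebesgue" and "periodic torus_periods F"
  then have F': "\<forall>x. F (x + v) = F x" by (simp add: per)
  define z where "z = \<lfloor>h \<bullet> e / w\<rfloor>"
  define r where "r = h \<bullet> e - of_int z * w"
  have r: "0 \<le> r" "r < w" using floor_divide_lower[OF w, of "h \<bullet> e"] floor_divide_upper[OF w, of "h \<bullet> e"]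
   by (simp_all add: r_def z_def algebra_simps)
  have "(\<integral>\<^sup>+x\<in>S 0 w. F (x + h) \<partial>lebesgue) = (\<integral>\<^sup>+x\<in>S (of_int z * w + r) (of_int z * w + (w + r)). F x \<partial>lebesgue)"
   using shiftS[OF F, of h 0 w] by (simp add: r_def)
  also have "... = (\<integral>\<^sup>+x\<in>S r (w + r). F x \<partial>lebesgue)" by (rule tile[OF F F'])
  also have "... = (\<integral>\<^sup>+x\<in>S r w. F x \<partial>lebesgue) + (\<integral>\<^sup>+x\<in>S w (w + r). F x \<partial>lebesgue)"
   using r by (intro split[OF F]) auto
  also have "(\<integral>\<^sup>+x\<in>S w (w + r). F x \<partial>lebesgue) = (\<integral>\<^sup>+x\<in>S 0 r. F x \<partial>lebesgue)"
   using tile[OF F F', of 1 0 r] by simp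
  also have "(\<integral>\<^sup>+x\<in>S r w. F x \<partial>lebesgue) + (\<integral>\<^sup>+x\<in>S 0 r. F x \<partial>lebesgue) = (\<integral>\<^sup>+x\<in>S 0 w. F x \<partial>lebesgue)"
   using r split[OF F, of 0 r w] by (simp add: add.commute)
  finally show "(\<integral>\<^sup>+x\<in>S 0 w. F (x + h) \<partial>lebesgue) = (\<integral>\<^sup>+x\<in>S 0 w. F x \<partial>lebesgue)" .
 next
  fix K :: "'a set" assume "compact K"
  then obtain R where R: "\<And>x. x \<in> K ==> norm x \<le> R" by (meson bounded_iff compact_imp_bounded)
  obtain N where N: "max R 0 < real N * w" using reals_Archimedean3[OF w] by blast
  have main: "(\<integral>\<^sup>+x\<in>S (- real n * w) (real n * w). F x \<partial>lebesgue) \<le> ennreal (real (2 * n)) * (\<integral>\<^sup>+x\<in>S 0 w. F x \<partial>lebesgue)"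
   if F: "F \<in> borel_measurable lebesgue" and F': "\<forall>x. F (x + v) = F x" for F :: "'a => ennreal" and n
  proof (induction n)
   case 0
   have "S 0 0 = {}" by (auto simp: S_def)
   then show ?case by simp
  next
   case (Suc n)
   let ?I = "\<integral>\<^sup>+x\<in>S 0 w. F x \<partial>lebesgue"
   have 1: "- real (Suc n) * w \<le> - real n * w" "- real n * w \<le> real (Suc n) * w" "- real n * w \<le> real n * w" "real n * w \<le> real (Suc n) * w"
    using w by (auto simp: algebra_simps add_increasing)
   have t1: "(\<integral>\<^sup>+x\<in>S (- real (Suc n) * w) (- real n * w). F x \<partial>lebesgue) = ?I"
    using tile[OF F F', of "- int (Suc n)" 0 w] by (simp add: algebra_simps)
   have t2: "(\<integral>\<^sup>+x\<in>S (real n * w) (real (Suc n) * w). F x \<partial>lebesgue) = ?I"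
    using tile[OF F F', of "int n" 0 w] by (simp add: algebra_simps)
   have "(\<integral>\<^sup>+x\<in>S (- real (Suc n) * w) (real (Suc n) * w). F x \<partial>lebesgue) = ?I + ((\<integral>\<^sup>+x\<in>S (- real n * w) (real n * w). F x \<partial>lebesgue) + ?I)"
    unfolding split[OF F 1(1,2)] split[OF F 1(3,4)] t1 t2 ..
   also have "... \<le> ?I + (ennreal (real (2 * n)) * ?I + ?I)" using Suc.IH by (intro add_mono) auto
   also have "... = (1 + (ennreal (real (2 * n)) + 1)) * ?I" by (simp only: distrib_right mult_1_left)
   also have "1 + (ennreal (real (2 * n)) + 1) = ennreal (1 + (real (2 * n) + 1))"
    by (simp only: ennreal_plus ennreal_1 of_nat_0_le_iff zero_le_one add_nonneg_nonneg)
   also have "1 + (real (2 * n) + 1) = real (2 * Suc n)" by simp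
   finally show ?case .
  qed
  show "\<exists>C<\<infinity>. \<forall>F :: 'a => ennreal. F \<in> borel_measurable lebesgue \<longrightarrow> periodic torus_periods F \<longrightarrow>
   (\<integral>\<^sup>+x\<in>K. F x \<partial>lebesgue) \<le> C * (\<integral>\<^sup>+x\<in>S 0 w. F x \<partial>lebesgue)"
  proof (intro exI[of _ "ennreal (real (2 * N))"] conjI allI impI)
   fix F :: "'a => ennreal" assume F: "F \<in> borel_measurable lebesgue" "periodic torus_periods F"
   have "x \<in> S (- real N * w) (real N * w)" if "x \<in> K" for x
   proof -
    have "\<bar>x \<bullet> e\<bar> \<le> norm x" using Basis_le_norm[of e x] by (simp add: e)
    then have "- real N * w \<le> x \<bullet> e" "x \<bullet> e < real N * w" using R[OF that] N by (auto simp: abs_le_iff)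
    then show ?thesis by (simp add: S_def)
   qed
   then have "(\<integral>\<^sup>+x\<in>K. F x \<partial>lebesgue) \<le> (\<integral>\<^sup>+x\<in>S (- real N * w) (real N * w). F x \<partial>lebesgue)"
    by (intro nn_integral_mono mult_left_mono) (auto simp: indicator_def)
   also have "... \<le> ennreal (real (2 * N)) * (\<integral>\<^sup>+x\<in>S 0 w. F x \<partial>lebesgue)"
    using F by (intro main) (auto simp: per)
   finally show "(\<integral>\<^sup>+x\<in>K. F x \<partial>lebesgue) \<le> ennreal (real (2 * N)) * (\<integral>\<^sup>+x\<in>S 0 w. F x \<partial>lebesgue)" .
  qed simp
 next
  fix f :: "'a => complex" assume f: "f \<in> borel_measurable lebesgue" and "periodic torus_periods f"
  then have fv: "f (x + v) = f x" for x by (simp add: per)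
  obtain g where [measurable]: "g \<in> borel_measurable borel" and g: "AE x in lborel. f x = g x"
   by (rule lebesgue_complex_borel_representative[OF f]) (rule that)
  define z where "z = (\<lambda>x. \<lfloor>x \<bullet> e / w\<rfloor>)"
  \<comment> \<open>Folding x into the cell before applying g forces periodicity; countably many
    translates of the exceptional null set are still null.\<close>
  define f' where "f' = (\<lambda>x. g (x + of_int (- z x) *\<^sub>R v))"
  show "\<exists>f'\<in>borel_measurable borel. periodic torus_periods f' \<and> (AE x in lborel. f x = f' x)"
  proof (intro bexI[of _ f'] conjI)
   show "f' \<in> borel_measurable borel" unfolding f'_def z_def by measurable
   have "z (x + v) = z x + 1" for x using w by (simp add: z_def inner_add_left ve add_divide_distrib)
   then show "periodic torus_periods f'" unfolding per f'_def by (simp add: algebra_simps)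
   have "AE x in lborel. \<forall>i. f (x + of_int i *\<^sub>R v) = g (x + of_int i *\<^sub>R v)"
    using AE_lborel_shift[OF g] by (subst AE_all_countable) blast
   then show "AE x in lborel. f x = f' x"
    by eventually_elim (metis f'_def fv periodic_multiple)
  qed
 qed
qed

lemma Lp_torus_eq:
 assumes "DIM('a::euclidean_space) = 1" "1 \<le> p"
 shows "Lp_torus p = lp_setting.L (torus_periods :: 'a set) torus_cell p"
 by (auto simp: fun_eq_iff Lp_torus_def lp_setting.L_def lp_setting.V_def[OF lp_setting_torus[OF assms]] lp_setting_torus[OF assms] periodic_def)

theorem theorem11p1:
  fixes k :: nat and p q r :: ennreal
    and L :: "('a::euclidean_space \<Rightarrow> complex) \<Rightarrow> ennreal"
  assumes "k \<ge> 1" and "1 \<le> p" and "0 < q" and "0 < r"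
    and "L = Lp_space p \<or> (DIM('a) = 1 \<and> L = Lp_torus p)"
  shows
    " \<comment> \<open>(i)\<close>
     (\<forall>(s::real) (b::real) (m::nat). 0 < s \<and> s < real k \<and> s < real m \<longrightarrow>
        equivalent_on L
          (\<lambda>f t. K_functional (t powr (s / k) * (1 - ln t) powr (- b)) f L (besov L m s b q))
          (\<lambda>f t. ennreal (t powr (s / k) * (1 - ln t) powr (- b)) * L f
             + ennreal (t powr (s / k) * (1 - ln t) powr (- b))
               * log_integral (- s) b q (t powr (1 / k)) 1 (modulus L k f)))
   \<and> \<comment> \<open>(ii)\<close>
     (\<forall>(s::real) (b::real) (m::nat). 0 < s \<and> s < real k \<and> s < real m \<longrightarrow>
        equivalent_on (besov L m s b q)
          (\<lambda>f t. K_functional (t powr (1 - s / k) * (1 - ln t) powr b) f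
                   (besov L m s b q) (sobolev L k))
          (\<lambda>f t. ennreal (t powr (1 - s / k) * (1 - ln t) powr b) * L f
             + log_integral (- s) b q 0 (t powr (1 / k)) (modulus L k f)))
   \<and> \<comment> \<open>(iii)\<close>
     (\<forall>\<alpha>::real. \<alpha> > recip r \<or> (r = \<infinity> \<and> \<alpha> \<ge> 0) \<longrightarrow>
        equivalent_on L
          (\<lambda>f t. K_functional (t ^ k * (1 - ln t) powr (\<alpha> - recip r)) f L (lip L k \<alpha> r))
          (\<lambda>f t. ennreal (t ^ k * (1 - ln t) powr (\<alpha> - recip r)) * L f
             + modulus L k f t
             + ennreal (t ^ k * (1 - ln t) powr (\<alpha> - recip r))
               * log_integral (- real k) (- \<alpha>) r t 1 (modulus L k f)))
   \<and> \<comment> \<open>(iv)\<close>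
     (\<forall>(b::real) (m::nat). b > - recip q \<and> m \<ge> 1 \<longrightarrow>
        equivalent_on (besov L m 0 b q)
          (\<lambda>f t. K_functional (t ^ k * (1 - ln t) powr (b + recip q)) f
                   (besov L m 0 b q) (sobolev L k))
          (\<lambda>f t. ennreal (t ^ k * (1 - ln t) powr (b + recip q)) * L f
             + ennreal ((1 - ln t) powr (b + recip q)) * modulus L k f t
             + log_integral 0 b q 0 t (modulus L k f)))
   \<and> \<comment> \<open>(v)\<close>
     (\<forall>(b::real) (m::nat). b > - recip q \<and> m \<ge> 1 \<longrightarrow>
        equivalent_on L
          (\<lambda>f t. K_functional ((1 - ln t) powr (- b - recip q)) f L (besov L m 0 b q))
          (\<lambda>f t. ennreal ((1 - ln t) powr (- b - recip q)) * L f
             + ennreal ((1 - ln t) powr (- b - recip q))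
               * log_integral 0 b q t 1 (modulus L k f)))
   \<and> \<comment> \<open>(vi)\<close>
     (\<forall>\<alpha>::real. \<alpha> > recip r \<or> (r = \<infinity> \<and> \<alpha> \<ge> 0) \<longrightarrow>
        equivalent_on (lip L k \<alpha> r)
          (\<lambda>f t. K_functional ((1 - ln t) powr (- \<alpha> + recip r)) f (lip L k \<alpha> r) (sobolev L k))
          (\<lambda>f t. ennreal ((1 - ln t) powr (- \<alpha> + recip r)) * L f
             + log_integral (- real k) (- \<alpha>) r 0 t (modulus L k f)))
   \<and> \<comment> \<open>(vii)\<close>
     (\<forall>(b::real) (\<alpha>::real) (m::nat). b > - recip q \<and> \<alpha> > recip r \<and> m \<ge> 1 \<longrightarrow>
        equivalent_on (besov L m 0 b q)
          (\<lambda>f t. K_functional (t ^ k * (1 - ln t) powr (b + recip q + \<alpha> - recip r)) f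
                   (besov L m 0 b q) (lip L k \<alpha> r))
          (\<lambda>f t. ennreal (t ^ k * (1 - ln t) powr (b + recip q + \<alpha> - recip r)) * L f
             + ennreal ((1 - ln t) powr (b + recip q)) * modulus L k f t
             + log_integral 0 b q 0 t (modulus L k f)
             + ennreal (t ^ k * (1 - ln t) powr (b + recip q + \<alpha> - recip r))
               * log_integral (- real k) (- \<alpha>) r t 1 (modulus L k f)))"
proof -
 have "smoothing_norm L k"
  using assms(5)
 proof
  assume "L = Lp_space p"
  with lp_setting.smoothing_norm[OF lp_setting_space[OF assms(2)] assms(1)] show ?thesis
   by (simp add: Lp_space_eq[OF assms(2)])
 next
  assume "DIM('a) = 1 \<and> L = Lp_torus p"
  then have dim: "DIM('a) = 1" and L: "L = Lp_torus p" by auto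
  from lp_setting.smoothing_norm[OF lp_setting_torus[OF dim assms(2)] assms(1)] show ?thesis
   by (simp only: L Lp_torus_eq[OF dim assms(2)])
 qed
 then interpret smoothing_norm L k .
 note q = assms(3) and r = assms(4)
 let "?i \<and> ?ii \<and> ?iii \<and> ?iv \<and> ?v \<and> ?vi \<and> ?vii" = ?thesis
 have char0: "characteristic k 0 b q t = (1 - ln t) powr (b + recip q)" if "0 < t" for b t
  using that by (simp add: characteristic_def)
 have chark: "characteristic k (real k) (- \<alpha>) r t = weight (- real k) (- \<alpha> + recip r) t" for \<alpha> t
  by (simp add: characteristic_def)
 have tk: "t powr (- real k) = 1 / t ^ k" if "0 < t" for t
  using that by (simp add: powr_minus_divide powr_realpow)
 have pw: "1 / (1 - ln t) powr e = (1 - ln t) powr (- e)" for t e :: real by (simp add: powr_minus_divide)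
 have adm0: "admissible k 0 b q" if "b > - recip q" for b using that k_pos q by (simp add: admissible_def)
 have admk: "admissible k (real k) (- \<alpha>) r" if "\<alpha> > recip r \<or> (r = \<infinity> \<and> \<alpha> \<ge> 0)" for \<alpha>
  using that k_pos r by (auto simp: admissible_def)
 have swap: "dominated_on UNIV (besov L k s b q) (besov L m s b q)" "dominated_on UNIV (besov L m s b q) (besov L k s b q)"
  if "s < real k" "s < real m" for s b m
  using besov_dominated[OF q] that by auto
 \<comment> \<open>The reciprocal growth function at t^(1/k) has the power t^(s/k), and
   \<open>root_power_compare\<close> adjusts the logarithm.\<close>
 have i: ?i
 proof (intro allI impI, goal_cases)
  case (1 s b m)
  note s = this
  have adm: "admissible k s b q" using s k_pos q by (simp add: admissible_def)
  obtain c where c: "c > 0"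
   "\<And>t. 0 < t ==> t < 1 ==> (1 - ln (t powr (1 / real k))) powr (- b) \<le> c * (1 - ln t) powr (- b)"
   "\<And>t. 0 < t ==> t < 1 ==> (1 - ln t) powr (- b) \<le> c * (1 - ln (t powr (1 / real k))) powr (- b)"
   by (rule root_power_compare[OF k_pos, of "- b"]) (rule that)
  have R: "1 / characteristic k s b q (t powr (1 / real k)) = t powr (s / real k) * (1 - ln (t powr (1 / real k))) powr (- b)" for t
  proof -
   have "1 / (t powr (1 / real k)) powr (- s) = t powr (s / real k)" by (simp add: powr_powr powr_minus_divide)
   then have "1 / ((t powr (1 / real k)) powr (- s) * (1 - ln (t powr (1 / real k))) powr b) = t powr (s / real k) * (1 - ln (t powr (1 / real k))) powr (- b)"
    unfolding powr_minus_divide[of _ b] by (metis divide_divide_eq_left mult.commute times_divide_eq_left mult_1)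
   then show ?thesis using s by (simp add: characteristic_def)
  qed
  show ?case
  proof (rule K_norm_besov_high[OF adm _ swap root_in_unit c(1)])
   fix t :: real assume t: "0 < t" "t < 1"
   show "0 \<le> t powr (s / real k) * (1 - ln t) powr - b \<and>
     1 / characteristic k s b q (t powr (1 / real k)) \<le> c * (t powr (s / real k) * (1 - ln t) powr - b) \<and>
     t powr (s / real k) * (1 - ln t) powr - b \<le> c * (1 / characteristic k s b q (t powr (1 / real k)))"
    unfolding R using mult_left_mono[OF c(2)[OF t], of "t powr (s / real k)"] mult_left_mono[OF c(3)[OF t], of "t powr (s / real k)"]
    by (simp add: mult.left_commute)
  qed (use s in auto)
 qed
 have ii: ?ii
 proof (intro allI impI, goal_cases)
  case (1 s b m)
  note s = this
  have adm: "admissible k s b q" using s k_pos q by (simp add: admissible_def)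
  obtain c where c: "c > 0"
   "\<And>t. 0 < t ==> t < 1 ==> (1 - ln (t powr (1 / real k))) powr b \<le> c * (1 - ln t) powr b"
   "\<And>t. 0 < t ==> t < 1 ==> (1 - ln t) powr b \<le> c * (1 - ln (t powr (1 / real k))) powr b"
   by (rule root_power_compare[OF k_pos, of b]) (rule that)
  have R: "characteristic k s b q (t powr (1 / real k)) / (t powr (1 / real k)) powr (- real k) = t powr (1 - s / real k) * (1 - ln (t powr (1 / real k))) powr b" if "0 < t" for t
  proof -
   have 1: "(t powr (1 / real k)) powr (- real k) = 1 / t" using k_pos that by (simp add: powr_powr powr_minus_divide)
   have 2: "(t powr (1 / real k)) powr (- s) * t = t powr (1 - s / real k)"
    using that by (simp add: powr_powr powr_diff powr_minus_divide)
   have "characteristic k s b q (t powr (1 / real k)) = (t powr (1 / real k)) powr (- s) * (1 - ln (t powr (1 / real k))) powr b"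
    using s by (simp add: characteristic_def)
   then have "characteristic k s b q (t powr (1 / real k)) / (t powr (1 / real k)) powr (- real k)
     = ((t powr (1 / real k)) powr (- s) * t) * (1 - ln (t powr (1 / real k))) powr b"
    unfolding 1 by simp
   then show ?thesis unfolding 2 .
  qed
  show ?case
  proof (rule K_besov_sobolev_low[OF adm _ swap root_in_unit c(1)])
   fix t :: real assume t: "0 < t" "t < 1"
   show "0 \<le> weight (1 - s / real k) b t \<and>
     characteristic k s b q (t powr (1 / real k)) / (t powr (1 / real k)) powr (- real k) \<le> c * weight (1 - s / real k) b t \<and>
     weight (1 - s / real k) b t \<le> c * (characteristic k s b q (t powr (1 / real k)) / (t powr (1 / real k)) powr (- real k))"
    unfolding R[OF t(1)] using mult_left_mono[OF c(2)[OF t], of "t powr (1 - s / real k)"] mult_left_mono[OF c(3)[OF t], of "t powr (1 - s / real k)"]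
    by (simp add: mult.left_commute)
  qed (use s in auto)
 qed
 have inv_k: "1 / characteristic k (real k) (- \<alpha>) r t = t ^ k * (1 - ln t) powr (\<alpha> - recip r)" if "0 < t" for \<alpha> t
 proof -
  have "1 / characteristic k (real k) (- \<alpha>) r t = t ^ k * (1 / (1 - ln t) powr (- \<alpha> + recip r))"
   unfolding chark tk[OF that] by simp
  then show ?thesis unfolding pw by simp
 qed
 \<comment> \<open>The integral over (t, 1) at s = k does not absorb the modulus, so the equivalence
   is used as it stands.\<close>
 have iii: ?iii
 proof (intro allI impI, goal_cases)
  case (1 \<alpha>)
  note \<alpha> = this
  show ?case
   by (rule equivalent_on_cong[OF K_norm_besov[OF admk[OF \<alpha>]]]) (auto simp: inv_k lip_eq_besov)
 qed
 \<comment> \<open>Again the modulus stays, now because the integral over (0, t) has s = 0; the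
   transfer replaces differences of order k by order m in the Besov norm.\<close>
 have iv: ?iv
 proof (intro allI impI, goal_cases)
  case (1 b m)
  note b = this
  have e: "(1 - ln t) powr (b + recip q) / t powr - real k = t ^ k * (1 - ln t) powr (b + recip q)" if "0 < t" for t
   using that by (simp add: tk)
  show ?case
   by (rule K_functional_transfer[OF K_besov_sobolev[OF adm0] swap dominated_on_refl dominated_on_refl dominated_on_finite[OF swap(1)], where \<phi>="\<lambda>t. t" and c=1])
    (use b k_pos in \<open>auto simp: e char0 intro!: dominated_on_le\<close>)
 qed
 \<comment> \<open>At s = 0 the integral over (t, 1) does absorb the modulus; in (vi) the integral
   over (0, t) at s = k does.\<close>
 have v: ?v
 proof (intro allI impI, goal_cases)
  case (1 b m)
  note b = this
  have e: "1 / characteristic k 0 b q t = (1 - ln t) powr (- b - recip q)" if "0 < t" for t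
   using that pw[of t "b + recip q"] by (simp add: char0)
  have "equivalent_on L (\<lambda>f t. K_functional ((1 - ln t) powr (- b - recip q)) f L (besov L m 0 b q))
   (\<lambda>f t. ennreal ((1 - ln t) powr (- b - recip q)) * L f + ennreal ((1 - ln t) powr (- b - recip q)) * log_integral (- 0) b q t 1 (modulus L k f))"
   by (rule K_norm_besov_high[OF adm0 _ swap, where \<phi>="\<lambda>t. t" and c=1]) (use b k_pos in \<open>auto simp: e\<close>)
  then show ?case by simp
 qed
 have vi: ?vi
 proof (intro allI impI, goal_cases)
  case (1 \<alpha>)
  note \<alpha> = this
  have e: "characteristic k (real k) (- \<alpha>) r t / t powr - real k = (1 - ln t) powr (- \<alpha> + recip r)" if "0 < t" for t
   using that by (simp add: chark)
  show ?case
   unfolding lip_eq_besov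
   by (rule K_besov_sobolev_low[OF admk[OF \<alpha>] _ dominated_on_refl dominated_on_refl, where \<phi>="\<lambda>t. t" and c=1]) (use k_pos in \<open>auto simp: e\<close>)
 qed
 \<comment> \<open>Both integrals are on their non-absorbing side, s = 0 over (0, t) and s = k over
   (t, 1), so all four terms remain.\<close>
 have vii: ?vii
 proof (intro allI impI, goal_cases)
  case (1 b \<alpha> m)
  note b = this
  have e: "(1 - ln t) powr (b + recip q) / characteristic k (real k) (- \<alpha>) r t = t ^ k * (1 - ln t) powr (b + recip q + \<alpha> - recip r)" if t: "0 < t" for t
  proof -
   have "characteristic k 0 b q t / characteristic k (real k) (- \<alpha>) r t = characteristic k 0 b q t * (1 / characteristic k (real k) (- \<alpha>) r t)" by simp
   also have "... = t ^ k * ((1 - ln t) powr (b + recip q) * (1 - ln t) powr (\<alpha> - recip r))"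
    unfolding inv_k[OF t] char0[OF t] by simp
   also have "... = t ^ k * (1 - ln t) powr (b + recip q + \<alpha> - recip r)"
    unfolding powr_add[symmetric] by (simp add: add_diff_eq)
   finally show ?thesis by (simp add: char0[OF t])
  qed
  have adm: "admissible k 0 b q" "admissible k (real k) (- \<alpha>) r" using b adm0 admk by auto
  show ?case
   unfolding lip_eq_besov
   by (rule K_functional_transfer[OF K_besov_lip[OF adm] swap dominated_on_refl dominated_on_refl dominated_on_finite[OF swap(1)], where \<phi>="\<lambda>t. t" and c=1])
    (use b k_pos in \<open>auto simp: e char0 intro!: dominated_on_le\<close>)
 qed
 show ?thesis by (intro conjI i ii iii iv v vi vii)
qed

end
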